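(* Fix $k\in\mathbb{Z}_{\ge1}$. For $n>k$ let $(s_1,\dots,s_N)$ be a uniformly random element of $\Omega_n$, $N=\binom n2$, and let $$\mathbf{T}_{FS,n}(k)=\min\{t\ge 1:\ s_t=k\}$$ be the first occurrence time of the swap $(k,k+1)$. Then, as $n\to\infty$, $$\frac{\mathbf{T}_{FS,n}(k)}{n^{3/2}}\longrightarrow \frac12\,\mathbf{T}_{FS}(k)\quad\text{in distribution},$$ where $\mathbf{T}_{FS}(k)$ is the smallest positive eigenvalue of a $2k\times 2k$ aGUE matrix.
   Context: For $n\ge2$ and $1\le k\le n-1$ let $\tau_k\in\mathfrak S_n$ be the adjacent transposition $(k,k+1)$, acting on one-row notation by $(a_1\dots a_n)\cdot\tau_k=(a_1\dots a_{k-1}\,a_{k+1}\,a_k\,a_{k+2}\dots a_n)$. A sorting network of size $n$ is a sequence $(s_1,\dots,s_N)$, $N=\binom n2$, $s_i\in\{1,\dots,n-1\}$, with $\tau_{s_1}\tau_{s_2}\cdots\tau_{s_N}=(n\ n-1\ \dots\ 2\ 1)$ (the reverse permutation); $\Omega_n$ denotes the (finite) set of all sorting networks of size $n$. For $\ell\ge1$, an $\ell\times\ell$ aGUE matrix is $M_\ell=\frac{\mathbf i}{2}(Y-Y^T)$ where $Y$ is an $\ell\times\ell$ matrix of i.i.d. standard Gaussian $N(0,1)$ entries; its eigenvalues are real and symmetric about $0$, and for even $\ell$ zero is almost surely not an eigenvalue. *)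

theory Defs
  imports "HOL-Probability.Probability" "Jordan_Normal_Form.Char_Poly"
begin

text \<open>Right action of the adjacent transposition tau_k (k is 1-indexed) on a
  permutation in one-row notation: swap the entries in positions k and k+1.\<close>
definition adj_swap :: "nat \<Rightarrow> nat list \<Rightarrow> nat list" where
  "adj_swap k xs = xs[k - 1 := xs ! k, k := xs ! (k - 1)]"

text \<open>Sorting networks of size n: sequences (s_1,...,s_N), N = n choose 2,
  s_i in {1..n-1}, with tau_{s_1} ... tau_{s_N} = reverse permutation,
  computed by acting on the identity (1 2 ... n) from the right.\<close>
definition sorting_networks :: "nat \<Rightarrow> nat list set" where
  "sorting_networks n =
     {s. length s = n choose 2 \<and> set s \<subseteq> {1..n-1} \<and>
         fold adj_swap s [1..<n+1] = rev [1..<n+1]}"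

definition first_swap_time :: "nat \<Rightarrow> nat list \<Rightarrow> nat" where
  "first_swap_time k s = (LEAST t. 1 \<le> t \<and> t \<le> length s \<and> s ! (t - 1) = k)"

definition aGUE_mat :: "nat \<Rightarrow> (nat \<times> nat \<Rightarrow> real) \<Rightarrow> complex mat" where
  "aGUE_mat l Y = mat l l (\<lambda>(i, j). (\<i> / 2) * complex_of_real (Y (i, j) - Y (j, i)))"

definition gaussian_array :: "nat \<Rightarrow> (nat \<times> nat \<Rightarrow> real) measure" where
  "gaussian_array l = PiM ({..<l} \<times> {..<l}) (\<lambda>_. std_normal_distribution)"

definition smallest_pos_eigenvalue :: "complex mat \<Rightarrow> real" where
  "smallest_pos_eigenvalue A = Min {x :: real. 0 < x \<and> eigenvalue A (complex_of_real x)}"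

end

theory Submission
  imports Defs "HOL-Real_Asymp.Real_Asymp" "Jordan_Normal_Form.Schur_Decomposition"
begin

text \<open>
  Sorting networks are the reduced words of the reverse permutation. The number of those whose first
  \<open>t\<close> letters avoid \<open>k\<close> is computed by divided difference operators, which turn it into a
  \<open>k \<times> k\<close> determinant of explicit binomial sums; after rescaling by \<open>n\<close> to the power \<open>3/2\<close> its entries
  converge to incomplete Gaussian moments, so the tail probability converges to a ratio of two Hankel
  determinants.

  For the antisymmetric Gaussian matrix, integration by parts gives loop equations that determine all
  joint moments of the even power sums of the eigenvalues. The density proportional to the squared
  Vandermonde determinant in the squares of \<open>k\<close> Gaussian variables satisfies the same equations.
  Passing from even powers to cosines and then to indicator functions, both point processes have the same
  gap probability at \<open>0\<close>, and Andreief's identity evaluates it as the same ratio of Hankel determinants.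
\<close>

text \<open>Divided differences obey the nil-Coxeter relations: a reduced word acts by an operator
  that depends only on its permutation, any other word by 0. Take a polynomial of degree
  \<open>n choose 2\<close> on which the longest element gives 1. Then exp(t * all letters),
  followed by exp(s * letters other than \<open>k\<close>), generates the networks that avoid
  \<open>k\<close> at their end. What makes this usable is a closed form of the double exponential:
  a determinant one of whose rows is frozen by truncation at degree \<open>2 * k\<close>. For t = 1
  - s the generating function is a Bernstein average, as if a binomial number of letters had been
  read. At s = x / sqrt n about x n^(3/2) / 2 letters have been read, which is the origin of the
  factor 1/2.

  The law of the eigenvalues is never obtained by a change of variables; loop equations need only
  polynomial calculus. The price is that everything about eigenvalues, measurability included, has
  to pass through symmetric functions of the spectrum.\<close>

section \<open>Divided differences and the nil-Coxeter relations\<close>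

text \<open>The value 0 off the injective points lets the relations below hold as equations between
  functions, for arbitrary \<open>f\<close>. In return, evaluation at the origin becomes a limit
  along injective points.\<close>

definition dd :: "nat \<Rightarrow> ((nat \<Rightarrow> real) \<Rightarrow> real) \<Rightarrow> (nat \<Rightarrow> real) \<Rightarrow> real" where
  "dd i f = (\<lambda>x. if inj x then (f x - f (x \<circ> Transposition.transpose i (Suc i))) / (x i - x (Suc i)) else 0)"

lemma inj_comp_transpose [simp]: "inj (x \<circ> Transposition.transpose a b) \<longleftrightarrow> inj x"
  by (metis bij_swap_iff bij_transpose inj_compose bij_is_inj comp_assoc transpose_comp_involutory comp_id)

lemma dd_0 [simp]: "dd i (\<lambda>x. 0) = (\<lambda>x. 0)"
  by (simp add: dd_def fun_eq_iff)

lemma dd_eq_0: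
  assumes "\<And>x. inj x \<Longrightarrow> f (x \<circ> Transposition.transpose i (Suc i)) = f x"
  shows "dd i f = (\<lambda>x. 0)"
  using assms by (auto simp: dd_def fun_eq_iff)

text \<open>\<open>dd i f\<close> is symmetric in the two variables, because numerator and
  denominator both change sign.\<close>

lemma dd_dd: "dd i (dd i f) = (\<lambda>x. 0)"
proof (rule dd_eq_0)
  fix x :: "nat \<Rightarrow> real" assume x: "inj x"
  have "x i \<noteq> x (Suc i)" using x by (metis injD n_not_Suc_n)
  then show "dd i f (x \<circ> Transposition.transpose i (Suc i)) = dd i f x"
    using x by (simp add: dd_def comp_assoc transpose_comp_involutory divide_simps) (simp add: algebra_simps)
qed

lemma dd_commute:
  assumes "Suc i < j \<or> Suc j < i"
  shows "dd i (dd j f) = dd j (dd i f)"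
proof
  fix x :: "nat \<Rightarrow> real"
  have c: "Transposition.transpose i (Suc i) \<circ> Transposition.transpose j (Suc j)
         = Transposition.transpose j (Suc j) \<circ> Transposition.transpose i (Suc i)"
    using assms by (auto simp: fun_eq_iff Transposition.transpose_def)
  have e: "x \<circ> Transposition.transpose i (Suc i) \<circ> Transposition.transpose j (Suc j)
        = x \<circ> Transposition.transpose j (Suc j) \<circ> Transposition.transpose i (Suc i)"
    by (metis c comp_assoc)
  have "(x \<circ> Transposition.transpose i (Suc i)) j = x j" "(x \<circ> Transposition.transpose i (Suc i)) (Suc j) = x (Suc j)"
     "(x \<circ> Transposition.transpose j (Suc j)) i = x i" "(x \<circ> Transposition.transpose j (Suc j)) (Suc i) = x (Suc i)"
    using assms by (auto simp: Transposition.transpose_def)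
  then show "dd i (dd j f) x = dd j (dd i f) x"
    by (simp add: dd_def e) (simp add: divide_simps)
qed

text \<open>The six values stand for \<open>f\<close> at the six rearrangements of three
  coordinates. Both sides are their alternating sum divided by the product of the three
  differences.\<close>

lemma braid_identity:
  fixes a b c :: real
  assumes "a \<noteq> b" "b \<noteq> c" "a \<noteq> c"
  shows "(((f0 - f1) / (a - b) - (f2 - f3) / (a - c)) / (b - c)
        - ((f1 - f0) / (b - a) - (f4 - f5) / (b - c)) / (a - c)) / (a - b)
     = (((f0 - f2) / (b - c) - (f1 - f4) / (a - c)) / (a - b)
        - ((f2 - f0) / (c - b) - (f3 - f5) / (a - b)) / (a - c)) / (b - c)"
proof -
  obtain p where p: "p = a - b" "p \<noteq> 0" using assms by auto
  obtain q where q: "q = b - c" "q \<noteq> 0" using assms by auto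
  obtain r where r: "r = a - c" "r \<noteq> 0" using assms by auto
  have e: "b - a = -p" "c - b = -q" "r = p + q" using p q r by auto
  show ?thesis unfolding p(1)[symmetric] q(1)[symmetric] r(1)[symmetric] e(1,2)
    using p(2) q(2) r(2) by (simp add: divide_simps) (simp add: e(3) algebra_simps)
qed

lemma dd_braid: "dd i (dd (Suc i) (dd i f)) = dd (Suc i) (dd i (dd (Suc i) f))"
proof
  fix x :: "nat \<Rightarrow> real"
  let ?s = "Transposition.transpose i (Suc i)" and ?t = "Transposition.transpose (Suc i) (Suc (Suc i))"
  show "dd i (dd (Suc i) (dd i f)) x = dd (Suc i) (dd i (dd (Suc i) f)) x"
  proof (cases "inj x")
    case True
    have ne: "x i \<noteq> x (Suc i)" "x (Suc i) \<noteq> x (Suc (Suc i))" "x i \<noteq> x (Suc (Suc i))"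
      using True by (auto dest!: injD)
    have e1: "x \<circ> ?s \<circ> ?s = x" "x \<circ> ?t \<circ> ?t = x" by (simp_all add: comp_assoc transpose_comp_involutory)
    have e2: "x \<circ> ?t \<circ> ?s \<circ> ?t = x \<circ> ?s \<circ> ?t \<circ> ?s"
      by (auto simp: fun_eq_iff Transposition.transpose_def)
    have s: "?s i = Suc i" "?s (Suc i) = i" "?s (Suc (Suc i)) = Suc (Suc i)"
       "?t i = i" "?t (Suc i) = Suc (Suc i)" "?t (Suc (Suc i)) = Suc i"
      by (auto simp: Transposition.transpose_def)
    show ?thesis
      using braid_identity[OF ne, of "f x" "f (x \<circ> ?s)" "f (x \<circ> ?t)" "f (x \<circ> ?t \<circ> ?s)" "f (x \<circ> ?s \<circ> ?t)" "f (x \<circ> ?s \<circ> ?t \<circ> ?s)"]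
      by (simp add: dd_def True e1 e2 s comp_apply)
  qed (simp add: dd_def)
qed

section \<open>Adjacent swaps, inversions and reduced words\<close>

lemma length_adj_swap [simp]: "length (adj_swap i p) = length p"
  by (simp add: adj_swap_def)

lemma nth_adj_swap:
  assumes "1 \<le> i" "i < length p" "a < length p"
  shows "adj_swap i p ! a = p ! Transposition.transpose (i - 1) i a"
  using assms by (auto simp: adj_swap_def nth_list_update Transposition.transpose_def)

lemma adj_swap_adj_swap:
  assumes "1 \<le> i" "i < length p"
  shows "adj_swap i (adj_swap i p) = p"
  using assms by (intro nth_equalityI) (auto simp: nth_adj_swap Transposition.transpose_def)

lemma mset_adj_swap [simp]:
  assumes "1 \<le> i" "i < length p"
  shows "mset (adj_swap i p) = mset p"
  using assms by (simp add: adj_swap_def mset_swap)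

lemma distinct_adj_swap [simp]:
  assumes "1 \<le> i" "i < length p"
  shows "distinct (adj_swap i p) \<longleftrightarrow> distinct p"
  by (metis assms mset_adj_swap mset_eq_imp_distinct_iff)

lemma adj_swap_map:
  assumes "1 \<le> i" "i < length p"
  shows "adj_swap i (map g p) = map g (adj_swap i p)"
  using assms by (intro nth_equalityI) (auto simp: nth_adj_swap Transposition.transpose_def)

definition Invs :: "nat list \<Rightarrow> (nat \<times> nat) set" where
  "Invs p = {(a, b). a < b \<and> b < length p \<and> p ! b < p ! a}"

lemma finite_Invs [simp]: "finite (Invs p)"
  by (rule finite_subset[of _ "{..<length p} \<times> {..<length p}"]) (auto simp: Invs_def)

text \<open>Swapping an ascent permutes the old inversions and creates exactly one more, at the
  swapped positions themselves.\<close>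

lemma card_Invs_adj_swap_ascent:
  assumes i: "1 \<le> i" "i < length p" and asc: "p ! (i - 1) < p ! i"
  shows "card (Invs (adj_swap i p)) = Suc (card (Invs p))"
proof -
  let ?t = "Transposition.transpose (i - 1) i"
  have 1: "Invs (adj_swap i p) = insert (i - 1, i) (map_prod ?t ?t ` Invs p)" (is "?L = ?R")
  proof (intro Set.set_eqI iffI)
    fix z assume "z \<in> ?L"
    then obtain a b where ab: "z = (a, b)" "a < b" "b < length p" "p ! ?t b < p ! ?t a"
      using i by (auto simp: Invs_def nth_adj_swap)
    show "z \<in> ?R"
    proof (cases "a = i - 1 \<and> b = i")
      case False
      then have "(?t a, ?t b) \<in> Invs p"
        using ab i asc by (auto simp: Invs_def Transposition.transpose_def split: if_splits)
      then show ?thesis using ab(1) by (force simp: image_iff)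
    qed (simp add: ab)
  next
    fix z assume "z \<in> ?R"
    then show "z \<in> ?L" using i asc
      by (auto simp: Invs_def nth_adj_swap Transposition.transpose_def split: if_splits)
  qed
  have 2: "(i - 1, i) \<notin> map_prod ?t ?t ` Invs p"
    using i asc by (auto simp: Invs_def Transposition.transpose_def split: if_splits)
  have "inj_on (map_prod ?t ?t) (Invs p)"
    by (intro inj_on_subset[OF prod.inj_map subset_UNIV]) simp_all
  then show ?thesis using 1 2 by (simp add: card_image)
qed

lemma card_Invs_adj_swap_descent:
  assumes i: "1 \<le> i" "i < length p" and "p ! i < p ! (i - 1)"
  shows "card (Invs p) = Suc (card (Invs (adj_swap i p)))"
  using card_Invs_adj_swap_ascent[of i "adj_swap i p"] assms
  by (simp add: adj_swap_adj_swap nth_adj_swap)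

text \<open>Reducedness in a local form: every letter, at the moment it acts, swaps an
  ascent.\<close>

fun ascends :: "nat list \<Rightarrow> nat list \<Rightarrow> bool" where
  "ascends p [] = True"
| "ascends p (i # w) = (1 \<le> i \<and> i < length p \<and> p ! (i - 1) < p ! i \<and> ascends (adj_swap i p) w)"

lemma ascends_append: "ascends p (u @ v) \<longleftrightarrow> ascends p u \<and> ascends (fold adj_swap u p) v"
  by (induction u arbitrary: p) auto

lemma length_fold_adj_swap [simp]: "length (fold adj_swap w p) = length p"
  by (induction w arbitrary: p) auto

lemma mset_fold_adj_swap:
  assumes "set w \<subseteq> {1..<length p}"
  shows "mset (fold adj_swap w p) = mset p"
  using assms by (induction w arbitrary: p) auto

lemma ascends_letters: "ascends p w \<Longrightarrow> set w \<subseteq> {1..<length p}"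
proof (induction w arbitrary: p)
  case (Cons i w)
  then show ?case using Cons.IH[of "adj_swap i p"] by auto
qed auto

lemma card_Invs_ascends:
  "ascends p w \<Longrightarrow> card (Invs (fold adj_swap w p)) = card (Invs p) + length w"
  by (induction w arbitrary: p) (auto simp: card_Invs_adj_swap_ascent)

text \<open>A letter adds at most one inversion and at a descent removes one, so a word attaining
  the bound meets ascents only.\<close>

lemma card_Invs_fold:
  assumes "distinct p" "set w \<subseteq> {1..<length p}"
  shows "card (Invs (fold adj_swap w p)) \<le> card (Invs p) + length w
    \<and> (card (Invs (fold adj_swap w p)) = card (Invs p) + length w \<longrightarrow> ascends p w)"
  using assms
proof (induction w arbitrary: p)
  case (Cons i w)
  then have i: "1 \<le> i" "i < length p" by auto
  note IH = Cons.IH[of "adj_swap i p"]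
  show ?case
  proof (cases "p ! (i - 1) < p ! i")
    case True
    with IH card_Invs_adj_swap_ascent[OF i True] Cons.prems i show ?thesis by auto
  next
    case False
    moreover have "p ! (i - 1) \<noteq> p ! i" using Cons.prems i by (simp add: nth_eq_iff_index_eq)
    ultimately have "p ! i < p ! (i - 1)" by simp
    with IH card_Invs_adj_swap_descent[OF i] Cons.prems i show ?thesis by fastforce
  qed
qed auto

lemma sorted_descent:
  assumes "distinct p" "\<not> sorted p"
  obtains i where "1 \<le> i" "i < length p" "p ! i < p ! (i - 1)"
proof -
  from assms(2) obtain i where "Suc i < length p" "p ! Suc i < p ! i"
    by (auto simp: sorted_iff_nth_Suc not_le)
  then show ?thesis using that[of "Suc i"] by auto
qed

section \<open>A word acts through its permutation or by zero\<close>

context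
  fixes n :: nat and st :: "nat list"
  assumes st: "st = [1..<Suc n]"
begin

text \<open>Bubble sort read backwards: undoing a descent lowers the inversion number, and the
  letter is appended to the word.\<close>

lemma ex_ascends:
  assumes "mset p = mset st"
  shows "\<exists>w. ascends st w \<and> fold adj_swap w st = p"
  using assms
proof (induction "card (Invs p)" arbitrary: p rule: less_induct)
  case less
  have d: "distinct p" using less.prems st by (metis distinct_upt mset_eq_imp_distinct_iff)
  show ?case
  proof (cases "sorted p")
    case True
    then have "p = st" using less.prems st
      by (metis properties_for_sort sort_upt)
    then show ?thesis by (intro exI[of _ "[]"]) auto
  next
    case False
    with d obtain i where i: "1 \<le> i" "i < length p" "p ! i < p ! (i - 1)" by (rule sorted_descent)
    from less.hyps[of "adj_swap i p"] card_Invs_adj_swap_descent[OF i] i less.prems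
    obtain w where w: "ascends st w" "fold adj_swap w st = adj_swap i p" by auto
    have "ascends st (w @ [i])" using w i by (simp add: ascends_append nth_adj_swap)
    moreover have "fold adj_swap (w @ [i]) st = p" using w i by (simp add: adj_swap_adj_swap)
    ultimately show ?thesis by blast
  qed
qed

lemma ascends_snocD:
  assumes "ascends st (u @ [i])"
  defines "p \<equiv> fold adj_swap (u @ [i]) st"
  shows "1 \<le> i" "i < n" "p ! i < p ! (i - 1)" "fold adj_swap u st = adj_swap i p"
    "mset p = mset st" "length p = n" "ascends st u"
proof -
  have a: "1 \<le> i" "i < length st" "fold adj_swap u st ! (i-1) < fold adj_swap u st ! i" "ascends st u"
    using assms(1) by (auto simp: ascends_append)
  moreover have "length st = n" by (simp add: st)
  ultimately show "1 \<le> i" "i < n" "ascends st u" by auto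
  show "length p = n" by (simp add: p_def st)
  show "mset p = mset st" unfolding p_def using ascends_letters[OF assms(1)] by (intro mset_fold_adj_swap)
  show "p ! i < p ! (i-1)" using a by (simp add: p_def nth_adj_swap)
  show "fold adj_swap u st = adj_swap i p" using a by (simp add: p_def adj_swap_adj_swap)
qed

text \<open>Matsumoto's theorem for these operators, by induction on the length. The last letters
  \<open>i\<close> and \<open>j\<close> of the two words are both descents of the common permutation
  \<open>p\<close>. Undoing them leads to a smaller permutation \<open>q\<close> from which both
  words can be completed, and the commutation or braid relation identifies the completions.\<close>

lemma fold_dd_unique:
  assumes "ascends st u" "ascends st v" "fold adj_swap u st = fold adj_swap v st"
  shows "fold dd u f = fold dd v f"
  using assms
proof (induction "length u" arbitrary: u v rule: less_induct)
  case less
  have len: "length u = length v"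
    using card_Invs_ascends[OF less.prems(1)] card_Invs_ascends[OF less.prems(2)] less.prems(3) by simp
  show ?case
  proof (cases u rule: rev_cases)
    case Nil
    then show ?thesis using len by simp
  next
    case (snoc u' i)
    obtain v' j where v: "v = v' @ [j]" using len snoc by (cases v rule: rev_cases) auto
    define p where "p = fold adj_swap u st"
    have pv: "p = fold adj_swap v st" using less.prems p_def by simp
    note U = ascends_snocD[of u' i, folded snoc, OF less.prems(1), folded p_def]
    note V = ascends_snocD[of v' j, folded v, OF less.prems(2), folded pv]
    have IH: "fold dd w f = fold dd w' f" if "length w < length u" "ascends st w" "ascends st w'"
       "fold adj_swap w st = fold adj_swap w' st" for w w'
      using less.hyps[of w w'] that by simp
    have lenw: "card (Invs (fold adj_swap w st)) = card (Invs st) + length w" if "ascends st w" for w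
      using card_Invs_ascends[OF that] .
    have cp: "card (Invs p) = card (Invs st) + length u" using lenw[OF less.prems(1)] p_def by simp
    have braid: "fold dd (u' @ [i]) f = fold dd (v' @ [Suc i]) f"
      if i: "1 \<le> i" "Suc i < n" and d: "p ! i < p ! (i - 1)" "p ! Suc i < p ! i"
        and u': "ascends st u'" "fold adj_swap u' st = adj_swap i p" "length u' < length u"
        and v': "ascends st v'" "fold adj_swap v' st = adj_swap (Suc i) p" "length v' < length u" for i u' v'
    proof -
      \<comment> \<open>Two neighbouring descents make \<open>p\<close> decreasing on three
        positions; \<open>q\<close> is \<open>p\<close> with this triple sorted, three inversions
        lower.\<close>
      define q where "q = adj_swap (Suc i) (adj_swap i (adj_swap (Suc i) p))"
      have q2: "q = adj_swap i (adj_swap (Suc i) (adj_swap i p))"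
        unfolding q_def using i U(6)
        by (intro nth_equalityI) (auto simp: nth_adj_swap Transposition.transpose_def)
      have "mset q = mset st" using U i by (simp add: q_def)
      then obtain r where r: "ascends st r" "fold adj_swap r st = q" using ex_ascends by blast
      have q_at: "q ! (i-1) = p ! Suc i" "q ! i = p ! i" "q ! Suc i = p ! (i - 1)"
        using i U(6) by (auto simp: q_def nth_adj_swap Transposition.transpose_def)
      have a1: "ascends st (r @ [i, Suc i])" 
        using r i U(6) d q_at by (auto simp: ascends_append st nth_adj_swap Transposition.transpose_def)
      have a2: "ascends st (r @ [Suc i, i])" 
        using r i U(6) d q_at by (auto simp: ascends_append st nth_adj_swap Transposition.transpose_def)
      have f1: "fold adj_swap (r @ [i, Suc i]) st = adj_swap i p"
        using r i U(6) by (simp add: q2 adj_swap_adj_swap)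
      have f2: "fold adj_swap (r @ [Suc i, i]) st = adj_swap (Suc i) p"
        using r i U(6) by (simp add: q_def adj_swap_adj_swap)
      have "fold dd u' f = fold dd (r @ [i, Suc i]) f"
        using IH[of u' "r @ [i, Suc i]"] a1 f1 u' by simp
      moreover have "fold dd v' f = fold dd (r @ [Suc i, i]) f"
        using IH[of v' "r @ [Suc i, i]"] a2 f2 v' by simp
      ultimately show ?thesis by (simp add: dd_braid)
    qed
    consider "i = j" | "Suc i < j \<or> Suc j < i" | "j = Suc i" | "i = Suc j" by linarith
    then show ?thesis
    proof cases
      case 1
      then have "fold dd u' f = fold dd v' f" using IH[of u' v'] U V snoc by simp
      then show ?thesis using snoc v 1 by simp
    next
      case 2
      \<comment> \<open>Two disjoint descents can be undone independently, in either order.\<close>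
      define q where "q = adj_swap j (adj_swap i p)"
      have q2: "q = adj_swap i (adj_swap j p)"
        unfolding q_def using U V 2
        by (intro nth_equalityI) (auto simp: nth_adj_swap Transposition.transpose_def)
      have "mset q = mset st" using U V by (simp add: q_def)
      then obtain r where r: "ascends st r" "fold adj_swap r st = q" using ex_ascends by blast
      have q_at: "q ! (i-1) = p ! i" "q ! i = p ! (i-1)" "q ! (j-1) = p ! j" "q ! j = p ! (j-1)"
        using U V 2 by (auto simp: q_def nth_adj_swap Transposition.transpose_def)
      have "fold dd u' f = fold dd (r @ [j]) f"
        using IH[of u' "r @ [j]"] U V snoc r q_at by (simp add: ascends_append st q_def adj_swap_adj_swap)
      moreover have "fold dd v' f = fold dd (r @ [i]) f"
        using IH[of v' "r @ [i]"] U V snoc v len r q_at by (simp add: ascends_append st q2 adj_swap_adj_swap)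
      ultimately show ?thesis using snoc v by (simp add: dd_commute[OF 2])
    next
      case 3
      then show ?thesis using braid[of i u' v'] U V snoc v len by simp
    next
      case 4
      then show ?thesis using braid[of j v' u'] U V snoc v len by simp
    qed
  qed
qed

lemma fold_dd_0 [simp]: "fold dd w (\<lambda>x. 0) = (\<lambda>x. 0)"
  by (induction w) auto

lemma not_ascends_split:
  assumes "\<not> ascends p w" 
  shows "\<exists>u i v. w = u @ i # v \<and> ascends p u \<and> \<not> ascends p (u @ [i])"
  using assms
proof (induction w rule: rev_induct)
  case (snoc i w)
  show ?case
  proof (cases "ascends p w")
    case False
    then show ?thesis using snoc.IH by (metis append.assoc append_Cons)
  qed (use snoc.prems in auto)
qed auto

text \<open>At the first letter \<open>i\<close> that meets a descent, the prefix may be replaced by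
  a reduced word ending in \<open>i\<close>; the repeated letter then gives 0 by
  \<open>dd_dd\<close>.\<close>

lemma fold_dd_not_ascends:
  assumes w: "set w \<subseteq> {1..n-1}" and "\<not> ascends st w"
  shows "fold dd w f = (\<lambda>x. 0)"
proof -
  obtain u i v where *: "w = u @ i # v" "ascends st u" "\<not> ascends st (u @ [i])"
    using not_ascends_split[OF assms(2)] by blast
  define p where "p = fold adj_swap u st"
  have p: "length p = n" "mset p = mset st"
    using mset_fold_adj_swap[of u st] ascends_letters[OF *(2)] by (auto simp: p_def st)
  have d: "distinct p" using p st by (metis distinct_upt mset_eq_imp_distinct_iff)
  have i: "1 \<le> i" "i < n" using w * by auto
  have "\<not> p ! (i-1) < p ! i" using * i by (auto simp: ascends_append p_def st)
  moreover have "p ! (i-1) \<noteq> p ! i" using d i p by (simp add: nth_eq_iff_index_eq)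
  ultimately have lt: "p ! i < p ! (i-1)" by simp
  have "mset (adj_swap i p) = mset st" using i p by simp
  then obtain r where r: "ascends st r" "fold adj_swap r st = adj_swap i p" using ex_ascends by blast
  have "ascends st (r @ [i])" using r i p lt by (simp add: ascends_append st nth_adj_swap)
  moreover have "fold adj_swap (r @ [i]) st = p" using r i p by (simp add: adj_swap_adj_swap)
  ultimately have "fold dd u f = fold dd (r @ [i]) f" using fold_dd_unique[OF *(2)] p_def by metis
  then show ?thesis using * by (simp add: dd_dd)
qed

lemma Invs_subset: "length p = n \<Longrightarrow> Invs p \<subseteq> {(a, b). a < b \<and> b < n}"
  by (auto simp: Invs_def)

lemma card_pairs: "card {(a, b). a < b \<and> b < (n::nat)} = n choose 2"
proof -
  have "{(a, b). a < b \<and> b < (n::nat)} = (\<Union>b<n. (\<lambda>a. (a, b)) ` {..<b})" by auto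
  also have "card \<dots> = (\<Sum>b<n. card ((\<lambda>a. (a, b)) ` {..<b}))"
    by (intro card_UN_disjoint) auto
  also have "\<dots> = (\<Sum>b<n. b)" by (simp add: card_image inj_on_def)
  also have "\<dots> = n choose 2" by (simp add: choose_two lessThan_atLeast0 Sum_Ico_nat)
  finally show ?thesis .
qed

lemma finite_pairs: "finite {(a, b). a < b \<and> b < (n::nat)}"
  by (rule finite_subset[of _ "{..<n} \<times> {..<n}"]) auto

lemma Invs_st: "Invs st = {}"
  by (auto simp: Invs_def st simp del: upt_Suc)

lemma Invs_rev: "Invs (rev st) = {(a, b). a < b \<and> b < n}"
  by (auto simp: Invs_def st rev_nth simp del: upt_Suc)

lemma Invs_full:
  assumes "mset p = mset st" "card (Invs p) = n choose 2"
  shows "p = rev st"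
proof -
  have l: "length p = n" using assms(1) by (metis diff_Suc_1 length_upt size_mset st)
  have "Invs p = {(a, b). a < b \<and> b < n}"
    using card_subset_eq[OF finite_pairs Invs_subset[OF l]] card_pairs assms by simp
  then have "p ! b < p ! a" if "a < b" "b < n" for a b using that by (auto simp: Invs_def)
  then have "sorted (rev p)" using l
    by (auto simp: sorted_rev_iff_nth_mono le_less)
  then have "rev p = st"
    using assms(1) st by (metis properties_for_sort sort_upt mset_rev)
  then show ?thesis by auto
qed

text \<open>The length equals the number of all pairs, so the reverse permutation is reached exactly
  when no letter fails to create an inversion.\<close>

lemma sorting_network_iff_ascends:
  assumes "length w = n choose 2" "set w \<subseteq> {1..n-1}"
  shows "w \<in> sorting_networks n \<longleftrightarrow> ascends st w"
proof
  have sub: "set w \<subseteq> {1..<length st}" using assms(2) by (force simp: st)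
  {
    assume "w \<in> sorting_networks n"
    then have "fold adj_swap w st = rev st" by (simp add: sorting_networks_def st)
    then have "card (Invs (fold adj_swap w st)) = card (Invs st) + length w"
      using Invs_rev card_pairs Invs_st assms by simp
    then show "ascends st w" using card_Invs_fold[of st w] sub st by auto
  next
    assume a: "ascends st w"
    have "fold adj_swap w st = rev st"
      using card_Invs_ascends[OF a] Invs_st assms mset_fold_adj_swap[OF sub] by (intro Invs_full) auto
    then show "w \<in> sorting_networks n" using assms by (simp add: sorting_networks_def st)
  }
qed

text \<open>There are only \<open>n choose 2\<close> pairs to invert. This makes the exponential
  series of the operators terminate.\<close>

lemma fold_dd_long:
  assumes "set w \<subseteq> {1..n-1}" "length w > n choose 2"
  shows "fold dd w f = (\<lambda>x. 0)"
proof (rule fold_dd_not_ascends[OF assms(1)], rule notI)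
  assume a: "ascends st w"
  have "card (Invs (fold adj_swap w st)) \<le> n choose 2"
    using card_mono[OF finite_pairs Invs_subset[of "fold adj_swap w st"]] card_pairs by (simp add: st)
  then show False using card_Invs_ascends[OF a] assms by simp
qed

lemma fold_dd_word:
  assumes "set w \<subseteq> {1..n-1}" "length w = n choose 2" "v \<in> sorting_networks n"
  shows "fold dd w f = (if w \<in> sorting_networks n then fold dd v f else (\<lambda>x. 0))"
proof (cases "w \<in> sorting_networks n")
  case True
  have v: "length v = n choose 2" "set v \<subseteq> {1..n-1}" using assms(3) by (auto simp: sorting_networks_def)
  have "fold dd w f = fold dd v f"
    using True assms(3) sorting_network_iff_ascends[OF assms(2,1)] sorting_network_iff_ascends[OF v]
    by (intro fold_dd_unique) (auto simp: sorting_networks_def st)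
  then show ?thesis using True by simp
next
  case False
  then show ?thesis using fold_dd_not_ascends[OF assms(1)] sorting_network_iff_ascends[OF assms(2,1)] by simp
qed

end

lemma fold_adj_swap_rev:
  assumes "set w \<subseteq> {1..<length p}"
  shows "fold adj_swap (rev w) (fold adj_swap w p) = p"
  using assms by (induction w arbitrary: p) (auto simp: adj_swap_adj_swap)

lemma fold_adj_swap_map:
  assumes "set w \<subseteq> {1..<length p}"
  shows "fold adj_swap w (map g p) = map g (fold adj_swap w p)"
  using assms by (induction w arbitrary: p) (auto simp: adj_swap_map)

text \<open>The operators see the avoided letter at the end of a word, while
  \<open>first_swap_time\<close> looks at its beginning; reversal connects the two. Undoing a
  network leads from the reverse permutation to the identity, and relabelling entries by n + 1 - a
  makes this a path that starts at the identity.\<close>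

lemma rev_sorting_network:
  assumes "s \<in> sorting_networks n"
  shows "rev s \<in> sorting_networks n"
proof -
  let ?st = "[1..<n+1]"
  have s: "length s = n choose 2" "set s \<subseteq> {1..n-1}" "fold adj_swap s ?st = rev ?st"
    using assms by (auto simp: sorting_networks_def)
  have sub: "set s \<subseteq> {1..<length ?st}" using s(2) by force
  have g: "rev ?st = map (\<lambda>a. n + 1 - a) ?st"
    by (intro nth_equalityI) (auto simp: rev_nth nth_append)
  have gg: "map (\<lambda>a. n + 1 - a) (rev ?st) = ?st"
    by (intro nth_equalityI) (auto simp: rev_nth nth_append)
  have "?st = fold adj_swap (rev s) (rev ?st)" using fold_adj_swap_rev[OF sub] s by simp
  also have "\<dots> = map (\<lambda>a. n + 1 - a) (fold adj_swap (rev s) ?st)"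
    unfolding g by (rule fold_adj_swap_map) (use sub in auto)
  finally have "map (\<lambda>a. n + 1 - a) ?st = map (\<lambda>a. n + 1 - a) (map (\<lambda>a. n + 1 - a) (fold adj_swap (rev s) ?st))"
    by simp
  also have "\<dots> = fold adj_swap (rev s) ?st"
  proof -
    \<comment> \<open>The relabelling is an involution only on the entries 1, ..., n, so it must be
      known that no others occur.\<close>
    have "set (fold adj_swap (rev s) ?st) = set ?st"
      using mset_fold_adj_swap[of "rev s" ?st] sub by (metis mset_eq_setD set_rev)
    then show ?thesis by (auto intro!: map_idI)
  qed
  finally show ?thesis using s g by (auto simp: sorting_networks_def)
qed

section \<open>Minors formed by rows of power series\<close>

text \<open>The rows are numbered 1 to n - 1 and the columns are the coefficients n + 1 to 2n - 1. A
  row divisible by X^(2n) is therefore invisible.\<close>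

definition minor :: "nat \<Rightarrow> (nat \<Rightarrow> real fps) \<Rightarrow> real" where
  "minor n R = Determinant.det (Matrix.mat (n - 1) (n - 1) (\<lambda>(a, b). fps_nth (R (Suc a)) (n + 1 + b)))"

lemma minor_leibniz:
  "minor n R = (\<Sum>p | p permutes {0..<n-1}. signof p * (\<Prod>a = 0..<n-1. fps_nth (R (Suc a)) (n + 1 + p a)))"
  unfolding minor_def
  by (subst det_def'[of _ "n-1"])
     (auto intro!: sum.cong prod.cong arg_cong2[of _ _ _ _ "(*)"] simp: permutes_in_image)

lemma minor_cong:
  assumes "\<And>i. 1 \<le> i \<Longrightarrow> i < n \<Longrightarrow> R i = R' i"
  shows "minor n R = minor n R'"
  unfolding minor_leibniz using assms by (intro sum.cong refl arg_cong2[of _ _ _ _ "(*)"] prod.cong) auto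

lemma minor_row:
  assumes "1 \<le> i" "i < n"
  shows "minor n (R(i := F)) = (\<Sum>p | p permutes {0..<n-1}. 
     (signof p * (\<Prod>a \<in> {0..<n-1} - {i-1}. fps_nth (R (Suc a)) (n + 1 + p a))) * fps_nth F (n + 1 + p (i - 1)))"
  unfolding minor_leibniz
proof (intro sum.cong refl)
  fix p :: "nat \<Rightarrow> nat"
  have "(\<Prod>a = 0..<n-1. fps_nth ((R(i := F)) (Suc a)) (n + 1 + p a)) =
     fps_nth ((R(i := F)) (Suc (i - 1))) (n + 1 + p (i-1)) * (\<Prod>a \<in> {0..<n-1} - {i-1}. fps_nth ((R(i := F)) (Suc a)) (n + 1 + p a))"
    using assms by (intro prod.remove) auto
  also have "(\<Prod>a \<in> {0..<n-1} - {i-1}. fps_nth ((R(i := F)) (Suc a)) (n + 1 + p a))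
     = (\<Prod>a \<in> {0..<n-1} - {i-1}. fps_nth (R (Suc a)) (n + 1 + p a))"
    by (intro prod.cong) auto
  finally show "signof p * (\<Prod>a = 0..<n-1. fps_nth ((R(i := F)) (Suc a)) (n + 1 + p a)) = 
     signof p * (\<Prod>a \<in> {0..<n-1} - {i-1}. fps_nth (R (Suc a)) (n + 1 + p a)) * fps_nth F (n + 1 + p (i - 1))"
    using assms by simp
qed

lemma minor_row_add:
  assumes "1 \<le> i" "i < n"
  shows "minor n (R(i := F + G)) = minor n (R(i := F)) + minor n (R(i := G))"
  by (simp add: minor_row[OF assms] ring_distribs sum.distrib)

lemma minor_row_cmult:
  assumes "1 \<le> i" "i < n"
  shows "minor n (R(i := fps_const c * F)) = c * minor n (R(i := F))"
  by (simp add: minor_row[OF assms] sum_distrib_left mult_ac)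

lemma minor_row_diff:
  assumes "1 \<le> i" "i < n"
  shows "minor n (R(i := F - G)) = minor n (R(i := F)) - minor n (R(i := G))"
  by (simp add: minor_row[OF assms] ring_distribs sum_subtractf)

lemma minor_row_dup:
  assumes "1 \<le> i" "i < n" "1 \<le> j" "j < n" "i \<noteq> j"
  shows "minor n (R(i := R j)) = 0"
  unfolding minor_def
  by (rule det_identical_rows[of _ "n-1" "i-1" "j-1"]) (use assms in \<open>auto intro!: eq_vecI\<close>)

lemma minor_row_high:
  assumes "1 \<le> i" "i < n" "\<And>m. n < m \<Longrightarrow> m < 2 * n \<Longrightarrow> fps_nth F m = 0"
  shows "minor n (R(i := F)) = 0"
  unfolding minor_row[OF assms(1,2)]
proof (intro sum.neutral ballI)
  fix p assume "p \<in> {p. p permutes {0..<n - 1}}"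
  then have "p (i - 1) \<in> {0..<n-1}" using assms by (simp add: permutes_in_image)
  then have "fps_nth F (n + 1 + p (i - 1)) = 0" using assms by auto
  then show "signof p * (\<Prod>a\<in>{0..<n - 1} - {i - 1}. fps_nth (R (Suc a)) (n + 1 + p a)) *
         fps_nth F (n + 1 + p (i - 1)) = 0" by (simp only: mult_zero_right)
qed

section \<open>Differentiating a minor with respect to a parameter\<close>

definition fps_deriv_at :: "(real \<Rightarrow> real fps) \<Rightarrow> real fps \<Rightarrow> real \<Rightarrow> bool" where
  "fps_deriv_at F F' t \<longleftrightarrow> (\<forall>m. ((\<lambda>t. fps_nth (F t) m) has_real_derivative fps_nth F' m) (at t))"

lemma fps_deriv_at_cmult_left: "fps_deriv_at F F' t \<Longrightarrow> fps_deriv_at (\<lambda>t. G * F t) (G * F') t"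
  unfolding fps_deriv_at_def fps_mult_nth by (auto intro!: DERIV_sum DERIV_cmult)

lemma fps_deriv_at_cmult_right: "fps_deriv_at F F' t \<Longrightarrow> fps_deriv_at (\<lambda>t. F t * G) (F' * G) t"
  using fps_deriv_at_cmult_left[of F F' t G] by (simp add: mult.commute)

lemma fps_deriv_at_cutoff: "fps_deriv_at F F' t \<Longrightarrow> fps_deriv_at (\<lambda>t. fps_cutoff m (F t)) (fps_cutoff m F') t"
  unfolding fps_deriv_at_def by auto

lemma fps_deriv_at_exp: "fps_deriv_at (\<lambda>t. fps_exp (c + t)) (fps_X * fps_exp (c + t)) t"
  unfolding fps_deriv_at_def
proof
  fix m
  show "((\<lambda>t. fps_nth (fps_exp (c + t)) m) has_real_derivative fps_nth (fps_X * fps_exp (c + t)) m) (at t)"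
  proof (cases m)
    case (Suc m')
    have "((\<lambda>t. (c + t) ^ Suc m' / fact (Suc m')) has_real_derivative (real (Suc m') * (c + t) ^ m') / fact (Suc m')) (at t)"
      by (intro DERIV_cdivide) (rule DERIV_cong[OF DERIV_power_Suc[OF DERIV_add[OF DERIV_const DERIV_ident]]], simp)
    moreover have "(real (Suc m') * (c + t) ^ m') / fact (Suc m') = (c + t) ^ m' / fact m'"
      by (simp add: fact_Suc del: of_nat_Suc)
    ultimately have "((\<lambda>t. (c + t) ^ Suc m' / fact (Suc m')) has_real_derivative (c + t) ^ m' / fact m') (at t)"
      by simp
    moreover have "fps_nth (fps_exp (c + t)) m = (c + t) ^ Suc m' / fact (Suc m')" for t
      by (simp only: fps_exp_nth Suc of_nat_fact)
    moreover have "fps_nth (fps_X * fps_exp (c + t)) m = (c + t) ^ m' / fact m'"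
      by (simp add: Suc)
    ultimately show ?thesis by (simp only:)
  qed simp
qed

lemma minor_has_derivative:
  assumes "\<And>i. 1 \<le> i \<Longrightarrow> i < n \<Longrightarrow> fps_deriv_at (\<lambda>t. R t i) (R' i) t"
  shows "((\<lambda>t. minor n (R t)) has_real_derivative (\<Sum>i = 1..<n. minor n ((R t)(i := R' i)))) (at t)"
proof -
  have "((\<lambda>t. minor n (R t)) has_real_derivative
     (\<Sum>p | p permutes {0..<n-1}. signof p * (\<Sum>a = 0..<n-1. fps_nth (R' (Suc a)) (n + 1 + p a)
        * (\<Prod>b \<in> {0..<n-1} - {a}. fps_nth (R t (Suc b)) (n + 1 + p b))))) (at t)"
    unfolding minor_leibniz
    by (intro DERIV_sum DERIV_cmult has_field_derivative_prod)
       (use assms in \<open>auto simp: fps_deriv_at_def\<close>)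
  also have "(\<Sum>p | p permutes {0..<n-1}. signof p * (\<Sum>a = 0..<n-1. fps_nth (R' (Suc a)) (n + 1 + p a)
        * (\<Prod>b \<in> {0..<n-1} - {a}. fps_nth (R t (Suc b)) (n + 1 + p b))))
     = (\<Sum>a = 0..<n-1. minor n ((R t)(Suc a := R' (Suc a))))"
    unfolding sum_distrib_left
    by (subst sum.swap) (intro sum.cong refl, subst minor_row, auto simp: mult_ac)
  also have "\<dots> = (\<Sum>i = 1..<n. minor n ((R t)(i := R' i)))"
    by (rule sum.reindex_bij_witness[of _ "\<lambda>i. i - 1" Suc]) auto
  finally show ?thesis .
qed

section \<open>Complete and elementary symmetric series\<close>

definition geo :: "real \<Rightarrow> real fps" where "geo a = Abs_fps (\<lambda>m. a ^ m)"

definition lin :: "real \<Rightarrow> real fps" where "lin a = 1 - fps_const a * fps_X"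

lemma geo_eq: "geo a = 1 + fps_const a * fps_X * geo a"
proof (rule fps_ext)
  fix m show "fps_nth (geo a) m = fps_nth (1 + fps_const a * fps_X * geo a) m"
    by (cases m) (simp_all add: geo_def mult.assoc)
qed

lemma geo_lin: "geo a * lin a = 1"
  using geo_eq[of a] by (simp add: lin_def algebra_simps)

lemma geo_diff: "geo a - geo b = fps_const (a - b) * fps_X * geo a * geo b"
proof -
  have "geo a - geo b = geo a * (geo b * lin b) - geo b * (geo a * lin a)"
    by (simp add: geo_lin)
  also have "\<dots> = geo a * geo b * (lin b - lin a)" by (simp only: right_diff_distrib mult_ac)
  also have "lin b - lin a = fps_const (a - b) * fps_X"
    by (simp add: lin_def fps_const_sub[symmetric] left_diff_distrib del: fps_const_sub)
  finally show ?thesis by (simp add: mult_ac)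
qed

text \<open>Generating series of the complete homogeneous symmetric polynomials in the first
  \<open>m\<close> variables.\<close>

definition Hser :: "nat \<Rightarrow> (nat \<Rightarrow> real) \<Rightarrow> real fps" where
  "Hser m x = (\<Prod>j = 1..m. geo (x j))"

text \<open>Signed generating series of the elementary symmetric polynomials in the variables m + 1
  to k. It is the quotient of \<open>Hser m x\<close> by \<open>Hser k x\<close>.\<close>

definition Eser :: "nat \<Rightarrow> nat \<Rightarrow> (nat \<Rightarrow> real) \<Rightarrow> real fps" where
  "Eser k m x = (\<Prod>j = m+1..k. lin (x j))"

abbreviation "adjt i \<equiv> Transposition.transpose i (Suc i)"

lemma Hser_Suc: "Hser (Suc m) x = Hser m x * geo (x (Suc m))"
  by (simp add: Hser_def)

lemma Eser_step: "m < k \<Longrightarrow> Eser k m x = lin (x (Suc m)) * Eser k (Suc m) x"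
  unfolding Eser_def by (simp add: prod.atLeast_Suc_atMost)

lemma Hser_below: "m < i \<Longrightarrow> Hser m (x \<circ> adjt i) = Hser m x"
  unfolding Hser_def by (intro prod.cong) (auto simp: Transposition.transpose_def)

lemma Hser_above: "1 \<le> i \<Longrightarrow> i < m \<Longrightarrow> Hser m (x \<circ> adjt i) = Hser m x"
  unfolding Hser_def
  using prod.permute[OF permutes_swap_id, of i "{1..m}" "Suc i" "\<lambda>j. geo (x j)"] by (simp add: o_def)

lemma Hser_sym: "1 \<le> i \<Longrightarrow> m \<noteq> i \<Longrightarrow> Hser m (x \<circ> adjt i) = Hser m x"
  using Hser_below[of m i x] Hser_above[of i m x] by fastforce

lemma Eser_sym: 
  assumes "1 \<le> i" "m \<noteq> i" "k \<noteq> i" 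
  shows "Eser k m (x \<circ> adjt i) = Eser k m x"
proof (cases "m < i \<and> i < k")
  case True
  then show ?thesis unfolding Eser_def
    using prod.permute[OF permutes_swap_id, of i "{m+1..k}" "Suc i" "\<lambda>j. lin (x j)"] by (simp add: o_def)
next
  case False
  then show ?thesis unfolding Eser_def using assms
    by (intro prod.cong) (auto simp: Transposition.transpose_def)
qed

text \<open>The factor in front is the denominator of \<open>dd i\<close>. So \<open>dd i\<close>
  sends the series in i variables to X times the series in i + 1 variables.\<close>

lemma Hser_diff:
  assumes "1 \<le> i"
  shows "Hser i x - Hser i (x \<circ> adjt i) = fps_const (x i - x (Suc i)) * (fps_X * Hser (Suc i) x)"
proof -
  obtain j where j: "i = Suc j" using assms by (cases i) auto
  have "Hser i x - Hser i (x \<circ> adjt i) = Hser j x * (geo (x i) - geo (x (Suc i)))"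
    using Hser_below[of j i x] by (simp add: j Hser_Suc right_diff_distrib)
  also have "\<dots> = fps_const (x i - x (Suc i)) * (fps_X * Hser (Suc i) x)"
    by (simp only: geo_diff j Hser_Suc mult_ac)
  finally show ?thesis .
qed

lemma Hser_shift: "Hser (Suc i) x = Hser i x + fps_const (x (Suc i)) * (fps_X * Hser (Suc i) x)"
  unfolding Hser_Suc by (subst (1) geo_eq) (simp add: ring_distribs mult_ac)

lemma Eser_diff:
  assumes "1 \<le> i" "i < k"
  shows "Eser k i x - Eser k i (x \<circ> adjt i) = fps_const (x i - x (Suc i)) * (fps_X * Eser k (Suc i) x)"
proof -
  have "Eser k i x - Eser k i (x \<circ> adjt i) = (lin (x (Suc i)) - lin (x i)) * Eser k (Suc i) x"
    using assms Eser_sym[of i "Suc i" k x] by (simp add: Eser_step left_diff_distrib)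
  also have "lin (x (Suc i)) - lin (x i) = fps_const (x i - x (Suc i)) * fps_X"
    by (simp add: lin_def fps_const_sub[symmetric] left_diff_distrib del: fps_const_sub)
  finally show ?thesis by (simp only: mult_ac)
qed

lemma Eser_shift:
  assumes "i < k"
  shows "Eser k (Suc i) x = Eser k i x + fps_const (x (Suc i)) * (fps_X * Eser k (Suc i) x)"
  using Eser_step[OF assms, of x] by (simp add: lin_def algebra_simps)

section \<open>A determinant that solves the flow of the divided differences\<close>

text \<open>Without the truncation both branches would be X^(2i) e^((t+s)X) \<open>Hser i x\<close>,
  because \<open>Hser k\<close> times \<open>Eser k i\<close> is \<open>Hser i\<close>. The shift 2i
  is chosen so that \<open>dd i\<close> turns row \<open>i\<close> into X times itself plus a
  multiple of row \<open>i + 1\<close>, which a determinant ignores. For rows up to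
  \<open>k\<close>, time \<open>s\<close> acts under a truncation at degree 2k. This freezes row
  \<open>k\<close>, and with it letter \<open>k\<close>; the factor \<open>Hser k\<close> outside is
  symmetric under all the other exchanges.\<close>

definition rowU :: "nat \<Rightarrow> real \<Rightarrow> real \<Rightarrow> (nat \<Rightarrow> real) \<Rightarrow> nat \<Rightarrow> real fps" where
  "rowU k s t x i = (if i \<le> k
     then fps_exp t * Hser k x * fps_cutoff (Suc (2 * k)) (fps_X ^ (2 * i) * fps_exp s * Eser k i x)
     else fps_X ^ (2 * i) * fps_exp (t + s) * Hser i x)"

definition rowU' :: "nat \<Rightarrow> real \<Rightarrow> real \<Rightarrow> (nat \<Rightarrow> real) \<Rightarrow> nat \<Rightarrow> real fps" where
  "rowU' k s t x i = (if i \<le> k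
     then fps_exp t * Hser k x * fps_cutoff (Suc (2 * k)) (fps_X ^ Suc (2 * i) * fps_exp s * Eser k i x)
     else fps_X ^ Suc (2 * i) * fps_exp (t + s) * Hser i x)"

definition Udet :: "nat \<Rightarrow> nat \<Rightarrow> real \<Rightarrow> real \<Rightarrow> (nat \<Rightarrow> real) \<Rightarrow> real" where
  "Udet n k s t x = minor n (rowU k s t x)"

lemma rowU_deriv: "fps_deriv_at (\<lambda>s. rowU k s t x i) (rowU' k s t x i) s"
proof (cases "i \<le> k")
  case True
  have *: "fps_X ^ Suc (2 * i) * fps_exp s * Eser k i x = fps_X ^ (2 * i) * (fps_X * fps_exp s) * Eser k i x"
    by (simp add: mult_ac)
  have "fps_deriv_at (\<lambda>s. fps_exp s) (fps_X * fps_exp s) s"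
    using fps_deriv_at_exp[of 0 s] by simp
  then show ?thesis using True unfolding rowU_def rowU'_def *
    by (auto intro!: fps_deriv_at_cmult_left fps_deriv_at_cmult_right fps_deriv_at_cutoff simp del: fps_cutoff_nth)
next
  case False
  have *: "fps_X ^ Suc (2 * i) * fps_exp (t + s) * Hser i x = fps_X ^ (2 * i) * (fps_X * fps_exp (t + s)) * Hser i x"
    by (simp add: mult_ac)
  show ?thesis using False fps_deriv_at_exp[of t s] unfolding rowU_def rowU'_def *
    by (auto intro!: fps_deriv_at_cmult_left fps_deriv_at_cmult_right)
qed

lemma fps_cutoff_cmult: "fps_cutoff m (fps_const c * F :: real fps) = fps_const c * fps_cutoff m F"
  by (rule fps_ext) simp

text \<open>The shift identities split the difference into the \<open>s\<close>-derivative of row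
  \<open>i\<close> and a multiple of row \<open>i + 1\<close>. Truncation is linear, so the
  splitting survives it.\<close>

lemma rowU_diff:
  assumes "1 \<le> i" "i \<noteq> k"
  shows "rowU k s t x i - rowU k s t (x \<circ> adjt i) i
     = fps_const (x i - x (Suc i)) * (rowU' k s t x i + fps_const (x (Suc i)) * rowU k s t x (Suc i))"
proof (cases "i \<le> k")
  case True
  then have i: "i < k" using assms by simp
  let ?c = "fps_cutoff (Suc (2 * k))" and ?P = "fps_X ^ (2 * i) * fps_exp s"
  have "rowU k s t x i - rowU k s t (x \<circ> adjt i) i = fps_exp t * Hser k x * ?c (?P * (Eser k i x - Eser k i (x \<circ> adjt i)))"
    using True assms Hser_sym[of i k x]
    by (simp add: rowU_def right_diff_distrib fps_cutoff_diff)
  also have "?P * (Eser k i x - Eser k i (x \<circ> adjt i)) = fps_const (x i - x (Suc i)) * (?P * (fps_X * Eser k (Suc i) x))"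
    by (subst Eser_diff[OF assms(1) i]) (simp only: mult_ac)
  also have "?P * (fps_X * Eser k (Suc i) x) = fps_X ^ Suc (2 * i) * fps_exp s * Eser k i x
      + fps_const (x (Suc i)) * (fps_X ^ (2 * Suc i) * fps_exp s * Eser k (Suc i) x)"
    by (subst Eser_shift[OF i]) (simp add: ring_distribs mult_ac)
  finally have e: "rowU k s t x i - rowU k s t (x \<circ> adjt i) i = fps_exp t * Hser k x *
     (fps_const (x i - x (Suc i)) * (?c (fps_X ^ Suc (2 * i) * fps_exp s * Eser k i x)
      + fps_const (x (Suc i)) * ?c (fps_X ^ (2 * Suc i) * fps_exp s * Eser k (Suc i) x)))"
    by (simp only: fps_cutoff_cmult fps_cutoff_add)
  have r: "rowU' k s t x i = fps_exp t * Hser k x * ?c (fps_X ^ Suc (2 * i) * fps_exp s * Eser k i x)"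
    "rowU k s t x (Suc i) = fps_exp t * Hser k x * ?c (fps_X ^ (2 * Suc i) * fps_exp s * Eser k (Suc i) x)"
    using i unfolding rowU_def rowU'_def by simp_all
  show ?thesis unfolding e r by (simp only: ring_distribs mult_ac)
next
  case False
  let ?P = "fps_X ^ (2 * i) * fps_exp (t + s)"
  have "rowU k s t x i - rowU k s t (x \<circ> adjt i) i = ?P * (Hser i x - Hser i (x \<circ> adjt i))"
    using False by (simp add: rowU_def right_diff_distrib)
  also have "\<dots> = fps_const (x i - x (Suc i)) * (?P * (fps_X * Hser (Suc i) x))"
    by (subst Hser_diff[OF assms(1)]) (simp only: mult_ac)
  also have "?P * (fps_X * Hser (Suc i) x) = fps_X ^ Suc (2 * i) * fps_exp (t + s) * Hser i x
      + fps_const (x (Suc i)) * (fps_X ^ (2 * Suc i) * fps_exp (t + s) * Hser (Suc i) x)"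
    by (subst Hser_shift) (simp add: ring_distribs mult_ac)
  finally have e: "rowU k s t x i - rowU k s t (x \<circ> adjt i) i = fps_const (x i - x (Suc i)) *
     (fps_X ^ Suc (2 * i) * fps_exp (t + s) * Hser i x
      + fps_const (x (Suc i)) * (fps_X ^ (2 * Suc i) * fps_exp (t + s) * Hser (Suc i) x))" .
  have r: "rowU' k s t x i = fps_X ^ Suc (2 * i) * fps_exp (t + s) * Hser i x"
    "rowU k s t x (Suc i) = fps_X ^ (2 * Suc i) * fps_exp (t + s) * Hser (Suc i) x"
    using False unfolding rowU_def rowU'_def by simp_all
  show ?thesis unfolding e r ..
qed

lemma rowU_sym:
  assumes "1 \<le> i" "i \<noteq> k" "m \<noteq> i"
  shows "rowU k s t (x \<circ> adjt i) m = rowU k s t x m"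
  using assms Hser_sym[of i k x] Hser_sym[of i m x] Eser_sym[of i m k x] by (simp add: rowU_def)

lemma dd_minor:
  assumes x: "inj x" and i: "1 \<le> i" "i < n" 
    and sym: "\<And>m. 1 \<le> m \<Longrightarrow> m < n \<Longrightarrow> m \<noteq> i \<Longrightarrow> R (x \<circ> adjt i) m = R x m"
    and diff: "R x i - R (x \<circ> adjt i) i = fps_const (x i - x (Suc i)) * F"
  shows "dd i (\<lambda>x. minor n (R x)) x = minor n ((R x)(i := F))"
proof -
  have ne: "x i - x (Suc i) \<noteq> 0" using x by (auto dest: injD)
  have "minor n (R x) - minor n (R (x \<circ> adjt i)) = minor n ((R x)(i := R x i)) - minor n ((R x)(i := R (x \<circ> adjt i) i))"
    using sym by (intro arg_cong2[of _ _ _ _ "(-)"] minor_cong) auto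
  also have "\<dots> = (x i - x (Suc i)) * minor n ((R x)(i := F))"
    by (simp only: minor_row_diff[OF i, symmetric] diff minor_row_cmult[OF i])
  finally show ?thesis using x ne by (simp add: dd_def)
qed

lemma dd_Udet:
  assumes x: "inj x" and i: "1 \<le> i" "i < n" "i \<noteq> k"
  shows "dd i (Udet n k s t) x = minor n ((rowU k s t x)(i := rowU' k s t x i))"
proof -
  have "dd i (Udet n k s t) x = minor n ((rowU k s t x)(i := rowU' k s t x i + fps_const (x (Suc i)) * rowU k s t x (Suc i)))"
    unfolding Udet_def using rowU_sym[OF i(1,3)] rowU_diff[OF i(1,3)]
    by (intro dd_minor[of x i n "rowU k s t", OF x i(1,2)])
  also have "\<dots> = minor n ((rowU k s t x)(i := rowU' k s t x i)) + x (Suc i) * minor n ((rowU k s t x)(i := rowU k s t x (Suc i)))"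
    by (simp only: minor_row_add[OF i(1,2)] minor_row_cmult[OF i(1,2)])
  \<comment> \<open>Row \<open>i + 1\<close> either occurs in the minor already or, for i = n - 1,
    starts at degree 2n, past the last column.\<close>
  also have "minor n ((rowU k s t x)(i := rowU k s t x (Suc i))) = 0"
  proof (cases "Suc i < n")
    case True
    then show ?thesis using i by (intro minor_row_dup) auto
  next
    case False
    then have n: "n = Suc i" using i by simp
    show ?thesis
    proof (rule minor_row_high[OF i(1,2)])
      fix m assume m: "n < m" "m < 2 * n"
      show "fps_nth (rowU k s t x (Suc i)) m = 0"
      proof (cases "n \<le> k")
        case True
        have "fps_cutoff (Suc (2 * k)) (fps_X ^ (2 * n) * fps_exp s * Eser k n x)
           = fps_X ^ (2 * n) * fps_cutoff (Suc (2 * k) - 2 * n) (fps_exp s * Eser k n x)"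
          by (rule fps_ext) (auto simp: fps_X_power_mult_nth mult.assoc)
        then have "rowU k s t x (Suc i) = fps_X ^ (2 * n) * (fps_exp t * Hser k x * fps_cutoff (Suc (2 * k) - 2 * n) (fps_exp s * Eser k n x))"
          using True n by (simp add: rowU_def mult_ac)
        then show ?thesis using m by (simp add: fps_X_power_mult_nth)
      next
        case False
        then show ?thesis using m n by (simp add: rowU_def mult.assoc fps_X_power_mult_nth)
      qed
    qed
  qed
  finally show ?thesis by (simp only: mult_zero_right add_0_right)
qed

lemma Udet_deriv:
  assumes x: "inj x"
  shows "((\<lambda>s. Udet n k s t x) has_real_derivative (\<Sum>i\<in>{1..<n} - {k}. dd i (Udet n k s t) x)) (at s)"
proof -
  have "((\<lambda>s. Udet n k s t x) has_real_derivative (\<Sum>i = 1..<n. minor n ((rowU k s t x)(i := rowU' k s t x i)))) (at s)"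
    unfolding Udet_def by (rule minor_has_derivative) (rule rowU_deriv)
  also have "(\<Sum>i = 1..<n. minor n ((rowU k s t x)(i := rowU' k s t x i))) = 
      (\<Sum>i\<in>{1..<n} - {k}. minor n ((rowU k s t x)(i := rowU' k s t x i)))"
  proof (rule sum.mono_neutral_right)
    show "\<forall>i\<in>{1..<n} - ({1..<n} - {k}). minor n ((rowU k s t x)(i := rowU' k s t x i)) = 0"
    proof
      fix i assume "i \<in> {1..<n} - ({1..<n} - {k})"
      then have i: "i = k" "1 \<le> i" "i < n" by auto
      \<comment> \<open>The derivative of row \<open>k\<close> starts at degree 2k + 1 and is
        truncated away. This is how letter \<open>k\<close> disappears from the flow.\<close>
      have "fps_cutoff (Suc (2 * k)) (fps_X ^ Suc (2 * i) * fps_exp s * Eser k i x) = 0"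
        by (rule fps_ext) (auto simp: i fps_X_power_mult_nth mult.assoc simp del: power_Suc)
      then have "rowU' k s t x i = 0" by (simp add: rowU'_def i)
      then show "minor n ((rowU k s t x)(i := rowU' k s t x i)) = 0"
        by (intro minor_row_high) (use i in auto)
    qed
  qed auto
  also have "\<dots> = (\<Sum>i\<in>{1..<n} - {k}. dd i (Udet n k s t) x)"
    by (intro sum.cong refl dd_Udet[symmetric] x) auto
  finally show ?thesis .
qed

lemma Eser_high: "k - i < m \<Longrightarrow> fps_nth (Eser k i x) m = 0"
proof (induction "k - i" arbitrary: i m)
  case 0
  then show ?case by (simp add: Eser_def)
next
  case (Suc d)
  then have i: "i < k" by simp
  have "fps_nth (Eser k (Suc i) x) m = 0" "fps_nth (Eser k (Suc i) x) (m - 1) = 0"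
    using Suc.hyps Suc.prems by (auto intro!: Suc.hyps(1))
  then show ?case using i
    by (simp add: Eser_step lin_def left_diff_distrib mult.assoc)
qed

lemma Hser_Eser: "i \<le> k \<Longrightarrow> Hser k x * Eser k i x = Hser i x"
proof (induction "k - i" arbitrary: i)
  case (Suc d)
  then have i: "i < k" by simp
  have "Hser k x * Eser k i x = lin (x (Suc i)) * (Hser k x * Eser k (Suc i) x)"
    using Eser_step[OF i] by (simp add: mult_ac)
  also have "Hser k x * Eser k (Suc i) x = Hser (Suc i) x" using Suc i by auto
  also have "lin (x (Suc i)) * Hser (Suc i) x = Hser i x * (geo (x (Suc i)) * lin (x (Suc i)))"
    by (simp only: Hser_Suc mult_ac)
  finally show ?case by (simp add: geo_lin)
qed (simp add: Eser_def)

text \<open>At s = 0 the truncation removes nothing, since X^(2i) \<open>Eser k i x\<close> has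
  degree at most 2i + (k - i) \<le> 2k.\<close>

lemma rowU_0:
  assumes "1 \<le> i"
  shows "rowU k 0 t x i = rowU 0 t 0 x i"
proof (cases "i \<le> k")
  case True
  have "fps_cutoff (Suc (2 * k)) (fps_X ^ (2 * i) * Eser k i x) = fps_X ^ (2 * i) * Eser k i x"
    using True by (intro fps_ext) (auto simp: fps_X_power_mult_nth intro!: Eser_high)
  then have "rowU k 0 t x i = fps_exp t * fps_X ^ (2 * i) * (Hser k x * Eser k i x)"
    using True by (simp add: rowU_def mult_ac)
  then show ?thesis using assms by (simp add: Hser_Eser[OF True] rowU_def mult_ac)
qed (use assms in \<open>simp add: rowU_def\<close>)

lemma Udet_0: "Udet n k 0 t x = Udet n 0 t 0 x"
  unfolding Udet_def by (intro minor_cong rowU_0) auto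

section \<open>The exponential flow as a sum over words\<close>

definition words :: "'a set \<Rightarrow> nat \<Rightarrow> 'a list set" where
  "words S q = {w. set w \<subseteq> S \<and> length w = q}"

lemma finite_words [simp]: "finite S \<Longrightarrow> finite (words S q)"
  unfolding words_def by (rule finite_lists_length_eq)

lemma words_0 [simp]: "words S 0 = {[]}"
  by (auto simp: words_def)

lemma dd_sum:
  "dd i (\<lambda>x. \<Sum>a\<in>A. c a * f a x) = (\<lambda>x. \<Sum>a\<in>A. c a * dd i (f a) x)"
proof
  fix x
  show "dd i (\<lambda>x. \<Sum>a\<in>A. c a * f a x) x = (\<Sum>a\<in>A. c a * dd i (f a) x)"
    by (simp add: dd_def sum_subtractf[symmetric] sum_divide_distrib right_diff_distrib)
qed

lemma fold_dd_sum:
  "fold dd w (\<lambda>x. \<Sum>a\<in>A. c a * f a x) = (\<lambda>x. \<Sum>a\<in>A. c a * fold dd w (f a) x)"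
proof (induction w rule: rev_induct)
  case (snoc i w)
  then show ?case using dd_sum[of i c "\<lambda>a. fold dd w (f a)" A] by simp
qed simp

lemma fold_dd_sum1:
  "fold dd w (\<lambda>x. \<Sum>a\<in>A. f a x) = (\<lambda>x. \<Sum>a\<in>A. fold dd w (f a) x)"
  using fold_dd_sum[of w "\<lambda>_. 1" f A] by simp

lemma dd_cong_inj:
  assumes "\<And>x. inj x \<Longrightarrow> f x = g x" 
  shows "dd i f = dd i g"
  using assms by (auto simp: dd_def fun_eq_iff)

lemma fold_dd_cong_inj:
  assumes "\<And>x. inj x \<Longrightarrow> f x = g x" and "inj x"
  shows "fold dd w f x = fold dd w g x"
  using assms(2)
proof (induction w arbitrary: x rule: rev_induct)
  case (snoc i w)
  then show ?case using dd_cong_inj[of "fold dd w f" "fold dd w g" i] by simp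
qed (use assms in auto)

lemma dd_inj: "inj x \<Longrightarrow> dd i f x = (f x - f (x \<circ> adjt i)) / (x i - x (Suc i))"
  by (simp add: dd_def)

lemma fold_dd_deriv:
  assumes "\<And>x. inj x \<Longrightarrow> ((\<lambda>s. f s x) has_real_derivative g x) (at s)" and "inj x"
  shows "((\<lambda>s. fold dd w (f s) x) has_real_derivative fold dd w g x) (at s)"
  using assms(2)
proof (induction w arbitrary: x rule: rev_induct)
  case (snoc i w)
  have "((\<lambda>s. (fold dd w (f s) x - fold dd w (f s) (x \<circ> adjt i)) / (x i - x (Suc i))) has_real_derivative
         (fold dd w g x - fold dd w g (x \<circ> adjt i)) / (x i - x (Suc i))) (at s)"
    by (intro DERIV_cdivide DERIV_diff snoc.IH) (simp_all only: inj_comp_transpose snoc.prems)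
  then show ?case using snoc.prems by (simp add: dd_inj)
qed (use assms in auto)

text \<open>Taylor's formula in \<open>s\<close>: the m-th derivative is the sum over words of
  length m, and words longer than \<open>n choose 2\<close> act as 0, so the remainder
  vanishes.\<close>

lemma dd_flow_expansion:
  fixes f :: "real \<Rightarrow> (nat \<Rightarrow> real) \<Rightarrow> real"
  assumes S: "finite S" "S \<subseteq> {1..n-1}"
    and ode: "\<And>x s. inj x \<Longrightarrow> ((\<lambda>s. f s x) has_real_derivative (\<Sum>i\<in>S. dd i (f s) x)) (at s)"
    and x: "inj x"
  shows "f s x = (\<Sum>r\<le>n choose 2. s ^ r / fact r * (\<Sum>w\<in>words S r. fold dd w (f 0) x))"
proof -
  define diff where "diff m s = (\<Sum>w\<in>words S m. fold dd w (f s) x)" for m s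
  have "DERIV (diff m) s :> diff (Suc m) s" for m s
  proof -
    have "DERIV (diff m) s :> (\<Sum>w\<in>words S m. fold dd w (\<lambda>x. \<Sum>i\<in>S. dd i (f s) x) x)"
      unfolding diff_def by (intro DERIV_sum fold_dd_deriv ode x)
    also have "(\<Sum>w\<in>words S m. fold dd w (\<lambda>x. \<Sum>i\<in>S. dd i (f s) x) x)
        = (\<Sum>(i, w)\<in>S \<times> words S m. fold dd (i # w) (f s) x)"
      using S by (subst sum.cartesian_product[symmetric], subst sum.swap) (simp add: fold_dd_sum1)
    also have "\<dots> = diff (Suc m) s" unfolding diff_def
      by (rule sum.reindex_bij_witness[of _ "\<lambda>w. (hd w, tl w)" "\<lambda>(i, w). i # w"])
         (auto simp: words_def length_Suc_conv)
    finally show ?thesis .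
  qed
  moreover have "diff 0 = (\<lambda>s. f s x)" by (simp add: diff_def fun_eq_iff)
  ultimately obtain t where t: "f s x = (\<Sum>m<Suc (n choose 2). (diff m 0 / fact m) * s ^ m) 
      + (diff (Suc (n choose 2)) t / fact (Suc (n choose 2))) * s ^ Suc (n choose 2)"
    using Maclaurin_all_le[of diff "\<lambda>s. f s x" s "Suc (n choose 2)"] by blast
  have "diff (Suc (n choose 2)) t = 0"
    unfolding diff_def
  proof (intro sum.neutral ballI)
    fix w assume "w \<in> words S (Suc (n choose 2))"
    then have "set w \<subseteq> {1..n-1}" "length w > n choose 2" using S by (auto simp: words_def)
    then show "fold dd w (f t) x = 0" using fold_dd_long[OF refl, of w n] by simp
  qed
  then have "f s x = (\<Sum>m<Suc (n choose 2). (diff m 0 / fact m) * s ^ m)" using t by simp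
  also have "\<dots> = (\<Sum>r\<le>n choose 2. s ^ r / fact r * diff r 0)"
    by (simp add: lessThan_Suc_atMost mult_ac)
  finally show ?thesis by (simp add: diff_def)
qed

text \<open>Two flows in succession: for time \<open>t\<close> with all letters (the value 0 in
  place of \<open>k\<close> excludes none of them), then for time \<open>s\<close> without
  \<open>k\<close>. Since \<open>fold\<close> applies the head first, \<open>u\<close> precedes
  \<open>v\<close> in the word.\<close>

lemma Udet_expansion:
  assumes x: "inj x"
  shows "Udet n k s t x = (\<Sum>r\<le>n choose 2. s ^ r / fact r * (\<Sum>v\<in>words ({1..<n} - {k}) r.
     \<Sum>q\<le>n choose 2. t ^ q / fact q * (\<Sum>u\<in>words {1..<n} q. fold dd (u @ v) (Udet n 0 0 0) x)))"
proof -
  have sub: "{1..<n} - {j} \<subseteq> {1..n-1}" for j by auto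
  have U0: "Udet n 0 t 0 y = (\<Sum>q\<le>n choose 2. t ^ q / fact q * (\<Sum>u\<in>words {1..<n} q. fold dd u (Udet n 0 0 0) y))"
    if "inj y" for y
    using dd_flow_expansion[of "{1..<n} - {0}" n "\<lambda>s. Udet n 0 s 0" y t, OF _ sub Udet_deriv that] by simp
  have F: "fold dd v (Udet n k 0 t) x = (\<Sum>q\<le>n choose 2. t ^ q / fact q * (\<Sum>u\<in>words {1..<n} q. fold dd (u @ v) (Udet n 0 0 0) x))" for v
  proof -
    have "fold dd v (Udet n k 0 t) x = fold dd v (\<lambda>y. \<Sum>q\<le>n choose 2. t ^ q / fact q * (\<Sum>u\<in>words {1..<n} q. fold dd u (Udet n 0 0 0) y)) x"
      using U0 x by (intro fold_dd_cong_inj) (simp_all add: Udet_0)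
    also have "\<dots> = (\<Sum>q\<le>n choose 2. t ^ q / fact q * fold dd v (\<lambda>y. \<Sum>u\<in>words {1..<n} q. fold dd u (Udet n 0 0 0) y) x)"
      by (rule fun_cong[OF fold_dd_sum])
    finally show ?thesis by (simp only: fold_dd_sum1 fold_append comp_apply)
  qed
  have "Udet n k s t x = (\<Sum>r\<le>n choose 2. s ^ r / fact r * (\<Sum>v\<in>words ({1..<n} - {k}) r. fold dd v (Udet n k 0 t) x))"
    by (rule dd_flow_expansion[OF _ sub Udet_deriv x]) auto
  then show ?thesis by (simp only: F)
qed

section \<open>Homogeneity and continuity near the origin\<close>

text \<open>Restricted to injective points, where \<open>dd\<close> is a genuine quotient, and to
  positive factors, which preserve injectivity.\<close>

definition homog :: "nat \<Rightarrow> ((nat \<Rightarrow> real) \<Rightarrow> real) \<Rightarrow> bool" where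
  "homog d f \<longleftrightarrow> (\<forall>c>0. \<forall>x. inj x \<longrightarrow> f (\<lambda>i. c * x i) = c ^ d * f x)"

lemma homog_dd:
  assumes "homog (Suc d) f"
  shows "homog d (dd i f)"
  unfolding homog_def
proof (intro allI impI)
  fix c :: real and x :: "nat \<Rightarrow> real" assume c: "0 < c" and x: "inj x"
  have cx: "inj (\<lambda>i. c * x i)" using c x by (auto simp: inj_def)
  have "f ((\<lambda>i. c * x i) \<circ> adjt i) = f (\<lambda>j. c * (x \<circ> adjt i) j)" by (simp add: o_def)
  also have "\<dots> = c ^ Suc d * f (x \<circ> adjt i)" using assms c x by (simp only: homog_def inj_comp_transpose)
  finally have "dd i f (\<lambda>i. c * x i) = (c ^ Suc d * f x - c ^ Suc d * f (x \<circ> adjt i)) / (c * x i - c * x (Suc i))"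
    using assms c x cx by (simp add: dd_def homog_def)
  also have "\<dots> = (c * (c ^ d * (f x - f (x \<circ> adjt i)))) / (c * (x i - x (Suc i)))"
    by (simp add: algebra_simps)
  also have "\<dots> = c ^ d * dd i f x" using c x by (simp add: dd_def)
  finally show "dd i f (\<lambda>i. c * x i) = c ^ d * dd i f x" .
qed

lemma homog_fold_dd: "homog (d + length w) f \<Longrightarrow> homog d (fold dd w f)"
  by (induction w arbitrary: f) (auto intro: homog_dd)

lemma Hser_scale: "fps_nth (Hser i (\<lambda>i. c * x i)) m = c ^ m * fps_nth (Hser i x) m"
proof (induction i arbitrary: m)
  case 0
  show ?case by (simp add: Hser_def)
next
  case (Suc i)
  show ?case unfolding Hser_Suc fps_mult_nth sum_distrib_left
  proof (intro sum.cong refl)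
    fix j assume j: "j \<in> {0..m}"
    have "c ^ m = c ^ j * c ^ (m - j)" using j by (simp add: power_add[symmetric])
    then show "fps_nth (Hser i (\<lambda>i. c * x i)) j * fps_nth (geo (c * x (Suc i))) (m - j) =
         c ^ m * (fps_nth (Hser i x) j * fps_nth (geo (x (Suc i))) (m - j))"
      by (simp add: Suc geo_def power_mult_distrib)
  qed
qed

text \<open>The entry of row i and column m has degree m - 2i. Hence each Leibniz term has as degree
  the sum of the columns minus twice the sum of the rows, whatever the permutation. Multiplying row
  i by c^(2i) avoids negative exponents.\<close>

lemma homog_Udet0: "homog (n choose 2) (Udet n 0 0 0)"
  unfolding homog_def
proof (intro allI impI)
  fix c :: real and x :: "nat \<Rightarrow> real" assume c: "0 < c"
  have e: "c ^ (2 * i) * fps_nth (rowU 0 0 0 (\<lambda>i. c * x i) i) m = c ^ m * fps_nth (rowU 0 0 0 x i) m" if "1 \<le> i" for i m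
  proof (cases "m < 2 * i")
    case False
    then have "c ^ m = c ^ (2 * i) * c ^ (m - 2 * i)" by (simp add: power_add[symmetric])
    then show ?thesis using that by (simp add: rowU_def fps_X_power_mult_nth Hser_scale)
  qed (use that in \<open>simp add: rowU_def fps_X_power_mult_nth\<close>)
  have pc: "(\<Prod>a = 0..<n-1. c ^ (n + 1 + p a)) = (\<Prod>a = 0..<n-1. c ^ (n + 1 + a))" if "p permutes {0..<n-1}" for p
    using prod.permute[OF that, of "\<lambda>a. c ^ (n + 1 + a)"] by (simp only: o_def)
  have sums: "(\<Sum>a = 0..<n-1. n + 1 + a) = (\<Sum>a = 0..<n-1. 2 * Suc a) + (n choose 2)"
  proof -
    have "(\<Sum>a = 0..<n-1. n + 1 + a) = (\<Sum>a = 0..<n-1. 2 * Suc a + (n - 1 - a))"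
      by (intro sum.cong) auto
    also have "\<dots> = (\<Sum>a = 0..<n-1. 2 * Suc a) + (\<Sum>a = 0..<n-1. n - 1 - a)" by (rule sum.distrib)
    also have "(\<Sum>a = 0..<n-1. n - 1 - a) = (\<Sum>b = 0..<n. b)"
      by (rule sum.reindex_bij_witness_not_neutral[of "{}" "{0::nat}" _ "\<lambda>b. n - 1 - b" "\<lambda>b. n - 1 - b"]) auto
    also have "\<dots> = n choose 2" by (simp add: choose_two Sum_Ico_nat)
    finally show ?thesis .
  qed
  have "(\<Prod>a = 0..<n-1. c ^ (2 * Suc a)) * Udet n 0 0 0 (\<lambda>i. c * x i) 
     = (\<Sum>p | p permutes {0..<n-1}. signof p * (\<Prod>a = 0..<n-1. c ^ (2 * Suc a) * fps_nth (rowU 0 0 0 (\<lambda>i. c * x i) (Suc a)) (n + 1 + p a)))"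
    unfolding Udet_def minor_leibniz by (simp add: sum_distrib_left prod.distrib mult_ac)
  also have "\<dots> = (\<Sum>p | p permutes {0..<n-1}. signof p * (\<Prod>a = 0..<n-1. c ^ (n + 1 + p a) * fps_nth (rowU 0 0 0 x (Suc a)) (n + 1 + p a)))"
    by (subst e) auto
  also have "\<dots> = (\<Prod>a = 0..<n-1. c ^ (n + 1 + a)) * Udet n 0 0 0 x"
    unfolding Udet_def minor_leibniz sum_distrib_left
    by (intro sum.cong refl) (simp only: prod.distrib mem_Collect_eq pc mult_ac)
  also have "(\<Prod>a = 0..<n-1. c ^ (n + 1 + a)) = (\<Prod>a = 0..<n-1. c ^ (2 * Suc a)) * c ^ (n choose 2)"
    unfolding power_sum[symmetric] sums by (simp add: power_add)
  finally show "Udet n 0 0 0 (\<lambda>i. c * x i) = c ^ (n choose 2) * Udet n 0 0 0 x"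
    using c by simp
qed

definition fps_tendsto :: "('c \<Rightarrow> real fps) \<Rightarrow> real fps \<Rightarrow> 'c filter \<Rightarrow> bool" where
  "fps_tendsto F G A \<longleftrightarrow> (\<forall>m. ((\<lambda>c. fps_nth (F c) m) \<longlongrightarrow> fps_nth G m) A)"

lemma fps_tendsto_const: "fps_tendsto (\<lambda>c. F) F A"
  by (simp add: fps_tendsto_def)

lemma fps_tendsto_mult: "fps_tendsto F F' A \<Longrightarrow> fps_tendsto G G' A \<Longrightarrow> fps_tendsto (\<lambda>c. F c * G c) (F' * G') A"
  unfolding fps_tendsto_def fps_mult_nth by (auto intro!: tendsto_intros)

lemma fps_tendsto_cutoff: "fps_tendsto F F' A \<Longrightarrow> fps_tendsto (\<lambda>c. fps_cutoff m (F c)) (fps_cutoff m F') A"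
  unfolding fps_tendsto_def by auto

lemma fps_tendsto_prod: "(\<And>i. i \<in> I \<Longrightarrow> fps_tendsto (F i) (F' i) A) \<Longrightarrow> fps_tendsto (\<lambda>c. \<Prod>i\<in>I. F i c) (\<Prod>i\<in>I. F' i) A"
  by (induction I rule: infinite_finite_induct) (auto intro: fps_tendsto_mult fps_tendsto_const)

lemma fps_tendsto_geo: "(f \<longlongrightarrow> a) A \<Longrightarrow> fps_tendsto (\<lambda>c. geo (f c)) (geo a) A"
  unfolding fps_tendsto_def geo_def by (auto intro!: tendsto_intros)

lemma fps_tendsto_lin:
  assumes "(f \<longlongrightarrow> a) A" shows "fps_tendsto (\<lambda>c. lin (f c)) (lin a) A"
  unfolding fps_tendsto_def
proof
  fix m
  have "fps_nth (lin b) m = (if m = 0 then 1 else if m = 1 then - b else 0)" for b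
    by (simp add: lin_def)
  then show "((\<lambda>c. fps_nth (lin (f c)) m) \<longlongrightarrow> fps_nth (lin a) m) A"
    using assms by (auto intro!: tendsto_intros)
qed

lemma Udet_tendsto:
  assumes "\<And>i. ((\<lambda>c. x c i) \<longlongrightarrow> y i) A"
  shows "((\<lambda>c. Udet n k s t (x c)) \<longlongrightarrow> Udet n k s t y) A"
proof -
  have "fps_tendsto (\<lambda>c. rowU k s t (x c) i) (rowU k s t y i) A" for i
    unfolding rowU_def Hser_def Eser_def
    by (cases "i \<le> k") (auto intro!: fps_tendsto_mult fps_tendsto_cutoff fps_tendsto_prod fps_tendsto_geo fps_tendsto_lin fps_tendsto_const assms)
  then show ?thesis unfolding Udet_def minor_leibniz
    by (intro tendsto_sum tendsto_mult tendsto_prod tendsto_const) (auto simp: fps_tendsto_def)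
qed

section \<open>The longest element takes the value one\<close>

text \<open>Power of X and number of variables are decoupled here, so that one row can be moved
  while the others rest.\<close>

definition DH :: "nat \<Rightarrow> (nat \<Rightarrow> nat) \<Rightarrow> (nat \<Rightarrow> nat) \<Rightarrow> (nat \<Rightarrow> real) \<Rightarrow> real" where
  "DH n a b x = minor n (\<lambda>m. fps_X ^ a m * Hser (b m) x)"

text \<open>Row \<open>i\<close> is the only one that sees the exchange of the variables
  \<open>j\<close> and \<open>j + 1\<close>.\<close>

lemma dd_DH:
  assumes x: "inj x" and i: "1 \<le> i" "i < n" and j: "1 \<le> j" "b i = j" "\<And>m. 1 \<le> m \<Longrightarrow> m < n \<Longrightarrow> m \<noteq> i \<Longrightarrow> b m \<noteq> j"
  shows "dd j (DH n a b) x = DH n (a(i := Suc (a i))) (b(i := Suc j)) x"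
proof -
  have ne: "x j - x (Suc j) \<noteq> 0" using x by (auto dest: injD)
  let ?R = "\<lambda>x m. fps_X ^ a m * Hser (b m) x"
  have 1: "minor n (?R (x \<circ> adjt j)) = minor n ((?R x)(i := ?R (x \<circ> adjt j) i))"
    by (rule minor_cong) (use j in \<open>simp add: Hser_sym\<close>)
  have 2: "minor n (?R x) = minor n ((?R x)(i := ?R x i))" by (rule minor_cong) simp
  have 3: "?R x i - ?R (x \<circ> adjt j) i = fps_const (x j - x (Suc j)) * (fps_X ^ Suc (a i) * Hser (Suc j) x)"
  proof -
    have "?R x i - ?R (x \<circ> adjt j) i = fps_X ^ a i * (Hser j x - Hser j (x \<circ> adjt j))"
      by (simp only: right_diff_distrib j(2))
    also have "\<dots> = fps_const (x j - x (Suc j)) * (fps_X ^ Suc (a i) * Hser (Suc j) x)"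
      by (simp only: Hser_diff[OF j(1)] power_Suc mult_ac)
    finally show ?thesis .
  qed
  have "DH n a b x - DH n a b (x \<circ> adjt j) = minor n ((?R x)(i := ?R x i)) - minor n ((?R x)(i := ?R (x \<circ> adjt j) i))"
    unfolding DH_def 1 using 2 by (simp only:)
  also have "\<dots> = (x j - x (Suc j)) * minor n ((?R x)(i := fps_X ^ Suc (a i) * Hser (Suc j) x))"
    by (simp only: minor_row_diff[OF i, symmetric] 3 minor_row_cmult[OF i])
  also have "(?R x)(i := fps_X ^ Suc (a i) * Hser (Suc j) x) = (\<lambda>m. fps_X ^ (a(i := Suc (a i))) m * Hser ((b(i := Suc j)) m) x)"
    by auto
  finally show ?thesis using x ne unfolding dd_def DH_def by simp
qed

text \<open>The blocks n-1; n-2, n-1; and so on up to 1, ..., n-1. The block starting at i carries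
  row i from X^(2i) \<open>Hser i\<close> to X^(n+i) \<open>Hser n\<close>.\<close>

definition stairw :: "nat \<Rightarrow> nat \<Rightarrow> nat list" where
  "stairw n d = concat (map (\<lambda>i. [n - i..<n]) [1..<Suc d])"

lemma fold_stairw:
  assumes "d < n" "inj x"
  shows "fold dd (stairw n d) (DH n (\<lambda>m. 2 * m) (\<lambda>m. m)) x
     = DH n (\<lambda>m. if n - d \<le> m then n + m else 2 * m) (\<lambda>m. if n - d \<le> m then n else m) x"
  using assms
proof (induction d arbitrary: x)
  case 0
  have "DH n (\<lambda>m. 2 * m) (\<lambda>m. m) x = DH n (\<lambda>m. if n - 0 \<le> m then n + m else 2 * m) (\<lambda>m. if n - 0 \<le> m then n else m) x"
    unfolding DH_def by (rule minor_cong) auto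
  then show ?case by (simp add: stairw_def)
next
  case (Suc d)
  define i where "i = n - Suc d"
  have i: "1 \<le> i" "i < n" "n - d = Suc i" using Suc.prems by (auto simp: i_def)
  define f where "f = fold dd (stairw n d) (DH n (\<lambda>m. 2 * m) (\<lambda>m. m))"
  have f: "f x = DH n (\<lambda>m. if i < m then n + m else 2 * m) (\<lambda>m. if i < m then n else m) x" if "inj x" for x
    using Suc.IH[of x] Suc.prems that i by (simp add: f_def Suc_le_eq)
  have block: "fold dd [i..<j] f x = DH n ((\<lambda>m. if i < m then n + m else 2 * m)(i := i + j)) ((\<lambda>m. if i < m then n else m)(i := j)) x"
    if "i \<le> j" "j \<le> n" "inj x" for j x
    using that
  proof (induction "j - i" arbitrary: j x)
    case 0
    then have "j = i" by simp
    moreover have "(\<lambda>m. if i < m then n + m else 2 * m)(i := i + i) = (\<lambda>m. if i < m then n + m else 2 * m)"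
      "(\<lambda>m. if i < m then n else m)(i := i) = (\<lambda>m. if i < m then n else m)" by auto
    ultimately show ?case using f 0 by simp
  next
    case (Suc e)
    then obtain j' where j': "j = Suc j'" "i \<le> j'" by (cases j) auto
    let ?a = "(\<lambda>m. if i < m then n + m else 2 * m)(i := i + j')" and ?b = "(\<lambda>m. if i < m then n else m)(i := j')"
    have "fold dd [i..<j] f x = dd j' (fold dd [i..<j'] f) x" using j' by simp
    also have "dd j' (fold dd [i..<j'] f) = dd j' (DH n ?a ?b)"
      by (intro dd_cong_inj) (use Suc j' in auto)
    also have "dd j' (DH n ?a ?b) x = DH n (?a(i := Suc (?a i))) (?b(i := Suc j')) x"
      by (intro dd_DH) (use Suc j' i in auto)
    finally show ?case using j' by simp
  qed
  have "fold dd (stairw n (Suc d)) (DH n (\<lambda>m. 2 * m) (\<lambda>m. m)) x = fold dd [i..<n] f x"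
    by (simp add: stairw_def f_def i_def)
  also have "\<dots> = DH n ((\<lambda>m. if i < m then n + m else 2 * m)(i := i + n)) ((\<lambda>m. if i < m then n else m)(i := n)) x"
    by (rule block) (use i Suc.prems in auto)
  also have "\<dots> = DH n (\<lambda>m. if n - Suc d \<le> m then n + m else 2 * m) (\<lambda>m. if n - Suc d \<le> m then n else m) x"
    unfolding i_def[symmetric] by (rule arg_cong2[of _ _ _ _ "\<lambda>a b. DH n a b x"]) auto
  finally show ?case .
qed

text \<open>All rows are successive shifts of one series with constant term 1, so the matrix is
  unitriangular.\<close>

lemma DH_final: "DH n (\<lambda>m. n + m) (\<lambda>m. n) x = 1"
proof -
  have H0: "fps_nth (Hser m x) 0 = 1" for m
    by (induction m) (auto simp: Hser_def geo_def)
  let ?M = "Matrix.mat (n - 1) (n - 1) (\<lambda>(a, b). fps_nth (fps_X ^ (n + Suc a) * Hser n x) (n + 1 + b))"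
  have e: "fps_nth (fps_X ^ (n + Suc a) * Hser n x) (n + 1 + b) = (if n + 1 + b < n + Suc a then 0 else fps_nth (Hser n x) (n + 1 + b - (n + Suc a)))" for a b
    by (rule fps_X_power_mult_nth)
  have "upper_triangular ?M" unfolding e upper_triangular_def by auto
  then have "Determinant.det ?M = prod_list (diag_mat ?M)" by (rule det_upper_triangular[of _ "n-1"]) auto
  also have "diag_mat ?M = map (\<lambda>_. 1) [0..<n-1]"
    unfolding e by (auto simp: diag_mat_def H0)
  finally show ?thesis unfolding DH_def minor_def by (simp add: map_replicate_const)
qed

lemma stairw_props:
  assumes "1 \<le> n"
  shows "length (stairw n (n - 1)) = n choose 2" "set (stairw n (n - 1)) \<subseteq> {1..n-1}"
    "inj x \<Longrightarrow> fold dd (stairw n (n - 1)) (Udet n 0 0 0) x = 1"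
proof -
  have "length (stairw n d) = (\<Sum>i = 1..d. i)" if "d < n" for d
    using that by (induction d) (auto simp: stairw_def)
  then have "length (stairw n (n - 1)) = (\<Sum>i = 1..n-1. i)" using assms by simp
  also have "\<dots> = (\<Sum>i = 0..n-1. i)" by (simp add: sum.atLeast_Suc_atMost)
  also have "\<dots> = n choose 2" using assms by (simp add: choose_two gauss_sum_nat mult.commute)
  finally show "length (stairw n (n - 1)) = n choose 2" .
  show "set (stairw n (n - 1)) \<subseteq> {1..n-1}" using assms by (auto simp: stairw_def)
  assume x: "inj x"
  have "Udet n 0 0 0 = DH n (\<lambda>m. 2 * m) (\<lambda>m. m)"
    unfolding Udet_def DH_def by (intro ext minor_cong) (simp add: rowU_def)
  then have "fold dd (stairw n (n - 1)) (Udet n 0 0 0) x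
     = DH n (\<lambda>m. if n - (n-1) \<le> m then n + m else 2 * m) (\<lambda>m. if n - (n-1) \<le> m then n else m) x"
    using fold_stairw[of "n-1" n x] assms x by simp
  also have "\<dots> = DH n (\<lambda>m. n + m) (\<lambda>m. n) x"
    unfolding DH_def by (rule minor_cong) (use assms in auto)
  finally show "fold dd (stairw n (n - 1)) (Udet n 0 0 0) x = 1" by (simp add: DH_final)
qed

lemma fold_dd_Udet0:
  assumes n: "1 \<le> n" and w: "length w = n choose 2" "set w \<subseteq> {1..n-1}" and x: "inj x"
  shows "fold dd w (Udet n 0 0 0) x = (if w \<in> sorting_networks n then 1 else 0)"
proof -
  let ?v = "stairw n (n-1)"
  note v = stairw_props[OF n]
  \<comment> \<open>A word that is not reduced would give 0, but the staircase word gives 1. This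
    also shows that networks exist.\<close>
  have "?v \<in> sorting_networks n"
  proof (rule ccontr)
    assume "?v \<notin> sorting_networks n"
    then have "\<not> ascends [1..<Suc n] ?v" using sorting_network_iff_ascends[OF refl v(1,2)] by simp
    then have "fold dd ?v (Udet n 0 0 0) = (\<lambda>x. 0)" by (rule fold_dd_not_ascends[OF refl v(2)])
    then show False using v(3)[OF x] by simp
  qed
  then show ?thesis using fold_dd_word[OF refl w(2,1), of ?v "Udet n 0 0 0"] v(3)[OF x] by simp
qed

lemma ex_sorting_network: "1 \<le> n \<Longrightarrow> sorting_networks n \<noteq> {}"
  using fold_dd_Udet0[of n "stairw n (n-1)" real] stairw_props(1,2)[of n] stairw_props(3)[of n real]
  by (auto simp: inj_def split: if_splits)

section \<open>Generating function of the networks that avoid a letter early\<close>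

lemma finite_sorting_networks: "finite (sorting_networks n)"
  by (rule finite_subset[OF _ finite_lists_length_eq[of "{1..n-1}" "n choose 2"]])
     (auto simp: sorting_networks_def)

text \<open>Reversing the concatenation moves the block \<open>v\<close>, which avoids
  \<open>k\<close>, from the end of the network to its beginning.\<close>

lemma card_networks_split:
  assumes "r \<le> n choose 2"
  shows "(\<Sum>v\<in>words ({1..<n} - {k}) r. \<Sum>u\<in>words {1..<n} ((n choose 2) - r). if u @ v \<in> sorting_networks n then 1 else (0::real))
    = real (card {w \<in> sorting_networks n. k \<notin> set (take r w)})"
proof -
  let ?N = "n choose 2" and ?S = "{1..<n}"
  have "(\<Sum>v\<in>words (?S - {k}) r. \<Sum>u\<in>words ?S (?N - r). if u @ v \<in> sorting_networks n then 1 else (0::real))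
     = (\<Sum>(v, u)\<in>words (?S - {k}) r \<times> words ?S (?N - r). if u @ v \<in> sorting_networks n then 1 else 0)"
    by (simp add: sum.cartesian_product)
  also have "\<dots> = (\<Sum>z\<in>words (?S - {k}) r \<times> words ?S (?N - r). if (case z of (v, u) \<Rightarrow> u @ v \<in> sorting_networks n) then 1 else 0)"
    by (intro sum.cong) auto
  also have "\<dots> = (\<Sum>z\<in>{z \<in> words (?S - {k}) r \<times> words ?S (?N - r). case z of (v, u) \<Rightarrow> u @ v \<in> sorting_networks n}. 1)"
    by (rule sum.inter_filter[symmetric]) simp
  also have "\<dots> = real (card {z \<in> words (?S - {k}) r \<times> words ?S (?N - r). case z of (v, u) \<Rightarrow> u @ v \<in> sorting_networks n})"
    by simp
  also have "{z \<in> words (?S - {k}) r \<times> words ?S (?N - r). case z of (v, u) \<Rightarrow> u @ v \<in> sorting_networks n}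
     = {(v, u)\<in>words (?S - {k}) r \<times> words ?S (?N - r). u @ v \<in> sorting_networks n}"
    by auto
  also have "card {(v, u)\<in>words (?S - {k}) r \<times> words ?S (?N - r). u @ v \<in> sorting_networks n}
      = card {w \<in> sorting_networks n. k \<notin> set (take r w)}"
  proof (rule bij_betw_same_card[of "\<lambda>(v, u). rev (u @ v)"], rule bij_betw_byWitness[where f' = "\<lambda>w. (rev (take r w), rev (drop r w))"])
    show "(\<lambda>(v, u). rev (u @ v)) ` {(v, u)\<in>words (?S - {k}) r \<times> words ?S (?N - r). u @ v \<in> sorting_networks n}
       \<subseteq> {w \<in> sorting_networks n. k \<notin> set (take r w)}"
    proof safe
      fix v u assume vu: "v \<in> words (?S - {k}) r" "u \<in> words ?S (?N - r)" "u @ v \<in> sorting_networks n"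
      show "rev (u @ v) \<in> sorting_networks n" by (rule rev_sorting_network[OF vu(3)])
      assume "k \<in> set (take r (rev (u @ v)))"
      then show False using vu by (auto simp: words_def)
    qed
    show "(\<lambda>w. (rev (take r w), rev (drop r w))) ` {w \<in> sorting_networks n. k \<notin> set (take r w)}
       \<subseteq> {(v, u)\<in>words (?S - {k}) r \<times> words ?S (?N - r). u @ v \<in> sorting_networks n}"
    proof safe
      fix w assume w: "w \<in> sorting_networks n" "k \<notin> set (take r w)"
      have l: "length w = ?N" "set w \<subseteq> {1..n-1}" using w by (auto simp: sorting_networks_def)
      then have sw: "set w \<subseteq> ?S" by force
      show "rev (take r w) \<in> words (?S - {k}) r" using l sw w assms set_take_subset[of r w] by (auto simp: words_def)
      show "rev (drop r w) \<in> words ?S (?N - r)" using l sw set_drop_subset[of r w] by (auto simp: words_def)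
      have "rev (drop r w) @ rev (take r w) = rev w" by (simp flip: rev_append)
      then show "rev (drop r w) @ rev (take r w) \<in> sorting_networks n" using rev_sorting_network[OF w(1)] by simp
    qed
  qed (auto simp: words_def)
  finally show ?thesis .
qed

lemma sum_complement_term:
  fixes a :: "nat \<Rightarrow> real"
  assumes "r \<le> N"
  shows "(\<Sum>q\<le>N. a q * (\<Sum>u\<in>W q. if q + r = N then g u else 0)) = a (N - r) * (\<Sum>u\<in>W (N - r). g u)"
proof -
  have "(\<Sum>q\<le>N. a q * (\<Sum>u\<in>W q. if q + r = N then g u else 0)) = (\<Sum>q\<in>{N - r}. a q * (\<Sum>u\<in>W q. if q + r = N then g u else 0))"
  proof (rule sum.mono_neutral_right)
    show "\<forall>q\<in>{..N} - {N - r}. a q * (\<Sum>u\<in>W q. if q + r = N then g u else 0) = 0"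
    proof
      fix q assume "q \<in> {..N} - {N - r}"
      then have "q + r \<noteq> N" by auto
      then show "a q * (\<Sum>u\<in>W q. if q + r = N then g u else 0) = 0" by simp
    qed
  qed auto
  then show ?thesis using assms by simp
qed

text \<open>At the origin only words of full length count, because a shorter word leaves a
  homogeneous function of positive degree. The origin is not an injective point, so it is approached
  along the multiples of (0, 1, 2, ...) by a factor decreasing to 0; \<open>Udet\<close> is
  continuous there.\<close>

theorem network_generating_function:
  assumes n: "1 \<le> n"
  shows "Udet n k s t (\<lambda>_. 0) = (\<Sum>r\<le>n choose 2. s ^ r / fact r * (t ^ ((n choose 2) - r) / fact ((n choose 2) - r))
      * real (card {w \<in> sorting_networks n. k \<notin> set (take r w)}))"
proof -
  let ?N = "n choose 2" and ?S = "{1..<n}" and ?D = "Udet n 0 0 0"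
  define x0 :: "nat \<Rightarrow> real" where "x0 = real"
  have x0: "inj x0" by (simp add: x0_def inj_def)
  have lim: "((\<lambda>c. fold dd (u @ v) ?D (\<lambda>i. c * x0 i)) \<longlongrightarrow> 
       (if q + r = ?N then fold dd (u @ v) ?D x0 else 0)) (at_right 0)"
    if uv: "u \<in> words ?S q" "v \<in> words (?S - {k}) r" for u v q r
  proof (cases "q + r \<le> ?N")
    case True
    have l: "length (u @ v) = q + r" using uv by (simp add: words_def)
    have "homog (?N - (q + r)) (fold dd (u @ v) ?D)"
      by (rule homog_fold_dd) (use l True homog_Udet0[of n] in simp)
    then have h: "fold dd (u @ v) ?D (\<lambda>i. c * x0 i) = c ^ (?N - (q + r)) * fold dd (u @ v) ?D x0" if "c > 0" for c
      using that x0 unfolding homog_def by blast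
    have "((\<lambda>c. c ^ (?N - (q + r)) * fold dd (u @ v) ?D x0) \<longlongrightarrow> 0 ^ (?N - (q + r)) * fold dd (u @ v) ?D x0) (at_right 0)"
      by (intro tendsto_intros)
    then have lim0: "((\<lambda>c. fold dd (u @ v) ?D (\<lambda>i. c * x0 i)) \<longlongrightarrow> 0 ^ (?N - (q + r)) * fold dd (u @ v) ?D x0) (at_right 0)"
    proof (rule Lim_transform_eventually)
      show "\<forall>\<^sub>F c in at_right 0. c ^ (?N - (q + r)) * fold dd (u @ v) ?D x0 = fold dd (u @ v) ?D (\<lambda>i. c * x0 i)"
        using eventually_at_right_less[of "0::real"] by eventually_elim (simp only: h)
    qed
    then show ?thesis
    proof (cases "q + r = ?N")
      case False
      then have "?N - (q + r) \<noteq> 0" using True by simp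
      then have "(0::real) ^ (?N - (q + r)) = 0" by (simp only: power_0_left if_False)
      then show ?thesis using lim0 False by (simp only: mult_zero_left if_False)
    qed (use lim0 in simp)
  next
    case False
    have "fold dd (u @ v) ?D = (\<lambda>x. 0)"
      by (rule fold_dd_long[OF refl, of _ n]) (use uv False in \<open>force simp: words_def\<close>)+
    then show ?thesis using False by simp
  qed
  have L1: "((\<lambda>c. Udet n k s t (\<lambda>i. c * x0 i)) \<longlongrightarrow> 
     (\<Sum>r\<le>?N. s ^ r / fact r * (\<Sum>v\<in>words (?S - {k}) r. \<Sum>q\<le>?N. t ^ q / fact q * (\<Sum>u\<in>words ?S q. 
       (if q + r = ?N then fold dd (u @ v) ?D x0 else 0))))) (at_right 0)"
  proof (rule Lim_transform_eventually)
    show "((\<lambda>c. (\<Sum>r\<le>?N. s ^ r / fact r * (\<Sum>v\<in>words (?S - {k}) r. \<Sum>q\<le>?N. t ^ q / fact q * (\<Sum>u\<in>words ?S q. 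
       fold dd (u @ v) ?D (\<lambda>i. c * x0 i))))) \<longlongrightarrow> 
     (\<Sum>r\<le>?N. s ^ r / fact r * (\<Sum>v\<in>words (?S - {k}) r. \<Sum>q\<le>?N. t ^ q / fact q * (\<Sum>u\<in>words ?S q. 
       (if q + r = ?N then fold dd (u @ v) ?D x0 else 0))))) (at_right 0)"
      by (intro tendsto_sum tendsto_mult_left lim)
    show "\<forall>\<^sub>F c in at_right 0. (\<Sum>r\<le>?N. s ^ r / fact r * (\<Sum>v\<in>words (?S - {k}) r. \<Sum>q\<le>?N. t ^ q / fact q * (\<Sum>u\<in>words ?S q. 
       fold dd (u @ v) ?D (\<lambda>i. c * x0 i)))) = Udet n k s t (\<lambda>i. c * x0 i)"
      using eventually_at_right_less[of "0::real"]
    proof eventually_elim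
      case (elim c)
      then have "inj (\<lambda>i. c * x0 i)" by (auto simp: x0_def inj_def)
      then show ?case using Udet_expansion[of "\<lambda>i. c * x0 i" n k s t] by simp
    qed
  qed
  have z: "((\<lambda>c::real. c * x0 i) \<longlongrightarrow> 0) (at_right 0)" for i
    by (auto intro!: tendsto_eq_intros)
  have L2: "((\<lambda>c. Udet n k s t (\<lambda>i. c * x0 i)) \<longlongrightarrow> Udet n k s t (\<lambda>_. 0)) (at_right 0)"
    by (rule Udet_tendsto) (rule z)
  have "Udet n k s t (\<lambda>_. 0) = (\<Sum>r\<le>?N. s ^ r / fact r * (\<Sum>v\<in>words (?S - {k}) r. \<Sum>q\<le>?N. t ^ q / fact q * (\<Sum>u\<in>words ?S q. 
       (if q + r = ?N then fold dd (u @ v) ?D x0 else 0))))"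
    by (rule tendsto_unique[OF trivial_limit_at_right_real L2 L1])
  also have "\<dots> = (\<Sum>r\<le>?N. s ^ r / fact r * (t ^ (?N - r) / fact (?N - r)) * real (card {w \<in> sorting_networks n. k \<notin> set (take r w)}))"
  proof (rule sum.cong[OF refl])
    fix r assume "r \<in> {..?N}"
    then have r: "r \<le> ?N" by simp
    have inner: "(\<Sum>q\<le>?N. t ^ q / fact q * (\<Sum>u\<in>words ?S q. (if q + r = ?N then fold dd (u @ v) ?D x0 else 0)))
       = t ^ (?N - r) / fact (?N - r) * (\<Sum>u\<in>words ?S (?N - r). if u @ v \<in> sorting_networks n then 1 else 0)"
      if v: "v \<in> words (?S - {k}) r" for v
    proof -
      have "(\<Sum>q\<le>?N. t ^ q / fact q * (\<Sum>u\<in>words ?S q. (if q + r = ?N then fold dd (u @ v) ?D x0 else 0)))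
        = t ^ (?N - r) / fact (?N - r) * (\<Sum>u\<in>words ?S (?N - r). fold dd (u @ v) ?D x0)"
        by (rule sum_complement_term[OF r])
      also have "(\<Sum>u\<in>words ?S (?N - r). fold dd (u @ v) ?D x0) = (\<Sum>u\<in>words ?S (?N - r). if u @ v \<in> sorting_networks n then 1 else 0)"
      proof (rule sum.cong[OF refl])
        fix u assume "u \<in> words ?S (?N - r)"
        then show "fold dd (u @ v) ?D x0 = (if u @ v \<in> sorting_networks n then 1 else 0)"
          using v r x0 n by (intro fold_dd_Udet0) (force simp: words_def)+
      qed
      finally show ?thesis .
    qed
    have "(\<Sum>v\<in>words (?S - {k}) r. \<Sum>q\<le>?N. t ^ q / fact q * (\<Sum>u\<in>words ?S q. (if q + r = ?N then fold dd (u @ v) ?D x0 else 0)))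
      = (\<Sum>v\<in>words (?S - {k}) r. t ^ (?N - r) / fact (?N - r) * (\<Sum>u\<in>words ?S (?N - r). if u @ v \<in> sorting_networks n then 1 else 0))"
      by (intro sum.cong refl inner)
    also have "\<dots> = t ^ (?N - r) / fact (?N - r) * (\<Sum>v\<in>words (?S - {k}) r. \<Sum>u\<in>words ?S (?N - r). if u @ v \<in> sorting_networks n then 1 else 0)"
      by (rule sum_distrib_left[symmetric])
    finally have "(\<Sum>v\<in>words (?S - {k}) r. \<Sum>q\<le>?N. t ^ q / fact q * (\<Sum>u\<in>words ?S q. (if q + r = ?N then fold dd (u @ v) ?D x0 else 0)))
       = t ^ (?N - r) / fact (?N - r) * real (card {w \<in> sorting_networks n. k \<notin> set (take r w)})"
      by (simp only: card_networks_split[OF r])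
    then show "s ^ r / fact r * (\<Sum>v\<in>words (?S - {k}) r. \<Sum>q\<le>?N. t ^ q / fact q * (\<Sum>u\<in>words ?S q. (if q + r = ?N then fold dd (u @ v) ?D x0 else 0)))
       = s ^ r / fact r * (t ^ (?N - r) / fact (?N - r)) * real (card {w \<in> sorting_networks n. k \<notin> set (take r w)})"
      by (simp only: mult.assoc)
  qed
  finally show ?thesis .
qed

section \<open>A polynomial that is even about one\<close>

text \<open>In u = 1 - y this is u^(2l) (1 - u^2)^p. Being even about y = 1, it has vanishing odd
  derivatives there, which will annihilate the rows beyond \<open>k\<close>. The factor y^p makes
  its coefficients start at the first column of the minor.\<close>

definition Gpoly :: "nat \<Rightarrow> nat \<Rightarrow> real poly" where
  "Gpoly p l = monom 1 p * ([:2, -1:] ^ p * [:1, -1:] ^ (2 * l))"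

lemma poly_Gpoly: "poly (Gpoly p l) y = y ^ p * (2 - y) ^ p * (1 - y) ^ (2 * l)"
  by (simp add: Gpoly_def poly_monom poly_power)

lemma poly_Gpoly_refl: "poly (Gpoly p l) (1 - u) = u ^ (2 * l) * (1 - u\<^sup>2) ^ p"
proof -
  have "(1 - u) ^ p * (2 - (1 - u)) ^ p = ((1 - u) * (1 + u)) ^ p" by (simp add: power_mult_distrib)
  also have "(1 - u) * (1 + u) = 1 - u\<^sup>2" by (simp add: power2_eq_square algebra_simps)
  finally show ?thesis by (simp add: poly_Gpoly)
qed

lemma coeff_Gpoly_low: "m < p \<Longrightarrow> coeff (Gpoly p l) m = 0"
  by (simp add: Gpoly_def coeff_monom_mult)

lemma degree_Gpoly: "Polynomial.degree (Gpoly p l) \<le> 2 * p + 2 * l"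
proof -
  have "Polynomial.degree (Gpoly p l) \<le> p + (p * Polynomial.degree [:2, -1::real:] + (2 * l) * Polynomial.degree [:1, -1::real:])"
    unfolding Gpoly_def
    by (intro order.trans[OF degree_mult_le] add_mono degree_monom_le)
       (auto intro!: order.trans[OF degree_mult_le] add_mono order.trans[OF degree_power_le])
  then show ?thesis by simp
qed

lemma Gpoly_reflect: "pcompose (Gpoly p l) [:2, -1:] = Gpoly p l"
proof (rule poly_eq_poly_eq_iff[THEN iffD1], rule ext)
  fix y :: real
  have "(y - 1) ^ (2 * l) = (1 - y) ^ (2 * l)" by (metis power2_commute power_mult)
  then show "poly (pcompose (Gpoly p l) [:2, -1:]) y = poly (Gpoly p l) y"
    by (simp add: poly_pcompose poly_Gpoly mult_ac)
qed

lemma higher_pderiv_reflect: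
  fixes G :: "real poly"
  assumes "pcompose G [:2, -1:] = G"
  shows "pcompose ((pderiv ^^ e) G) [:2, -1:] = Polynomial.smult ((-1) ^ e) ((pderiv ^^ e) G)"
proof (induction e)
  case (Suc e)
  have "pderiv (pcompose ((pderiv ^^ e) G) [:2, -1:]) = - pcompose (pderiv ((pderiv ^^ e) G)) [:2, -1:]"
    by (simp add: pderiv_pcompose pderiv_pCons)
  moreover have "pderiv (Polynomial.smult ((-1) ^ e) ((pderiv ^^ e) G)) = Polynomial.smult ((-1) ^ e) (pderiv ((pderiv ^^ e) G))"
    by (rule pderiv_smult)
  ultimately have "- pcompose (pderiv ((pderiv ^^ e) G)) [:2, -1:] = Polynomial.smult ((-1) ^ e) (pderiv ((pderiv ^^ e) G))"
    using Suc by simp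
  then have "pcompose (pderiv ((pderiv ^^ e) G)) [:2, -1:] = - Polynomial.smult ((-1) ^ e) (pderiv ((pderiv ^^ e) G))"
    by (metis minus_minus)
  then show ?case by simp
qed (use assms in simp)

lemma odd_pderiv_Gpoly: "odd e \<Longrightarrow> poly ((pderiv ^^ e) (Gpoly p l)) 1 = 0"
  using arg_cong[OF higher_pderiv_reflect[OF Gpoly_reflect, of e p l], of "\<lambda>q. poly q 1"]
  by (simp add: poly_pcompose)

lemma poly_higher_pderiv:
  fixes G :: "real poly"
  assumes "Polynomial.degree G \<le> d"
  shows "poly ((pderiv ^^ e) G) t = (\<Sum>m\<in>{e..d}. fact m / fact (m - e) * coeff G m * t ^ (m - e))"
proof -
  have "poly ((pderiv ^^ e) G) t = (\<Sum>j\<le>d - e. coeff ((pderiv ^^ e) G) j * t ^ j)"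
    unfolding poly_altdef
    by (rule sum.mono_neutral_left) (use assms in \<open>auto simp: degree_higher_pderiv coeff_eq_0 not_le\<close>)
  also have "\<dots> = (\<Sum>j\<le>d - e. fact (j + e) / fact j * coeff G (j + e) * t ^ j)"
  proof (intro sum.cong refl)
    fix j
    have "fact (j + e) = (fact j * pochhammer (of_nat (Suc j)) e :: real)"
      using pochhammer_product'[of "1::real" j e] by (simp add: pochhammer_fact[symmetric] add.commute)
    then show "coeff ((pderiv ^^ e) G) j * t ^ j = fact (j + e) / fact j * coeff G (j + e) * t ^ j"
      by (simp add: coeff_higher_pderiv)
  qed
  also have "\<dots> = (\<Sum>m\<in>{e..d}. fact m / fact (m - e) * coeff G m * t ^ (m - e))"
  proof (cases "e \<le> d")
    case True
    then show ?thesis by (intro sum.reindex_bij_witness[of _ "\<lambda>m. m - e" "\<lambda>j. j + e"]) auto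
  next
    case False
    then show ?thesis using assms by (simp add: coeff_eq_0)
  qed
  finally show ?thesis .
qed

lemma fps_deriv_at_mult:
  assumes "fps_deriv_at F F' t" "fps_deriv_at G G' t"
  shows "fps_deriv_at (\<lambda>t. F t * G t) (F' * G t + F t * G') t"
  unfolding fps_deriv_at_def
proof
  fix m
  have "((\<lambda>t. fps_nth (F t * G t) m) has_real_derivative
      (\<Sum>i = 0..m. fps_nth F' i * fps_nth (G t) (m - i) + fps_nth G' (m - i) * fps_nth (F t) i)) (at t)"
    unfolding fps_mult_nth using assms unfolding fps_deriv_at_def
    by (intro DERIV_sum DERIV_mult) auto
  then show "((\<lambda>t. fps_nth (F t * G t) m) has_real_derivative fps_nth (F' * G t + F t * G') m) (at t)"
    by (simp only: fps_mult_nth fps_add_nth sum.distrib mult.commute[of "fps_nth G' _"])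
qed

section \<open>Reduction to a Hankel determinant of size k\<close>

context
  fixes n k :: nat
  assumes nk: "2 * k \<le> n" "1 \<le> n"
begin

text \<open>A combination of the columns of the minor. The weights m! times the coefficients of
  \<open>Gpoly\<close> turn X^(2k+1+e) e^(tX) into the e-th derivative of that polynomial at t. For
  l < k the coefficients lie in degrees n - 2k to 2n - 2k - 2, so the columns capture all of
  them.\<close>

definition Lam :: "nat \<Rightarrow> real fps \<Rightarrow> real" where
  "Lam l F = (\<Sum>b<n - 1. fact (n - 2 * k + b) * coeff (Gpoly (n - 2 * k) l) (n - 2 * k + b) * fps_nth F (n + 1 + b))"

lemma Lam_monom_exp:
  assumes "l < k"
  shows "Lam l (fps_X ^ (2 * k + 1 + e) * fps_exp t) = poly ((pderiv ^^ e) (Gpoly (n - 2 * k) l)) t"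
proof -
  let ?p = "n - 2 * k" and ?G = "Gpoly (n - 2 * k) l"
  have d: "Polynomial.degree ?G \<le> ?p + (n - 2)" using degree_Gpoly[of ?p l] assms nk by linarith
  have n2: "n \<ge> 2" using assms nk by linarith
  have "Lam l (fps_X ^ (2 * k + 1 + e) * fps_exp t) = (\<Sum>b<n - 1. (if ?p + b < e then 0 else
       fact (?p + b) / fact (?p + b - e) * coeff ?G (?p + b) * t ^ (?p + b - e)))"
    unfolding Lam_def
  proof (intro sum.cong refl)
    fix b
    have "n + 1 + b - (2 * k + 1 + e) = ?p + b - e" "n + 1 + b < 2 * k + 1 + e \<longleftrightarrow> ?p + b < e" using nk by linarith+
    then show "fact (?p + b) * coeff ?G (?p + b) * fps_nth (fps_X ^ (2 * k + 1 + e) * fps_exp t) (n + 1 + b)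
      = (if ?p + b < e then 0 else fact (?p + b) / fact (?p + b - e) * coeff ?G (?p + b) * t ^ (?p + b - e))"
      by (simp only: fps_X_power_mult_nth) simp
  qed
  also have "\<dots> = (\<Sum>m\<in>{?p..<?p + (n - 1)}. (if m < e then 0 else fact m / fact (m - e) * coeff ?G m * t ^ (m - e)))"
    by (rule sum.reindex_bij_witness[of _ "\<lambda>m. m - ?p" "\<lambda>b. ?p + b"]) auto
  also have "\<dots> = (\<Sum>m\<in>{e..?p + (n - 2)}. fact m / fact (m - e) * coeff ?G m * t ^ (m - e))"
    by (rule sum.mono_neutral_cong) (use n2 coeff_Gpoly_low[of _ ?p l] in \<open>auto split: if_splits\<close>)
  also have "\<dots> = poly ((pderiv ^^ e) ?G) t" by (rule poly_higher_pderiv[OF d, symmetric])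
  finally show ?thesis .
qed

lemma Lam_cmult: "Lam l (fps_const c * F) = c * Lam l F"
  by (simp add: Lam_def sum_distrib_left mult_ac)

lemma Lam_uminus: "Lam l (- F) = - Lam l F"
  by (simp add: Lam_def sum_negf)

lemma Lam_deriv:
  assumes "fps_deriv_at F F' t"
  shows "((\<lambda>t. Lam l (F t)) has_real_derivative Lam l F') (at t)"
  unfolding Lam_def using assms unfolding fps_deriv_at_def by (intro DERIV_sum DERIV_cmult) auto

definition rowZ :: "real \<Rightarrow> nat \<Rightarrow> real fps" where
  "rowZ s i = (if i \<le> k then fps_exp (1 - s) * fps_cutoff (Suc (2 * k)) (fps_X ^ (2 * i) * fps_exp s)
     else fps_X ^ (2 * i) * fps_exp 1)"

lemma rowU_at_0: "rowU k s (1 - s) (\<lambda>_. 0) i = rowZ s i"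
proof -
  have "geo 0 = 1" by (simp add: geo_def fps_eq_iff power_0_left)
  moreover have "lin 0 = 1" by (simp add: lin_def)
  ultimately show ?thesis by (simp add: rowU_def rowZ_def Hser_def Eser_def)
qed

text \<open>The dependences on \<open>s\<close> through 1 - s and under the truncation cancel,
  except for the one monomial of degree 2k + 1 that the truncation cuts off.\<close>

lemma rowZ_deriv:
  assumes "i \<le> k"
  shows "fps_deriv_at (\<lambda>s. rowZ s i) (- (fps_const (s ^ (2 * k - 2 * i) / fact (2 * k - 2 * i)) * (fps_X ^ (2 * k + 1) * fps_exp (1 - s)))) s"
proof -
  let ?c = "fps_cutoff (Suc (2 * k))" and ?K = "2 * k - 2 * i"
  have e1: "fps_deriv_at (\<lambda>s. fps_exp (1 - s)) (- (fps_X * fps_exp (1 - s))) s"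
    unfolding fps_deriv_at_def
  proof
    fix m
    have "((\<lambda>t. fps_nth (fps_exp (1 + t)) m) has_real_derivative fps_nth (fps_X * fps_exp (1 + (- s))) m) (at (- s))"
      using fps_deriv_at_exp[of 1 "- s"] by (simp only: fps_deriv_at_def)
    then have "((\<lambda>t. fps_nth (fps_exp (1 + (- t))) m) has_real_derivative fps_nth (fps_X * fps_exp (1 + (- s))) m * (- 1)) (at s)"
      by (rule DERIV_chain2) (auto intro!: derivative_eq_intros)
    then show "((\<lambda>s. fps_nth (fps_exp (1 - s)) m) has_real_derivative fps_nth (- (fps_X * fps_exp (1 - s))) m) (at s)"
      by (simp only: fps_neg_nth) simp
  qed
  have e2: "fps_deriv_at (\<lambda>s. ?c (fps_X ^ (2 * i) * fps_exp s)) (?c (fps_X ^ (2 * i) * (fps_X * fps_exp s))) s"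
    using fps_deriv_at_exp[of 0 s] by (intro fps_deriv_at_cutoff fps_deriv_at_cmult_left) simp
  have c: "?c (fps_X ^ (2 * i) * (fps_X * fps_exp s)) = fps_X * ?c (fps_X ^ (2 * i) * fps_exp s) - fps_const (s ^ ?K / fact ?K) * fps_X ^ (2 * k + 1)"
  proof (rule fps_ext)
    fix m
    have r: "fps_X ^ (2 * i) * (fps_X * fps_exp s) = fps_X ^ (2 * i + 1) * fps_exp s" by (simp add: mult_ac)
    show "fps_nth (?c (fps_X ^ (2 * i) * (fps_X * fps_exp s))) m = fps_nth (fps_X * ?c (fps_X ^ (2 * i) * fps_exp s) - fps_const (s ^ ?K / fact ?K) * fps_X ^ (2 * k + 1)) m"
    proof (cases m)
      case 0
      then show ?thesis by (simp add: r)
    next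
      case (Suc j)
      have "fps_nth (?c (fps_X ^ (2 * i) * (fps_X * fps_exp s))) m = (if j < 2 * k then if j < 2 * i then 0 else s ^ (j - 2 * i) / fact (j - 2 * i) else 0)"
      proof -
        define N where "N = 2 * i + 1"
        have e: "fps_nth (fps_X ^ N * fps_exp s) (Suc j) = (if j < 2 * i then 0 else s ^ (j - 2 * i) / fact (j - 2 * i))"
          unfolding fps_X_power_mult_nth N_def by simp
        show ?thesis unfolding r N_def[symmetric] by (simp add: Suc e)
      qed
      moreover have "fps_nth (fps_X * ?c (fps_X ^ (2 * i) * fps_exp s)) m = (if j < Suc (2 * k) then if j < 2 * i then 0 else s ^ (j - 2 * i) / fact (j - 2 * i) else 0)"
        by (simp add: Suc fps_X_power_mult_nth)
      moreover have "fps_nth (fps_const (s ^ ?K / fact ?K) * fps_X ^ (2 * k + 1)) m = (if j = 2 * k then s ^ ?K / fact ?K else 0)"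
        by (simp add: Suc fps_X_power_nth del: power_Suc)
      ultimately show ?thesis using assms by (simp only: fps_sub_nth) auto
    qed
  qed
  have "fps_deriv_at (\<lambda>s. fps_exp (1 - s) * ?c (fps_X ^ (2 * i) * fps_exp s))
     (- (fps_X * fps_exp (1 - s)) * ?c (fps_X ^ (2 * i) * fps_exp s) + fps_exp (1 - s) * ?c (fps_X ^ (2 * i) * (fps_X * fps_exp s))) s"
    by (rule fps_deriv_at_mult[OF e1 e2])
  also have "- (fps_X * fps_exp (1 - s)) * ?c (fps_X ^ (2 * i) * fps_exp s) + fps_exp (1 - s) * ?c (fps_X ^ (2 * i) * (fps_X * fps_exp s))
     = - (fps_const (s ^ ?K / fact ?K) * (fps_X ^ (2 * k + 1) * fps_exp (1 - s)))"
    unfolding c by (simp only: right_diff_distrib mult_minus_left mult_ac) simp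
  finally show ?thesis using assms by (simp add: rowZ_def)
qed

text \<open>The row is X^(2i) e^X, so the functional returns a derivative at 1, of odd order 2i - 2k
  - 1.\<close>

lemma Lam_rowZ_high:
  assumes "l < k" "k < i"
  shows "Lam l (rowZ s i) = 0"
proof -
  have "2 * i = 2 * k + 1 + (2 * i - 2 * k - 1)" using assms by simp
  then have "Lam l (rowZ s i) = poly ((pderiv ^^ (2 * i - 2 * k - 1)) (Gpoly (n - 2 * k) l)) 1"
    using assms Lam_monom_exp[OF assms(1), of "2 * i - 2 * k - 1" 1] by (simp add: rowZ_def)
  also have "\<dots> = 0" by (rule odd_pderiv_Gpoly) (use assms in auto)
  finally show ?thesis .
qed

definition Jint :: "nat \<Rightarrow> real \<Rightarrow> real" where
  "Jint m s = integral {s..1} (\<lambda>u. u ^ (2 * m) * (1 - u\<^sup>2) ^ (n - 2 * k))"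

text \<open>Integrate \<open>rowZ_deriv\<close> from \<open>s\<close> to 1. At s = 1 the row is a
  polynomial of degree at most 2k \<le> n, which vanishes on all columns.\<close>

lemma Lam_rowZ_low:
  assumes "l < k" "i \<le> k" "s \<le> 1"
  shows "Lam l (rowZ s i) = Jint (k - i + l) s / fact (2 * k - 2 * i)"
proof -
  let ?K = "2 * k - 2 * i" and ?p = "n - 2 * k"
  define L where "L s = Lam l (rowZ s i)" for s
  have "(L has_real_derivative - (u ^ ?K / fact ?K * (u ^ (2 * l) * (1 - u\<^sup>2) ^ ?p))) (at u)" for u
  proof -
    have "(L has_real_derivative Lam l (- (fps_const (u ^ ?K / fact ?K) * (fps_X ^ (2 * k + 1) * fps_exp (1 - u))))) (at u)"
      unfolding L_def by (rule Lam_deriv[OF rowZ_deriv[OF assms(2)]])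
    also have "Lam l (- (fps_const (u ^ ?K / fact ?K) * (fps_X ^ (2 * k + 1) * fps_exp (1 - u))))
       = - (u ^ ?K / fact ?K * poly (Gpoly ?p l) (1 - u))"
      using Lam_monom_exp[OF assms(1), of 0 "1 - u"] by (simp only: Lam_uminus Lam_cmult add_0_right funpow_0)
    finally show ?thesis by (simp only: poly_Gpoly_refl)
  qed
  then have "((\<lambda>u. - (u ^ ?K / fact ?K * (u ^ (2 * l) * (1 - u\<^sup>2) ^ ?p))) has_integral L 1 - L s) {s..1}"
    using assms(3) by (intro fundamental_theorem_of_calculus)
      (auto simp flip: has_real_derivative_iff_has_vector_derivative intro: has_field_derivative_at_within)
  moreover have "L 1 = 0"
  proof -
    have "fps_nth (rowZ 1 i) (n + 1 + b) = 0" for b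
      using assms(2) nk by (simp add: rowZ_def)
    then show ?thesis unfolding L_def Lam_def by (simp only: mult_zero_right sum.neutral_const)
  qed
  ultimately have "((\<lambda>u. - (u ^ ?K / fact ?K * (u ^ (2 * l) * (1 - u\<^sup>2) ^ ?p))) has_integral - L s) {s..1}" by simp
  then have "((\<lambda>u. fact ?K * (u ^ ?K / fact ?K * (u ^ (2 * l) * (1 - u\<^sup>2) ^ ?p))) has_integral fact ?K * L s) {s..1}"
    by (intro has_integral_mult_right) (auto dest: has_integral_neg)
  then have "((\<lambda>u. u ^ (2 * (k - i + l)) * (1 - u\<^sup>2) ^ ?p) has_integral fact ?K * L s) {s..1}"
  proof (rule has_integral_eq[rotated])
    fix u :: real
    have "2 * (k - i + l) = ?K + 2 * l" using assms(2) by simp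
    then have "u ^ (2 * (k - i + l)) = u ^ ?K * u ^ (2 * l)" by (simp only: power_add)
    then show "fact ?K * (u ^ ?K / fact ?K * (u ^ (2 * l) * (1 - u\<^sup>2) ^ ?p)) = u ^ (2 * (k - i + l)) * (1 - u\<^sup>2) ^ ?p"
      by (simp only:) (simp add: mult.assoc)
  qed
  then have "Jint (k - i + l) s = fact ?K * L s" unfolding Jint_def by (rule integral_unique)
  then show ?thesis by (simp add: L_def)
qed

definition Hdet :: "real \<Rightarrow> real" where
  "Hdet s = Determinant.det (Matrix.mat k k (\<lambda>(a, l). Jint (a + l) s))"

definition Rmat :: "real \<Rightarrow> real mat" where
  "Rmat s = Matrix.mat (n - 1) (n - 1) (\<lambda>(a, b). fps_nth (rowZ s (Suc a)) (n + 1 + b))"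

lemma det_A1:
  "Determinant.det (Matrix.mat k k (\<lambda>(a, l). Jint (k - Suc a + l) s / fact (2 * k - 2 * Suc a)))
    = (\<Prod>a = 0..<k. 1 / fact (2 * k - 2 * Suc a)) * signof (\<lambda>a. if a < k then k - Suc a else a) * Hdet s"
proof -
  let ?p = "\<lambda>a. if a < k then k - Suc a else a"
  have p: "?p permutes {0..<k}"
    by (rule bij_imp_permutes) (auto intro!: bij_betw_byWitness[of _ ?p])
  let ?A = "Matrix.mat k k (\<lambda>(a, l). Jint (a + l) s)"
  have "Determinant.det (Matrix.mat k k (\<lambda>(a, l). Jint (k - Suc a + l) s / fact (2 * k - 2 * Suc a)))
     = (\<Prod>a = 0..<k. 1 / fact (2 * k - 2 * Suc a)) * Determinant.det (Matrix.mat k k (\<lambda>(a, l). ?A $$ (?p a, l)))"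
    unfolding det_def'[of _ k, OF mat_carrier] sum_distrib_left
  proof (intro sum.cong refl)
    fix q assume "q \<in> {q. q permutes {0..<k}}"
    then have q: "q a < k" if "a < k" for a using that permutes_in_image[of q "{0..<k}" a] by auto
    have "(\<Prod>a = 0..<k. Matrix.mat k k (\<lambda>(a, l). Jint (k - Suc a + l) s / fact (2 * k - 2 * Suc a)) $$ (a, q a))
      = (\<Prod>a = 0..<k. 1 / fact (2 * k - 2 * Suc a) * Matrix.mat k k (\<lambda>(a, l). ?A $$ (?p a, l)) $$ (a, q a))"
      by (intro prod.cong refl) (use q in auto)
    then show "signof q * (\<Prod>a = 0..<k. Matrix.mat k k (\<lambda>(a, l). Jint (k - Suc a + l) s / fact (2 * k - 2 * Suc a)) $$ (a, q a))
      = (\<Prod>a = 0..<k. 1 / fact (2 * k - 2 * Suc a)) * (signof q * (\<Prod>a = 0..<k. Matrix.mat k k (\<lambda>(a, l). ?A $$ (?p a, l)) $$ (a, q a)))"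
      by (simp only: prod.distrib mult_ac)
  qed
  also have "Determinant.det (Matrix.mat k k (\<lambda>(a, l). ?A $$ (?p a, l))) = signof ?p * Determinant.det ?A"
    by (rule det_permute_rows[OF mat_carrier p])
  finally show ?thesis by (simp only: Hdet_def mult.assoc)
qed

text \<open>Multiply by a matrix \<open>C\<close> that does not depend on \<open>s\<close>: its
  first \<open>k\<close> columns are the functionals \<open>Lam l\<close>, the others come from an
  inverse of \<open>Rmat 0\<close>. Rows beyond \<open>k\<close> do not depend on \<open>s\<close>
  either, so for every \<open>s\<close> the product is block triangular with an identity block.
  Comparison with s = 0 cancels det C, and no determinant of size n - 1 has to be evaluated.\<close>

lemma det_Rmat_ratio:
  assumes s: "s \<le> 1" and nz: "Determinant.det (Rmat 0) \<noteq> 0"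
  shows "Determinant.det (Rmat s) * Hdet 0 = Determinant.det (Rmat 0) * Hdet s"
proof -
  have kn: "k \<le> n - 1" using nk by linarith
  have R: "Rmat s \<in> carrier_mat (n-1) (n-1)" for s by (simp add: Rmat_def)
  obtain B where B: "B \<in> carrier_mat (n-1) (n-1)" "Rmat 0 * B = 1\<^sub>m (n-1)"
    using det_non_zero_imp_unit[OF R nz, of undefined] unfolding Units_def ring_mat_def by auto
  define C where "C = Matrix.mat (n-1) (n-1) (\<lambda>(b, l). if l < k 
     then fact (n - 2 * k + b) * coeff (Gpoly (n - 2 * k) l) (n - 2 * k + b) else B $$ (b, l))"
  have C: "C \<in> carrier_mat (n-1) (n-1)" by (simp add: C_def)
  define A1 where "A1 s = Matrix.mat k k (\<lambda>(a, l). Jint (k - Suc a + l) s / fact (2 * k - 2 * Suc a))" for s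
  have main: "Determinant.det (Rmat s) * Determinant.det C = Determinant.det (A1 s)" if s: "s \<le> 1" for s
  proof -
    have low: "(Rmat s * C) $$ (a, l) = Lam l (rowZ s (Suc a))" if "a < n - 1" "l < k" for a l
    proof -
      have "(Rmat s * C) $$ (a, l) = (\<Sum>b = 0..<n-1. Rmat s $$ (a, b) * C $$ (b, l))"
        using that kn R C by (simp add: scalar_prod_def Rmat_def C_def)
      also have "\<dots> = (\<Sum>b<n-1. fact (n - 2 * k + b) * coeff (Gpoly (n - 2 * k) l) (n - 2 * k + b) * fps_nth (rowZ s (Suc a)) (n + 1 + b))"
        unfolding lessThan_atLeast0 by (intro sum.cong refl) (use that kn in \<open>auto simp: Rmat_def C_def mult_ac\<close>)
      finally show ?thesis by (simp add: Lam_def)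
    qed
    have high: "(Rmat s * C) $$ (a, l) = (if a = l then 1 else 0)" if "a < n - 1" "k \<le> a" "l < n - 1" "k \<le> l" for a l
    proof -
      have "(Rmat s * C) $$ (a, l) = (\<Sum>b = 0..<n-1. Rmat s $$ (a, b) * C $$ (b, l))"
        using that kn R C by (simp add: scalar_prod_def Rmat_def C_def)
      also have "\<dots> = (\<Sum>b = 0..<n-1. Rmat 0 $$ (a, b) * B $$ (b, l))"
        by (intro sum.cong refl) (use that kn in \<open>auto simp: Rmat_def C_def rowZ_def\<close>)
      also have "\<dots> = (Rmat 0 * B) $$ (a, l)" using that B(1) R[of 0] by (simp add: scalar_prod_def)
      finally show ?thesis using that B by simp
    qed
    define A2 where "A2 = Matrix.mat k (n-1-k) (\<lambda>(a, l). (Rmat s * C) $$ (a, l + k))"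
    have "Rmat s * C = four_block_mat (A1 s) A2 (0\<^sub>m (n-1-k) k) (1\<^sub>m (n-1-k))"
    proof (rule eq_matI)
      show "dim_row (Rmat s * C) = dim_row (four_block_mat (A1 s) A2 (0\<^sub>m (n-1-k) k) (1\<^sub>m (n-1-k)))"
        "dim_col (Rmat s * C) = dim_col (four_block_mat (A1 s) A2 (0\<^sub>m (n-1-k) k) (1\<^sub>m (n-1-k)))"
        using R[of s] C kn by (auto simp: A1_def A2_def)
    next
      fix a l assume "a < dim_row (four_block_mat (A1 s) A2 (0\<^sub>m (n-1-k) k) (1\<^sub>m (n-1-k)))"
        "l < dim_col (four_block_mat (A1 s) A2 (0\<^sub>m (n-1-k) k) (1\<^sub>m (n-1-k)))"
      then have al: "a < n - 1" "l < n - 1" using kn by (auto simp: A1_def A2_def)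
      consider "a < k" "l < k" | "a < k" "k \<le> l" | "k \<le> a" "l < k" | "k \<le> a" "k \<le> l" by linarith
      then show "(Rmat s * C) $$ (a, l) = four_block_mat (A1 s) A2 (0\<^sub>m (n-1-k) k) (1\<^sub>m (n-1-k)) $$ (a, l)"
      proof cases
        case 1
        then show ?thesis using al low[of a l] Lam_rowZ_low[of l "Suc a" s] s kn by (simp add: A1_def A2_def)
      next
        case 2
        then show ?thesis using al kn by (simp add: A1_def A2_def)
      next
        case 3
        then show ?thesis using al low[of a l] Lam_rowZ_high[of l "Suc a" s] kn by (simp add: A1_def A2_def)
      next
        case 4
        have "a - k = l - k \<longleftrightarrow> a = l" using 4 by auto
        then show ?thesis using al high[of a l] 4 kn by (simp add: A1_def A2_def)
      qed
    qed
    then have "Determinant.det (Rmat s * C) = Determinant.det (A1 s) * Determinant.det (1\<^sub>m (n-1-k))"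
      using det_four_block_mat_lower_left_zero[of "A1 s" k A2 "n-1-k" "0\<^sub>m (n-1-k) k" "1\<^sub>m (n-1-k)"]
      by (simp add: A1_def A2_def)
    then show ?thesis using det_mult[OF R C] by simp
  qed
  define K where "K = (\<Prod>a = 0..<k. 1 / fact (2 * k - 2 * Suc a)) * (signof (\<lambda>a. if a < k then k - Suc a else a) :: real)"
  have K: "K \<noteq> 0" by (auto simp: K_def sign_def)
  have A1: "Determinant.det (A1 s) = K * Hdet s" for s unfolding A1_def det_A1 K_def ..
  have "K * (Determinant.det (Rmat s) * Hdet 0) = Determinant.det (Rmat s) * Determinant.det (A1 0)" by (simp add: A1)
  also have "\<dots> = Determinant.det (Rmat 0) * Determinant.det (A1 s)"
    using main[OF s] main[of 0] by (simp flip: main)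
  also have "\<dots> = K * (Determinant.det (Rmat 0) * Hdet s)" by (simp add: A1)
  finally show ?thesis using K by simp
qed

text \<open>With t = 1 - s the weight of the generating function is a Bernstein polynomial over N!.
  At s = 0 the determinant counts all networks, so it is nonzero, as the ratio lemma
  requires.\<close>

theorem networks_Bernstein:
  assumes s: "s \<le> 1"
  shows "(\<Sum>r\<le>n choose 2. Bernstein (n choose 2) r s * real (card {w \<in> sorting_networks n. k \<notin> set (take r w)})) * Hdet 0
     = real (card (sorting_networks n)) * Hdet s"
proof -
  let ?N = "n choose 2" and ?c = "\<lambda>r. real (card {w \<in> sorting_networks n. k \<notin> set (take r w)})"
  have R: "Determinant.det (Rmat s) = (\<Sum>r\<le>?N. Bernstein ?N r s * ?c r) / fact ?N" for s
  proof -
    have "Determinant.det (Rmat s) = Udet n k s (1 - s) (\<lambda>_. 0)"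
      unfolding Udet_def minor_def Rmat_def rowU_at_0 ..
    also have "\<dots> = (\<Sum>r\<le>?N. s ^ r / fact r * ((1 - s) ^ (?N - r) / fact (?N - r)) * ?c r)"
      by (rule network_generating_function[OF nk(2)])
    also have "\<dots> = (\<Sum>r\<le>?N. Bernstein ?N r s * ?c r / fact ?N)"
      by (intro sum.cong refl) (simp add: Bernstein_def binomial_fact)
    finally show ?thesis by (simp add: sum_divide_distrib)
  qed
  have B0: "Bernstein ?N r 0 = (if r = 0 then 1 else 0)" for r by (simp add: Bernstein_def)
  have R0: "Determinant.det (Rmat 0) = real (card (sorting_networks n)) / fact ?N"
    unfolding R B0 by (simp add: if_distrib[of "\<lambda>x. x * _"] cong: if_cong)
  have nz: "Determinant.det (Rmat 0) \<noteq> 0"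
    using ex_sorting_network[OF nk(2)] finite_sorting_networks[of n] by (simp add: R0)
  show ?thesis using det_Rmat_ratio[OF s nz] unfolding R0 unfolding R by simp
qed

end

section \<open>Scaling limit of the Hankel determinants\<close>

text \<open>The limit of the integrals \<open>Jint\<close> in the variable y = sqrt(2n) u, which
  turns (1 - u^2)^n into exp(- y^2 / 2). This is the standard normal weight of the matrix
  side.\<close>

definition Kint :: "nat \<Rightarrow> real \<Rightarrow> real" where
  "Kint m x = (LINT y|lborel. indicator {sqrt 2 * x..} y * ((y\<^sup>2 / 2) ^ m * exp (- y\<^sup>2 / 2)))"

definition Kdet :: "nat \<Rightarrow> real \<Rightarrow> real" where
  "Kdet k x = Determinant.det (Matrix.mat k k (\<lambda>(a, l). Kint (a + l) x))"

definition Kapp :: "nat \<Rightarrow> nat \<Rightarrow> nat \<Rightarrow> real \<Rightarrow> real" where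
  "Kapp k n m x = (LINT y|lborel. indicator {sqrt 2 * x..sqrt (2 * real n)} y * ((y\<^sup>2 / 2) ^ m * (1 - y\<^sup>2 / (2 * real n)) ^ (n - 2 * k)))"

lemma Jint_eq_Kapp:
  assumes n: "2 * k \<le> n" "1 \<le> n" and x: "0 \<le> x"
  shows "real n ^ m * sqrt (2 * real n) * Jint n k m (x / sqrt n) = Kapp k n m x"
proof -
  let ?f = "\<lambda>u::real. indicator {x / sqrt n..1} u * (u ^ (2 * m) * (1 - u\<^sup>2) ^ (n - 2 * k))"
  let ?c = "1 / sqrt (2 * real n)"
  have c: "?c > 0" using n by simp
  have int: "set_integrable lborel {x / sqrt n..1} (\<lambda>u::real. u ^ (2 * m) * (1 - u\<^sup>2) ^ (n - 2 * k))"
    by (rule borel_integrable_atLeastAtMost') (auto intro!: continuous_intros)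
  have "Jint n k m (x / sqrt n) = (LINT u|lborel. ?f u)"
    using set_borel_integral_eq_integral(2)[OF int] n by (simp add: Jint_def set_lebesgue_integral_def)
  also have "\<dots> = \<bar>?c\<bar> *\<^sub>R (LINT y|lborel. ?f (0 + ?c * y))"
    by (rule lborel_integral_real_affine) (use c in simp)
  also have "(\<lambda>y. ?f (0 + ?c * y)) = (\<lambda>y. (1 / real n ^ m) * (indicator {sqrt 2 * x..sqrt (2 * real n)} y * ((y\<^sup>2 / 2) ^ m * (1 - y\<^sup>2 / (2 * real n)) ^ (n - 2 * k))))"
  proof
    fix y
    have i: "?c * y \<in> {x / sqrt n..1} \<longleftrightarrow> y \<in> {sqrt 2 * x..sqrt (2 * real n)}"
      using n by (auto simp: field_simps real_sqrt_mult)
    have sq: "(?c * y)\<^sup>2 = y\<^sup>2 / (2 * real n)" using n by (simp add: power_divide)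
    have "(?c * y) ^ (2 * m) = (y\<^sup>2 / (2 * real n)) ^ m" by (simp only: power_mult sq)
    also have "\<dots> = (1 / real n ^ m) * (y\<^sup>2 / 2) ^ m" by (simp add: power_divide power_mult_distrib)
    finally show "?f (0 + ?c * y) = (1 / real n ^ m) * (indicator {sqrt 2 * x..sqrt (2 * real n)} y * ((y\<^sup>2 / 2) ^ m * (1 - y\<^sup>2 / (2 * real n)) ^ (n - 2 * k)))"
      using i sq by (auto simp: indicator_def)
  qed
  finally have "Jint n k m (x / sqrt n) = ?c * ((1 / real n ^ m) * Kapp k n m x)"
    using c by (simp add: Kapp_def)
  then show ?thesis using n by (simp add: field_simps)
qed

text \<open>The majorant for the limit of \<open>Kapp\<close>. Half of the exponent is given away
  because only n - 2k \<ge> n / 2 factors are at hand for large n.\<close>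

lemma integrable_gauss_half: "integrable lborel (\<lambda>y::real. (y\<^sup>2 / 2) ^ m * exp (- y\<^sup>2 / 4))"
proof -
  have "integrable lborel (\<lambda>y::real. normal_density 0 (sqrt 2) y * (y - 0) ^ (2 * m))"
    by (rule integrable_normal_moment) simp
  then have "integrable lborel (\<lambda>y::real. (sqrt (2 * pi * 2) / 2 ^ m) * (normal_density 0 (sqrt 2) y * (y - 0) ^ (2 * m)))"
    by (rule integrable_mult_right)
  also have "(\<lambda>y::real. (sqrt (2 * pi * 2) / 2 ^ m) * (normal_density 0 (sqrt 2) y * (y - 0) ^ (2 * m))) = (\<lambda>y. (y\<^sup>2 / 2) ^ m * exp (- y\<^sup>2 / 4))"
    by (auto simp: normal_density_def fun_eq_iff power_divide power_mult)
  finally show ?thesis .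
qed

lemma power_limit_exp:
  fixes z :: real
  shows "(\<lambda>n. (1 - z / real n) ^ (n - 2 * k)) \<longlonglongrightarrow> exp (- z)"
proof (rule Lim_transform_eventually)
  have zn: "(\<lambda>n. z / real n) \<longlonglongrightarrow> 0" by (rule lim_const_over_n)
  have "(\<lambda>n. (1 + (- z) / real n) ^ n / (1 - z / real n) ^ (2 * k)) \<longlonglongrightarrow> exp (- z) / (1 - 0) ^ (2 * k)"
    by (intro tendsto_divide tendsto_exp_limit_sequentially tendsto_power tendsto_diff tendsto_const zn) simp
  then show "(\<lambda>n. (1 - z / real n) ^ n / (1 - z / real n) ^ (2 * k)) \<longlonglongrightarrow> exp (- z)" by simp
  have "eventually (\<lambda>n. z / real n < 1) sequentially" using order_tendstoD(2)[OF zn] by simp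
  then show "\<forall>\<^sub>F n in sequentially. (1 - z / real n) ^ n / (1 - z / real n) ^ (2 * k) = (1 - z / real n) ^ (n - 2 * k)"
    using eventually_ge_at_top[of "2 * k"] by eventually_elim (subst power_diff, auto)
qed

lemma Kapp_tendsto:
  assumes "0 \<le> x"
  shows "(\<lambda>n. Kapp k n m x) \<longlonglongrightarrow> Kint m x"
proof -
  let ?s = "\<lambda>n y. indicator {sqrt 2 * x..sqrt (2 * real n)} y * ((y\<^sup>2 / 2) ^ m * (1 - y\<^sup>2 / (2 * real n)) ^ (n - 2 * k))"
  let ?f = "\<lambda>y. indicator {sqrt 2 * x..} y * ((y\<^sup>2 / 2) ^ m * exp (- y\<^sup>2 / 2)) :: real"
  \<comment> \<open>Starting at 4k + 1 guarantees n \<le> 2 (n - 2k), on which the majorant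
    rests.\<close>
  have "(\<lambda>n. LINT y|lborel. ?s (n + (4 * k + 1)) y) \<longlonglongrightarrow> (LINT y|lborel. ?f y)"
  proof (rule integral_dominated_convergence[where w = "\<lambda>y. (y\<^sup>2 / 2) ^ m * exp (- y\<^sup>2 / 4)"])
    show "?f \<in> borel_measurable lborel" by measurable
    show "?s (n + (4 * k + 1)) \<in> borel_measurable lborel" for n by measurable
    show "integrable lborel (\<lambda>y::real. (y\<^sup>2 / 2) ^ m * exp (- y\<^sup>2 / 4))" by (rule integrable_gauss_half)
    show "AE y in lborel. (\<lambda>n. ?s (n + (4 * k + 1)) y) \<longlonglongrightarrow> ?f y"
    proof (rule AE_I2)
      fix y :: real
      have "(\<lambda>n. indicator {sqrt 2 * x..sqrt (2 * real n)} y :: real) \<longlonglongrightarrow> indicator {sqrt 2 * x..} y"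
      proof (rule tendsto_eventually)
        have "filterlim (\<lambda>n. sqrt (2 * real n)) at_top sequentially" by real_asymp
        then have "eventually (\<lambda>n. y \<le> sqrt (2 * real n)) sequentially" by (simp add: filterlim_at_top)
        then show "\<forall>\<^sub>F n in sequentially. (indicator {sqrt 2 * x..sqrt (2 * real n)} y :: real) = indicator {sqrt 2 * x..} y"
          by eventually_elim (auto simp: indicator_def)
      qed
      moreover have "(\<lambda>n. (1 - y\<^sup>2 / (2 * real n)) ^ (n - 2 * k)) \<longlonglongrightarrow> exp (- y\<^sup>2 / 2)"
        using power_limit_exp[of "y\<^sup>2 / 2" k] by (simp add: field_simps)
      ultimately have "(\<lambda>n. ?s n y) \<longlonglongrightarrow> ?f y" by (intro tendsto_mult tendsto_const)
      then show "(\<lambda>n. ?s (n + (4 * k + 1)) y) \<longlonglongrightarrow> ?f y" by (rule LIMSEQ_ignore_initial_segment)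
    qed
    fix j
    show "AE y in lborel. norm (?s (j + (4 * k + 1)) y) \<le> (y\<^sup>2 / 2) ^ m * exp (- y\<^sup>2 / 4)"
    proof (rule AE_I2)
      fix y :: real
      define n where "n = j + (4 * k + 1)"
      show "norm (?s (j + (4 * k + 1)) y) \<le> (y\<^sup>2 / 2) ^ m * exp (- y\<^sup>2 / 4)"
      proof (cases "y \<in> {sqrt 2 * x..sqrt (2 * real n)}")
        case True
        have y0: "0 \<le> y" using True assms by (auto intro: order.trans[rotated])
        have "y\<^sup>2 \<le> (sqrt (2 * real n))\<^sup>2" using True y0 by (intro power_mono) auto
        then have z: "y\<^sup>2 / (2 * real n) \<le> 1" by (simp add: n_def)
        have "(1 - y\<^sup>2 / (2 * real n)) ^ (n - 2 * k) \<le> exp (- (y\<^sup>2 / (2 * real n))) ^ (n - 2 * k)"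
          using z exp_ge_add_one_self[of "- (y\<^sup>2 / (2 * real n))"] by (intro power_mono) auto
        also have "\<dots> = exp (- (y\<^sup>2 * real (n - 2 * k) / (2 * real n)))"
          by (simp add: exp_of_nat_mult[symmetric] field_simps)
        also have "\<dots> \<le> exp (- y\<^sup>2 / 4)"
        proof -
          have "real n \<le> 2 * real (n - 2 * k)" by (simp add: n_def)
          then have "y\<^sup>2 * real n \<le> y\<^sup>2 * (2 * real (n - 2 * k))" by (intro mult_left_mono) auto
          moreover have "real n > 0" by (simp add: n_def)
          ultimately show ?thesis by (simp add: field_simps)
        qed
        finally have "(y\<^sup>2 / 2) ^ m * (1 - y\<^sup>2 / (2 * real n)) ^ (n - 2 * k) \<le> (y\<^sup>2 / 2) ^ m * exp (- y\<^sup>2 / 4)"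
          by (intro mult_left_mono) auto
        then show ?thesis unfolding n_def[symmetric] using True z by (simp add: abs_mult)
      qed (simp add: n_def)
    qed
  qed
  then have "(\<lambda>n. Kapp k (n + (4 * k + 1)) m x) \<longlonglongrightarrow> Kint m x"
    unfolding Kapp_def Kint_def .
  then show ?thesis by (rule LIMSEQ_offset)
qed

lemma tendsto_det:
  assumes "\<And>a l. a < k \<Longrightarrow> l < k \<Longrightarrow> ((\<lambda>n. f n a l) \<longlongrightarrow> (g a l :: real)) F"
  shows "((\<lambda>n. Determinant.det (Matrix.mat k k (\<lambda>(a, l). f n a l))) \<longlongrightarrow> Determinant.det (Matrix.mat k k (\<lambda>(a, l). g a l))) F"
proof -
  have "((\<lambda>n. \<Sum>p | p permutes {0..<k}. signof p * (\<Prod>a = 0..<k. Matrix.mat k k (\<lambda>(a, l). f n a l) $$ (a, p a))) \<longlongrightarrow>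
     (\<Sum>p | p permutes {0..<k}. signof p * (\<Prod>a = 0..<k. Matrix.mat k k (\<lambda>(a, l). g a l) $$ (a, p a)))) F"
  proof (intro tendsto_sum tendsto_mult tendsto_const tendsto_prod)
    fix p a assume "p \<in> {p. p permutes {0..<k}}" "a \<in> {0..<k}"
    then have "a < k" "p a < k" using permutes_in_image[of p "{0..<k}" a] by auto
    then show "((\<lambda>n. Matrix.mat k k (\<lambda>(a, l). f n a l) $$ (a, p a)) \<longlongrightarrow> Matrix.mat k k (\<lambda>(a, l). g a l) $$ (a, p a)) F"
      using assms by simp
  qed
  then show ?thesis by (simp add: det_def'[of _ k])
qed

text \<open>Rows and columns contribute the same powers of n for every permutation in the Leibniz
  sum. The common factor does not depend on \<open>x\<close>, so it cancels in ratios.\<close>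

lemma Hdet_scale:
  assumes n: "2 * k \<le> n" "1 \<le> n" and x: "0 \<le> x"
  shows "(\<Prod>a = 0..<k. real n ^ a)\<^sup>2 * sqrt (2 * real n) ^ k * Hdet n k (x / sqrt n) = Determinant.det (Matrix.mat k k (\<lambda>(a, l). Kapp k n (a + l) x))"
proof -
  have "Determinant.det (Matrix.mat k k (\<lambda>(a, l). Kapp k n (a + l) x)) = 
     (\<Sum>p | p permutes {0..<k}. signof p * (\<Prod>a = 0..<k. Kapp k n (a + p a) x))"
    by (subst det_def'[of _ k]) (auto intro!: sum.cong prod.cong arg_cong2[of _ _ _ _ "(*)"] simp: permutes_in_image)
  also have "\<dots> = (\<Sum>p | p permutes {0..<k}. (\<Prod>a = 0..<k. real n ^ a)\<^sup>2 * sqrt (2 * real n) ^ k * (signof p * (\<Prod>a = 0..<k. Jint n k (a + p a) (x / sqrt n))))"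
  proof (intro sum.cong refl)
    fix p assume "p \<in> {p. p permutes {0..<k}}"
    then have p: "p permutes {0..<k}" by simp
    have "(\<Prod>a = 0..<k. Kapp k n (a + p a) x) = (\<Prod>a = 0..<k. real n ^ a * real n ^ p a * sqrt (2 * real n) * Jint n k (a + p a) (x / sqrt n))"
      by (simp only: Jint_eq_Kapp[OF n x, symmetric] power_add)
    also have "\<dots> = (\<Prod>a = 0..<k. real n ^ a) * (\<Prod>a = 0..<k. real n ^ p a) * sqrt (2 * real n) ^ k * (\<Prod>a = 0..<k. Jint n k (a + p a) (x / sqrt n))"
      by (simp add: prod.distrib)
    also have "(\<Prod>a = 0..<k. real n ^ p a) = (\<Prod>a = 0..<k. real n ^ a)"
      using prod.permute[OF p, of "\<lambda>a. real n ^ a"] by (simp add: o_def)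
    finally show "signof p * (\<Prod>a = 0..<k. Kapp k n (a + p a) x) = (\<Prod>a = 0..<k. real n ^ a)\<^sup>2 * sqrt (2 * real n) ^ k * (signof p * (\<Prod>a = 0..<k. Jint n k (a + p a) (x / sqrt n)))"
      by (simp add: power2_eq_square mult_ac)
  qed
  also have "\<dots> = (\<Prod>a = 0..<k. real n ^ a)\<^sup>2 * sqrt (2 * real n) ^ k * Hdet n k (x / sqrt n)"
    unfolding Hdet_def[OF n] sum_distrib_left[symmetric]
    by (subst det_def'[of _ k]) (auto intro!: sum.cong prod.cong arg_cong2[of _ _ _ _ "(*)"] simp: permutes_in_image)
  finally show ?thesis ..
qed

section \<open>From the binomial clock to the number of letters\<close>

definition surv :: "nat \<Rightarrow> nat \<Rightarrow> nat \<Rightarrow> real" where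
  "surv k n r = real (card {w \<in> sorting_networks n. k \<notin> set (take r w)}) / real (card (sorting_networks n))"

text \<open>Survival when the number of letters read by time \<open>s\<close> is binomial with
  success probability \<open>s\<close>.\<close>

definition Bsurv :: "nat \<Rightarrow> nat \<Rightarrow> real \<Rightarrow> real" where
  "Bsurv k n s = (\<Sum>r\<le>n choose 2. Bernstein (n choose 2) r s * surv k n r)"

lemma card_networks_pos: "1 \<le> n \<Longrightarrow> card (sorting_networks n) > 0"
  using ex_sorting_network finite_sorting_networks by (simp add: card_gt_0_iff)

lemma Bsurv_Hdet:
  assumes n: "2 * k \<le> n" "1 \<le> n" and s: "s \<le> 1"
  shows "Bsurv k n s * Hdet n k 0 = Hdet n k s"
proof -
  have "Bsurv k n s = (\<Sum>r\<le>n choose 2. Bernstein (n choose 2) r s * real (card {w \<in> sorting_networks n. k \<notin> set (take r w)})) / real (card (sorting_networks n))"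
    by (simp add: Bsurv_def surv_def sum_divide_distrib)
  then have "Bsurv k n s * Hdet n k 0 = ((\<Sum>r\<le>n choose 2. Bernstein (n choose 2) r s * real (card {w \<in> sorting_networks n. k \<notin> set (take r w)})) * Hdet n k 0) / real (card (sorting_networks n))"
    by simp
  also have "\<dots> = Hdet n k s" unfolding networks_Bernstein[OF n s] using card_networks_pos[OF n(2)] by simp
  finally show ?thesis .
qed

lemma Bsurv_tendsto:
  assumes K: "Kdet k 0 \<noteq> 0" and x: "0 \<le> x"
  shows "(\<lambda>n. Bsurv k n (x / sqrt n)) \<longlonglongrightarrow> Kdet k x / Kdet k 0"
proof -
  let ?D = "\<lambda>x n. Determinant.det (Matrix.mat k k (\<lambda>(a, l). Kapp k n (a + l) x))"
  have lim: "?D x \<longlonglongrightarrow> Kdet k x" if "0 \<le> x" for x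
    unfolding Kdet_def by (intro tendsto_det Kapp_tendsto that)
  have "(\<lambda>n. ?D x n / ?D 0 n) \<longlonglongrightarrow> Kdet k x / Kdet k 0"
    by (intro tendsto_divide lim x order.refl K)
  then show ?thesis
  proof (rule Lim_transform_eventually)
    have "\<forall>\<^sub>F n in sequentially. ?D 0 n \<noteq> 0"
      using tendsto_imp_eventually_ne[OF lim[OF order.refl] K] .
    moreover have "filterlim (\<lambda>n. sqrt (real n)) at_top sequentially" by real_asymp
    then have "\<forall>\<^sub>F n in sequentially. x \<le> sqrt (real n)" by (simp add: filterlim_at_top)
    ultimately show "\<forall>\<^sub>F n in sequentially. ?D x n / ?D 0 n = Bsurv k n (x / sqrt n)"
      using eventually_ge_at_top[of "2 * k + 1"]
    proof eventually_elim
      case (elim n)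
      then have n: "2 * k \<le> n" "1 \<le> n" by auto
      define C where "C = (\<Prod>a = 0..<k. real n ^ a)\<^sup>2 * sqrt (2 * real n) ^ k"
      have Dx: "?D x n = C * Hdet n k (x / sqrt n)" using Hdet_scale[OF n x] by (simp add: C_def)
      have D0: "?D 0 n = C * Hdet n k 0" using Hdet_scale[OF n order.refl] by (simp add: C_def)
      have "x / sqrt n \<le> 1" using elim n by (simp add: field_simps)
      then have "Bsurv k n (x / sqrt n) * Hdet n k 0 = Hdet n k (x / sqrt n)" by (rule Bsurv_Hdet[OF n])
      moreover have "C \<noteq> 0" "Hdet n k 0 \<noteq> 0" using elim(1) D0 by auto
      ultimately show ?case unfolding Dx D0 by (simp add: field_simps)
    qed
  qed
qed

lemma surv_nonneg: "0 \<le> surv k n r" and surv_le_1: "surv k n r \<le> 1"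
  using card_mono[OF finite_sorting_networks, of "{w \<in> sorting_networks n. k \<notin> set (take r w)}" n]
  by (auto simp: surv_def divide_le_eq_1)

lemma surv_antimono: "r \<le> r' \<Longrightarrow> surv k n r' \<le> surv k n r"
proof -
  assume "r \<le> r'"
  then have "set (take r w) \<subseteq> set (take r' w)" for w :: "nat list" by (rule set_take_subset_set_take)
  then have "{w \<in> sorting_networks n. k \<notin> set (take r' w)} \<subseteq> {w \<in> sorting_networks n. k \<notin> set (take r w)}" by auto
  then have "card {w \<in> sorting_networks n. k \<notin> set (take r' w)} \<le> card {w \<in> sorting_networks n. k \<notin> set (take r w)}"
    by (intro card_mono) (auto simp: finite_sorting_networks)
  then show ?thesis unfolding surv_def by (intro divide_right_mono) auto
qed

lemma Bernstein_variance:
  "(\<Sum>r\<le>N. (real r - real N * s)\<^sup>2 * Bernstein N r s) = real N * s * (1 - s)"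
proof -
  have "(\<Sum>r\<le>N. (real r - real N * s)\<^sup>2 * Bernstein N r s) = 
     (\<Sum>r\<le>N. real r * (real r - 1) * Bernstein N r s) + (1 - 2 * real N * s) * (\<Sum>r\<le>N. real r * Bernstein N r s)
       + (real N * s)\<^sup>2 * (\<Sum>r\<le>N. Bernstein N r s)"
    unfolding sum_distrib_left sum.distrib[symmetric]
    by (intro sum.cong refl) (simp add: power2_eq_square algebra_simps)
  also have "\<dots> = real N * s * (1 - s)"
    unfolding sum_kk_Bernstein sum_k_Bernstein sum_Bernstein by (simp add: power2_eq_square algebra_simps)
  finally show ?thesis .
qed

text \<open>Chebyshev's inequality for the binomial distribution.\<close>

lemma Bernstein_tail:
  assumes s: "0 \<le> s" "s \<le> 1" and d: "0 < d" and A: "A \<subseteq> {..N}" "\<And>r. r \<in> A \<Longrightarrow> d \<le> \<bar>real r - real N * s\<bar>"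
  shows "(\<Sum>r\<in>A. Bernstein N r s) \<le> real N * s / d\<^sup>2"
proof -
  have "d\<^sup>2 * (\<Sum>r\<in>A. Bernstein N r s) \<le> (\<Sum>r\<in>A. (real r - real N * s)\<^sup>2 * Bernstein N r s)"
    unfolding sum_distrib_left
  proof (intro sum_mono mult_right_mono Bernstein_nonneg s)
    fix r assume "r \<in> A"
    then have "d \<le> \<bar>real r - real N * s\<bar>" by (rule A)
    then show "d\<^sup>2 \<le> (real r - real N * s)\<^sup>2" using d by (simp add: abs_le_square_iff[symmetric])
  qed
  also have "\<dots> \<le> (\<Sum>r\<le>N. (real r - real N * s)\<^sup>2 * Bernstein N r s)"
    by (intro sum_mono2) (use A s in \<open>auto intro!: mult_nonneg_nonneg Bernstein_nonneg\<close>)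
  also have "\<dots> = real N * s * (1 - s)" by (rule Bernstein_variance)
  also have "\<dots> \<le> real N * s" using s by (simp add: mult_left_le)
  finally show ?thesis using d by (simp add: field_simps)
qed

text \<open>Survival decreases in the number of letters, so only the tail below \<open>r0\<close>
  can exceed \<open>surv k n r0\<close>.\<close>

lemma Bsurv_upper:
  assumes s: "0 \<le> s" "s \<le> 1" and d: "0 < d" "real r0 + d \<le> real (n choose 2) * s"
  shows "Bsurv k n s \<le> surv k n r0 + real (n choose 2) * s / d\<^sup>2"
proof -
  let ?N = "n choose 2"
  have "Bsurv k n s \<le> (\<Sum>r\<le>?N. Bernstein ?N r s * (surv k n r0 + (if r < r0 then 1 else 0)))"
    unfolding Bsurv_def
  proof (intro sum_mono mult_left_mono Bernstein_nonneg s)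
    fix r show "surv k n r \<le> surv k n r0 + (if r < r0 then 1 else 0)"
      using surv_antimono[of r0 r k n] surv_le_1[of k n r] surv_nonneg[of k n r0] by auto
  qed
  also have "\<dots> = surv k n r0 + (\<Sum>r\<in>{r\<in>{..?N}. r < r0}. Bernstein ?N r s)"
    by (subst sum.inter_filter) (simp_all add: distrib_left sum.distrib sum_distrib_right[symmetric] if_distrib[of "\<lambda>x. _ * x"] cong: if_cong)
  also have "(\<Sum>r\<in>{r\<in>{..?N}. r < r0}. Bernstein ?N r s) \<le> real ?N * s / d\<^sup>2"
    by (intro Bernstein_tail s d) (use d in auto)
  finally show ?thesis by simp
qed

lemma Bsurv_lower:
  assumes s: "0 \<le> s" "s \<le> 1" and d: "0 < d" "real (n choose 2) * s + d \<le> real r0"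
  shows "surv k n r0 \<le> Bsurv k n s + real (n choose 2) * s / d\<^sup>2"
proof -
  let ?N = "n choose 2"
  have "surv k n r0 = (\<Sum>r\<le>?N. Bernstein ?N r s * surv k n r0)"
    by (simp add: sum_distrib_right[symmetric])
  also have "\<dots> \<le> (\<Sum>r\<le>?N. Bernstein ?N r s * (surv k n r + (if r0 < r then 1 else 0)))"
  proof (intro sum_mono mult_left_mono Bernstein_nonneg s)
    fix r show "surv k n r0 \<le> surv k n r + (if r0 < r then 1 else 0)"
      using surv_antimono[of r r0 k n] surv_le_1[of k n r0] surv_nonneg[of k n r] by auto
  qed
  also have "\<dots> = Bsurv k n s + (\<Sum>r\<in>{r\<in>{..?N}. r0 < r}. Bernstein ?N r s)"
    by (subst sum.inter_filter) (simp_all add: Bsurv_def distrib_left sum.distrib if_distrib[of "\<lambda>x. _ * x"] cong: if_cong)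
  also have "(\<Sum>r\<in>{r\<in>{..?N}. r0 < r}. Bernstein ?N r s) \<le> real ?N * s / d\<^sup>2"
    by (intro Bernstein_tail s d) (use d in auto)
  finally show ?thesis by simp
qed

lemma real_choose_two: "real (n choose 2) = real n * (real n - 1) / 2"
proof (induction n)
  case (Suc n)
  have "Suc n choose 2 = n + (n choose 2)" by (simp add: numeral_2_eq_2)
  then have "real (Suc n choose 2) = real n + real (n choose 2)" by simp
  then show ?case unfolding Suc by (simp add: field_simps)
qed simp

text \<open>Monotonicity undoes the averaging: the value at \<open>y\<close> is compared with the
  clock at nearby times \<open>z\<close> on either side. The binomial mean is about z n^(3/2) and
  the variance has the same order, while the gap between \<open>z\<close> and \<open>y\<close>
  leaves a window of order n^(3/2). Chebyshev's error is therefore of order n^(-3/2), and continuity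
  of \<open>C\<close> lets \<open>z\<close> approach \<open>y\<close>.\<close>

lemma surv_tendsto:
  assumes K: "Kdet k 0 \<noteq> 0" and y: "0 < y"
    and cont: "isCont C y" and C: "\<And>y. 0 \<le> y \<Longrightarrow> C y = 1 - Kdet k (2 * y) / Kdet k 0"
  shows "(\<lambda>n. surv k n (nat \<lfloor>y * real n powr (3/2)\<rfloor>)) \<longlonglongrightarrow> 1 - C y"
proof -
  define r0 where "r0 n = nat \<lfloor>y * real n powr (3/2)\<rfloor>" for n
  have r0: "real (r0 n) \<le> y * real n powr (3/2)" "y * real n powr (3/2) < real (r0 n) + 1" for n
    using y by (auto simp: r0_def)
  have Bt: "(\<lambda>n. Bsurv k n (2 * z / sqrt n)) \<longlonglongrightarrow> 1 - C z" if "0 \<le> z" for z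
    using Bsurv_tendsto[OF K, of "2 * z"] that C by simp
  have err: "(\<lambda>n. real (n choose 2) * (2 * z / sqrt n) / (c * real n powr (3/2))\<^sup>2) \<longlonglongrightarrow> 0" if "c > 0" for z c
    unfolding real_choose_two using that by real_asymp
  have scale: "real n powr (3/2) = real n * sqrt n" "real n * (real n - 1) / 2 * (2 * z / sqrt n) = z * (real n * sqrt n) - z * sqrt n" if "n > 0" for n z
  proof -
    have "real n powr (3/2) = real n powr (1 + 1/2)" by simp
    also have "\<dots> = real n * sqrt n" unfolding powr_add using that by (simp add: powr_half_sqrt)
    finally show "real n powr (3/2) = real n * sqrt n" .
    have "real n * (real n - 1) / 2 * (2 * z / sqrt n) = z * (real n - 1) * (real n / sqrt n)" by (simp add: divide_simps) (simp add: algebra_simps)?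
    then show "real n * (real n - 1) / 2 * (2 * z / sqrt n) = z * (real n * sqrt n) - z * sqrt n"
      by (simp add: real_div_sqrt algebra_simps)
  qed
  have s1: "\<forall>\<^sub>F n in sequentially. 2 * z / sqrt (real n) \<le> 1" for z by real_asymp
  have lower: "\<forall>\<^sub>F n in sequentially. 1 - C y - e < surv k n (r0 n)" if e: "e > 0" for e
  proof -
    obtain dl where dl: "dl > 0" "\<And>z. \<bar>z - y\<bar> < dl \<Longrightarrow> \<bar>C z - C y\<bar> < e / 2"
      using cont e unfolding continuous_at_eps_delta dist_real_def by (metis half_gt_zero)
    define z where "z = y + dl / 2"
    have z: "y < z" "0 \<le> z" "\<bar>C z - C y\<bar> < e / 2" using dl y by (auto simp: z_def)
    \<comment> \<open>Half of the gap is the Chebyshev window; the other half absorbs the lower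
      order term z sqrt n of the binomial mean.\<close>
    define c where "c = (z - y) / 2"
    have c: "c > 0" using z by (simp add: c_def)
    have "(\<lambda>n. Bsurv k n (2 * z / sqrt n) - real (n choose 2) * (2 * z / sqrt n) / (c * real n powr (3/2))\<^sup>2) \<longlonglongrightarrow> (1 - C z) - 0"
      by (intro tendsto_diff Bt err c z)
    then have "\<forall>\<^sub>F n in sequentially. 1 - C z - e / 2 < Bsurv k n (2 * z / sqrt n) - real (n choose 2) * (2 * z / sqrt n) / (c * real n powr (3/2))\<^sup>2"
      by (rule order_tendstoD) (use e in simp)
    moreover have "\<forall>\<^sub>F n in sequentially. y * real n powr (3/2) + c * real n powr (3/2) \<le> real n * (real n - 1) / 2 * (2 * z / sqrt n)"
    proof -
      have "\<forall>\<^sub>F n in sequentially. z \<le> c * real n" using c by real_asymp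
      then show ?thesis using eventually_gt_at_top[of 0]
      proof eventually_elim
        case (elim n)
        have "z * sqrt n \<le> (c * real n) * sqrt n" using elim by (intro mult_right_mono) auto
        moreover have "z * (real n * sqrt n) = (y + 2 * c) * (real n * sqrt n)"
          by (rule arg_cong[of _ _ "\<lambda>u. u * _"]) (simp add: c_def field_simps)
        ultimately show ?case unfolding scale[OF elim(2)] by (simp add: algebra_simps)
      qed
    qed
    ultimately show ?thesis using s1[of z] eventually_gt_at_top[of 0]
    proof eventually_elim
      case (elim n)
      have "Bsurv k n (2 * z / sqrt n) \<le> surv k n (r0 n) + real (n choose 2) * (2 * z / sqrt n) / (c * real n powr (3/2))\<^sup>2"
        by (rule Bsurv_upper) (use elim z c r0(1)[of n] in \<open>auto simp: real_choose_two\<close>)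
      then show ?case using elim z by linarith
    qed
  qed
  have upper: "\<forall>\<^sub>F n in sequentially. surv k n (r0 n) < 1 - C y + e" if e: "e > 0" for e
  proof -
    obtain dl where dl: "dl > 0" "\<And>z. \<bar>z - y\<bar> < dl \<Longrightarrow> \<bar>C z - C y\<bar> < e / 2"
      using cont e unfolding continuous_at_eps_delta dist_real_def by (metis half_gt_zero)
    \<comment> \<open>The minimum keeps \<open>z\<close> nonnegative, where the formula for
      \<open>C\<close> is available.\<close>
    define z where "z = y - min dl y / 2"
    have z: "z < y" "0 \<le> z" "\<bar>C z - C y\<bar> < e / 2" using dl y by (auto simp: z_def min_def)
    \<comment> \<open>Here the other half of the gap pays for rounding y n^(3/2) down to an
      integer.\<close>
    define c where "c = (y - z) / 2"
    have c: "c > 0" using z by (simp add: c_def)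
    have "(\<lambda>n. Bsurv k n (2 * z / sqrt n) + real (n choose 2) * (2 * z / sqrt n) / (c * real n powr (3/2))\<^sup>2) \<longlonglongrightarrow> (1 - C z) + 0"
      by (intro tendsto_add Bt err c z)
    then have "\<forall>\<^sub>F n in sequentially. Bsurv k n (2 * z / sqrt n) + real (n choose 2) * (2 * z / sqrt n) / (c * real n powr (3/2))\<^sup>2 < 1 - C z + e / 2"
      by (rule order_tendstoD) (use e in simp)
    moreover have "\<forall>\<^sub>F n in sequentially. real n * (real n - 1) / 2 * (2 * z / sqrt n) + c * real n powr (3/2) \<le> y * real n powr (3/2) - 1"
    proof -
      have "\<forall>\<^sub>F n in sequentially. 1 \<le> c * (real n * sqrt n)" using c by real_asymp
      then show ?thesis using eventually_gt_at_top[of 0]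
      proof eventually_elim
        case (elim n)
        have "0 \<le> z * sqrt n" using z by simp
        moreover have "y * (real n * sqrt n) = (z + 2 * c) * (real n * sqrt n)"
          by (rule arg_cong[of _ _ "\<lambda>u. u * _"]) (simp add: c_def field_simps)
        ultimately show ?case using elim(1) unfolding scale[OF elim(2)] by (simp add: algebra_simps)
      qed
    qed
    ultimately show ?thesis using s1[of z] eventually_gt_at_top[of 0]
    proof eventually_elim
      case (elim n)
      have "surv k n (r0 n) \<le> Bsurv k n (2 * z / sqrt n) + real (n choose 2) * (2 * z / sqrt n) / (c * real n powr (3/2))\<^sup>2"
        by (rule Bsurv_lower) (use elim z c r0(2)[of n] in \<open>auto simp: real_choose_two\<close>)
      then show ?case using elim z by linarith
    qed
  qed
  show ?thesis unfolding r0_def[symmetric]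
  proof (rule order_tendstoI)
    fix a assume "a < 1 - C y"
    then show "\<forall>\<^sub>F n in sequentially. a < surv k n (r0 n)" using lower[of "1 - C y - a"] by simp
  next
    fix a assume "1 - C y < a"
    then show "\<forall>\<^sub>F n in sequentially. surv k n (r0 n) < a" using upper[of "a - (1 - C y)"] by simp
  qed
qed

section \<open>Convergence of the distribution functions\<close>

text \<open>If \<open>k\<close> did not occur, \<open>first_swap_time\<close> would be a
  \<open>LEAST\<close> over nothing. At s = 1 the clock has read every letter, while the integrals
  run over a single point and the Hankel determinant is 0; so no network avoids \<open>k\<close>
  throughout.\<close>

lemma network_contains:
  assumes n: "2 * k \<le> n" "1 \<le> n" and k: "1 \<le> k" and H: "Hdet n k 0 \<noteq> 0" and w: "w \<in> sorting_networks n"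
  shows "k \<in> set w"
proof (rule ccontr)
  assume a: "k \<notin> set w"
  have "Jint n k m 1 = 0" for m using n by (simp add: Jint_def)
  then have "Hdet n k 1 = Determinant.det (0\<^sub>m k k)"
    unfolding Hdet_def[OF n] by (intro arg_cong[of _ _ Determinant.det]) (auto intro!: eq_matI)
  also have "\<dots> = 0" using k by simp
  finally have "Bsurv k n 1 = 0" using Bsurv_Hdet[OF n, of 1] H by simp
  moreover have "Bernstein (n choose 2) r 1 = (if r = n choose 2 then 1 else 0)" if "r \<le> n choose 2" for r
    using that by (auto simp: Bernstein_def power_0_left)
  then have "Bsurv k n 1 = (\<Sum>r\<le>n choose 2. (if r = n choose 2 then 1 else 0) * surv k n r)"
    unfolding Bsurv_def by (intro sum.cong refl) auto
  then have "Bsurv k n 1 = surv k n (n choose 2)"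
    by (simp add: if_distrib[of "\<lambda>x. x * _"] cong: if_cong)
  ultimately have "card {w \<in> sorting_networks n. k \<notin> set (take (n choose 2) w)} = 0"
    using card_networks_pos[OF n(2)] by (simp add: surv_def)
  then have "{w \<in> sorting_networks n. k \<notin> set (take (n choose 2) w)} = {}" by (simp add: finite_sorting_networks)
  moreover have "length w = n choose 2" using w by (simp add: sorting_networks_def)
  ultimately show False using a w by auto
qed

lemma first_swap_time_gt:
  assumes "k \<in> set w"
  shows "first_swap_time k w > r \<longleftrightarrow> k \<notin> set (take r w)"
proof -
  define P where "P t \<longleftrightarrow> 1 \<le> t \<and> t \<le> length w \<and> w ! (t - 1) = k" for t
  define T where "T = first_swap_time k w"
  have T: "T = (LEAST t. P t)" by (simp add: T_def first_swap_time_def P_def)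
  obtain i where "i < length w" "w ! i = k" using assms by (auto simp: in_set_conv_nth)
  then have "P (Suc i)" by (simp add: P_def)
  then have "P T" unfolding T by (rule LeastI)
  then have L: "1 \<le> T" "T \<le> length w" "w ! (T - 1) = k" by (auto simp: P_def)
  have le: "T \<le> t" if "P t" for t unfolding T using that by (rule Least_le)
  have "r < T \<longleftrightarrow> k \<notin> set (take r w)"
  proof
    assume rT: "r < T"
    show "k \<notin> set (take r w)"
    proof
      assume "k \<in> set (take r w)"
      then obtain j where j: "j < length (take r w)" "take r w ! j = k" unfolding in_set_conv_nth by blast
      then have "P (Suc j)" by (simp add: P_def)
      from le[OF this] show False using rT j by simp
    qed
  next
    assume a: "k \<notin> set (take r w)"
    show "r < T"
    proof (rule ccontr)
      assume "\<not> r < T"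
      then have r: "T - 1 < r" using L by linarith
      have "T - 1 < length w" using L by linarith
      then have "take r w ! (T - 1) \<in> set (take r w)" using r by (intro nth_mem) simp
      moreover have "take r w ! (T - 1) = k" using L r by (simp only: nth_take)
      ultimately show False using a by (simp only:)
    qed
  qed
  then show ?thesis by (simp only: T_def)
qed

lemma cdf_distr_pmf_of_set:
  assumes "finite S" "S \<noteq> {}"
  shows "cdf (distr (measure_pmf (pmf_of_set S)) borel f) y = real (card {s \<in> S. f s \<le> y}) / real (card S)"
proof -
  have "cdf (distr (measure_pmf (pmf_of_set S)) borel f) y = measure_pmf.prob (pmf_of_set S) {s. f s \<le> y}"
    by (simp add: cdf_def measure_distr vimage_def)
  also have "\<dots> = real (card (S \<inter> {s. f s \<le> y})) / real (card S)"
    by (rule measure_pmf_of_set[OF assms(2,1)])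
  also have "S \<inter> {s. f s \<le> y} = {s \<in> S. f s \<le> y}" by blast
  finally show ?thesis .
qed

lemma card_swapped_early:
  assumes S: "finite S" and P: "P > 0" and y: "0 \<le> y" and k: "\<And>w. w \<in> S \<Longrightarrow> k \<in> set w"
  shows "card {s \<in> S. real (first_swap_time k s) / P \<le> y} = card S - card {w \<in> S. k \<notin> set (take (nat \<lfloor>y * P\<rfloor>) w)}"
proof -
  have "real t / P \<le> y \<longleftrightarrow> t \<le> nat \<lfloor>y * P\<rfloor>" for t
  proof -
    have "real t / P \<le> y \<longleftrightarrow> real t \<le> y * P" by (rule pos_divide_le_eq[OF P])
    also have "\<dots> \<longleftrightarrow> t \<le> nat \<lfloor>y * P\<rfloor>"
    proof
      assume "t \<le> nat \<lfloor>y * P\<rfloor>"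
      then have "real t \<le> real (nat \<lfloor>y * P\<rfloor>)" by simp
      also have "\<dots> \<le> y * P" using P y by (intro of_nat_floor) simp
      finally show "real t \<le> y * P" .
    qed (rule le_nat_floor)
    finally show ?thesis .
  qed
  moreover have "t \<le> r \<longleftrightarrow> k \<in> set (take r w)" if "w \<in> S" "t = first_swap_time k w" for w r t
    using first_swap_time_gt[OF k[OF that(1)], of r] that(2) by (metis not_less)
  ultimately have "{s \<in> S. real (first_swap_time k s) / P \<le> y} = S - {w \<in> S. k \<notin> set (take (nat \<lfloor>y * P\<rfloor>) w)}"
    by blast
  then show ?thesis using S by (simp add: card_Diff_subset)
qed

text \<open>\<open>C\<close> stays abstract; its expression through \<open>Kdet\<close> is what the
  eigenvalue side has to supply. The argument 2y reflects that s = x / sqrt n amounts to x n^(3/2) /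
  2 letters.\<close>

theorem first_swap_cdf_tendsto:
  assumes k: "1 \<le> k" and K: "Kdet k 0 \<noteq> 0"
    and cont: "isCont C y" and C: "\<And>y. 0 \<le> y \<Longrightarrow> C y = 1 - Kdet k (2 * y) / Kdet k 0" "\<And>y. y < 0 \<Longrightarrow> C y = 0"
  shows "(\<lambda>n. cdf (distr (measure_pmf (pmf_of_set (sorting_networks n))) borel
                   (\<lambda>s. real (first_swap_time k s) / real n powr (3 / 2))) y) \<longlonglongrightarrow> C y"
proof -
  have Hnz: "\<forall>\<^sub>F n in sequentially. Hdet n k 0 \<noteq> 0"
  proof -
    have "(\<lambda>n. Determinant.det (Matrix.mat k k (\<lambda>(a, l). Kapp k n (a + l) 0))) \<longlonglongrightarrow> Kdet k 0"
      unfolding Kdet_def by (intro tendsto_det Kapp_tendsto order.refl)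
    from tendsto_imp_eventually_ne[OF this K] show ?thesis using eventually_ge_at_top[of "2 * k + 1"]
    proof eventually_elim
      case (elim n)
      then have n: "2 * k \<le> n" "1 \<le> n" by auto
      show ?case using elim(1) Hdet_scale[OF n order.refl] by auto
    qed
  qed
  have cdf: "\<forall>\<^sub>F n in sequentially. (if y < 0 then 0 else 1 - surv k n (nat \<lfloor>y * real n powr (3/2)\<rfloor>)) = 
     cdf (distr (measure_pmf (pmf_of_set (sorting_networks n))) borel (\<lambda>s. real (first_swap_time k s) / real n powr (3 / 2))) y"
    using Hnz eventually_ge_at_top[of "2 * k + 1"]
  proof eventually_elim
    case (elim n)
    then have n: "2 * k \<le> n" "1 \<le> n" by auto
    let ?S = "sorting_networks n"
    have S: "finite ?S" "?S \<noteq> {}" using finite_sorting_networks ex_sorting_network[OF n(2)] by auto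
    have pw: "real n powr (3/2) > 0" using n by simp
    have "cdf (distr (measure_pmf (pmf_of_set ?S)) borel (\<lambda>s. real (first_swap_time k s) / real n powr (3 / 2))) y
      = real (card {s \<in> ?S. real (first_swap_time k s) / real n powr (3 / 2) \<le> y}) / real (card ?S)"
      by (rule cdf_distr_pmf_of_set[OF S])
    also have "\<dots> = (if y < 0 then 0 else 1 - surv k n (nat \<lfloor>y * real n powr (3/2)\<rfloor>))"
    proof (cases "y < 0")
      case True
      have "\<not> real (first_swap_time k s) / real n powr (3 / 2) \<le> y" for s
      proof -
        have "0 \<le> real (first_swap_time k s) / real n powr (3 / 2)" by simp
        then show ?thesis using True by linarith
      qed
      then show ?thesis using True by simp
    next
      case False
      let ?r = "nat \<lfloor>y * real n powr (3/2)\<rfloor>"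
      have "card {s \<in> ?S. real (first_swap_time k s) / real n powr (3 / 2) \<le> y} = card ?S - card {w \<in> ?S. k \<notin> set (take ?r w)}"
        by (rule card_swapped_early[OF S(1) pw]) (use False network_contains[OF n k elim(1)] in auto)
      moreover have "card {w \<in> ?S. k \<notin> set (take ?r w)} \<le> card ?S" by (rule card_mono) (use S in auto)
      ultimately show ?thesis using False card_networks_pos[OF n(2)]
        by (simp add: surv_def of_nat_diff diff_divide_distrib)
    qed
    finally show ?case ..
  qed
  have "(\<lambda>n. if y < 0 then 0 else 1 - surv k n (nat \<lfloor>y * real n powr (3/2)\<rfloor>)) \<longlonglongrightarrow> C y"
  proof -
    consider "y < 0" | "y = 0" | "y > 0" by linarith
    then show ?thesis
    proof cases
      case 2
      have "surv k n 0 = 1" if "n \<ge> 1" for n using card_networks_pos[OF that] by (simp add: surv_def)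
      note s0 = this
      have "\<forall>\<^sub>F n in sequentially. (if y < 0 then 0 else 1 - surv k n (nat \<lfloor>y * real n powr (3/2)\<rfloor>)) = C y"
        using eventually_ge_at_top[of 1] by eventually_elim (use 2 C(1)[of 0] K s0 in simp)
      then show ?thesis by (rule tendsto_eventually)
    next
      case 3
      have "(\<lambda>n. 1 - surv k n (nat \<lfloor>y * real n powr (3/2)\<rfloor>)) \<longlonglongrightarrow> 1 - (1 - C y)"
        by (intro tendsto_diff tendsto_const surv_tendsto[OF K 3 cont C(1)])
      then show ?thesis using 3 by simp
    qed (use C in simp)
  qed
  then show ?thesis using cdf by (rule Lim_transform_eventually)
qed

section \<open>Gaussian integration by parts for polynomials\<close>

definition gauss :: "'i set \<Rightarrow> ('i \<Rightarrow> real) measure" where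
  "gauss I = PiM I (\<lambda>_. std_normal_distribution)"

lemma prob_space_std_normal: "prob_space std_normal_distribution"
  using real_dist_normal_dist by (simp add: real_distribution_def)

lemma product_sigma_std_normal: "product_sigma_finite (\<lambda>_. std_normal_distribution)"
  unfolding product_sigma_finite_def using prob_space_std_normal by (auto intro: prob_space_imp_sigma_finite)

lemma prob_space_gauss: "prob_space (gauss I)"
  unfolding gauss_def by (intro prob_space_PiM prob_space_std_normal)

lemma measurable_gauss_coord [measurable]: "d \<in> I \<Longrightarrow> (\<lambda>y. y d) \<in> borel_measurable (gauss I)"
  unfolding gauss_def by simp

text \<open>Polynomials in the coordinates of \<open>I\<close>, paired with their formal derivative
  in \<open>c\<close>. Keeping the pair in one inductive relation allows growth bounds,
  measurability and integration by parts to be proved by rule induction.\<close>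

inductive pderivable :: "'i set \<Rightarrow> 'i \<Rightarrow> (('i \<Rightarrow> real) \<Rightarrow> real) \<Rightarrow> (('i \<Rightarrow> real) \<Rightarrow> real) \<Rightarrow> bool" for I c where
  pd_const: "pderivable I c (\<lambda>_. a) (\<lambda>_. 0)"
| pd_coord: "d \<in> I \<Longrightarrow> pderivable I c (\<lambda>y. y d) (\<lambda>_. if d = c then 1 else 0)"
| pd_add: "pderivable I c f f' \<Longrightarrow> pderivable I c g g' \<Longrightarrow> pderivable I c (\<lambda>y. f y + g y) (\<lambda>y. f' y + g' y)"
| pd_mult: "pderivable I c f f' \<Longrightarrow> pderivable I c g g' \<Longrightarrow> pderivable I c (\<lambda>y. f y * g y) (\<lambda>y. f' y * g y + f y * g' y)"

lemma pd_cong: "pderivable I c f f' \<Longrightarrow> (\<And>y. f y = g y) \<Longrightarrow> (\<And>y. f' y = g' y) \<Longrightarrow> pderivable I c g g'"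
  using ext[of f g] ext[of f' g'] by simp

lemma pd_cmult: "pderivable I c f f' \<Longrightarrow> pderivable I c (\<lambda>y. a * f y) (\<lambda>y. a * f' y)"
  using pd_mult[OF pd_const[of I c a]] by (simp add: pd_cong)

lemma pd_diff: "pderivable I c f f' \<Longrightarrow> pderivable I c g g' \<Longrightarrow> pderivable I c (\<lambda>y. f y - g y) (\<lambda>y. f' y - g' y)"
  using pd_add[OF _ pd_cmult[of I c g g' "-1"]] by simp

lemma pd_sum: "(\<And>a. a \<in> A \<Longrightarrow> pderivable I c (f a) (f' a)) \<Longrightarrow> pderivable I c (\<lambda>y. \<Sum>a\<in>A. f a y) (\<lambda>y. \<Sum>a\<in>A. f' a y)"
  by (induction A rule: infinite_finite_induct) (auto intro: pd_const pd_add)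

definition polyfun :: "'i set \<Rightarrow> (('i \<Rightarrow> real) \<Rightarrow> real) \<Rightarrow> bool" where
  "polyfun I f \<longleftrightarrow> (\<forall>c. \<exists>f'. pderivable I c f f')"

lemma polyfun_const: "polyfun I (\<lambda>_. a)"
  unfolding polyfun_def by (intro allI exI, rule pd_const)
lemma polyfun_coord: "d \<in> I \<Longrightarrow> polyfun I (\<lambda>y. y d)"
  unfolding polyfun_def by (intro allI exI, rule pd_coord)
lemma polyfun_add: "polyfun I f \<Longrightarrow> polyfun I g \<Longrightarrow> polyfun I (\<lambda>y. f y + g y)"
  unfolding polyfun_def
proof
  fix c assume "\<forall>c. \<exists>f'. pderivable I c f f'" "\<forall>c. \<exists>g'. pderivable I c g g'"
  then obtain f' g' where "pderivable I c f f'" "pderivable I c g g'" by blast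
  from pd_add[OF this] show "\<exists>h. pderivable I c (\<lambda>y. f y + g y) h" by (rule exI[of "pderivable I c (\<lambda>y. f y + g y)"])
qed
lemma polyfun_mult: "polyfun I f \<Longrightarrow> polyfun I g \<Longrightarrow> polyfun I (\<lambda>y. f y * g y)"
  unfolding polyfun_def
proof
  fix c assume "\<forall>c. \<exists>f'. pderivable I c f f'" "\<forall>c. \<exists>g'. pderivable I c g g'"
  then obtain f' g' where "pderivable I c f f'" "pderivable I c g g'" by blast
  from pd_mult[OF this] show "\<exists>h. pderivable I c (\<lambda>y. f y * g y) h" by (rule exI[of "pderivable I c (\<lambda>y. f y * g y)"])
qed
lemma polyfun_sum: "(\<And>a. a \<in> A \<Longrightarrow> polyfun I (f a)) \<Longrightarrow> polyfun I (\<lambda>y. \<Sum>a\<in>A. f a y)"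
  by (induction A rule: infinite_finite_induct) (auto intro: polyfun_const polyfun_add)
lemma polyfun_prod: "(\<And>a. a \<in> A \<Longrightarrow> polyfun I (f a)) \<Longrightarrow> polyfun I (\<lambda>y. \<Prod>a\<in>A. f a y)"
  by (induction A rule: infinite_finite_induct) (auto intro: polyfun_const polyfun_mult)
lemma polyfun_power: "polyfun I f \<Longrightarrow> polyfun I (\<lambda>y. f y ^ m)"
  by (induction m) (auto intro: polyfun_const polyfun_mult)
lemma polyfun_cmult: "polyfun I f \<Longrightarrow> polyfun I (\<lambda>y. a * f y)"
  by (intro polyfun_mult polyfun_const)
lemma polyfun_diff: "polyfun I f \<Longrightarrow> polyfun I g \<Longrightarrow> polyfun I (\<lambda>y. f y - g y)"
  using polyfun_add[OF _ polyfun_cmult[of I g "-1"], of f] by simp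
lemma polyfun_prod_list: "(\<And>f. f \<in> set fs \<Longrightarrow> polyfun I f) \<Longrightarrow> polyfun I (\<lambda>y. prod_list (map (\<lambda>f. f y) fs))"
  by (induction fs) (auto intro: polyfun_const polyfun_mult)

lemma pderivable_deriv_polyfun:
  assumes "pderivable I c f f'"
  shows "polyfun I f" "polyfun I f'"
proof -
  have "polyfun I f \<and> polyfun I f'" using assms
  proof induction
    case (pd_const a)
    show ?case by (intro conjI polyfun_const)
  next
    case (pd_coord d)
    then show ?case by (intro conjI polyfun_const polyfun_coord)
  next
    case (pd_add f f' g g')
    then show ?case by (intro conjI polyfun_add) simp_all
  next
    case (pd_mult f f' g g')
    then show ?case by (intro conjI polyfun_add polyfun_mult) simp_all
  qed
  then show "polyfun I f" "polyfun I f'" by auto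
qed

text \<open>One majorant for all polynomials: products of such bounds are again of this form, and it
  factorises over the coordinates, hence is Gaussian integrable.\<close>

definition expsum :: "'i set \<Rightarrow> real \<Rightarrow> ('i \<Rightarrow> real) \<Rightarrow> real" where
  "expsum I m y = exp (m * (\<Sum>d\<in>I. \<bar>y d\<bar>))"

lemma expsum_mono: "m \<le> m' \<Longrightarrow> expsum I m y \<le> expsum I m' y"
  unfolding expsum_def by (auto intro!: mult_right_mono sum_nonneg)

lemma expsum_add: "expsum I (m + m') y = expsum I m y * expsum I m' y"
  by (simp add: expsum_def exp_add[symmetric] algebra_simps)

lemma expsum_pos [simp]: "expsum I m y > 0" "expsum I m y \<ge> 0" by (simp_all add: expsum_def)

lemma polyfun_bound:
  assumes I: "finite I" and f: "polyfun I f"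
  shows "\<exists>C\<ge>0. \<exists>m\<ge>0. \<forall>y. \<bar>f y\<bar> \<le> C * expsum I m y"
proof -
  \<comment> \<open>Any direction serves: \<open>polyfun\<close> provides a derivative in each, and
    only the inductive structure is wanted.\<close>
  obtain c :: 'a where True by simp
  from f obtain f' where "pderivable I c f f'" unfolding polyfun_def by blast
  then show ?thesis
  proof induction
    case (pd_const a)
    then show ?case by (intro exI[of _ "\<bar>a\<bar>"] conjI exI[of _ 0]) (auto simp: expsum_def)
  next
    case (pd_coord d)
    have "\<bar>y d\<bar> \<le> expsum I 1 y" for y
    proof -
      have "\<bar>y d\<bar> \<le> (\<Sum>d\<in>I. \<bar>y d\<bar>)" using I pd_coord by (intro member_le_sum) auto
      also have "\<dots> \<le> exp (\<Sum>d\<in>I. \<bar>y d\<bar>)" using exp_ge_add_one_self[of "\<Sum>d\<in>I. \<bar>y d\<bar>"] by linarith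
      finally show ?thesis by (simp add: expsum_def)
    qed
    then show ?case by (intro exI[of _ 1] conjI) auto
  next
    case (pd_add f f' g g')
    then obtain C m D l where *: "C \<ge> 0" "m \<ge> 0" "D \<ge> 0" "l \<ge> 0" "\<And>y. \<bar>f y\<bar> \<le> C * expsum I m y" "\<And>y. \<bar>g y\<bar> \<le> D * expsum I l y" by blast
    have "\<bar>f y + g y\<bar> \<le> (C + D) * expsum I (max m l) y" for y
    proof -
      have "C * expsum I m y \<le> C * expsum I (max m l) y" "D * expsum I l y \<le> D * expsum I (max m l) y"
        using * by (auto intro!: mult_left_mono expsum_mono)
      then show ?thesis using *(5,6)[of y] unfolding distrib_right by linarith
    qed
    then show ?case using * by (intro exI[of _ "C + D"] conjI exI[of _ "max m l"]) auto
  next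
    case (pd_mult f f' g g')
    then obtain C m D l where *: "C \<ge> 0" "m \<ge> 0" "D \<ge> 0" "l \<ge> 0" "\<And>y. \<bar>f y\<bar> \<le> C * expsum I m y" "\<And>y. \<bar>g y\<bar> \<le> D * expsum I l y" by blast
    have "\<bar>f y * g y\<bar> \<le> (C * D) * expsum I (m + l) y" for y
    proof -
      have "\<bar>f y\<bar> * \<bar>g y\<bar> \<le> (C * expsum I m y) * (D * expsum I l y)"
        using * by (intro mult_mono) auto
      then show ?thesis by (simp add: abs_mult expsum_add mult_ac)
    qed
    then show ?case using * by (intro exI[of _ "C * D"] conjI exI[of _ "m + l"]) auto
  qed
qed

lemma polyfun_measurable:
  assumes "polyfun I f" shows "f \<in> borel_measurable (gauss I)"
proof -
  obtain c :: 'a where True by simp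
  from assms obtain f' where "pderivable I c f f'" unfolding polyfun_def by blast
  then show ?thesis
  proof induction
    case (pd_coord d)
    then show ?case by (rule measurable_gauss_coord)
  next
    case (pd_add f f' g g')
    show ?case by (rule borel_measurable_add[OF pd_add.IH])
  next
    case (pd_mult f f' g g')
    show ?case by (rule borel_measurable_times[OF pd_mult.IH])
  qed (rule borel_measurable_const)
qed

lemma integrable_exp_abs_normal: "integrable std_normal_distribution (\<lambda>u. exp (m * \<bar>u\<bar>))"
proof -
  have e: "integrable std_normal_distribution (\<lambda>u. exp (a * u))" for a :: real
  proof -
    have "integrable lborel (\<lambda>u. exp (a\<^sup>2 / 2) * normal_density a 1 u)"
      by (rule integrable_mult_right) (simp add: integrable_normal_density)
    also have "(\<lambda>u. exp (a\<^sup>2 / 2) * normal_density a 1 u) = (\<lambda>u. std_normal_density u * exp (a * u))"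
    proof
      fix u
      have "a\<^sup>2 / 2 + - (u - a)\<^sup>2 / 2 = - u\<^sup>2 / 2 + a * u"
        by (simp add: power2_eq_square field_simps)
      then have e: "exp (a\<^sup>2 / 2) * exp (- (u - a)\<^sup>2 / 2) = exp (- u\<^sup>2 / 2) * exp (a * u)"
        by (simp only: exp_add[symmetric])
      have "exp (a\<^sup>2 / 2) * normal_density a 1 u = 1 / sqrt (2 * pi) * (exp (a\<^sup>2 / 2) * exp (- (u - a)\<^sup>2 / 2))"
        by (simp only: normal_density_def power_one mult_1_right mult_1_left mult_ac)
      also have "\<dots> = std_normal_density u * exp (a * u)"
        unfolding e normal_density_def by simp
      finally show "exp (a\<^sup>2 / 2) * normal_density a 1 u = std_normal_density u * exp (a * u)" .
    qed
    finally show ?thesis by (subst integrable_density) (auto simp: normal_density_nonneg)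
  qed
  have "integrable std_normal_distribution (\<lambda>u. exp (m * u) + exp (- m * u))"
    by (rule Bochner_Integration.integrable_add[OF e e])
  then show ?thesis
  proof (rule Bochner_Integration.integrable_bound)
    show "AE u in std_normal_distribution. norm (exp (m * \<bar>u\<bar>)) \<le> norm (exp (m * u) + exp (- m * u))"
    proof (rule AE_I2)
      fix u :: real
      have "exp (m * \<bar>u\<bar>) \<le> exp (m * u) + exp (- m * u)"
      proof (cases "u \<ge> 0")
        case True
        then show ?thesis using exp_ge_zero[of "- m * u"] by (simp only: abs_of_nonneg)
      next
        case False
        then have "m * \<bar>u\<bar> = - m * u" by simp
        then show ?thesis using exp_ge_zero[of "m * u"] by (simp only:)
      qed
      also have "\<dots> \<le> norm (exp (m * u) + exp (- m * u))" unfolding real_norm_def by (rule abs_ge_self)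
      finally show "norm (exp (m * \<bar>u\<bar>)) \<le> norm (exp (m * u) + exp (- m * u))"
        by (simp only: real_norm_def abs_exp_cancel)
    qed
    show "(\<lambda>u. exp (m * \<bar>u\<bar>)) \<in> borel_measurable std_normal_distribution" by simp
  qed
qed

lemma integrable_expsum: "finite I \<Longrightarrow> integrable (gauss I) (expsum I m)"
proof -
  assume I: "finite I"
  have "integrable (gauss I) (\<lambda>y. \<Prod>d\<in>I. exp (m * \<bar>y d\<bar>))"
    unfolding gauss_def
    by (rule product_sigma_finite.product_integrable_prod[OF product_sigma_std_normal I integrable_exp_abs_normal])
  also have "(\<lambda>y. \<Prod>d\<in>I. exp (m * \<bar>y d\<bar>)) = expsum I m"
    unfolding expsum_def sum_distrib_left exp_sum[OF I] ..
  finally show ?thesis .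
qed

lemma expsum_measurable [measurable]: "expsum I m \<in> borel_measurable (gauss I)"
proof -
  have "(\<lambda>y. \<Sum>d\<in>I. \<bar>y d\<bar>) \<in> borel_measurable (gauss I)"
    by (intro borel_measurable_sum borel_measurable_abs measurable_gauss_coord)
  then show ?thesis unfolding expsum_def by measurable
qed

lemma polyfun_expsum_integrable:
  assumes I: "finite I" and f: "polyfun I f" and g: "g \<in> borel_measurable (gauss I)" "\<And>y. \<bar>g y\<bar> \<le> C * expsum I m y" "0 \<le> C"
  shows "integrable (gauss I) (\<lambda>y. f y * g y)"
proof -
  obtain D l where D: "D \<ge> 0" "l \<ge> 0" "\<And>y. \<bar>f y\<bar> \<le> D * expsum I l y" using polyfun_bound[OF I f] by blast
  have "integrable (gauss I) (\<lambda>y. (D * C) * expsum I (l + m) y)"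
    by (rule integrable_mult_right) (rule integrable_expsum[OF I])
  then show ?thesis
  proof (rule Bochner_Integration.integrable_bound)
    show "(\<lambda>y. f y * g y) \<in> borel_measurable (gauss I)" by (rule borel_measurable_times[OF polyfun_measurable[OF f] g(1)])
    show "AE y in gauss I. norm (f y * g y) \<le> norm (D * C * expsum I (l + m) y)"
    proof (rule AE_I2)
      fix y
      have "\<bar>f y\<bar> * \<bar>g y\<bar> \<le> (D * expsum I l y) * (C * expsum I m y)"
        by (rule mult_mono[OF D(3) g(2)]) (simp_all add: D(1))
      also have "\<dots> = D * C * expsum I (l + m) y" by (simp only: expsum_add mult_ac)
      also have "\<dots> \<le> norm (D * C * expsum I (l + m) y)" unfolding real_norm_def by (rule abs_ge_self)
      finally show "norm (f y * g y) \<le> norm (D * C * expsum I (l + m) y)"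
        by (simp only: real_norm_def abs_mult)
    qed
  qed
qed

lemma polyfun_integrable: "finite I \<Longrightarrow> polyfun I f \<Longrightarrow> integrable (gauss I) f"
  using polyfun_expsum_integrable[of I f "\<lambda>_. 1" 1 0] by (simp add: expsum_def)

text \<open>For i = 0 the truncated exponent \<open>i - 1\<close> is harmless because of the factor
  \<open>real i\<close>.\<close>

lemma normal_moment_rec: "(LINT u|std_normal_distribution. u * u ^ i) = real i * (LINT u|std_normal_distribution. u ^ (i - 1))"
proof (cases "even i")
  case True
  then have o: "odd (Suc i)" by simp
  have "(LINT u|std_normal_distribution. u * u ^ i) = 0"
    using integral_std_normal_distribution_moment_odd[OF o] by simp
  moreover have "i = 0 \<or> odd (i - 1)" using True by (cases i) auto
  ultimately show ?thesis using integral_std_normal_distribution_moment_odd[of "i - 1"] by auto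
next
  case False
  then obtain j where j: "i = Suc (2 * j)" by (metis oddE Suc_eq_plus1)
  have "(LINT u|std_normal_distribution. u * u ^ i) = fact (2 * Suc j) / (2 ^ Suc j * fact (Suc j))"
    using std_normal_distribution_even_moments(1)[of "Suc j"] by (simp add: j)
  also have "\<dots> = ((2 * (real j + 1)) * (real i * fact (2 * j))) / ((2 * (real j + 1)) * (2 ^ j * fact j))"
    by (rule arg_cong2[of _ _ _ _ "(/)"]) (simp_all add: j algebra_simps)
  also have "\<dots> = (real i * fact (2 * j)) / (2 ^ j * fact j)"
    by (rule mult_divide_mult_cancel_left) simp
  also have "\<dots> = real i * (fact (2 * j) / (2 ^ j * fact j))" by simp
  finally show ?thesis using std_normal_distribution_even_moments(1)[of j] by (simp add: j)
qed

text \<open>Stein's identity, by linearity from the recursion of the moments.\<close>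

lemma normal_ibp_poly:
  fixes p :: "real poly"
  shows "(LINT u|std_normal_distribution. u * poly p u) = (LINT u|std_normal_distribution. poly (pderiv p) u)"
proof -
  let ?d = "Polynomial.degree p"
  have int: "integrable std_normal_distribution (\<lambda>u. a * u ^ i)" for a :: real and i
    by (intro integrable_mult_right integrable_std_normal_distribution_moment)
  have p: "p = (\<Sum>i\<le>?d. monom (coeff p i) i)" by (simp add: poly_as_sum_of_monoms)
  have pd: "poly (pderiv p) u = (\<Sum>i\<le>?d. (real i * coeff p i) * u ^ (i - 1))" for u
    by (subst p) (simp add: pderiv_sum poly_sum pderiv_monom poly_monom)
  have "(LINT u|std_normal_distribution. u * poly p u) = (LINT u|std_normal_distribution. (\<Sum>i\<le>?d. coeff p i * u ^ Suc i))"
    by (simp add: poly_altdef sum_distrib_left mult_ac)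
  also have "\<dots> = (\<Sum>i\<le>?d. LINT u|std_normal_distribution. coeff p i * u ^ Suc i)"
    by (intro Bochner_Integration.integral_sum int)
  also have "\<dots> = (\<Sum>i\<le>?d. coeff p i * (real i * (LINT u|std_normal_distribution. u ^ (i - 1))))"
    by (simp add: normal_moment_rec)
  also have "\<dots> = (\<Sum>i\<le>?d. LINT u|std_normal_distribution. (real i * coeff p i) * u ^ (i - 1))"
    by (simp add: mult_ac)
  also have "\<dots> = (LINT u|std_normal_distribution. (\<Sum>i\<le>?d. (real i * coeff p i) * u ^ (i - 1)))"
    by (rule Bochner_Integration.integral_sum[symmetric]) (rule int)
  finally show ?thesis by (simp add: pd)
qed

lemma pderivable_section:
  assumes "pderivable I c f f'"
  shows "\<exists>p. \<forall>u. f (x(c := u)) = poly p u \<and> f' (x(c := u)) = poly (pderiv p) u"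
  using assms
proof induction
  case (pd_const a)
  then show ?case by (intro exI[of _ "[:a:]"]) simp
next
  case (pd_coord d)
  then show ?case by (cases "d = c") (auto intro: exI[of _ "[:0, 1:]"] exI[of _ "[:x d:]"] simp: pderiv_pCons)
next
  case (pd_add f f' g g')
  then obtain p q where "\<forall>u. f (x(c := u)) = poly p u \<and> f' (x(c := u)) = poly (pderiv p) u"
    "\<forall>u. g (x(c := u)) = poly q u \<and> g' (x(c := u)) = poly (pderiv q) u" by blast
  then show ?case by (intro exI[of _ "p + q"]) (simp only: Polynomial.pderiv_add poly_add simp_thms)
next
  case (pd_mult f f' g g')
  then obtain p q where "\<forall>u. f (x(c := u)) = poly p u \<and> f' (x(c := u)) = poly (pderiv p) u"
    "\<forall>u. g (x(c := u)) = poly q u \<and> g' (x(c := u)) = poly (pderiv q) u" by blast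
  moreover have "poly (pderiv (p * q)) u = poly (pderiv p) u * poly q u + poly p u * poly (pderiv q) u" for u
    by (simp add: Polynomial.pderiv_mult)
  ultimately show ?case by (intro exI[of _ "p * q"]) (simp only: poly_mult simp_thms)
qed

lemma gauss_ibp:
  assumes I: "finite I" "c \<in> I" and f: "pderivable I c f f'"
  shows "(LINT y|gauss I. y c * f y) = (LINT y|gauss I. f' y)"
proof -
  have ic: "insert c (I - {c}) = I" using I by auto
  note pf = pderivable_deriv_polyfun[OF f]
  have i1: "integrable (PiM (insert c (I - {c})) (\<lambda>_. std_normal_distribution)) (\<lambda>y. y c * f y)"
    using polyfun_integrable[OF I(1) polyfun_mult[OF polyfun_coord[OF I(2)] pf(1)]] by (simp only: gauss_def ic)
  have i2: "integrable (PiM (insert c (I - {c})) (\<lambda>_. std_normal_distribution)) f'"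
    using polyfun_integrable[OF I(1) pf(2)] by (simp only: gauss_def ic)
  have "(LINT y|gauss I. y c * f y) = (LINT x|PiM (I - {c}) (\<lambda>_. std_normal_distribution). LINT u|std_normal_distribution. u * f (x(c := u)))"
    using product_sigma_finite.product_integral_insert[OF product_sigma_std_normal _ _ i1] I unfolding gauss_def ic by simp
  also have "\<dots> = (LINT x|PiM (I - {c}) (\<lambda>_. std_normal_distribution). LINT u|std_normal_distribution. f' (x(c := u)))"
  proof (rule Bochner_Integration.integral_cong[OF refl])
    fix x
    obtain p where "\<forall>u. f (x(c := u)) = poly p u \<and> f' (x(c := u)) = poly (pderiv p) u"
      using pderivable_section[OF f] by blast
    then show "(LINT u|std_normal_distribution. u * f (x(c := u))) = (LINT u|std_normal_distribution. f' (x(c := u)))"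
      using normal_ibp_poly[of p] by simp
  qed
  also have "\<dots> = (LINT y|gauss I. f' y)"
    using product_sigma_finite.product_integral_insert[OF product_sigma_std_normal _ _ i2] I unfolding gauss_def ic by simp
  finally show ?thesis .
qed

text \<open>The derivative along the vector field with components \<open>W c\<close>, for a
  polynomial \<open>f\<close>.\<close>

definition derivn :: "'i set \<Rightarrow> ('i \<Rightarrow> ('i \<Rightarrow> real) \<Rightarrow> real) \<Rightarrow> (('i \<Rightarrow> real) \<Rightarrow> real) \<Rightarrow> (('i \<Rightarrow> real) \<Rightarrow> real) \<Rightarrow> bool" where
  "derivn I W f g \<longleftrightarrow> (\<exists>f'. (\<forall>c\<in>I. pderivable I c f (f' c)) \<and> (\<forall>y. g y = (\<Sum>c\<in>I. W c y * f' c y))) \<and> polyfun I f"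

lemma derivnI:
  assumes "\<And>c. c \<in> I \<Longrightarrow> pderivable I c f (f' c)" "\<And>y. g y = (\<Sum>c\<in>I. W c y * f' c y)" "polyfun I f"
  shows "derivn I W f g"
  unfolding derivn_def using assms by (intro conjI exI[of _ f'] ballI allI)

lemma derivn_const: "derivn I W (\<lambda>_. a) (\<lambda>_. 0)"
  by (rule derivnI[of _ _ "\<lambda>_ _. 0"]) (simp_all add: pd_const polyfun_const)

lemma derivn_add: 
  assumes "derivn I W f g" "derivn I W f2 g2"
  shows "derivn I W (\<lambda>y. f y + f2 y) (\<lambda>y. g y + g2 y)"
proof -
  from assms(1) obtain f' where f0: "\<forall>c\<in>I. pderivable I c f (f' c)" "\<forall>y. g y = (\<Sum>c\<in>I. W c y * f' c y)" "polyfun I f"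
    unfolding derivn_def by (elim exE conjE)
  note f = f0(1)[rule_format] f0(2)[rule_format] f0(3)
  from assms(2) obtain f2' where f20: "\<forall>c\<in>I. pderivable I c f2 (f2' c)" "\<forall>y. g2 y = (\<Sum>c\<in>I. W c y * f2' c y)" "polyfun I f2"
    unfolding derivn_def by (elim exE conjE)
  note f2 = f20(1)[rule_format] f20(2)[rule_format] f20(3)
  show ?thesis
  proof (rule derivnI[of _ _ "\<lambda>c y. f' c y + f2' c y"])
    show "polyfun I (\<lambda>y. f y + f2 y)" by (rule polyfun_add[OF f(3) f2(3)])
    show "pderivable I c (\<lambda>y. f y + f2 y) (\<lambda>y. f' c y + f2' c y)" if "c \<in> I" for c
      by (rule pd_add[OF f(1)[OF that] f2(1)[OF that]])
    show "g y + g2 y = (\<Sum>c\<in>I. W c y * (f' c y + f2' c y))" for y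
      by (simp only: f(2) f2(2) distrib_left sum.distrib)
  qed
qed

lemma derivn_mult: 
  assumes "derivn I W f g" "derivn I W f2 g2"
  shows "derivn I W (\<lambda>y. f y * f2 y) (\<lambda>y. g y * f2 y + f y * g2 y)"
proof -
  from assms(1) obtain f' where f0: "\<forall>c\<in>I. pderivable I c f (f' c)" "\<forall>y. g y = (\<Sum>c\<in>I. W c y * f' c y)" "polyfun I f"
    unfolding derivn_def by (elim exE conjE)
  note f = f0(1)[rule_format] f0(2)[rule_format] f0(3)
  from assms(2) obtain f2' where f20: "\<forall>c\<in>I. pderivable I c f2 (f2' c)" "\<forall>y. g2 y = (\<Sum>c\<in>I. W c y * f2' c y)" "polyfun I f2"
    unfolding derivn_def by (elim exE conjE)
  note f2 = f20(1)[rule_format] f20(2)[rule_format] f20(3)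
  show ?thesis
  proof (rule derivnI[of _ _ "\<lambda>c y. f' c y * f2 y + f y * f2' c y"])
    show "polyfun I (\<lambda>y. f y * f2 y)" by (rule polyfun_mult[OF f(3) f2(3)])
    show "pderivable I c (\<lambda>y. f y * f2 y) (\<lambda>y. f' c y * f2 y + f y * f2' c y)" if "c \<in> I" for c
      by (rule pd_mult[OF f(1)[OF that] f2(1)[OF that]])
    show "g y * f2 y + f y * g2 y = (\<Sum>c\<in>I. W c y * (f' c y * f2 y + f y * f2' c y))" for y
      unfolding f(2) f2(2) sum_distrib_right sum_distrib_left sum.distrib[symmetric]
      by (intro sum.cong refl) (simp only: distrib_left mult_ac)
  qed
qed

lemma derivn_cong: "derivn I W f g \<Longrightarrow> (\<And>y. f y = f2 y) \<Longrightarrow> (\<And>y. g y = g2 y) \<Longrightarrow> derivn I W f2 g2"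
  using ext[of f f2] ext[of g g2] by simp

lemma derivn_sum: "(\<And>a. a \<in> A \<Longrightarrow> derivn I W (f a) (g a)) \<Longrightarrow> derivn I W (\<lambda>y. \<Sum>a\<in>A. f a y) (\<lambda>y. \<Sum>a\<in>A. g a y)"
  by (induction A rule: infinite_finite_induct) (simp_all add: derivn_const derivn_add)

lemma derivn_cmult:
  assumes "derivn I W f g"
  shows "derivn I W (\<lambda>y. a * f y) (\<lambda>y. a * g y)"
  by (rule derivn_cong[OF derivn_mult[OF derivn_const[of I W a] assms]]) simp_all

text \<open>Logarithmic derivatives add. The multiplicative form stays valid where factors vanish,
  as those of a Vandermonde product do.\<close>

lemma derivn_logprod: 
  assumes "finite A" "\<And>a. a \<in> A \<Longrightarrow> derivn I W (f a) (\<lambda>y. f a y * s a y)"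
  shows "derivn I W (\<lambda>y. \<Prod>a\<in>A. f a y) (\<lambda>y. (\<Prod>a\<in>A. f a y) * (\<Sum>a\<in>A. s a y))"
  using assms
proof (induction A rule: finite_induct)
  case empty
  then show ?case using derivn_const[of I W 1] by simp
next
  case (insert a A)
  have "derivn I W (\<lambda>y. f a y * (\<Prod>a\<in>A. f a y)) (\<lambda>y. (f a y * s a y) * (\<Prod>a\<in>A. f a y) + f a y * ((\<Prod>a\<in>A. f a y) * (\<Sum>a\<in>A. s a y)))"
    by (rule derivn_mult[OF insert.prems insert.IH[OF insert.prems]]) simp_all
  then show ?case by (rule derivn_cong) (simp_all only: prod.insert[OF insert.hyps(1,2)] sum.insert[OF insert.hyps(1,2)] distrib_left mult_ac)
qed

text \<open>The divergence theorem for the Gaussian measure: \<open>gauss_ibp\<close> is applied to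
  each product of \<open>W c\<close> and \<open>f\<close>.\<close>

lemma divergence_ibp:
  assumes I: "finite I" and W: "\<And>c. c \<in> I \<Longrightarrow> pderivable I c (W c) (W' c)" and f: "derivn I W f g"
  shows "(LINT y|gauss I. (\<Sum>c\<in>I. y c * W c y) * f y) = (LINT y|gauss I. (\<Sum>c\<in>I. W' c y) * f y + g y)"
proof -
  from f obtain f' where f0: "\<forall>c\<in>I. pderivable I c f (f' c)" "\<forall>y. g y = (\<Sum>c\<in>I. W c y * f' c y)" "polyfun I f"
    unfolding derivn_def by (elim exE conjE)
  note f' = f0(1)[rule_format] f0(2)[rule_format] f0(3)
  have pW: "polyfun I (W c)" "polyfun I (W' c)" "polyfun I (f' c)" if "c \<in> I" for c
    by (rule pderivable_deriv_polyfun[OF W[OF that]] pderivable_deriv_polyfun(2)[OF f'(1)[OF that]])+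
  have i1: "integrable (gauss I) (\<lambda>y. y c * (W c y * f y))" if "c \<in> I" for c
    by (rule polyfun_integrable[OF I polyfun_mult[OF polyfun_coord[OF that] polyfun_mult[OF pW(1)[OF that] f'(3)]]])
  have i2: "integrable (gauss I) (\<lambda>y. W' c y * f y + W c y * f' c y)" if "c \<in> I" for c
    by (rule polyfun_integrable[OF I polyfun_add[OF polyfun_mult[OF pW(2)[OF that] f'(3)] polyfun_mult[OF pW(1)[OF that] pW(3)[OF that]]]])
  have "(LINT y|gauss I. (\<Sum>c\<in>I. y c * W c y) * f y) = (LINT y|gauss I. (\<Sum>c\<in>I. y c * (W c y * f y)))"
    by (simp only: sum_distrib_right mult.assoc)
  also have "\<dots> = (\<Sum>c\<in>I. LINT y|gauss I. y c * (W c y * f y))"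
    by (rule Bochner_Integration.integral_sum[OF i1])
  also have "\<dots> = (\<Sum>c\<in>I. LINT y|gauss I. W' c y * f y + W c y * f' c y)"
    by (rule sum.cong[OF refl]) (rule gauss_ibp[OF I _ pd_mult[OF W f'(1)]])
  also have "\<dots> = (LINT y|gauss I. (\<Sum>c\<in>I. W' c y * f y + W c y * f' c y))"
    by (rule Bochner_Integration.integral_sum[OF i2, symmetric])
  also have "\<dots> = (LINT y|gauss I. (\<Sum>c\<in>I. W' c y) * f y + g y)"
    by (simp only: f'(2) sum.distrib sum_distrib_right)
  finally show ?thesis .
qed

section \<open>Loop equations determine all moments\<close>

text \<open>The effect on a product of power sums of a derivation that sends \<open>P m\<close> to m
  \<open>P (q + m)\<close>: each factor is hit in turn.\<close>

fun merges :: "(nat \<Rightarrow> 'a \<Rightarrow> real) \<Rightarrow> nat \<Rightarrow> nat list \<Rightarrow> 'a \<Rightarrow> real" where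
  "merges P q [] y = 0"
| "merges P q (m # ms) y = real m * P (q + m) y * prod_list (map (\<lambda>m. P m y) ms) + P m y * merges P q ms y"

text \<open>\<open>M\<close> weighted by \<open>w\<close> is a law, and \<open>P m\<close> plays the
  role of a power sum of degree m. The equation trades an expectation of degree q + 1 + d for
  expectations of degree q + d.\<close>

definition loopsys :: "'a measure \<Rightarrow> ('a \<Rightarrow> real) \<Rightarrow> (nat \<Rightarrow> 'a \<Rightarrow> real) \<Rightarrow> real \<Rightarrow> bool" where
  "loopsys M w P k \<longleftrightarrow> (\<forall>ms. integrable M (\<lambda>y. w y * prod_list (map (\<lambda>m. P m y) ms))) \<and> (\<forall>y. P 0 y = k) \<and> (LINT y|M. w y) = 1 \<and>
    (\<forall>q ms. (LINT y|M. w y * (P (Suc q) y * prod_list (map (\<lambda>m. P m y) ms))) = 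
      (LINT y|M. w y * (((\<Sum>b\<le>q. P b y * P (q - b) y) - P q y / 2) * prod_list (map (\<lambda>m. P m y) ms) + merges P q ms y)))"

text \<open>The equation is integration by parts along a field \<open>W q\<close> that moves each
  squared eigenvalue z at speed 2 z^(q+1), so that \<open>P m\<close> changes at rate 2m
  \<open>P (q + m)\<close>. The function \<open>s q\<close> is the logarithmic derivative of the
  weight. The last hypothesis is the identity that the two ensembles share.\<close>

lemma gauss_loopsys:
  assumes I: "finite I" and P0: "\<And>y. P 0 y = k" and polyP: "\<And>m. polyfun I (P m)" and polyw: "polyfun I w" and w1: "(LINT y|gauss I. w y) = 1"
    and W: "\<And>q c. c \<in> I \<Longrightarrow> pderivable I c (W q c) (W' q c)"
    and euler: "\<And>q y. (\<Sum>c\<in>I. y c * W q c y) = 2 * P (Suc q) y"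
    and TP: "\<And>q m. derivn I (W q) (P m) (\<lambda>y. 2 * real m * P (q + m) y)"
    and Tw: "\<And>q. derivn I (W q) w (\<lambda>y. w y * s q y)"
    and dv: "\<And>q y. (\<Sum>c\<in>I. W' q c y) + s q y = 2 * (\<Sum>b\<le>q. P b y * P (q - b) y) - P q y"
  shows "loopsys (gauss I) w P k"
  unfolding loopsys_def
proof (intro conjI allI)
  fix q ms
  let ?F = "\<lambda>ms y. prod_list (map (\<lambda>m. P m y) ms)"
  have TF: "derivn I (W q) (?F ms) (\<lambda>y. 2 * merges P q ms y)" for ms
  proof (induction ms)
    case Nil
    then show ?case using derivn_const[of I "W q" 1] by simp
  next
    case (Cons m ms)
    show ?case by (rule derivn_cong[OF derivn_mult[OF TP[of q m] Cons]]) (simp_all add: algebra_simps)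
  qed
  have T: "derivn I (W q) (\<lambda>y. w y * ?F ms y) (\<lambda>y. w y * s q y * ?F ms y + w y * (2 * merges P q ms y))"
    by (rule derivn_mult[OF Tw TF])
  have "(LINT y|gauss I. (\<Sum>c\<in>I. y c * W q c y) * (w y * ?F ms y)) = 
     (LINT y|gauss I. (\<Sum>c\<in>I. W' q c y) * (w y * ?F ms y) + (w y * s q y * ?F ms y + w y * (2 * merges P q ms y)))"
    by (rule divergence_ibp[OF I W T])
  then have "(LINT y|gauss I. 2 * (w y * (P (Suc q) y * ?F ms y))) = 
     (LINT y|gauss I. w y * (((\<Sum>c\<in>I. W' q c y) + s q y) * ?F ms y + 2 * merges P q ms y))"
    by (simp only: euler) (simp add: algebra_simps)
  also have "\<dots> = (LINT y|gauss I. 2 * (w y * (((\<Sum>b\<le>q. P b y * P (q - b) y) - P q y / 2) * ?F ms y + merges P q ms y)))"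
    by (simp only: dv) (simp add: algebra_simps)
  finally show "(LINT y|gauss I. w y * (P (Suc q) y * ?F ms y)) = 
      (LINT y|gauss I. w y * (((\<Sum>b\<le>q. P b y * P (q - b) y) - P q y / 2) * ?F ms y + merges P q ms y))"
    by simp
next
  fix ms
  have "polyfun I (\<lambda>y. prod_list (map (\<lambda>m. P m y) ms))"
    using polyfun_prod_list[of "map P ms" I] polyP by (auto simp: o_def)
  then show "integrable (gauss I) (\<lambda>y. w y * prod_list (map (\<lambda>m. P m y) ms))"
    by (rule polyfun_integrable[OF I polyfun_mult[OF polyw]])
qed (use P0 w1 in auto)

context
  fixes M1 :: "'a measure" and w1 P1 k and M2 :: "'b measure" and w2 P2
  assumes L1: "loopsys M1 w1 P1 k" and L2: "loopsys M2 w2 P2 k"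
begin

lemma loop_int: "integrable M1 (\<lambda>y. w1 y * prod_list (map (\<lambda>m. P1 m y) ms))" "integrable M2 (\<lambda>y. w2 y * prod_list (map (\<lambda>m. P2 m y) ms))"
  by (rule L1[unfolded loopsys_def, THEN conjunct1, rule_format], rule L2[unfolded loopsys_def, THEN conjunct1, rule_format])

lemma loop_eq:
  "(LINT y|M1. w1 y * (P1 (Suc q) y * prod_list (map (\<lambda>m. P1 m y) ms))) = 
      (LINT y|M1. w1 y * (((\<Sum>b\<le>q. P1 b y * P1 (q - b) y) - P1 q y / 2) * prod_list (map (\<lambda>m. P1 m y) ms) + merges P1 q ms y))"
  "(LINT y|M2. w2 y * (P2 (Suc q) y * prod_list (map (\<lambda>m. P2 m y) ms))) = 
      (LINT y|M2. w2 y * (((\<Sum>b\<le>q. P2 b y * P2 (q - b) y) - P2 q y / 2) * prod_list (map (\<lambda>m. P2 m y) ms) + merges P2 q ms y))"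
  by (rule L1[unfolded loopsys_def, THEN conjunct2, THEN conjunct2, THEN conjunct2, rule_format],
      rule L2[unfolded loopsys_def, THEN conjunct2, THEN conjunct2, THEN conjunct2, rule_format])

lemma loop_P0: "P1 0 y = k" "P2 0 z = k"
  by (rule L1[unfolded loopsys_def, THEN conjunct2, THEN conjunct1, rule_format],
      rule L2[unfolded loopsys_def, THEN conjunct2, THEN conjunct1, rule_format])

lemma loop_w: "(LINT y|M1. w1 y) = 1" "(LINT y|M2. w2 y) = 1"
  by (rule L1[unfolded loopsys_def, THEN conjunct2, THEN conjunct2, THEN conjunct1],
      rule L2[unfolded loopsys_def, THEN conjunct2, THEN conjunct2, THEN conjunct1])

text \<open>The prefix \<open>pre\<close> holds the factors that the recursion of
  \<open>merges\<close> has already passed.\<close>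

lemma merges_agree:
  assumes "\<And>ls. sum_list ls = d \<Longrightarrow> (LINT y|M1. w1 y * prod_list (map (\<lambda>m. P1 m y) ls)) = (LINT y|M2. w2 y * prod_list (map (\<lambda>m. P2 m y) ls))"
    and "sum_list pre + q + sum_list ms = d"
  shows "integrable M1 (\<lambda>y. w1 y * (prod_list (map (\<lambda>m. P1 m y) pre) * merges P1 q ms y)) \<and>
    integrable M2 (\<lambda>y. w2 y * (prod_list (map (\<lambda>m. P2 m y) pre) * merges P2 q ms y)) \<and>
   (LINT y|M1. w1 y * (prod_list (map (\<lambda>m. P1 m y) pre) * merges P1 q ms y)) = (LINT y|M2. w2 y * (prod_list (map (\<lambda>m. P2 m y) pre) * merges P2 q ms y))"
  using assms(2)
proof (induction ms arbitrary: pre)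
  case (Cons m ms)
  have e1: "w1 y * (prod_list (map (\<lambda>m. P1 m y) pre) * merges P1 q (m # ms) y) =
     real m * (w1 y * prod_list (map (\<lambda>m. P1 m y) (pre @ (q + m) # ms))) + w1 y * (prod_list (map (\<lambda>m. P1 m y) (pre @ [m])) * merges P1 q ms y)" for y
    by (simp add: algebra_simps)
  have e2: "w2 y * (prod_list (map (\<lambda>m. P2 m y) pre) * merges P2 q (m # ms) y) =
     real m * (w2 y * prod_list (map (\<lambda>m. P2 m y) (pre @ (q + m) # ms))) + w2 y * (prod_list (map (\<lambda>m. P2 m y) (pre @ [m])) * merges P2 q ms y)" for y
    by (simp add: algebra_simps)
  have IH: "integrable M1 (\<lambda>y. w1 y * (prod_list (map (\<lambda>m. P1 m y) (pre @ [m])) * merges P1 q ms y))"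
    "integrable M2 (\<lambda>y. w2 y * (prod_list (map (\<lambda>m. P2 m y) (pre @ [m])) * merges P2 q ms y))"
    "(LINT y|M1. w1 y * (prod_list (map (\<lambda>m. P1 m y) (pre @ [m])) * merges P1 q ms y)) = (LINT y|M2. w2 y * (prod_list (map (\<lambda>m. P2 m y) (pre @ [m])) * merges P2 q ms y))"
    using Cons.IH[of "pre @ [m]"] Cons.prems by auto
  have eq: "(LINT y|M1. w1 y * prod_list (map (\<lambda>m. P1 m y) (pre @ (q + m) # ms))) = (LINT y|M2. w2 y * prod_list (map (\<lambda>m. P2 m y) (pre @ (q + m) # ms)))"
    by (rule assms(1)) (use Cons.prems in simp)
  have a1: "integrable M1 (\<lambda>y. real m * (w1 y * prod_list (map (\<lambda>m. P1 m y) (pre @ (q + m) # ms))))"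
    by (rule integrable_mult_right[OF loop_int(1)])
  have a2: "integrable M2 (\<lambda>y. real m * (w2 y * prod_list (map (\<lambda>m. P2 m y) (pre @ (q + m) # ms))))"
    by (rule integrable_mult_right[OF loop_int(2)])
  show ?case unfolding e1 e2
    by (intro conjI Bochner_Integration.integrable_add[OF a1 IH(1)] Bochner_Integration.integrable_add[OF a2 IH(2)])
       (simp only: Bochner_Integration.integral_add[OF a1 IH(1)] Bochner_Integration.integral_add[OF a2 IH(2)] integral_mult_right_zero eq IH(3))
qed simp

text \<open>Induction on the total degree: some nonzero entry is \<open>Suc q\<close>, and the loop
  equation lowers the degree by one. In degree 0 the product is a power of the constant
  \<open>k\<close>.\<close>

lemma loop_unique:
  "(LINT y|M1. w1 y * prod_list (map (\<lambda>m. P1 m y) ms)) = (LINT y|M2. w2 y * prod_list (map (\<lambda>m. P2 m y) ms))"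
proof (induction "sum_list ms" arbitrary: ms)
  case 0
  then have z: "\<forall>m\<in>set ms. m = 0" by simp
  have 1: "prod_list (map (\<lambda>m. P1 m y) ms) = k ^ length ms" for y
    using z by (induction ms) (simp_all add: loop_P0)
  have 2: "prod_list (map (\<lambda>m. P2 m y) ms) = k ^ length ms" for y
    using z by (induction ms) (simp_all add: loop_P0)
  show ?case unfolding 1 2 integral_mult_left_zero loop_w ..
next
  case (Suc d)
  then have "\<exists>m\<in>set ms. m \<noteq> 0" by (metis Zero_not_Suc sum_list_eq_0_iff)
  then obtain m where m: "m \<in> set ms" "m \<noteq> 0" by blast
  obtain q where q: "m = Suc q" using not0_implies_Suc[OF m(2)] by blast
  define ms' where "ms' = remove1 m ms"
  have s: "mset ms = mset (m # ms')" using m by (simp add: ms'_def)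
  have pl: "prod_list (map f ms) = f m * prod_list (map f ms')" for f :: "nat \<Rightarrow> real"
    using arg_cong[OF s, of "\<lambda>M. prod_mset (image_mset f M)"] by (simp add: prod_mset_prod_list[symmetric] mset_map)
  have sd: "sum_list ms = m + sum_list ms'" using arg_cong[OF s, of sum_mset] by (simp add: sum_mset_sum_list)
  then have d: "q + sum_list ms' = d" using Suc.hyps q by simp
  have IH: "(LINT y|M1. w1 y * prod_list (map (\<lambda>m. P1 m y) ls)) = (LINT y|M2. w2 y * prod_list (map (\<lambda>m. P2 m y) ls))" if "sum_list ls = d" for ls
    using Suc.hyps(1)[of ls] that by simp
  have mg: "integrable M1 (\<lambda>y. w1 y * merges P1 q ms' y)" "integrable M2 (\<lambda>y. w2 y * merges P2 q ms' y)"
    "(LINT y|M1. w1 y * merges P1 q ms' y) = (LINT y|M2. w2 y * merges P2 q ms' y)"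
    using merges_agree[of d "[]" q ms', OF IH] d by simp_all
  have split: "(LINT y|M. w y * (((\<Sum>b\<le>q. P b y * P (q - b) y) - P q y / 2) * prod_list (map (\<lambda>m. P m y) ms') + merges P q ms' y))
     = (\<Sum>b\<le>q. LINT y|M. w y * prod_list (map (\<lambda>m. P m y) (b # (q - b) # ms'))) - (LINT y|M. w y * prod_list (map (\<lambda>m. P m y) (q # ms'))) / 2 + (LINT y|M. w y * merges P q ms' y)"
    if int: "\<And>ms. integrable M (\<lambda>y. w y * prod_list (map (\<lambda>m. P m y) ms))" "integrable M (\<lambda>y. w y * merges P q ms' y)"
    for M :: "'c measure" and w P
  proof -
    have "(LINT y|M. w y * (((\<Sum>b\<le>q. P b y * P (q - b) y) - P q y / 2) * prod_list (map (\<lambda>m. P m y) ms') + merges P q ms' y))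
      = (LINT y|M. (\<Sum>b\<le>q. w y * prod_list (map (\<lambda>m. P m y) (b # (q - b) # ms'))) - (w y * prod_list (map (\<lambda>m. P m y) (q # ms'))) / 2 + w y * merges P q ms' y)"
      by (intro Bochner_Integration.integral_cong refl) (simp add: algebra_simps sum_distrib_left sum_distrib_right)
    also have "\<dots> = (LINT y|M. (\<Sum>b\<le>q. w y * prod_list (map (\<lambda>m. P m y) (b # (q - b) # ms')))) - (LINT y|M. (w y * prod_list (map (\<lambda>m. P m y) (q # ms'))) / 2) + (LINT y|M. w y * merges P q ms' y)"
      by (subst Bochner_Integration.integral_add, (intro Bochner_Integration.integrable_diff Bochner_Integration.integrable_sum integrable_divide int)+,
          subst Bochner_Integration.integral_diff, (intro Bochner_Integration.integrable_sum integrable_divide int refl)+)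
    also have "(LINT y|M. (\<Sum>b\<le>q. w y * prod_list (map (\<lambda>m. P m y) (b # (q - b) # ms')))) = (\<Sum>b\<le>q. LINT y|M. w y * prod_list (map (\<lambda>m. P m y) (b # (q - b) # ms')))"
      by (intro Bochner_Integration.integral_sum int)
    finally show ?thesis by simp
  qed
  have r: "(\<Sum>b\<le>q. LINT y|M1. w1 y * prod_list (map (\<lambda>m. P1 m y) (b # (q - b) # ms'))) = (\<Sum>b\<le>q. LINT y|M2. w2 y * prod_list (map (\<lambda>m. P2 m y) (b # (q - b) # ms')))"
    by (intro sum.cong refl IH) (use d in auto)
  have r2: "(LINT y|M1. w1 y * prod_list (map (\<lambda>m. P1 m y) (q # ms'))) = (LINT y|M2. w2 y * prod_list (map (\<lambda>m. P2 m y) (q # ms')))"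
    by (rule IH) (use d in simp)
  have "(LINT y|M1. w1 y * prod_list (map (\<lambda>m. P1 m y) ms)) = (LINT y|M1. w1 y * (P1 (Suc q) y * prod_list (map (\<lambda>m. P1 m y) ms')))"
    by (simp only: pl q)
  also have "\<dots> = (LINT y|M1. w1 y * (((\<Sum>b\<le>q. P1 b y * P1 (q - b) y) - P1 q y / 2) * prod_list (map (\<lambda>m. P1 m y) ms') + merges P1 q ms' y))"
    using loop_eq(1) .
  also have "\<dots> = (LINT y|M2. w2 y * (((\<Sum>b\<le>q. P2 b y * P2 (q - b) y) - P2 q y / 2) * prod_list (map (\<lambda>m. P2 m y) ms') + merges P2 q ms' y))"
    unfolding split[OF loop_int(1) mg(1)] split[OF loop_int(2) mg(2)] r r2 mg(3) ..
  also have "\<dots> = (LINT y|M2. w2 y * (P2 (Suc q) y * prod_list (map (\<lambda>m. P2 m y) ms')))"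
    using loop_eq(2)[symmetric] .
  also have "\<dots> = (LINT y|M2. w2 y * prod_list (map (\<lambda>m. P2 m y) ms))"
    by (simp only: pl q)
  finally show ?case .
qed

end

section \<open>The antisymmetric Gaussian matrix satisfies the loop equations\<close>

text \<open>The aGUE matrix M is i times this real antisymmetric matrix A, which keeps the moment
  calculus real.\<close>

definition Am :: "nat \<Rightarrow> nat \<Rightarrow> (nat \<times> nat \<Rightarrow> real) \<Rightarrow> real" where
  "Am i j y = (y (i, j) - y (j, i)) / 2"

text \<open>Entries of A^m as functions of \<open>y\<close>, the form to which
  \<open>pderivable\<close> applies.\<close>

fun Apow :: "nat \<Rightarrow> nat \<Rightarrow> nat \<Rightarrow> nat \<Rightarrow> (nat \<times> nat \<Rightarrow> real) \<Rightarrow> real" where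
  "Apow l 0 i j y = (if i = j then 1 else 0)"
| "Apow l (Suc m) i j y = (\<Sum>r<l. Am i r y * Apow l m r j y)"

lemma Apow_add: "i < l \<Longrightarrow> (\<Sum>r<l. Apow l a i r y * Apow l b r j y) = Apow l (a + b) i j y"
proof (induction a arbitrary: i)
  case 0
  have "(\<Sum>r<l. Apow l 0 i r y * Apow l b r j y) = (\<Sum>r<l. if i = r then Apow l b r j y else 0)"
    by (intro sum.cong) auto
  then show ?case using 0 by simp
next
  case (Suc a)
  have "(\<Sum>r<l. Apow l (Suc a) i r y * Apow l b r j y) = (\<Sum>r<l. \<Sum>s<l. Am i s y * (Apow l a s r y * Apow l b r j y))"
    by (simp add: sum_distrib_right mult.assoc)
  also have "\<dots> = (\<Sum>s<l. Am i s y * (\<Sum>r<l. Apow l a s r y * Apow l b r j y))"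
    by (subst sum.swap) (simp add: sum_distrib_left)
  also have "\<dots> = (\<Sum>s<l. Am i s y * Apow l (a + b) s j y)"
    by (intro sum.cong refl) (simp add: Suc.IH)
  finally show ?case by simp
qed

lemma Apow_1: "j < l \<Longrightarrow> Apow l (Suc 0) r j y = Am r j y"
proof -
  assume j: "j < l"
  show ?thesis using j by (simp add: if_distrib[of "\<lambda>x. _ * x"] cong: if_cong)
qed

lemma Apow_Suc_right: "i < l \<Longrightarrow> j < l \<Longrightarrow> Apow l (Suc m) i j y = (\<Sum>r<l. Apow l m i r y * Am r j y)"
  using Apow_add[of i l m y 1 j] Apow_1[of j l] by simp

lemma Am_antisym: "Am i j y = - Am j i y"
  by (simp add: Am_def field_simps)

lemma Apow_antisym: "i < l \<Longrightarrow> j < l \<Longrightarrow> Apow l m i j y = (- 1) ^ m * Apow l m j i y"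
proof (induction m arbitrary: i j)
  case (Suc m)
  have "Apow l (Suc m) i j y = (\<Sum>r<l. (- Am r i y) * ((- 1) ^ m * Apow l m j r y))"
    unfolding Apow.simps(2)
  proof (rule sum.cong[OF refl])
    fix r assume "r \<in> {..<l}"
    then have "Apow l m r j y = (- 1) ^ m * Apow l m j r y" using Suc.IH[of r j] Suc.prems by blast
    then show "Am i r y * Apow l m r j y = (- Am r i y) * ((- 1) ^ m * Apow l m j r y)"
      using Am_antisym[of i r y] by (rule arg_cong2[of _ _ _ _ "(*)", rotated])
  qed
  also have "\<dots> = (- 1) ^ Suc m * (\<Sum>r<l. Apow l m j r y * Am r i y)"
    unfolding sum_distrib_left by (rule sum.cong[OF refl]) simp
  also have "\<dots> = (- 1) ^ Suc m * Apow l (Suc m) j i y"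
    by (rule arg_cong[OF Apow_Suc_right[symmetric]]) (use Suc.prems in simp_all)
  finally show ?case .
qed simp

text \<open>The product rule for A^m. Moving the coordinate (p, q) moves A in the direction (E_pq -
  E_qp) / 2, which replaces one of the factors.\<close>

definition dApow :: "nat \<Rightarrow> nat \<Rightarrow> nat \<Rightarrow> nat \<Rightarrow> nat \<Rightarrow> nat \<Rightarrow> (nat \<times> nat \<Rightarrow> real) \<Rightarrow> real" where
  "dApow l p q m i j y = (\<Sum>a<m. Apow l a i p y * Apow l (m - Suc a) q j y - Apow l a i q y * Apow l (m - Suc a) p j y) / 2"

abbreviation "idx l \<equiv> {..<l} \<times> {..<(l::nat)}"

definition dAm :: "nat \<Rightarrow> nat \<Rightarrow> nat \<Rightarrow> nat \<Rightarrow> real" where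
  "dAm p q i r = ((if i = p \<and> r = q then 1 else 0) - (if r = p \<and> i = q then 1 else 0)) / 2"

lemma pd_Am:
  assumes "i < l" "r < l"
  shows "pderivable (idx l) (p, q) (Am i r) (\<lambda>_. dAm p q i r)"
proof -
  have "pderivable (idx l) (p, q) (\<lambda>y. (1/2) * (y (i, r) - y (r, i))) (\<lambda>_. (1/2) * ((if (i, r) = (p, q) then 1 else 0) - (if (r, i) = (p, q) then 1 else 0)))"
    by (rule pd_cmult[OF pd_diff[OF pd_coord pd_coord]]) (use assms in simp_all)
  then show ?thesis by (rule pd_cong) (simp_all add: Am_def dAm_def)
qed

lemma pd_Apow:
  assumes pq: "p < l" "q < l"
  shows "i < l \<Longrightarrow> j < l \<Longrightarrow> pderivable (idx l) (p, q) (Apow l m i j) (dApow l p q m i j)"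
proof (induction m arbitrary: i)
  case 0
  show ?case by (rule pd_cong[OF pd_const[of _ _ "if i = j then 1 else 0"]]) (simp_all add: dApow_def)
next
  case (Suc m)
  have "pderivable (idx l) (p, q) (\<lambda>y. \<Sum>r<l. Am i r y * Apow l m r j y) (\<lambda>y. \<Sum>r<l. dAm p q i r * Apow l m r j y + Am i r y * dApow l p q m r j y)"
    by (rule pd_sum, rule pd_mult[OF pd_Am Suc.IH]) (use Suc.prems in simp_all)
  then show ?case
  proof (rule pd_cong)
    fix y
    have e: "(\<Sum>r<l. dAm p q i r * Apow l m r j y) = (Apow l 0 i p y * Apow l m q j y - Apow l 0 i q y * Apow l m p j y) / 2"
    proof -
      have "(\<Sum>r<l. dAm p q i r * Apow l m r j y) = (\<Sum>r<l. (if r = q then (if i = p then Apow l m q j y / 2 else 0) else 0)) - (\<Sum>r<l. (if r = p then (if i = q then Apow l m p j y / 2 else 0) else 0))"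
        unfolding sum_subtractf[symmetric] by (intro sum.cong refl) (simp add: dAm_def)
      also have "\<dots> = (if i = p then Apow l m q j y / 2 else 0) - (if i = q then Apow l m p j y / 2 else 0)"
        using pq by simp
      finally show ?thesis by simp
    qed
    have "(\<Sum>r<l. Am i r y * dApow l p q m r j y) = (\<Sum>r<l. \<Sum>a<m. (Am i r y * Apow l a r p y * Apow l (m - Suc a) q j y - Am i r y * Apow l a r q y * Apow l (m - Suc a) p j y) / 2)"
      by (simp add: dApow_def sum_distrib_left sum_divide_distrib right_diff_distrib mult.assoc)
    also have "\<dots> = (\<Sum>a<m. \<Sum>r<l. (Am i r y * Apow l a r p y * Apow l (m - Suc a) q j y - Am i r y * Apow l a r q y * Apow l (m - Suc a) p j y) / 2)"
      by (rule sum.swap)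
    also have "\<dots> = (\<Sum>a<m. (Apow l (Suc a) i p y * Apow l (m - Suc a) q j y - Apow l (Suc a) i q y * Apow l (m - Suc a) p j y) / 2)"
      by (simp add: sum_subtractf sum_divide_distrib[symmetric] sum_distrib_right)
    finally have e2: "(\<Sum>r<l. Am i r y * dApow l p q m r j y) = (\<Sum>a<m. (Apow l (Suc a) i p y * Apow l (m - Suc a) q j y - Apow l (Suc a) i q y * Apow l (m - Suc a) p j y)) / 2"
      by (simp only: sum_divide_distrib)
    have "dApow l p q (Suc m) i j y = ((Apow l 0 i p y * Apow l m q j y - Apow l 0 i q y * Apow l m p j y)
       + (\<Sum>a<m. (Apow l (Suc a) i p y * Apow l (m - Suc a) q j y - Apow l (Suc a) i q y * Apow l (m - Suc a) p j y))) / 2"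
      unfolding dApow_def sum.lessThan_Suc_shift by (simp only: diff_Suc_Suc diff_zero)
    then show "(\<Sum>r<l. dAm p q i r * Apow l m r j y + Am i r y * dApow l p q m r j y) = dApow l p q (Suc m) i j y"
      unfolding sum.distrib e e2 by (simp only: add_divide_distrib)
  qed simp
qed

declare Apow.simps(2) [simp del]

definition trA :: "nat \<Rightarrow> nat \<Rightarrow> (nat \<times> nat \<Rightarrow> real) \<Rightarrow> real" where
  "trA l m y = (\<Sum>i<l. Apow l m i i y)"

text \<open>The trace of M^(2m) is (-1)^m times that of A^(2m); the half counts each pair of
  eigenvalues x, -x once.\<close>

definition PA :: "nat \<Rightarrow> nat \<Rightarrow> (nat \<times> nat \<Rightarrow> real) \<Rightarrow> real" where
  "PA l m y = (- 1) ^ m * trA l (2 * m) y / 2"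

text \<open>In matrix form this is the field A M^(2q), under which M^2 moves at speed 2 M^(2q+2).
  The transposed index, paid for by the sign, makes the sum against the coordinates a trace.\<close>

definition WA :: "nat \<Rightarrow> nat \<Rightarrow> nat \<times> nat \<Rightarrow> (nat \<times> nat \<Rightarrow> real) \<Rightarrow> real" where
  "WA l q c y = - ((- 1) ^ q) * Apow l (Suc (2 * q)) (snd c) (fst c) y"

definition WA' :: "nat \<Rightarrow> nat \<Rightarrow> nat \<times> nat \<Rightarrow> (nat \<times> nat \<Rightarrow> real) \<Rightarrow> real" where
  "WA' l q c y = - ((- 1) ^ q) * dApow l (fst c) (snd c) (Suc (2 * q)) (snd c) (fst c) y"

lemma trA_odd: "odd m \<Longrightarrow> trA l m y = 0"
proof -
  assume m: "odd m"
  have "Apow l m i i y = 0" if "i < l" for i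
    using Apow_antisym[of i l i m y] that m by simp
  then show ?thesis by (simp add: trA_def)
qed

text \<open>The double sum is the trace of A^a times the transpose of A^b, and transposing A^b costs
  (-1)^b.\<close>

lemma trA_prod: "(\<Sum>i<l. \<Sum>j<l. Apow l a j i y * Apow l b j i y) = (- 1) ^ b * trA l (a + b) y"
proof -
  have "(\<Sum>i<l. \<Sum>j<l. Apow l a j i y * Apow l b j i y) = (\<Sum>j<l. \<Sum>i<l. Apow l a j i y * Apow l b j i y)" by (rule sum.swap)
  also have "\<dots> = (\<Sum>j<l. \<Sum>i<l. (- 1) ^ b * (Apow l a j i y * Apow l b i j y))"
  proof (intro sum.cong refl)
    fix i j assume "j \<in> {..<l}" "i \<in> {..<l}"
    then show "Apow l a j i y * Apow l b j i y = (- 1) ^ b * (Apow l a j i y * Apow l b i j y)"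
      using Apow_antisym[of j l i b y] by simp
  qed
  also have "\<dots> = (- 1) ^ b * (\<Sum>j<l. Apow l (a + b) j j y)"
    unfolding sum_distrib_left[symmetric] by (simp add: Apow_add)
  finally show ?thesis by (simp add: trA_def)
qed

lemma pd_PA:
  assumes "p < l" "q < l"
  shows "pderivable (idx l) (p, q) (PA l m) (\<lambda>y. (- 1) ^ m * real m * Apow l (2 * m - 1) q p y)"
proof -
  have "pderivable (idx l) (p, q) (\<lambda>y. ((- 1) ^ m / 2) * (\<Sum>i<l. Apow l (2 * m) i i y)) (\<lambda>y. ((- 1) ^ m / 2) * (\<Sum>i<l. dApow l p q (2 * m) i i y))"
    by (rule pd_cmult[OF pd_sum], rule pd_Apow[OF assms]) simp_all
  then show ?thesis
  proof (rule pd_cong)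
    fix y
    show "((- 1) ^ m / 2) * (\<Sum>i<l. Apow l (2 * m) i i y) = PA l m y" by (simp add: PA_def trA_def)
    have "(\<Sum>i<l. dApow l p q (2 * m) i i y) = (\<Sum>i<l. \<Sum>a<2 * m. Apow l (2 * m - Suc a) q i y * Apow l a i p y - Apow l (2 * m - Suc a) p i y * Apow l a i q y) / 2"
      by (simp add: dApow_def sum_divide_distrib mult.commute)
    also have "\<dots> = (\<Sum>a<2 * m. \<Sum>i<l. Apow l (2 * m - Suc a) q i y * Apow l a i p y - Apow l (2 * m - Suc a) p i y * Apow l a i q y) / 2"
      by (subst sum.swap) simp
    also have "\<dots> = (\<Sum>a<2 * m. Apow l (2 * m - 1) q p y - Apow l (2 * m - 1) p q y) / 2"
    proof (rule arg_cong[of _ _ "\<lambda>z. z / 2"], rule sum.cong[OF refl])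
      fix a assume a: "a \<in> {..<2 * m}"
      then have "2 * m - Suc a + a = 2 * m - 1" by auto
      then show "(\<Sum>i<l. Apow l (2 * m - Suc a) q i y * Apow l a i p y - Apow l (2 * m - Suc a) p i y * Apow l a i q y) = Apow l (2 * m - 1) q p y - Apow l (2 * m - 1) p q y"
        unfolding sum_subtractf using assms by (simp only: Apow_add)
    qed
    also have "\<dots> = real m * (Apow l (2 * m - 1) q p y - Apow l (2 * m - 1) p q y)" by simp
    also have "\<dots> = real m * (2 * Apow l (2 * m - 1) q p y)"
    \<comment> \<open>For m = 0 the truncated exponent is 0 and not odd, but the factor
      \<open>real m\<close> vanishes.\<close>
    proof (cases "m = 0")
      case False
      then have "odd (2 * m - 1)" by simp
      then have "Apow l (2 * m - 1) p q y = - Apow l (2 * m - 1) q p y" using Apow_antisym[of p l q "2 * m - 1" y] assms by simp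
      then show ?thesis by simp
    qed simp
    finally show "((- 1) ^ m / 2) * (\<Sum>i<l. dApow l p q (2 * m) i i y) = (- 1) ^ m * real m * Apow l (2 * m - 1) q p y"
      by simp
  qed
qed

lemma polyfun_PA: "polyfun (idx l) (PA l m)"
proof -
  have A: "polyfun (idx l) (Apow l m i j)" if "i < l" "j < l" for m i j
    using pderivable_deriv_polyfun(1)[OF pd_Apow[OF that that]] .
  have "polyfun (idx l) (\<lambda>y. ((- 1) ^ m / 2) * (\<Sum>i<l. Apow l (2 * m) i i y))"
    by (rule polyfun_cmult[OF polyfun_sum]) (simp add: A)
  moreover have "(\<lambda>y. ((- 1) ^ m / 2) * (\<Sum>i<l. Apow l (2 * m) i i y)) = PA l m" by (rule ext) (simp add: PA_def trA_def)
  ultimately show ?thesis by simp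
qed

lemma sum_pairs_scale:
  fixes f :: "'a \<times> 'b \<Rightarrow> real"
  assumes "\<And>i j. f (i, j) = c * X i j / 2"
  shows "(\<Sum>p\<in>A \<times> B. f p) = c * (\<Sum>i\<in>A. \<Sum>j\<in>B. X i j) / 2"
proof -
  have "(\<Sum>p\<in>A \<times> B. f p) = (\<Sum>i\<in>A. \<Sum>j\<in>B. c * X i j / 2)"
    unfolding assms[symmetric] sum.cartesian_product by (rule sum.cong) auto
  then show ?thesis by (simp add: sum_distrib_left sum_divide_distrib)
qed

lemma sign_cancel:
  fixes u v A B :: real
  assumes "u * u = 1" "v * v = 1"
  shows "A * B = 4 * (u * v) * ((u * A / 2) * (v * B / 2))"
proof -
  have "4 * (u * v) * ((u * A / 2) * (v * B / 2)) = (u * u) * (v * v) * (A * B)" by simp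
  then show ?thesis using assms by simp
qed

lemma convolution_even_terms:
  fixes t :: "nat \<Rightarrow> real"
  assumes "\<And>m. odd m \<Longrightarrow> t m = 0"
  shows "(\<Sum>a<Suc (2 * q). t a * t (2 * q - a)) = (\<Sum>b\<le>q. t (2 * b) * t (2 * (q - b)))"
proof -
  have "(\<Sum>b\<le>q. t (2 * b) * t (2 * (q - b))) = (\<Sum>a | a < Suc (2 * q) \<and> even a. t a * t (2 * q - a))"
    by (rule sum.reindex_bij_witness[of _ "\<lambda>a. a div 2" "\<lambda>b. 2 * b"]) (auto simp: diff_mult_distrib2)
  also have "\<dots> = (\<Sum>a<Suc (2 * q). t a * t (2 * q - a))"
    by (rule sum.mono_neutral_left) (auto simp: assms)
  finally show ?thesis ..
qed

text \<open>Stated for an abstract sequence; for traces, the signs (-1)^b and (-1)^(q-b) of the two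
  power sums combine to (-1)^q.\<close>

lemma convolution_even_part:
  fixes t :: "nat \<Rightarrow> real"
  assumes "\<And>m. odd m \<Longrightarrow> t m = 0"
  shows "(\<Sum>a<Suc (2 * q). t a * t (2 * q - a)) = 4 * (- 1) ^ q * (\<Sum>b\<le>q. ((- 1) ^ b * t (2 * b) / 2) * ((- 1) ^ (q - b) * t (2 * (q - b)) / 2))"
proof -
  have "(\<Sum>b\<le>q. t (2 * b) * t (2 * (q - b))) = (\<Sum>b\<le>q. 4 * (- 1) ^ q * (((- 1) ^ b * t (2 * b) / 2) * ((- 1) ^ (q - b) * t (2 * (q - b)) / 2)))"
proof (rule sum.cong[OF refl])
  fix b assume "b \<in> {..q}"
  then have "b + (q - b) = q" by simp
  then have e: "(- 1 :: real) ^ q = (- 1) ^ b * (- 1) ^ (q - b)" by (metis power_add)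
  show "t (2 * b) * t (2 * (q - b)) = 4 * (- 1) ^ q * (((- 1) ^ b * t (2 * b) / 2) * ((- 1) ^ (q - b) * t (2 * (q - b)) / 2))"
    unfolding e by (rule sign_cancel[OF minus_one_mult_self minus_one_mult_self])
qed
  moreover have "(\<Sum>a<Suc (2 * q). t a * t (2 * q - a)) = (\<Sum>b\<le>q. t (2 * b) * t (2 * (q - b)))"
    by (rule convolution_even_terms) (rule assms)
  ultimately show ?thesis unfolding sum_distrib_left by (rule trans[rotated])
qed

lemma sum_cmult_diff:
  fixes c :: real
  shows "(\<Sum>a\<in>A. s a * c - t a) = (\<Sum>a\<in>A. s a) * c - (\<Sum>a\<in>A. t a)"
  by (simp add: sum_subtractf sum_distrib_right)

lemma alternating_sum: "(\<Sum>a<Suc (2 * q). (- 1 :: real) ^ (2 * q - a)) = 1"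
proof -
  have "(\<Sum>a<Suc (2 * q). (- 1 :: real) ^ (Suc (2 * q) - Suc a)) = (\<Sum>a<Suc (2 * q). (- 1) ^ a)"
    by (rule sum.nat_diff_reindex)
  also have "\<dots> = ((- 1) ^ Suc (2 * q) - 1) / (- 1 - 1)" by (rule geometric_sum) simp
  also have "\<dots> = 1" unfolding power_minus1_odd by simp
  finally show ?thesis unfolding diff_Suc_Suc .
qed

lemma sum_rotate:
  fixes g :: "'a \<Rightarrow> 'b \<Rightarrow> 'c \<Rightarrow> real"
  shows "(\<Sum>i\<in>A. \<Sum>j\<in>B. \<Sum>a\<in>C. g a i j) = (\<Sum>a\<in>C. \<Sum>i\<in>A. \<Sum>j\<in>B. g a i j)"
proof -
  have "(\<Sum>i\<in>A. \<Sum>j\<in>B. \<Sum>a\<in>C. g a i j) = (\<Sum>i\<in>A. \<Sum>a\<in>C. \<Sum>j\<in>B. g a i j)"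
    by (rule sum.cong[OF refl], rule sum.swap)
  also have "\<dots> = (\<Sum>a\<in>C. \<Sum>i\<in>A. \<Sum>j\<in>B. g a i j)" by (rule sum.swap)
  finally show ?thesis .
qed

lemma WA_euler: "(\<Sum>c\<in>idx l. y c * WA l q c y) = 2 * PA l (Suc q) y"
  proof -
    let ?B = "\<lambda>i j. Apow l (Suc (2 * q)) i j y"
    have B: "?B i j = - ?B j i" if "i < l" "j < l" for i j
      using Apow_antisym[OF that, of "Suc (2 * q)" y] unfolding power_minus1_odd mult_minus1 .
    have "trA l (Suc (Suc (2 * q))) y = (\<Sum>i<l. \<Sum>j<l. y (i, j) * ?B j i / 2 - y (j, i) * ?B j i / 2)"
      unfolding trA_def Apow.simps(2)[of l "Suc (2 * q)"]
      by (intro sum.cong refl) (simp only: Am_def left_diff_distrib diff_divide_distrib times_divide_eq_left)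
    also have "\<dots> = (\<Sum>i<l. \<Sum>j<l. y (i, j) * ?B j i / 2) - (\<Sum>i<l. \<Sum>j<l. y (j, i) * ?B j i / 2)"
      by (simp only: sum_subtractf)
    finally have t0: "trA l (Suc (Suc (2 * q))) y = (\<Sum>i<l. \<Sum>j<l. y (i, j) * ?B j i / 2) - (\<Sum>i<l. \<Sum>j<l. y (j, i) * ?B j i / 2)" .
    have "(\<Sum>i<l. \<Sum>j<l. y (j, i) * ?B j i / 2) = (\<Sum>i<l. \<Sum>j<l. y (i, j) * ?B i j / 2)"
      by (rule sum.swap)
    also have "\<dots> = (\<Sum>i<l. \<Sum>j<l. - (y (i, j) * ?B j i / 2))"
    proof (rule sum.cong[OF refl], rule sum.cong[OF refl])
      fix i j assume "i \<in> {..<l}" "j \<in> {..<l}"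
      then have e: "?B i j = - ?B j i" by (intro B) simp_all
      show "y (i, j) * ?B i j / 2 = - (y (i, j) * ?B j i / 2)" unfolding e by simp
    qed
    finally have t1: "(\<Sum>i<l. \<Sum>j<l. y (j, i) * ?B j i / 2) = (\<Sum>i<l. \<Sum>j<l. - (y (i, j) * ?B j i / 2))" .
    have t: "trA l (Suc (Suc (2 * q))) y = (\<Sum>i<l. \<Sum>j<l. y (i, j) * ?B j i)"
      unfolding t0 t1 sum_subtractf[symmetric]
      by (rule sum.cong[OF refl], rule sum.cong[OF refl]) simp
    have "(\<Sum>c\<in>idx l. y c * WA l q c y) = (\<Sum>i<l. \<Sum>j<l. y (i, j) * WA l q (i, j) y)"
      by (simp only: sum.cartesian_product case_prod_unfold prod.collapse)
    also have "\<dots> = - ((- 1) ^ q) * (\<Sum>i<l. \<Sum>j<l. y (i, j) * ?B j i)"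
      unfolding WA_def sum_distrib_left fst_conv snd_conv
      by (rule sum.cong[OF refl], rule sum.cong[OF refl]) (rule mult.left_commute)
    also have "\<dots> = 2 * PA l (Suc q) y" unfolding t[symmetric] PA_def by (simp add: mult_Suc_right)
    finally show ?thesis .
  qed

lemma derivn_PA: "derivn (idx l) (WA l q) (PA l m) (\<lambda>y. 2 * real m * PA l (q + m) y)"
  proof (rule derivnI[of _ _ "\<lambda>c y. (- 1) ^ m * real m * Apow l (2 * m - 1) (snd c) (fst c) y"])
    show "polyfun (idx l) (PA l m)" by (rule polyfun_PA)
    show "pderivable (idx l) c (PA l m) (\<lambda>y. (- 1) ^ m * real m * Apow l (2 * m - 1) (snd c) (fst c) y)" if "c \<in> idx l" for c
    proof -
      obtain i j where ij: "c = (i, j)" "i < l" "j < l" using \<open>c \<in> idx l\<close> by auto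
      show ?thesis unfolding ij(1) fst_conv snd_conv by (rule pd_PA[OF ij(2,3)])
    qed
    fix y
    have "(\<Sum>c\<in>idx l. WA l q c y * ((- 1) ^ m * real m * Apow l (2 * m - 1) (snd c) (fst c) y))
      = (\<Sum>i<l. \<Sum>j<l. WA l q (i, j) y * ((- 1) ^ m * real m * Apow l (2 * m - 1) j i y))"
      by (simp only: sum.cartesian_product case_prod_unfold prod.collapse fst_conv snd_conv)
    also have "\<dots> = - ((- 1) ^ (q + m)) * real m * (\<Sum>i<l. \<Sum>j<l. Apow l (Suc (2 * q)) j i y * Apow l (2 * m - 1) j i y)"
      unfolding WA_def sum_distrib_left fst_conv snd_conv power_add
      by (rule sum.cong[OF refl], rule sum.cong[OF refl]) simp
    also have "\<dots> = - ((- 1) ^ (q + m)) * real m * ((- 1) ^ (2 * m - 1) * trA l (Suc (2 * q) + (2 * m - 1)) y)"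
      by (simp only: trA_prod)
    also have "\<dots> = 2 * real m * PA l (q + m) y"
    proof (cases "m = 0")
      case False
      then have o: "(- 1 :: real) ^ (2 * m - 1) = - 1" and s: "Suc (2 * q) + (2 * m - 1) = 2 * (q + m)" by auto
      show ?thesis unfolding o s PA_def by simp
    qed simp
    finally show "2 * real m * PA l (q + m) y = (\<Sum>c\<in>idx l. WA l q c y * ((- 1) ^ m * real m * Apow l (2 * m - 1) (snd c) (fst c) y))" by simp
  qed

text \<open>The product rule yields, for each splitting of 2q, a trace with alternating sign and a
  product of two traces. The signs run over an odd number of terms and leave a single trace of
  A^(2q), the source of the last term; the products form the convolution.\<close>

lemma WA_divergence: "(\<Sum>c\<in>idx l. WA' l q c y) = 2 * (\<Sum>b\<le>q. PA l b y * PA l (q - b) y) - PA l q y"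
  proof -
    have alt: "(\<Sum>a<Suc (2 * q). (- 1 :: real) ^ (2 * q - a)) = 1"
      by (rule alternating_sum)
    define T where "T = (\<Sum>i<l. \<Sum>j<l. \<Sum>a<Suc (2 * q). Apow l a j i y * Apow l (2 * q - a) j i y - Apow l a j j y * Apow l (2 * q - a) i i y)"
    define S where "S = (\<Sum>a<Suc (2 * q). trA l a y * trA l (2 * q - a) y)"
    define R where "R = (\<Sum>b\<le>q. PA l b y * PA l (q - b) y)"
    have h1: "(\<Sum>c\<in>idx l. WA' l q c y) = - ((- 1) ^ q) * T / 2"
    proof -
      have e: "WA' l q (i, j) y = - ((- 1) ^ q) * (\<Sum>a<Suc (2 * q). Apow l a j i y * Apow l (2 * q - a) j i y - Apow l a j j y * Apow l (2 * q - a) i i y) / 2" for i j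
        unfolding WA'_def dApow_def fst_conv snd_conv diff_Suc_Suc by (rule times_divide_eq_right)
      show ?thesis unfolding T_def
        by (rule sum_pairs_scale[where f = "\<lambda>c. WA' l q c y"]) (rule e)
    qed
    have h2: "T = trA l (2 * q) y - S"
    proof -
      have "T = (\<Sum>a<Suc (2 * q). \<Sum>i<l. \<Sum>j<l. Apow l a j i y * Apow l (2 * q - a) j i y - Apow l a j j y * Apow l (2 * q - a) i i y)"
        unfolding T_def
        by (rule sum_rotate[where g = "\<lambda>a i j. Apow l a j i y * Apow l (2 * q - a) j i y - Apow l a j j y * Apow l (2 * q - a) i i y"])
      also have "\<dots> = (\<Sum>a<Suc (2 * q). (- 1) ^ (2 * q - a) * trA l (2 * q) y - trA l a y * trA l (2 * q - a) y)"
      proof (rule sum.cong[OF refl])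
        fix a assume "a \<in> {..<Suc (2 * q)}"
        then have e: "a + (2 * q - a) = 2 * q" by simp
        have "(\<Sum>i<l. \<Sum>j<l. Apow l a j j y * Apow l (2 * q - a) i i y) = trA l a y * trA l (2 * q - a) y"
          unfolding trA_def sum_product by (rule sum.swap)
        moreover have "(\<Sum>i<l. \<Sum>j<l. Apow l a j i y * Apow l (2 * q - a) j i y) = (- 1) ^ (2 * q - a) * trA l (2 * q) y"
          using trA_prod[of l a y "2 * q - a"] unfolding e .
        ultimately have "(\<Sum>i<l. \<Sum>j<l. Apow l a j i y * Apow l (2 * q - a) j i y) - (\<Sum>i<l. \<Sum>j<l. Apow l a j j y * Apow l (2 * q - a) i i y)
          = (- 1) ^ (2 * q - a) * trA l (2 * q) y - trA l a y * trA l (2 * q - a) y" by (rule arg_cong2[of _ _ _ _ "(-)", rotated])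
        then show "(\<Sum>i<l. \<Sum>j<l. Apow l a j i y * Apow l (2 * q - a) j i y - Apow l a j j y * Apow l (2 * q - a) i i y)
          = (- 1) ^ (2 * q - a) * trA l (2 * q) y - trA l a y * trA l (2 * q - a) y"
          unfolding sum_subtractf .
      qed
      also have "\<dots> = (\<Sum>a<Suc (2 * q). (- 1) ^ (2 * q - a)) * trA l (2 * q) y - S"
        unfolding S_def by (rule sum_cmult_diff)
      finally have "T = (\<Sum>a<Suc (2 * q). (- 1) ^ (2 * q - a)) * trA l (2 * q) y - S" .
      then show ?thesis by (simp only: alt mult_1_left)
    qed
    have h3: "S = 4 * (- 1) ^ q * R"
      unfolding S_def R_def PA_def by (rule convolution_even_part) (rule trA_odd)
    have e: "(- 1 :: real) ^ q * (- 1) ^ q = 1" by (rule minus_one_mult_self)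
    have "- ((- 1) ^ q) * (trA l (2 * q) y - 4 * (- 1) ^ q * R) / 2 = 2 * ((- 1) ^ q * (- 1) ^ q) * R - (- 1) ^ q * trA l (2 * q) y / 2"
      by (simp add: algebra_simps diff_divide_distrib)
    then show ?thesis unfolding h1 h2 h3 R_def[symmetric] PA_def[of l q] e by simp
  qed

lemma gauss_integral_const: "(LINT y|gauss I. (c :: real)) = c"
proof -
  interpret prob_space "gauss I" by (rule prob_space_gauss)
  show ?thesis using prob_space by simp
qed

lemma aGUE_loopsys: "loopsys (gauss (idx l)) (\<lambda>_. 1) (PA l) (real l / 2)"
proof (rule gauss_loopsys[where W = "WA l" and W' = "WA' l" and s = "\<lambda>_ _. 0"])
  show "finite (idx l)" by simp
  show "PA l 0 y = real l / 2" for y by (simp add: PA_def trA_def)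
  show "polyfun (idx l) (PA l m)" for m by (rule polyfun_PA)
  show "polyfun (idx l) (\<lambda>_. 1)" by (rule polyfun_const)
  show "(LINT y|gauss (idx l). (1::real)) = 1" by (rule gauss_integral_const)
  show "derivn (idx l) (WA l q) (\<lambda>_. 1) (\<lambda>y. 1 * 0)" for q using derivn_const[of "idx l" "WA l q" 1] by simp
  show "pderivable (idx l) c (WA l q c) (WA' l q c)" if c: "c \<in> idx l" for q c
  proof -
    obtain i j where ij: "c = (i, j)" "i < l" "j < l" using c by auto
    have "pderivable (idx l) (i, j) (\<lambda>y. - ((- 1) ^ q) * Apow l (Suc (2 * q)) j i y) (\<lambda>y. - ((- 1) ^ q) * dApow l i j (Suc (2 * q)) j i y)"
      by (rule pd_cmult[OF pd_Apow]) (use ij in simp_all)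
    then show ?thesis unfolding ij(1) by (rule pd_cong) (simp_all add: WA_def WA'_def)
  qed
  show "(\<Sum>c\<in>idx l. y c * WA l q c y) = 2 * PA l (Suc q) y" for q y by (rule WA_euler)
  show "derivn (idx l) (WA l q) (PA l m) (\<lambda>y. 2 * real m * PA l (q + m) y)" for q m by (rule derivn_PA)
  show "(\<Sum>c\<in>idx l. WA' l q c y) + 0 = 2 * (\<Sum>b\<le>q. PA l b y * PA l (q - b) y) - PA l q y" for q y
    using WA_divergence[of l q y] by simp
qed

section \<open>The squared Vandermonde density satisfies the same loop equations\<close>

text \<open>As a polynomial in the last variable the determinant has degree at most k, vanishes at
  the other variables, and has the smaller Vandermonde determinant as its coefficient of degree k.
  Counting roots needs the others distinct, so coincidences are treated apart.\<close>

lemma vandermonde_det: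
  fixes z :: "nat \<Rightarrow> real"
  shows "Determinant.det (Matrix.mat k k (\<lambda>(i, l). z i ^ l)) = (\<Prod>j<k. \<Prod>i<j. z j - z i)"
proof (induction k)
  case 0
  show ?case by simp
next
  case (Suc k)
  define A where "A x = Matrix.mat (Suc k) (Suc k) (\<lambda>(i, l). (if i = k then x else z i) ^ l)" for x
  have A: "A x \<in> carrier_mat (Suc k) (Suc k)" for x by (simp add: A_def)
  have Az: "A (z k) = Matrix.mat (Suc k) (Suc k) (\<lambda>(i, l). z i ^ l)"
    unfolding A_def by (rule cong_mat) auto
  have row0: "Determinant.det (A (z i)) = 0" if "i < k" for i
    by (rule det_identical_rows[OF A, of i k]) (use that in \<open>auto simp: A_def intro!: eq_vecI\<close>)
  show ?case
  proof (cases "inj_on z {..<k}")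
    case False
    then obtain i j where ij: "i < j" "j < k" "z i = z j"
    proof -
      from False obtain i j where h: "i < k" "j < k" "z i = z j" "i \<noteq> j" unfolding inj_on_def by auto
      show thesis
      proof (cases "i < j")
        case True
        then show thesis using h that[of i j] by simp
      next
        case F: False
        then show thesis using h that[of j i] by simp
      qed
    qed
    have "Determinant.det (Matrix.mat (Suc k) (Suc k) (\<lambda>(i, l). z i ^ l)) = 0"
      by (rule det_identical_rows[of _ "Suc k" i j]) (use ij in \<open>auto intro!: eq_vecI\<close>)
    moreover have "(\<Prod>i<j. z j - z i) = 0" by (rule prod_zero, simp, rule bexI[of _ i]) (simp_all add: ij)
    then have "(\<Prod>j<Suc k. \<Prod>i<j. z j - z i) = 0" by (intro prod_zero, simp, intro bexI[of _ j]) (use ij in simp_all)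
    ultimately show ?thesis by simp
  next
    case True
    define c where "c l = cofactor (A 0) k l" for l
    have cof: "cofactor (A x) k l = c l" if "l < Suc k" for x l
    proof -
      have "mat_delete (A x) k l = mat_delete (A 0) k l"
        by (rule eq_matI) (auto simp: mat_delete_def A_def)
      then show ?thesis by (simp add: cofactor_def c_def)
    qed
    define q where "q = (\<Sum>l<Suc k. monom (c l) l)"
    have pq: "poly q x = Determinant.det (A x)" for x
    proof -
      have "Determinant.det (A x) = (\<Sum>l<Suc k. A x $$ (k, l) * cofactor (A x) k l)"
        by (rule laplace_expansion_row[OF A]) simp
      also have "\<dots> = (\<Sum>l<Suc k. c l * x ^ l)"
        proof (rule sum.cong[OF refl])
        fix l assume "l \<in> {..<Suc k}"
        then have l: "l < Suc k" by simp
        have "A x $$ (k, l) = x ^ l" using l by (simp add: A_def)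
        then show "A x $$ (k, l) * cofactor (A x) k l = c l * x ^ l" unfolding cof[OF l] by simp
      qed
      finally show ?thesis by (simp add: q_def poly_sum poly_monom)
    qed
    have ck: "c k = (\<Prod>j<k. \<Prod>i<j. z j - z i)"
    proof -
      have "mat_delete (A 0) k k = Matrix.mat k k (\<lambda>(i, l). z i ^ l)"
        by (rule eq_matI) (auto simp: mat_delete_def A_def)
      then show ?thesis using Suc.IH by (simp add: c_def cofactor_def)
    qed
    define g where "g = (\<Prod>i<k. [:- z i, 1:])"
    have gm: "Polynomial.degree g = k" "coeff g k = 1"
    proof -
      have "Polynomial.degree (\<Prod>i<m. [:- z i, 1:]) = m \<and> coeff (\<Prod>i<m. [:- z i, 1:]) m = 1" for m
      proof (induction m)
        case (Suc m)
        let ?g = "\<Prod>i<m. [:- z i, 1:]"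
        have "coeff (?g * [:- z m, 1:]) (Suc m) = 1"
          using Suc by (simp add: coeff_eq_0)
        moreover have "Polynomial.degree (?g * [:- z m, 1:]) \<le> Suc m"
          by (rule order.trans[OF degree_mult_le]) (use Suc in simp)
        ultimately show ?case by (simp add: le_antisym le_degree)
      qed simp
      then show "Polynomial.degree g = k" "coeff g k = 1" unfolding g_def by auto
    qed
    define r where "r = q - Polynomial.smult (c k) g"
    have "r = 0"
    proof (rule ccontr)
      assume r: "r \<noteq> 0"
      have "coeff q m = (if m < Suc k then c m else 0)" for m
        by (simp add: q_def coeff_sum)
      then have "coeff r m = 0" if "m \<ge> k" for m
        using that gm coeff_eq_0[of g m] by (cases "m = k") (auto simp: r_def)
      then have "Polynomial.degree r < k \<or> (k = 0 \<and> r = 0)"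
        using r by (metis leading_coeff_0_iff linorder_not_le)
      then have d: "Polynomial.degree r < k" using r by auto
      have "z ` {..<k} \<subseteq> {x. poly r x = 0}"
      proof
        fix x assume "x \<in> z ` {..<k}"
        then obtain i where i: "i < k" "x = z i" by auto
        have "poly g x = 0" using i by (auto simp: g_def poly_prod prod_zero_iff)
        then show "x \<in> {x. poly r x = 0}" using i pq[of "z i"] row0[of i] by (simp add: r_def)
      qed
      then have "card (z ` {..<k}) \<le> card {x. poly r x = 0}"
        by (rule card_mono[OF poly_roots_finite[OF r]])
      also have "\<dots> \<le> Polynomial.degree r" by (rule card_poly_roots_bound[OF r])
      finally show False using d card_image[OF True] by simp
    qed
    then have "poly q (z k) = c k * poly g (z k)" by (simp add: r_def)
    then have "Determinant.det (A (z k)) = c k * (\<Prod>i<k. z k - z i)"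
      by (simp add: pq g_def poly_prod)
    then show ?thesis unfolding Az ck by (simp add: mult.commute)
  qed
qed

text \<open>The square of the point y_i / sqrt 2, which corresponds to a positive eigenvalue; with
  this factor 1/2 the loop equations agree with those of the matrix.\<close>

definition zf :: "nat \<Rightarrow> (nat \<Rightarrow> real) \<Rightarrow> real" where "zf i y = y i * y i / 2"

definition PZ :: "nat \<Rightarrow> nat \<Rightarrow> (nat \<Rightarrow> real) \<Rightarrow> real" where "PZ k m y = (\<Sum>i<k. zf i y ^ m)"

definition VZ :: "nat \<Rightarrow> (nat \<Rightarrow> real) \<Rightarrow> real" where
  "VZ k y = (\<Prod>e\<in>(SIGMA j:{..<k}. {..<j}). zf (fst e) y - zf (snd e) y)"

text \<open>Moves the i-th square z_i at speed 2 z_i^(q+1), in parallel to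
  \<open>WA\<close>.\<close>

definition WZ :: "nat \<Rightarrow> nat \<Rightarrow> (nat \<Rightarrow> real) \<Rightarrow> real" where "WZ q i y = y i * zf i y ^ q"

lemma pd_power: "pderivable I c f f' \<Longrightarrow> pderivable I c (\<lambda>y. f y ^ n) (\<lambda>y. real n * f y ^ (n - 1) * f' y)"
proof (induction n)
  case 0
  show ?case by (rule pd_cong[OF pd_const[of _ _ 1]]) simp_all
next
  case (Suc n)
  show ?case
  proof (rule pd_cong[OF pd_mult[OF Suc.prems Suc.IH[OF Suc.prems]]])
    fix y
    show "f' y * f y ^ n + f y * (real n * f y ^ (n - 1) * f' y) = real (Suc n) * f y ^ (Suc n - 1) * f' y"
      by (cases n) (simp_all add: algebra_simps)
  qed simp
qed

lemma derivn_power: "derivn I W f g \<Longrightarrow> derivn I W (\<lambda>y. f y ^ n) (\<lambda>y. real n * f y ^ (n - 1) * g y)"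
proof (induction n)
  case 0
  show ?case by (rule derivn_cong[OF derivn_const[of _ _ 1]]) simp_all
next
  case (Suc n)
  show ?case
  proof (rule derivn_cong[OF derivn_mult[OF Suc.prems Suc.IH[OF Suc.prems]]])
    fix y
    show "g y * f y ^ n + f y * (real n * f y ^ (n - 1) * g y) = real (Suc n) * f y ^ (Suc n - 1) * g y"
      by (cases n) (simp_all add: algebra_simps)
  qed simp
qed

lemma pd_zf:
  assumes "i \<in> I"
  shows "pderivable I c (zf i) (\<lambda>y. if i = c then y i else 0)"
proof -
  have "pderivable I c (\<lambda>y. (1/2) * (y i * y i)) (\<lambda>y. (1/2) * ((if i = c then 1 else 0) * y i + y i * (if i = c then 1 else 0)))"
    by (rule pd_cmult[OF pd_mult[OF pd_coord[OF assms] pd_coord[OF assms]]])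
  then show ?thesis by (rule pd_cong) (simp_all add: zf_def)
qed

lemma polyfun_zf: "i \<in> I \<Longrightarrow> polyfun I (zf i)"
  by (rule pderivable_deriv_polyfun(1)[OF pd_zf])

lemma derivn_zf:
  assumes "i < k"
  shows "derivn {..<k} (WZ q) (zf i) (\<lambda>y. 2 * zf i y ^ Suc q)"
proof (rule derivnI[of _ _ "\<lambda>c y. if i = c then y i else 0"])
  show "polyfun {..<k} (zf i)" by (rule polyfun_zf) (use assms in simp)
  show "pderivable {..<k} c (zf i) (\<lambda>y. if i = c then y i else 0)" for c by (rule pd_zf) (use assms in simp)
  fix y
  have "(\<Sum>c<k. WZ q c y * (if i = c then y i else 0)) = (\<Sum>c<k. if i = c then WZ q i y * y i else 0)"
    by (rule sum.cong[OF refl]) simp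
  also have "\<dots> = WZ q i y * y i" using assms by simp
  also have "\<dots> = 2 * zf i y ^ Suc q" by (simp add: WZ_def zf_def)
  finally show "2 * zf i y ^ Suc q = (\<Sum>c<k. WZ q c y * (if i = c then y i else 0))" ..
qed

lemma derivn_PZ: "derivn {..<k} (WZ q) (PZ k m) (\<lambda>y. 2 * real m * PZ k (q + m) y)"
proof -
  have "derivn {..<k} (WZ q) (\<lambda>y. \<Sum>i<k. zf i y ^ m) (\<lambda>y. \<Sum>i<k. real m * zf i y ^ (m - 1) * (2 * zf i y ^ Suc q))"
    by (rule derivn_sum, rule derivn_power, rule derivn_zf) simp
  then show ?thesis
  proof (rule derivn_cong)
    fix y
    have "real m * zf i y ^ (m - 1) * (2 * zf i y ^ Suc q) = 2 * real m * zf i y ^ (q + m)" for i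
      by (cases m) (simp_all add: power_add)
    then show "(\<Sum>i<k. real m * zf i y ^ (m - 1) * (2 * zf i y ^ Suc q)) = 2 * real m * PZ k (q + m) y"
      by (simp only: PZ_def sum_distrib_left)
  qed (simp add: PZ_def)
qed

text \<open>The quotient of z_j^(q+1) - z_i^(q+1) by z_j - z_i, written without a division.\<close>

definition hZ :: "nat \<Rightarrow> nat \<Rightarrow> nat \<Rightarrow> (nat \<Rightarrow> real) \<Rightarrow> real" where
  "hZ q j i y = (\<Sum>a<Suc q. zf j y ^ a * zf i y ^ (q - a))"

lemma derivn_VZ: "derivn {..<k} (WZ q) (VZ k) (\<lambda>y. VZ k y * (\<Sum>e\<in>(SIGMA j:{..<k}. {..<j}). 2 * hZ q (fst e) (snd e) y))"
  unfolding VZ_def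
proof (rule derivn_logprod)
  show "finite (SIGMA j:{..<k}. {..<j})" by simp
  fix e assume "e \<in> (SIGMA j:{..<k}. {..<j})"
  then have e: "fst e < k" "snd e < k" by auto
  have "derivn {..<k} (WZ q) (\<lambda>y. zf (fst e) y + (- 1) * zf (snd e) y) (\<lambda>y. 2 * zf (fst e) y ^ Suc q + (- 1) * (2 * zf (snd e) y ^ Suc q))"
    by (rule derivn_add[OF derivn_zf[OF e(1)] derivn_cmult[OF derivn_zf[OF e(2)]]])
  then show "derivn {..<k} (WZ q) (\<lambda>y. zf (fst e) y - zf (snd e) y) (\<lambda>y. (zf (fst e) y - zf (snd e) y) * (2 * hZ q (fst e) (snd e) y))"
  proof (rule derivn_cong)
    fix y
    have "zf (fst e) y ^ Suc q - zf (snd e) y ^ Suc q = (zf (fst e) y - zf (snd e) y) * hZ q (fst e) (snd e) y"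
      unfolding hZ_def by (rule diff_power_eq_sum)
    then show "2 * zf (fst e) y ^ Suc q + (- 1) * (2 * zf (snd e) y ^ Suc q) = (zf (fst e) y - zf (snd e) y) * (2 * hZ q (fst e) (snd e) y)"
      by (simp add: algebra_simps)
  qed simp
qed

lemma sum_square_split:
  fixes h :: "nat \<Rightarrow> nat \<Rightarrow> real"
  assumes "\<And>i j. h i j = h j i"
  shows "(\<Sum>i<k. \<Sum>j<k. h i j) = (\<Sum>i<k. h i i) + 2 * (\<Sum>j<k. \<Sum>i<j. h j i)"
proof (induction k)
  case (Suc k)
  have "(\<Sum>i<k. h i k) = (\<Sum>i<k. h k i)" by (rule sum.cong[OF refl]) (rule assms)
  then show ?case using Suc by (simp add: sum.distrib)
qed simp

text \<open>Summed over all ordered pairs, \<open>hZ\<close> gives the convolution of the power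
  sums. Its diagonal accounts for (q + 1) \<open>PZ k q\<close>; twice this against the 2q + 1 of
  the divergence leaves - \<open>PZ k q\<close>, the same defect as for the matrix.\<close>

lemma WZ_divergence:
  "(\<Sum>i<k. (2 * real q + 1) * zf i y ^ q) + 2 * (\<Sum>e\<in>(SIGMA j:{..<k}. {..<j}). 2 * hZ q (fst e) (snd e) y)
    = 2 * (\<Sum>b\<le>q. PZ k b y * PZ k (q - b) y) - PZ k q y"
proof -
  have sym: "hZ q i j y = hZ q j i y" for i j
  proof -
    have "hZ q j i y = (\<Sum>a<Suc q. zf j y ^ (Suc q - Suc a) * zf i y ^ (q - (Suc q - Suc a)))"
      unfolding hZ_def by (rule sum.nat_diff_reindex[symmetric])
    also have "\<dots> = hZ q i j y"
      unfolding hZ_def by (rule sum.cong[OF refl]) simp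
    finally show ?thesis ..
  qed
  have diag: "hZ q i i y = (real q + 1) * zf i y ^ q" for i
  proof -
    have "hZ q i i y = (\<Sum>a<Suc q. zf i y ^ q)"
      unfolding hZ_def by (rule sum.cong[OF refl]) (simp add: power_add[symmetric])
    then show ?thesis by (simp add: algebra_simps)
  qed
  have "(\<Sum>b\<le>q. PZ k b y * PZ k (q - b) y) = (\<Sum>b<Suc q. \<Sum>i<k. \<Sum>j<k. zf i y ^ b * zf j y ^ (q - b))"
    unfolding PZ_def sum_product lessThan_Suc_atMost ..
  also have "\<dots> = (\<Sum>i<k. \<Sum>j<k. hZ q i j y)"
    unfolding hZ_def by (rule sum_rotate[symmetric])
  also have "\<dots> = (\<Sum>i<k. hZ q i i y) + 2 * (\<Sum>j<k. \<Sum>i<j. hZ q j i y)"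
    by (rule sum_square_split) (rule sym)
  finally have 1: "(\<Sum>b\<le>q. PZ k b y * PZ k (q - b) y) = (real q + 1) * PZ k q y + 2 * (\<Sum>j<k. \<Sum>i<j. hZ q j i y)"
    unfolding diag by (simp only: PZ_def sum_distrib_left)
  have 2: "(\<Sum>e\<in>(SIGMA j:{..<k}. {..<j}). 2 * hZ q (fst e) (snd e) y) = 2 * (\<Sum>j<k. \<Sum>i<j. hZ q j i y)"
    unfolding sum_distrib_left[symmetric] by (subst sum.Sigma) (auto simp: case_prod_unfold)
  have 3: "(\<Sum>i<k. (2 * real q + 1) * zf i y ^ q) = (2 * real q + 1) * PZ k q y"
    by (simp only: PZ_def sum_distrib_left)
  show ?thesis unfolding 1 2 3 by (simp add: algebra_simps)
qed

lemma polyfun_PZ: "polyfun {..<k} (PZ k m)"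
proof -
  have "polyfun {..<k} (\<lambda>y. \<Sum>i<k. zf i y ^ m)"
    by (rule polyfun_sum, rule polyfun_power, rule polyfun_zf) simp
  moreover have "(\<lambda>y. \<Sum>i<k. zf i y ^ m) = PZ k m" by (rule ext) (simp add: PZ_def)
  ultimately show ?thesis by simp
qed

lemma polyfun_VZ: "polyfun {..<k} (VZ k)"
proof -
  have "polyfun {..<k} (\<lambda>y. \<Prod>e\<in>(SIGMA j:{..<k}. {..<j}). zf (fst e) y - zf (snd e) y)"
    by (rule polyfun_prod, rule polyfun_diff; rule polyfun_zf) auto
  moreover have "(\<lambda>y. \<Prod>e\<in>(SIGMA j:{..<k}. {..<j}). zf (fst e) y - zf (snd e) y) = VZ k" by (rule ext) (simp add: VZ_def)
  ultimately show ?thesis by simp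
qed

definition ZZ :: "nat \<Rightarrow> real" where "ZZ k = (LINT y|gauss {..<k}. VZ k y * VZ k y)"

definition wZ :: "nat \<Rightarrow> (nat \<Rightarrow> real) \<Rightarrow> real" where "wZ k y = (1 / ZZ k) * (VZ k y * VZ k y)"

lemma polyfun_wZ: "polyfun {..<k} (wZ k)"
proof -
  have "polyfun {..<k} (\<lambda>y. (1 / ZZ k) * (VZ k y * VZ k y))"
    by (rule polyfun_cmult[OF polyfun_mult[OF polyfun_VZ polyfun_VZ]])
  moreover have "(\<lambda>y. (1 / ZZ k) * (VZ k y * VZ k y)) = wZ k" by (rule ext) (simp add: wZ_def)
  ultimately show ?thesis by simp
qed

lemma density_loopsys:
  assumes Z: "ZZ k \<noteq> 0"
  shows "loopsys (gauss {..<k}) (wZ k) (PZ k) (real k)"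
proof (rule gauss_loopsys[where W = WZ and W' = "\<lambda>q i y. (2 * real q + 1) * zf i y ^ q"
      and s = "\<lambda>q y. 2 * (\<Sum>e\<in>(SIGMA j:{..<k}. {..<j}). 2 * hZ q (fst e) (snd e) y)"])
  show "finite {..<k}" by simp
  show "PZ k 0 y = real k" for y by (simp add: PZ_def)
  show "polyfun {..<k} (PZ k m)" for m by (rule polyfun_PZ)
  show "polyfun {..<k} (wZ k)" by (rule polyfun_wZ)
  have "(LINT y|gauss {..<k}. wZ k y) = (1 / ZZ k) * ZZ k"
    unfolding wZ_def ZZ_def[of k, symmetric] by (subst integral_mult_right_zero) (simp only: ZZ_def)
  then show "(LINT y|gauss {..<k}. wZ k y) = 1" using Z by simp
  show "pderivable {..<k} i (WZ q i) (\<lambda>y. (2 * real q + 1) * zf i y ^ q)" if "i \<in> {..<k}" for q i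
  proof -
    have "pderivable {..<k} i (\<lambda>y. y i * zf i y ^ q) (\<lambda>y. (if i = i then 1 else 0) * zf i y ^ q + y i * (real q * zf i y ^ (q - 1) * (if i = i then y i else 0)))"
      by (rule pd_mult[OF pd_coord[OF that] pd_power[OF pd_zf[OF that]]])
    then show ?thesis
    proof (rule pd_cong)
      fix y
      show "(if i = i then 1 else 0) * zf i y ^ q + y i * (real q * zf i y ^ (q - 1) * (if i = i then y i else 0)) = (2 * real q + 1) * zf i y ^ q"
      proof (cases q)
        case (Suc p)
        have "y i * (real q * zf i y ^ p * y i) = 2 * real q * (zf i y * zf i y ^ p)" by (simp add: zf_def)
        then show ?thesis using Suc by (simp add: algebra_simps)
      qed simp
    qed (simp add: WZ_def)
  qed
  show "(\<Sum>c<k. y c * WZ q c y) = 2 * PZ k (Suc q) y" for q y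
  proof -
    have "y c * WZ q c y = 2 * zf c y ^ Suc q" for c by (simp add: WZ_def zf_def)
    then show ?thesis by (simp only: PZ_def sum_distrib_left)
  qed
  show "derivn {..<k} (WZ q) (PZ k m) (\<lambda>y. 2 * real m * PZ k (q + m) y)" for q m by (rule derivn_PZ)
  show "derivn {..<k} (WZ q) (wZ k) (\<lambda>y. wZ k y * (2 * (\<Sum>e\<in>(SIGMA j:{..<k}. {..<j}). 2 * hZ q (fst e) (snd e) y)))" for q
    by (rule derivn_cong[OF derivn_cmult[OF derivn_mult[OF derivn_VZ derivn_VZ], where a = "1 / ZZ k"]]) (simp_all add: wZ_def algebra_simps)
  show "(\<Sum>c<k. (2 * real q + 1) * zf c y ^ q) + 2 * (\<Sum>e\<in>(SIGMA j:{..<k}. {..<j}). 2 * hZ q (fst e) (snd e) y)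
    = 2 * (\<Sum>b\<le>q. PZ k b y * PZ k (q - b) y) - PZ k q y" for q y by (rule WZ_divergence)
qed

section \<open>Andreief's identity and the normalising constant\<close>

lemma VZ_det: "VZ k y = (\<Sum>p | p permutes {0..<k}. signof p * (\<Prod>i = 0..<k. zf i y ^ p i))"
proof -
  have "VZ k y = (\<Prod>j<k. \<Prod>i<j. zf j y - zf i y)"
    unfolding VZ_def by (subst prod.Sigma) (auto simp: case_prod_unfold)
  also have "\<dots> = Determinant.det (Matrix.mat k k (\<lambda>(i, l). zf i y ^ l))" by (rule vandermonde_det[symmetric])
  also have "\<dots> = (\<Sum>p | p permutes {0..<k}. signof p * (\<Prod>i = 0..<k. zf i y ^ p i))"
    by (subst det_def'[of _ k]) (auto intro!: sum.cong prod.cong arg_cong2[of _ _ _ _ "(*)"] simp: permutes_in_image)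
  finally show ?thesis .
qed

definition mom :: "(real \<Rightarrow> real) \<Rightarrow> nat \<Rightarrow> real" where
  "mom \<phi> a = (LINT u|std_normal_distribution. \<phi> u * (u * u / 2) ^ a)"

lemma borel_std_normal: "borel_measurable std_normal_distribution = (borel_measurable borel :: (real \<Rightarrow> real) set)"
  by (rule measurable_cong_sets) simp_all

lemma weighted_power_measurable:
  assumes "\<phi> \<in> borel_measurable borel"
  shows "(\<lambda>u::real. \<phi> u * (u * u / 2) ^ a :: real) \<in> borel_measurable borel"
proof (rule borel_measurable_times[OF assms])
  show "(\<lambda>u::real. (u * u / 2) ^ a) \<in> borel_measurable borel"
    by (rule borel_measurable_continuous_onI) (intro continuous_intros; simp)
qed

text \<open>Expand both determinants, integrate coordinate by coordinate, and write the second
  permutation as s o p. Sign and product then depend on s alone, and the sum over p contributes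
  k!.\<close>

lemma andreief:
  assumes \<phi>: "\<phi> \<in> borel_measurable borel" "\<And>u. \<bar>\<phi> u\<bar> \<le> 1"
  shows "(LINT y|gauss {..<k}. (\<Prod>i<k. \<phi> (y i)) * (VZ k y * VZ k y)) = fact k * Determinant.det (Matrix.mat k k (\<lambda>(a, l). mom \<phi> (a + l)))"
proof -
  let ?S = "{p. p permutes {0..<k}}"
  have int: "integrable std_normal_distribution (\<lambda>u. \<phi> u * (u * u / 2) ^ a)" for a
  proof -
    have "integrable std_normal_distribution (\<lambda>u. (1 / 2 ^ a) * u ^ (2 * a))"
      by (rule integrable_mult_right) (rule integrable_std_normal_distribution_moment)
    then show ?thesis
    proof (rule Bochner_Integration.integrable_bound)
      show "(\<lambda>u. \<phi> u * (u * u / 2) ^ a) \<in> borel_measurable std_normal_distribution"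
        unfolding borel_std_normal by (rule weighted_power_measurable[OF \<phi>(1)])
      show "AE u in std_normal_distribution. norm (\<phi> u * (u * u / 2) ^ a) \<le> norm ((1 / 2 ^ a) * u ^ (2 * a))"
      proof (rule AE_I2)
        fix u :: real
        have "(u * u / 2) ^ a = (1 / 2 ^ a) * u ^ (2 * a)" by (simp add: power_divide power_mult power2_eq_square)
        moreover have "\<bar>\<phi> u\<bar> * \<bar>(1 / 2 ^ a) * u ^ (2 * a)\<bar> \<le> 1 * \<bar>(1 / 2 ^ a) * u ^ (2 * a)\<bar>"
          by (rule mult_right_mono[OF \<phi>(2)]) simp
        ultimately show "norm (\<phi> u * (u * u / 2) ^ a) \<le> norm ((1 / 2 ^ a) * u ^ (2 * a))"
          by (simp only: real_norm_def abs_mult mult_1_left)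
      qed
    qed
  qed
  have pint: "integrable (gauss {..<k}) (\<lambda>y. \<Prod>i<k. \<phi> (y i) * zf i y ^ (p i + p' i))" for p p' :: "nat \<Rightarrow> nat"
    unfolding gauss_def zf_def
    by (rule product_sigma_finite.product_integrable_prod[OF product_sigma_std_normal, where f = "\<lambda>i u. \<phi> u * (u * u / 2) ^ (p i + p' i)"]) (simp_all add: int)
  have pval: "(LINT y|gauss {..<k}. (\<Prod>i<k. \<phi> (y i) * zf i y ^ (p i + p' i))) = (\<Prod>i<k. mom \<phi> (p i + p' i))" for p p' :: "nat \<Rightarrow> nat"
    unfolding gauss_def zf_def mom_def
    by (rule product_sigma_finite.product_integral_prod[OF product_sigma_std_normal, where f = "\<lambda>i u. \<phi> u * (u * u / 2) ^ (p i + p' i)"]) (simp_all add: int)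
  have expand: "(\<Prod>i<k. \<phi> (y i)) * (VZ k y * VZ k y) = (\<Sum>p\<in>?S. \<Sum>p'\<in>?S. (signof p * signof p') * (\<Prod>i<k. \<phi> (y i) * zf i y ^ (p i + p' i)))" for y
  proof -
    have v: "VZ k y * VZ k y = (\<Sum>p\<in>?S. \<Sum>p'\<in>?S. (signof p * (\<Prod>i = 0..<k. zf i y ^ p i)) * (signof p' * (\<Prod>i = 0..<k. zf i y ^ p' i)))"
      unfolding VZ_det by (rule sum_product)
    have h: "(\<Prod>i<k. \<phi> (y i)) * ((signof p * (\<Prod>i = 0..<k. zf i y ^ p i)) * (signof p' * (\<Prod>i = 0..<k. zf i y ^ p' i)))
      = (signof p * signof p') * (\<Prod>i<k. \<phi> (y i) * zf i y ^ (p i + p' i))" for p p' :: "nat \<Rightarrow> nat"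
      unfolding atLeast0LessThan power_add prod.distrib by (simp only: mult_ac)
    show ?thesis unfolding v sum_distrib_left by (simp only: h)
  qed
  have "(LINT y|gauss {..<k}. (\<Prod>i<k. \<phi> (y i)) * (VZ k y * VZ k y)) = (\<Sum>p\<in>?S. (LINT y|gauss {..<k}. (\<Sum>p'\<in>?S. (signof p * signof p') * (\<Prod>i<k. \<phi> (y i) * zf i y ^ (p i + p' i)))))"
    unfolding expand
    by (rule Bochner_Integration.integral_sum) (rule Bochner_Integration.integrable_sum, rule integrable_mult_right, rule pint)
  also have "\<dots> = (\<Sum>p\<in>?S. \<Sum>p'\<in>?S. (signof p * signof p') * (\<Prod>i<k. mom \<phi> (p i + p' i)))"
  proof (rule sum.cong[OF refl])
    fix p
    have "(LINT y|gauss {..<k}. (\<Sum>p'\<in>?S. (signof p * signof p') * (\<Prod>i<k. \<phi> (y i) * zf i y ^ (p i + p' i)))) = (\<Sum>p'\<in>?S. (LINT y|gauss {..<k}. (signof p * signof p') * (\<Prod>i<k. \<phi> (y i) * zf i y ^ (p i + p' i))))"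
      by (rule Bochner_Integration.integral_sum) (rule integrable_mult_right, rule pint)
    then show "(LINT y|gauss {..<k}. (\<Sum>p'\<in>?S. (signof p * signof p') * (\<Prod>i<k. \<phi> (y i) * zf i y ^ (p i + p' i)))) = (\<Sum>p'\<in>?S. (signof p * signof p') * (\<Prod>i<k. mom \<phi> (p i + p' i)))"
      by (simp only: integral_mult_right_zero pval)
  qed
  also have "\<dots> = (\<Sum>p\<in>?S. \<Sum>s\<in>?S. signof s * (\<Prod>i<k. mom \<phi> (i + s i)))"
  proof (rule sum.cong[OF refl])
    fix p assume "p \<in> ?S"
    then have p: "p permutes {0..<k}" by simp
    have "(\<Sum>p'\<in>?S. (signof p * signof p') * (\<Prod>i<k. mom \<phi> (p i + p' i))) = (\<Sum>s\<in>?S. (signof p * signof (s \<circ> p)) * (\<Prod>i<k. mom \<phi> (p i + (s \<circ> p) i)))"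
      using sum_permutations_compose_right[OF p, where f = "\<lambda>p'. (signof p * signof p' :: real) * (\<Prod>i<k. mom \<phi> (p i + p' i))"] .
    also have "\<dots> = (\<Sum>s\<in>?S. signof s * (\<Prod>i<k. mom \<phi> (i + s i)))"
    proof (rule sum.cong[OF refl])
      fix s assume "s \<in> ?S"
      then have s: "s permutes {0..<k}" by simp
      have "sign (s \<circ> p) = sign s * sign p"
      proof (rule sign_compose)
        show "permutation s" unfolding permutation_permutes by (intro exI[of _ "{0..<k}"] conjI s) simp
        show "permutation p" unfolding permutation_permutes by (intro exI[of _ "{0..<k}"] conjI p) simp
      qed
      then have sg: "(signof p * signof (s \<circ> p) :: real) = signof s * (signof p * signof p)" by simp
      have sp: "(signof p * signof p :: real) = 1" by (simp add: sign_def)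
      have "(\<Prod>i<k. mom \<phi> (p i + (s \<circ> p) i)) = (\<Prod>i<k. mom \<phi> (i + s i))"
        using prod.permute[OF p, of "\<lambda>i. mom \<phi> (i + s i)"] by (simp add: o_def atLeast0LessThan)
      then show "(signof p * signof (s \<circ> p)) * (\<Prod>i<k. mom \<phi> (p i + (s \<circ> p) i)) = signof s * (\<Prod>i<k. mom \<phi> (i + s i))"
        unfolding sg sp by simp
    qed
    finally show "(\<Sum>p'\<in>?S. (signof p * signof p') * (\<Prod>i<k. mom \<phi> (p i + p' i))) = (\<Sum>s\<in>?S. signof s * (\<Prod>i<k. mom \<phi> (i + s i)))" .
  qed
  also have "\<dots> = fact k * (\<Sum>s\<in>?S. signof s * (\<Prod>i<k. mom \<phi> (i + s i)))"
  proof -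
    have "card ?S = fact k" by (rule card_permutations) simp_all
    then show ?thesis by (simp only: sum_constant of_nat_fact)
  qed
  finally have fin: "(LINT y|gauss {..<k}. (\<Prod>i<k. \<phi> (y i)) * (VZ k y * VZ k y)) = fact k * (\<Sum>s\<in>?S. signof s * (\<Prod>i<k. mom \<phi> (i + s i)))" .
  have D: "(\<Sum>s\<in>?S. signof s * (\<Prod>i<k. mom \<phi> (i + s i))) = Determinant.det (Matrix.mat k k (\<lambda>(a, l). mom \<phi> (a + l)))"
    by (subst det_def'[of _ k]) (auto intro!: sum.cong prod.cong arg_cong2[of _ _ _ _ "(*)"] simp: permutes_in_image atLeast0LessThan)
  show ?thesis unfolding fin D ..
qed

text \<open>On a box of disjoint positive intervals the squares are distinct, and the box has
  positive measure. Through \<open>ZZ_Kdet\<close> this is also why the denominator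
  \<open>Kdet k 0\<close> on the network side is nonzero.\<close>

lemma ZZ_pos: "ZZ k > 0"
proof -
  have int: "integrable (gauss {..<k}) (\<lambda>y. VZ k y * VZ k y)"
    by (rule polyfun_integrable[OF _ polyfun_mult[OF polyfun_VZ polyfun_VZ]]) simp
  have "ZZ k \<ge> 0" unfolding ZZ_def by (rule Bochner_Integration.integral_nonneg) simp
  moreover have "ZZ k \<noteq> 0"
  proof
    assume "ZZ k = 0"
    then have ae: "AE y in gauss {..<k}. VZ k y * VZ k y = 0"
      unfolding ZZ_def using integral_nonneg_eq_0_iff_AE[OF int] by simp
    define B where "B = Pi\<^sub>E {..<k} (\<lambda>i. {real i + 1..real i + 3/2})"
    have V: "VZ k y \<noteq> 0" if "y \<in> B" for y
    proof -
      have "zf (fst e) y - zf (snd e) y \<noteq> 0" if e: "e \<in> (SIGMA j:{..<k}. {..<j})" for e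
      proof -
        obtain j i where ji: "e = (j, i)" "i < j" "j < k" using e by auto
        have "y i \<in> {real i + 1..real i + 3/2}" "y j \<in> {real j + 1..real j + 3/2}"
          using PiE_mem[OF \<open>y \<in> B\<close>[unfolded B_def], of i] PiE_mem[OF \<open>y \<in> B\<close>[unfolded B_def], of j] ji by simp_all
        then have "0 \<le> y i" "y i < y j" using ji(2) by auto
        then have "y i * y i < y j * y j" by (intro mult_strict_mono') auto
        then show ?thesis by (simp add: ji zf_def)
      qed
      then show ?thesis unfolding VZ_def by (subst prod_zero_iff) auto
    qed
    have "B \<in> sets (gauss {..<k})" unfolding B_def gauss_def by (rule sets_PiM_I_finite) auto
    moreover have "AE y in gauss {..<k}. y \<notin> B" using ae by eventually_elim (use V in auto)
    ultimately have "emeasure (gauss {..<k}) B = 0"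
      by (subst (asm) AE_iff_measurable[of B]) (auto dest: sets.sets_into_space)
    moreover have "emeasure (gauss {..<k}) B = (\<Prod>i<k. emeasure std_normal_distribution {real i + 1..real i + 3/2})"
      unfolding B_def gauss_def
      by (rule product_sigma_finite.emeasure_PiM[OF product_sigma_std_normal]) auto
    ultimately obtain i where "emeasure std_normal_distribution {real i + 1..real i + 3/2} = 0"
      by (auto simp: prod_zero_iff)
    then have "AE u in lborel. ennreal (std_normal_density u) * indicator {real i + 1..real i + 3/2} u = 0"
      by (subst (asm) emeasure_density) (simp_all add: nn_integral_0_iff_AE)
    then have "AE u in lborel. u \<notin> {real i + 1..real i + 3/2}"
    proof eventually_elim
      case (elim u)
      have "ennreal (std_normal_density u) \<noteq> 0" using normal_density_pos[of 1 0 u] by simp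
      with elim show ?case by (cases "u \<in> {real i + 1..real i + 3/2}") simp_all
    qed
    then have "emeasure lborel {real i + 1..real i + 3/2} = 0"
      by (subst (asm) AE_iff_measurable[of "{real i + 1..real i + 3/2}"]) auto
    then show False by simp
  qed
  ultimately show ?thesis by simp
qed

section \<open>Linear statistics, from even powers to indicators\<close>

text \<open>The factor \<open>c\<close> makes 2k eigenvalues in pairs comparable with k points: it
  will be 1/2 for the former and 1 for the latter.\<close>

definition lst :: "real \<Rightarrow> ('a \<Rightarrow> real list) \<Rightarrow> (real \<Rightarrow> real) \<Rightarrow> 'a \<Rightarrow> real" where
  "lst c p \<phi> y = c * sum_list (map \<phi> (p y))"

text \<open>Closure under the operations that pass through expectations: linear combinations, and
  pointwise limits under a common exponential bound.\<close>

inductive mcl :: "(real \<Rightarrow> real) set \<Rightarrow> (real \<Rightarrow> real) \<Rightarrow> bool" for T where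
  mcl_base: "\<phi> \<in> T \<Longrightarrow> mcl T \<phi>"
| mcl_add: "mcl T f \<Longrightarrow> mcl T g \<Longrightarrow> mcl T (\<lambda>x. a * f x + g x)"
| mcl_lim: "(\<And>n. mcl T (f n)) \<Longrightarrow> (\<And>x. (\<lambda>n. f n x) \<longlonglongrightarrow> \<phi> x) \<Longrightarrow> (\<And>n x. \<bar>f n x\<bar> \<le> C * exp (m * \<bar>x\<bar>)) \<Longrightarrow> 0 \<le> C \<Longrightarrow> 0 \<le> m \<Longrightarrow> mcl T \<phi>"
for f :: "nat \<Rightarrow> real \<Rightarrow> real"

definition expbd :: "(real \<Rightarrow> real) \<Rightarrow> bool" where
  "expbd \<phi> \<longleftrightarrow> (\<exists>C\<ge>0. \<exists>m\<ge>0. \<forall>x. \<bar>\<phi> x\<bar> \<le> C * exp (m * \<bar>x\<bar>))"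

definition gd :: "'a measure \<Rightarrow> real \<Rightarrow> ('a \<Rightarrow> real list) \<Rightarrow> (real \<Rightarrow> real) \<Rightarrow> bool" where
  "gd M c p \<phi> \<longleftrightarrow> lst c p \<phi> \<in> borel_measurable M \<and> expbd \<phi>"

lemma expbdI:
  assumes "\<And>x. \<bar>\<phi> x\<bar> \<le> C * exp (m * \<bar>x\<bar>)" "0 \<le> C" "0 \<le> m"
  shows "expbd \<phi>"
  unfolding expbd_def
  by (rule exI[of _ C], rule conjI[OF assms(2)], rule exI[of _ m], rule conjI[OF assms(3)], rule allI, rule assms(1))

lemma lst_add: "lst c p (\<lambda>x. a * f x + g x) y = a * lst c p f y + lst c p g y"
proof -
  have "sum_list (map (\<lambda>x. a * f x + g x) xs) = a * sum_list (map f xs) + sum_list (map g xs)" for xs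
    by (induction xs) (simp_all add: algebra_simps)
  then show ?thesis by (simp add: lst_def algebra_simps)
qed

lemma lst_lim:
  assumes "\<And>x. (\<lambda>n. f n x) \<longlonglongrightarrow> \<phi> x"
  shows "(\<lambda>n. lst c p (f n) y) \<longlonglongrightarrow> lst c p \<phi> y"
proof -
  have "(\<lambda>n. sum_list (map (f n) xs)) \<longlonglongrightarrow> sum_list (map \<phi> xs)" for xs
    by (induction xs) (simp_all add: tendsto_add assms)
  then show ?thesis unfolding lst_def by (intro tendsto_mult tendsto_const)
qed

lemma gd_add:
  assumes "gd M c p f" "gd M c p g"
  shows "gd M c p (\<lambda>x. a * f x + g x)"
proof -
  from assms obtain C m D k where h: "0 \<le> C" "0 \<le> m" "\<forall>x. \<bar>f x\<bar> \<le> C * exp (m * \<bar>x\<bar>)" "0 \<le> D" "0 \<le> k" "\<forall>x. \<bar>g x\<bar> \<le> D * exp (k * \<bar>x\<bar>)"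
    unfolding gd_def expbd_def by (elim conjE exE)
  have "expbd (\<lambda>x. a * f x + g x)"
  proof (rule expbdI[of _ "\<bar>a\<bar> * C + D" "m + k"])
    fix x
    have 1: "C * exp (m * \<bar>x\<bar>) \<le> C * exp ((m + k) * \<bar>x\<bar>)"
      using h(1,2,5) by (intro mult_left_mono) (simp_all add: distrib_right)
    have 2: "D * exp (k * \<bar>x\<bar>) \<le> D * exp ((m + k) * \<bar>x\<bar>)"
      using h(2,4,5) by (intro mult_left_mono) (simp_all add: distrib_right)
    have "\<bar>f x\<bar> \<le> C * exp ((m + k) * \<bar>x\<bar>)" using h(3)[rule_format, of x] 1 by linarith
    then have 3: "\<bar>a\<bar> * \<bar>f x\<bar> \<le> \<bar>a\<bar> * (C * exp ((m + k) * \<bar>x\<bar>))" by (rule mult_left_mono) simp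
    have 4: "\<bar>g x\<bar> \<le> D * exp ((m + k) * \<bar>x\<bar>)" using h(6)[rule_format, of x] 2 by linarith
    have "\<bar>a * f x + g x\<bar> \<le> \<bar>a\<bar> * \<bar>f x\<bar> + \<bar>g x\<bar>" using abs_triangle_ineq[of "a * f x" "g x"] by (simp only: abs_mult)
    also have "\<dots> \<le> \<bar>a\<bar> * (C * exp ((m + k) * \<bar>x\<bar>)) + D * exp ((m + k) * \<bar>x\<bar>)" by (rule add_mono[OF 3 4])
    also have "\<dots> = (\<bar>a\<bar> * C + D) * exp ((m + k) * \<bar>x\<bar>)" by (simp only: distrib_right mult.assoc)
    finally show "\<bar>a * f x + g x\<bar> \<le> (\<bar>a\<bar> * C + D) * exp ((m + k) * \<bar>x\<bar>)" .
  qed (use h in simp_all)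
  moreover have "lst c p (\<lambda>x. a * f x + g x) = (\<lambda>y. a * lst c p f y + lst c p g y)" by (rule ext) (rule lst_add)
  moreover have "(\<lambda>y. a * lst c p f y + lst c p g y) \<in> borel_measurable M"
    by (intro borel_measurable_add borel_measurable_times borel_measurable_const assms[unfolded gd_def, THEN conjunct1])
  ultimately show ?thesis unfolding gd_def by (simp only: simp_thms)
qed

lemma gd_lim:
  assumes "\<And>n. gd M c p (f n)" and lim: "\<And>x. (\<lambda>n. f n x) \<longlonglongrightarrow> \<phi> x"
    and bd: "\<And>n x. \<bar>f n x\<bar> \<le> C * exp (m * \<bar>x\<bar>)" "0 \<le> C" "0 \<le> m"
  shows "gd M c p \<phi>"
  unfolding gd_def
proof
  show "lst c p \<phi> \<in> borel_measurable M"
  proof (rule borel_measurable_LIMSEQ_real)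
    show "(\<lambda>n. lst c p (f n) y) \<longlonglongrightarrow> lst c p \<phi> y" for y by (rule lst_lim[OF lim])
    show "lst c p (f n) \<in> borel_measurable M" for n using assms(1)[of n] unfolding gd_def by (rule conjunct1)
  qed
  show "expbd \<phi>"
  proof (rule expbdI[of _ C m])
    fix x
    show "\<bar>\<phi> x\<bar> \<le> C * exp (m * \<bar>x\<bar>)"
      by (rule LIMSEQ_le_const2[OF tendsto_rabs[OF lim]]) (intro exI[of _ 0] allI impI bd(1))
  qed (rule bd)+
qed

text \<open>\<open>e\<close> bounds every point of the configuration and has all exponential moments
  under the weight, which provides the majorants for dominated convergence.\<close>

locale linstat =
  fixes M :: "'a measure" and w :: "'a \<Rightarrow> real" and p :: "'a \<Rightarrow> real list" and e :: "'a \<Rightarrow> real" and L :: nat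
  assumes wm: "w \<in> borel_measurable M" and pb: "\<And>y x. x \<in> set (p y) \<Longrightarrow> \<bar>x\<bar> \<le> e y"
    and len: "\<And>y. length (p y) = L" and int: "\<And>m. integrable M (\<lambda>y. w y * exp (m * e y))"
begin

lemma S_bound:
  assumes "\<And>x. \<bar>\<phi> x\<bar> \<le> C * exp (m * \<bar>x\<bar>)" "0 \<le> C" "0 \<le> m"
  shows "\<bar>lst c p \<phi> y\<bar> \<le> (\<bar>c\<bar> * (real L * C)) * exp (m * e y)"
proof -
  have b: "\<bar>\<phi> x\<bar> \<le> C * exp (m * e y)" if "x \<in> set (p y)" for x
  proof -
    have "m * \<bar>x\<bar> \<le> m * e y" by (rule mult_left_mono[OF pb[OF that] assms(3)])
    then have "C * exp (m * \<bar>x\<bar>) \<le> C * exp (m * e y)" by (intro mult_left_mono assms(2)) simp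
    then show ?thesis using assms(1)[of x] by linarith
  qed
  have "sum_list (map (\<lambda>x. \<bar>\<phi> x\<bar>) (p y)) \<le> sum_list (map (\<lambda>x. C * exp (m * e y)) (p y))"
    by (rule sum_list_mono) (rule b)
  also have "\<dots> = real L * (C * exp (m * e y))" by (simp only: sum_list_triv len)
  finally have 1: "sum_list (map (\<lambda>x. \<bar>\<phi> x\<bar>) (p y)) \<le> real L * (C * exp (m * e y))" .
  have "\<bar>sum_list (map \<phi> xs)\<bar> \<le> sum_list (map (\<lambda>x. \<bar>\<phi> x\<bar>) xs)" for xs
    by (induction xs) simp_all
  from this[of "p y"] have "\<bar>sum_list (map \<phi> (p y))\<bar> \<le> real L * (C * exp (m * e y))" using 1 by linarith
  then have "\<bar>c\<bar> * \<bar>sum_list (map \<phi> (p y))\<bar> \<le> \<bar>c\<bar> * (real L * (C * exp (m * e y)))" by (rule mult_left_mono) simp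
  then show ?thesis by (simp only: lst_def abs_mult mult.assoc)
qed

abbreviation "Pl c \<phi>s y \<equiv> prod_list (map (\<lambda>\<phi>. lst c p \<phi> y) \<phi>s)"

lemma Pl_meas: "(\<And>\<phi>. \<phi> \<in> set \<phi>s \<Longrightarrow> gd M c p \<phi>) \<Longrightarrow> (\<lambda>y. Pl c \<phi>s y) \<in> borel_measurable M"
proof (induction \<phi>s)
  case (Cons \<phi> \<phi>s)
  have "gd M c p \<phi>" by (rule Cons.prems) simp
  then have 1: "lst c p \<phi> \<in> borel_measurable M" unfolding gd_def by (rule conjunct1)
  have 2: "(\<lambda>y. Pl c \<phi>s y) \<in> borel_measurable M" by (rule Cons.IH) (rule Cons.prems, rule list.set_intros(2))
  show ?case unfolding list.map prod_list.Cons by (rule borel_measurable_times[OF 1 2])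
next
  case Nil
  show ?case unfolding list.map prod_list.Nil by (rule borel_measurable_const)
qed

lemma Pl_bound:
  "(\<And>\<phi>. \<phi> \<in> set \<phi>s \<Longrightarrow> gd M c p \<phi>) \<Longrightarrow> \<exists>C\<ge>0. \<exists>m. \<forall>y. \<bar>Pl c \<phi>s y\<bar> \<le> C * exp (m * e y)"
proof (induction \<phi>s)
  case Nil
  show ?case by (rule exI[of _ 1], rule conjI[OF _ exI[of _ 0]]) simp_all
next
  case (Cons \<phi> \<phi>s)
  have "\<exists>C\<ge>0. \<exists>m. \<forall>y. \<bar>Pl c \<phi>s y\<bar> \<le> C * exp (m * e y)" by (rule Cons.IH) (rule Cons.prems, simp)
  then obtain C m where h: "0 \<le> C" "\<forall>y. \<bar>Pl c \<phi>s y\<bar> \<le> C * exp (m * e y)" by (elim exE conjE)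
  have "gd M c p \<phi>" by (rule Cons.prems) simp
  then have "expbd \<phi>" unfolding gd_def by (rule conjunct2)
  then obtain D k where g: "0 \<le> D" "0 \<le> k" "\<forall>x. \<bar>\<phi> x\<bar> \<le> D * exp (k * \<bar>x\<bar>)" unfolding expbd_def by (elim exE conjE)
  show ?case
  proof (rule exI[of _ "(\<bar>c\<bar> * (real L * D)) * C"], rule conjI[OF _ exI[of _ "k + m"]], goal_cases)
    case 1
    show ?case using h(1) g(1) by simp
  next
    case 2
    show ?case
    proof
    fix y
    have "\<bar>lst c p \<phi> y\<bar> * \<bar>Pl c \<phi>s y\<bar> \<le> ((\<bar>c\<bar> * (real L * D)) * exp (k * e y)) * (C * exp (m * e y))"
      by (rule mult_mono[OF S_bound[OF g(3)[rule_format] g(1,2)] h(2)[rule_format]]) (use g(1) in simp_all)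
    also have "\<dots> = (\<bar>c\<bar> * (real L * D)) * C * exp ((k + m) * e y)"
    proof -
      have ee: "exp ((k + m) * e y) = exp (k * e y) * exp (m * e y)" by (simp add: distrib_right exp_add)
      show ?thesis unfolding ee by (simp only: mult_ac)
    qed
    finally show "\<bar>Pl c (\<phi> # \<phi>s) y\<bar> \<le> (\<bar>c\<bar> * (real L * D)) * C * exp ((k + m) * e y)"
      by (simp only: list.map prod_list.Cons abs_mult)
    qed
  qed
qed

lemma int_bound:
  assumes "g \<in> borel_measurable M" "\<And>y. \<bar>g y\<bar> \<le> C * exp (m * e y)" "0 \<le> C"
  shows "integrable M (\<lambda>y. w y * g y)"
proof -
  have "integrable M (\<lambda>y. C * (w y * exp (m * e y)))" by (rule integrable_mult_right[OF int])
  then show ?thesis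
  proof (rule Bochner_Integration.integrable_bound)
    show "(\<lambda>y. w y * g y) \<in> borel_measurable M" by (rule borel_measurable_times[OF wm assms(1)])
    show "AE y in M. norm (w y * g y) \<le> norm (C * (w y * exp (m * e y)))"
    proof (rule AE_I2)
      fix y
      have "\<bar>w y\<bar> * \<bar>g y\<bar> \<le> \<bar>w y\<bar> * (C * exp (m * e y))" by (rule mult_left_mono[OF assms(2)]) simp
      also have "\<dots> = norm (C * (w y * exp (m * e y)))" using assms(3) by (simp add: abs_mult)
      finally show "norm (w y * g y) \<le> norm (C * (w y * exp (m * e y)))" by (simp only: real_norm_def abs_mult)
    qed
  qed
qed

lemma Pl_integrable:
  assumes "\<And>\<phi>. \<phi> \<in> set \<phi>s \<Longrightarrow> gd M c p \<phi>"
  shows "integrable M (\<lambda>y. w y * Pl c \<phi>s y)"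
proof -
  have "\<exists>C\<ge>0. \<exists>m. \<forall>y. \<bar>Pl c \<phi>s y\<bar> \<le> C * exp (m * e y)" by (rule Pl_bound) (rule assms)
  then obtain C m where h: "0 \<le> C" "\<forall>y. \<bar>Pl c \<phi>s y\<bar> \<le> C * exp (m * e y)" by (elim exE conjE)
  have "(\<lambda>y. Pl c \<phi>s y) \<in> borel_measurable M" by (rule Pl_meas) (rule assms)
  then show ?thesis by (rule int_bound) (rule h(2)[rule_format], rule h(1))
qed

lemma Pl_add:
  assumes "gd M c p f" "gd M c p g" "\<And>\<phi>. \<phi> \<in> set \<phi>s \<Longrightarrow> gd M c p \<phi>"
  shows "(LINT y|M. w y * Pl c ((\<lambda>x. a * f x + g x) # \<phi>s) y) = a * (LINT y|M. w y * Pl c (f # \<phi>s) y) + (LINT y|M. w y * Pl c (g # \<phi>s) y)"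
proof -
  have 1: "integrable M (\<lambda>y. a * (w y * Pl c (f # \<phi>s) y))"
    by (rule integrable_mult_right, rule Pl_integrable) (use assms in auto)
  have 2: "integrable M (\<lambda>y. w y * Pl c (g # \<phi>s) y)" by (rule Pl_integrable) (use assms in auto)
  have "w y * Pl c ((\<lambda>x. a * f x + g x) # \<phi>s) y = a * (w y * Pl c (f # \<phi>s) y) + w y * Pl c (g # \<phi>s) y" for y
    unfolding list.map prod_list.Cons lst_add by (simp add: algebra_simps)
  then show ?thesis by (simp only: Bochner_Integration.integral_add[OF 1 2] integral_mult_right_zero)
qed

lemma Pl_lim:
  assumes "\<And>n. gd M c p (f n)" and lim: "\<And>x. (\<lambda>n. f n x) \<longlonglongrightarrow> \<phi> x"
    and bd: "\<And>n x. \<bar>f n x\<bar> \<le> C * exp (m * \<bar>x\<bar>)" "0 \<le> C" "0 \<le> m"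
    and gs: "\<And>\<phi>. \<phi> \<in> set \<phi>s \<Longrightarrow> gd M c p \<phi>"
  shows "(\<lambda>n. LINT y|M. w y * Pl c (f n # \<phi>s) y) \<longlonglongrightarrow> (LINT y|M. w y * Pl c (\<phi> # \<phi>s) y)"
proof -
  have g: "gd M c p \<phi>" by (rule gd_lim[OF assms(1) lim bd])
  have "\<exists>C\<ge>0. \<exists>m. \<forall>y. \<bar>Pl c \<phi>s y\<bar> \<le> C * exp (m * e y)" by (rule Pl_bound) (rule gs)
  then obtain D k where h: "0 \<le> D" "\<forall>y. \<bar>Pl c \<phi>s y\<bar> \<le> D * exp (k * e y)" by (elim exE conjE)
  let ?K = "(\<bar>c\<bar> * (real L * C)) * D"
  show ?thesis
  proof (rule integral_dominated_convergence[where w = "\<lambda>y. norm (?K * (w y * exp ((m + k) * e y)))"])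
    show "(\<lambda>y. w y * Pl c (\<phi> # \<phi>s) y) \<in> borel_measurable M"
      by (rule borel_measurable_times[OF wm Pl_meas]) (use g gs in auto)
    show "(\<lambda>y. w y * Pl c (f n # \<phi>s) y) \<in> borel_measurable M" for n
      by (rule borel_measurable_times[OF wm Pl_meas]) (use assms(1) gs in auto)
    show "integrable M (\<lambda>y. norm (?K * (w y * exp ((m + k) * e y))))"
      by (rule integrable_norm, rule integrable_mult_right, rule int)
    show "AE y in M. (\<lambda>n. w y * Pl c (f n # \<phi>s) y) \<longlonglongrightarrow> w y * Pl c (\<phi> # \<phi>s) y"
    proof (rule AE_I2)
      fix y
      show "(\<lambda>n. w y * Pl c (f n # \<phi>s) y) \<longlonglongrightarrow> w y * Pl c (\<phi> # \<phi>s) y"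
        unfolding list.map prod_list.Cons by (intro tendsto_mult tendsto_const lst_lim[OF lim])
    qed
    fix n
    show "AE y in M. norm (w y * Pl c (f n # \<phi>s) y) \<le> norm (?K * (w y * exp ((m + k) * e y)))"
    proof (rule AE_I2)
      fix y
      have "\<bar>lst c p (f n) y\<bar> * \<bar>Pl c \<phi>s y\<bar> \<le> ((\<bar>c\<bar> * (real L * C)) * exp (m * e y)) * (D * exp (k * e y))"
        by (rule mult_mono[OF S_bound[OF bd] h(2)[rule_format]]) (use bd(2) in simp_all)
      also have "\<dots> = ?K * exp ((m + k) * e y)"
      proof -
        have ee: "exp ((m + k) * e y) = exp (m * e y) * exp (k * e y)" by (simp add: distrib_right exp_add)
        show ?thesis unfolding ee by (simp only: mult_ac)
      qed
      finally have "\<bar>w y\<bar> * (\<bar>lst c p (f n) y\<bar> * \<bar>Pl c \<phi>s y\<bar>) \<le> \<bar>w y\<bar> * (?K * exp ((m + k) * e y))"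
        by (rule mult_left_mono) simp
      moreover have "norm (?K * (w y * exp ((m + k) * e y))) = \<bar>w y\<bar> * (?K * exp ((m + k) * e y))"
        using h(1) bd(2) by (simp add: abs_mult)
      moreover have "norm (w y * Pl c (f n # \<phi>s) y) = \<bar>w y\<bar> * (\<bar>lst c p (f n) y\<bar> * \<bar>Pl c \<phi>s y\<bar>)"
        by (simp only: list.map prod_list.Cons abs_mult real_norm_def)
      ultimately show "norm (w y * Pl c (f n # \<phi>s) y) \<le> norm (?K * (w y * exp ((m + k) * e y)))" by simp
    qed
  qed
qed

end

lemma mcl_gd: "mcl T \<phi> \<Longrightarrow> (\<And>\<phi>. \<phi> \<in> T \<Longrightarrow> gd M c p \<phi>) \<Longrightarrow> gd M c p \<phi>"
proof (induction rule: mcl.induct)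
  case (mcl_base \<phi>)
  then show ?case by simp
next
  case (mcl_add f g a)
  show ?case by (rule gd_add[OF mcl_add.IH(1)[OF mcl_add.prems] mcl_add.IH(2)[OF mcl_add.prems]])
next
  case (mcl_lim f \<phi> C m)
  show ?case by (rule gd_lim[OF mcl_lim.IH[OF mcl_lim.prems] mcl_lim.hyps(2-5)])
qed

text \<open>Test functions are upgraded from \<open>T\<close> to its closure one at a time. The
  outer induction runs over the upgraded list \<open>\<psi>s\<close>, the inner one over
  \<open>mcl\<close> for its first function with all the others fixed; the base case of the latter
  hands a function of \<open>T\<close> over to \<open>\<chi>s\<close>.\<close>

lemma mcl_agree:
  assumes A: "linstat M1 w1 p1 e1 L1" and B: "linstat M2 w2 p2 e2 L2"
    and gA: "\<And>\<phi>. \<phi> \<in> T \<Longrightarrow> gd M1 c1 p1 \<phi>" and gB: "\<And>\<phi>. \<phi> \<in> T \<Longrightarrow> gd M2 c2 p2 \<phi>"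
    and ag: "\<And>\<phi>s. set \<phi>s \<subseteq> T \<Longrightarrow> (LINT y|M1. w1 y * prod_list (map (\<lambda>\<phi>. lst c1 p1 \<phi> y) \<phi>s)) = (LINT y|M2. w2 y * prod_list (map (\<lambda>\<phi>. lst c2 p2 \<phi> y) \<phi>s))"
  shows "(\<And>\<phi>. \<phi> \<in> set \<psi>s \<Longrightarrow> mcl T \<phi>) \<Longrightarrow> set \<chi>s \<subseteq> T \<Longrightarrow>
    (LINT y|M1. w1 y * prod_list (map (\<lambda>\<phi>. lst c1 p1 \<phi> y) (\<psi>s @ \<chi>s))) = (LINT y|M2. w2 y * prod_list (map (\<lambda>\<phi>. lst c2 p2 \<phi> y) (\<psi>s @ \<chi>s)))"
proof (induction \<psi>s arbitrary: \<chi>s)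
  case Nil
  then show ?case using ag by simp
next
  case (Cons \<psi> \<psi>s)
  have m: "mcl T \<phi>" if "\<phi> \<in> set (\<psi>s @ \<chi>s)" for \<phi>
    using that Cons.prems mcl_base[of \<phi> T] by auto
  have g1: "gd M1 c1 p1 \<phi>" if "mcl T \<phi>" for \<phi> by (rule mcl_gd[OF that gA])
  have g2: "gd M2 c2 p2 \<phi>" if "mcl T \<phi>" for \<phi> by (rule mcl_gd[OF that gB])
  note r1 = g1[OF m] and r2 = g2[OF m]
  have ih: "(LINT y|M1. w1 y * prod_list (map (\<lambda>\<phi>. lst c1 p1 \<phi> y) (\<psi>s @ \<xi>))) = (LINT y|M2. w2 y * prod_list (map (\<lambda>\<phi>. lst c2 p2 \<phi> y) (\<psi>s @ \<xi>)))"
    if "set \<xi> \<subseteq> T" for \<xi> by (rule Cons.IH[OF _ that]) (rule Cons.prems(1), simp)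
  have "mcl T \<psi>" by (rule Cons.prems(1)) simp
  then have "(LINT y|M1. w1 y * prod_list (map (\<lambda>\<phi>. lst c1 p1 \<phi> y) (\<psi> # (\<psi>s @ \<chi>s)))) = (LINT y|M2. w2 y * prod_list (map (\<lambda>\<phi>. lst c2 p2 \<phi> y) (\<psi> # (\<psi>s @ \<chi>s))))"
  proof (induction rule: mcl.induct)
    case (mcl_base \<phi>)
    have "prod_list (map f (\<phi> # (\<psi>s @ \<chi>s))) = prod_list (map f (\<psi>s @ (\<phi> # \<chi>s)))" for f :: "(real \<Rightarrow> real) \<Rightarrow> real"
      by (simp add: mult.left_commute)
    moreover have "set (\<phi> # \<chi>s) \<subseteq> T" using mcl_base Cons.prems(2) by simp
    ultimately show ?case using ih[of "\<phi> # \<chi>s"] by presburger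
  next
    case (mcl_add f g a)
    have 1: "(LINT y|M1. w1 y * prod_list (map (\<lambda>\<phi>. lst c1 p1 \<phi> y) ((\<lambda>x. a * f x + g x) # (\<psi>s @ \<chi>s)))) = a * (LINT y|M1. w1 y * prod_list (map (\<lambda>\<phi>. lst c1 p1 \<phi> y) (f # (\<psi>s @ \<chi>s)))) + (LINT y|M1. w1 y * prod_list (map (\<lambda>\<phi>. lst c1 p1 \<phi> y) (g # (\<psi>s @ \<chi>s))))"
      by (rule linstat.Pl_add[OF A g1[OF mcl_add.hyps(1)] g1[OF mcl_add.hyps(2)]]) (rule r1)
    have 2: "(LINT y|M2. w2 y * prod_list (map (\<lambda>\<phi>. lst c2 p2 \<phi> y) ((\<lambda>x. a * f x + g x) # (\<psi>s @ \<chi>s)))) = a * (LINT y|M2. w2 y * prod_list (map (\<lambda>\<phi>. lst c2 p2 \<phi> y) (f # (\<psi>s @ \<chi>s)))) + (LINT y|M2. w2 y * prod_list (map (\<lambda>\<phi>. lst c2 p2 \<phi> y) (g # (\<psi>s @ \<chi>s))))"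
      by (rule linstat.Pl_add[OF B g2[OF mcl_add.hyps(1)] g2[OF mcl_add.hyps(2)]]) (rule r2)
    show ?case unfolding 1 2 mcl_add.IH ..
  next
    case (mcl_lim f \<phi> C m)
    have 1: "(\<lambda>n. LINT y|M1. w1 y * prod_list (map (\<lambda>\<phi>. lst c1 p1 \<phi> y) (f n # (\<psi>s @ \<chi>s)))) \<longlonglongrightarrow> (LINT y|M1. w1 y * prod_list (map (\<lambda>\<phi>. lst c1 p1 \<phi> y) (\<phi> # (\<psi>s @ \<chi>s))))"
      by (rule linstat.Pl_lim[OF A g1[OF mcl_lim.hyps(1)] mcl_lim.hyps(2-5)]) (rule r1)
    have 2: "(\<lambda>n. LINT y|M2. w2 y * prod_list (map (\<lambda>\<phi>. lst c2 p2 \<phi> y) (f n # (\<psi>s @ \<chi>s)))) \<longlonglongrightarrow> (LINT y|M2. w2 y * prod_list (map (\<lambda>\<phi>. lst c2 p2 \<phi> y) (\<phi> # (\<psi>s @ \<chi>s))))"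
      by (rule linstat.Pl_lim[OF B g2[OF mcl_lim.hyps(1)] mcl_lim.hyps(2-5)]) (rule r2)
    show ?case by (rule LIMSEQ_unique[OF 1[unfolded mcl_lim.IH] 2])
  qed
  then show ?case by simp
qed

abbreviation "evenpow \<equiv> range (\<lambda>m x. (x::real) ^ (2 * m))"

lemma mcl_zero: "mcl evenpow (\<lambda>x. 0)"
proof -
  have "(\<lambda>x::real. x ^ (2 * 0)) \<in> evenpow" by (rule rangeI)
  then have 1: "mcl evenpow (\<lambda>x. 1)" by (intro mcl_base) simp
  show ?thesis using mcl_add[OF 1 1, of "-1"] by simp
qed

lemma mcl_sum:
  fixes n :: nat
  assumes "\<And>i. i < n \<Longrightarrow> mcl evenpow (f i)"
  shows "mcl evenpow (\<lambda>x. \<Sum>i<n. b i * f i x)"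
  using assms
proof (induction n)
  case 0
  then show ?case using mcl_zero by simp
next
  case (Suc n)
  have "mcl evenpow (\<lambda>x. b n * f n x + (\<Sum>i<n. b i * f i x))"
    by (rule mcl_add[OF Suc.prems[of n] Suc.IH]) (simp_all add: Suc.prems)
  then show ?case by (simp add: add.commute)
qed

text \<open>The Taylor polynomials of the cosine are bounded by exp(|t x|) uniformly in their
  length. This is the reason for exponential bounds in \<open>mcl\<close>.\<close>

lemma mcl_cos: "mcl evenpow (\<lambda>x. cos (t * x))"
proof (rule mcl_lim[where f = "\<lambda>n x. \<Sum>i<n. cos_coeff i * (t * x) ^ i" and C = 1 and m = "\<bar>t\<bar>"])
  fix n
  have "mcl evenpow (\<lambda>x. \<Sum>i<n. (cos_coeff i * t ^ i) * (if even i then x ^ (2 * (i div 2)) else 0))"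
  proof (rule mcl_sum)
    fix i
    show "mcl evenpow (\<lambda>x. if even i then x ^ (2 * (i div 2)) else 0)"
      using mcl_base[OF rangeI[of "\<lambda>m x. (x::real) ^ (2 * m)" "i div 2"]] mcl_zero by (cases "even i") simp_all
  qed
  also have "(\<lambda>x. \<Sum>i<n. (cos_coeff i * t ^ i) * (if even i then x ^ (2 * (i div 2)) else 0)) = (\<lambda>x. \<Sum>i<n. cos_coeff i * (t * x) ^ i)"
    by (intro ext sum.cong refl) (simp add: cos_coeff_def power_mult_distrib)
  finally show "mcl evenpow (\<lambda>x. \<Sum>i<n. cos_coeff i * (t * x) ^ i)" .
next
  fix x
  show "(\<lambda>n. \<Sum>i<n. cos_coeff i * (t * x) ^ i) \<longlonglongrightarrow> cos (t * x)"
    using cos_converges[of "t * x"] by (simp add: sums_def)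
next
  fix n and x :: real
  have "\<bar>\<Sum>i<n. cos_coeff i * (t * x) ^ i\<bar> \<le> (\<Sum>i<n. \<bar>cos_coeff i * (t * x) ^ i\<bar>)" by (rule sum_abs)
  also have "\<dots> \<le> (\<Sum>i<n. \<bar>t * x\<bar> ^ i /\<^sub>R fact i)"
  proof (rule sum_mono)
    fix i
    have "\<bar>cos_coeff i\<bar> \<le> inverse (fact i)" by (simp add: cos_coeff_def abs_mult power_abs divide_inverse)
    then have "\<bar>cos_coeff i\<bar> * \<bar>t * x\<bar> ^ i \<le> inverse (fact i) * \<bar>t * x\<bar> ^ i" by (rule mult_right_mono) simp
    then show "\<bar>cos_coeff i * (t * x) ^ i\<bar> \<le> \<bar>t * x\<bar> ^ i /\<^sub>R fact i" by (simp add: abs_mult power_abs)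
  qed
  also have "\<dots> \<le> exp \<bar>t * x\<bar>"
    unfolding exp_def by (rule sum_le_suminf[OF summable_exp_generic]) auto
  finally show "\<bar>\<Sum>i<n. cos_coeff i * (t * x) ^ i\<bar> \<le> 1 * exp (\<bar>t\<bar> * \<bar>x\<bar>)" by (simp add: abs_mult)
qed simp_all

text \<open>\<open>mcl\<close> offers no products, so powers of a cosine are linearised by the
  product-to-sum formula. The free frequency \<open>s\<close> carries the induction.\<close>

lemma mcl_cos_power: "mcl evenpow (\<lambda>x. cos (s * x) * cos (t * x) ^ j)"
proof (induction j arbitrary: s)
  case 0
  then show ?case using mcl_cos[of s] by simp
next
  case (Suc j)
  have "mcl evenpow (\<lambda>x. (1/2) * (cos ((s + t) * x) * cos (t * x) ^ j) + ((1/2) * (cos ((s - t) * x) * cos (t * x) ^ j) + 0))"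
    by (rule mcl_add[OF Suc.IH mcl_add[OF Suc.IH mcl_zero]])
  also have "(\<lambda>x. (1/2) * (cos ((s + t) * x) * cos (t * x) ^ j) + ((1/2) * (cos ((s - t) * x) * cos (t * x) ^ j) + 0)) = (\<lambda>x. cos (s * x) * cos (t * x) ^ Suc j)"
  proof (rule ext)
    fix x
    have "cos ((s + t) * x) + cos ((s - t) * x) = 2 * (cos (s * x) * cos (t * x))"
      by (simp add: distrib_right left_diff_distrib cos_add cos_diff)
    then have "(1/2) * (cos ((s + t) * x) + cos ((s - t) * x)) * cos (t * x) ^ j = cos (s * x) * cos (t * x) * cos (t * x) ^ j" by simp
    then show "(1/2) * (cos ((s + t) * x) * cos (t * x) ^ j) + ((1/2) * (cos ((s - t) * x) * cos (t * x) ^ j) + 0) = cos (s * x) * cos (t * x) ^ Suc j"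
      by (simp add: algebra_simps)
  qed
  finally show ?case .
qed

text \<open>A continuous cutoff: 1 up to \<open>a\<close>, then falling linearly to 0 over a length
  1/n.\<close>

definition trap :: "real \<Rightarrow> nat \<Rightarrow> real \<Rightarrow> real" where
  "trap a n u = max 0 (min 1 (1 + real n * (a - u)))"

text \<open>With T = n + 1, cos(pi x / T) determines |x| for |x| \<le> T, so the cutoff becomes a
  continuous function of the cosine, and Weierstrass supplies a polynomial in it. The approximation
  is good only for |x| \<le> n, but since the cosine stays in [-1, 1] the bound 2 holds on the whole
  line.\<close>

lemma trap_approx:
  "\<exists>f. mcl evenpow f \<and> (\<forall>x. \<bar>f x\<bar> \<le> 2) \<and> (\<forall>x. \<bar>x\<bar> \<le> real n \<longrightarrow> \<bar>f x - trap a n \<bar>x\<bar>\<bar> < 1 / real (Suc n))"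
proof -
  define T where "T = real (Suc n)"
  define h where "h u = trap a n (T / pi * arccos u)" for u
  have T: "T > 0" by (simp add: T_def)
  have hc: "continuous_on {-1..1} h"
    unfolding h_def trap_def by (intro continuous_intros continuous_on_arccos')
  have T1: "0 < 1 / T" using T by simp
  obtain g where g: "real_polynomial_function g" "\<And>u. u \<in> {-1..1} \<Longrightarrow> \<bar>h u - g u\<bar> < 1 / T"
    by (rule Stone_Weierstrass_real_polynomial_function[OF compact_Icc hc T1]) (rule that)
  from g(1) obtain b N where bN: "g = (\<lambda>u. \<Sum>i\<le>N. b i * u ^ i)" unfolding real_polynomial_function_iff_sum by blast
  have m: "mcl evenpow (\<lambda>x. g (cos (pi / T * x)))"
  proof -
    have "mcl evenpow (\<lambda>x. \<Sum>i<Suc N. b i * (cos (0 * x) * cos (pi / T * x) ^ i))"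
      by (rule mcl_sum) (rule mcl_cos_power)
    then show ?thesis by (simp add: bN lessThan_Suc_atMost)
  qed
  have i: "cos z \<in> {-1..1}" for z :: real by simp
  show ?thesis
  proof (intro exI[of _ "\<lambda>x. g (cos (pi / T * x))"] conjI allI impI)
    show "mcl evenpow (\<lambda>x. g (cos (pi / T * x)))" by (rule m)
  next
    fix x
    have "\<bar>h (cos (pi / T * x))\<bar> \<le> 1" unfolding h_def trap_def by simp
    moreover have "1 / T \<le> 1" by (simp add: T_def)
    ultimately show "\<bar>g (cos (pi / T * x))\<bar> \<le> 2" using g(2)[OF i[of "pi / T * x"]] by linarith
  next
    fix x :: real assume x: "\<bar>x\<bar> \<le> real n"
    have "\<bar>x\<bar> \<le> T" using x by (simp add: T_def)
    then have "pi / T * \<bar>x\<bar> \<le> pi / T * T" using T by (intro mult_left_mono) simp_all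
    then have "pi / T * \<bar>x\<bar> \<le> pi" using T by simp
    then have "arccos (cos (pi / T * \<bar>x\<bar>)) = pi / T * \<bar>x\<bar>" using T by (intro arccos_cos) simp_all
    moreover have "cos (pi / T * \<bar>x\<bar>) = cos (pi / T * x)" by (cases "x \<ge> 0") simp_all
    ultimately have "h (cos (pi / T * x)) = trap a n \<bar>x\<bar>" using T by (simp add: h_def)
    then show "\<bar>g (cos (pi / T * x)) - trap a n \<bar>x\<bar>\<bar> < 1 / real (Suc n)"
      using g(2)[OF i[of "pi / T * x"]] unfolding T_def by linarith
  qed
qed

lemma trap_lim: "(\<lambda>n. trap a n u) \<longlonglongrightarrow> (if u \<le> a then 1 else 0)"
proof (cases "u \<le> a")
  case True
  then have "trap a n u = 1" for n unfolding trap_def by (simp add: min_def max_def)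
  then show ?thesis using True by simp
next
  case False
  then have "0 < u - a" by simp
  then have "filterlim (\<lambda>n. (u - a) * real n) at_top sequentially"
    by (rule filterlim_tendsto_pos_mult_at_top[OF tendsto_const _ filterlim_real_sequentially])
  then have "\<forall>\<^sub>F n in sequentially. (u - a) * real n \<ge> 1" unfolding filterlim_at_top by (rule spec)
  then have "\<forall>\<^sub>F n in sequentially. trap a n u = 0"
  proof eventually_elim
    case (elim n)
    then have "1 + real n * (a - u) \<le> 0" by (simp add: algebra_simps)
    then show ?case unfolding trap_def by simp
  qed
  then show ?thesis using False by (simp add: tendsto_eventually)
qed

lemma mcl_indicator: "mcl evenpow (\<lambda>x. if \<bar>x\<bar> \<le> a then 1 else 0)"
proof -
  have "\<forall>n. \<exists>f. mcl evenpow f \<and> (\<forall>x. \<bar>f x\<bar> \<le> 2) \<and> (\<forall>x. \<bar>x\<bar> \<le> real n \<longrightarrow> \<bar>f x - trap a n \<bar>x\<bar>\<bar> < 1 / real (Suc n))"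
    by (rule allI) (rule trap_approx)
  from choice[OF this] obtain f where f: "\<forall>n. mcl evenpow (f n) \<and> (\<forall>x. \<bar>f n x\<bar> \<le> 2) \<and> (\<forall>x. \<bar>x\<bar> \<le> real n \<longrightarrow> \<bar>f n x - trap a n \<bar>x\<bar>\<bar> < 1 / real (Suc n))" ..
  show ?thesis
  proof (rule mcl_lim[where f = f and C = 2 and m = 0])
    show "mcl evenpow (f n)" for n using f by (elim allE[of _ n] conjE)
    show "\<bar>f n x\<bar> \<le> 2 * exp (0 * \<bar>x\<bar>)" for n x using f[rule_format, of n, THEN conjunct2, THEN conjunct1, rule_format, of x] by simp
    fix x
    have "(\<lambda>n. f n x - trap a n \<bar>x\<bar>) \<longlonglongrightarrow> 0"
    proof (rule Lim_null_comparison)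
      show "\<forall>\<^sub>F n in sequentially. norm (f n x - trap a n \<bar>x\<bar>) \<le> 1 / real (Suc n)"
        using eventually_ge_at_top[of "nat \<lceil>\<bar>x\<bar>\<rceil>"]
      proof eventually_elim
        case (elim n)
        then have "\<bar>x\<bar> \<le> real n" by linarith
        then show ?case using f[rule_format, of n, THEN conjunct2, THEN conjunct2, rule_format, of x] by simp
      qed
      show "(\<lambda>n. 1 / real (Suc n)) \<longlonglongrightarrow> 0" using LIMSEQ_inverse_real_of_nat by (simp only: inverse_eq_divide)
    qed
    from tendsto_add[OF this trap_lim[of a "\<bar>x\<bar>"]]
    show "(\<lambda>n. f n x) \<longlonglongrightarrow> (if \<bar>x\<bar> \<le> a then 1 else 0)" by simp
  qed simp_all
qed

text \<open>If n of L points lie in [-a, a] and d L = K, the j-th statistic with factor d/2 equals 1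
  - d n / j. The product over j = 1, ..., K is then 1 for n = 0 and 0 otherwise, since d n is one of
  the j. So the indicator of an empty interval is exactly a product of linear statistics.\<close>

definition void_list :: "nat \<Rightarrow> real \<Rightarrow> (real \<Rightarrow> real) list" where
  "void_list K a = map (\<lambda>j x. (- 2 / real j) * (if \<bar>x\<bar> \<le> a then 1 else 0) + 2 / real K) [1..<Suc K]"

lemma mcl_void_list: "\<phi> \<in> set (void_list K a) \<Longrightarrow> mcl evenpow \<phi>"
proof -
  assume "\<phi> \<in> set (void_list K a)"
  then obtain j where j: "\<phi> = (\<lambda>x. (- 2 / real j) * (if \<bar>x\<bar> \<le> a then 1 else 0) + 2 / real K)"
    unfolding void_list_def by auto
  have "(\<lambda>x::real. x ^ (2 * 0)) \<in> evenpow" by (rule rangeI)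
  then have "mcl evenpow (\<lambda>x. 1)" by (intro mcl_base) simp
  from mcl_add[OF this mcl_zero, of "2 / real K"] have "mcl evenpow (\<lambda>x. 2 / real K)" by simp
  from mcl_add[OF mcl_indicator this, of "- 2 / real j"] show ?thesis unfolding j .
qed

lemma void_prod:
  assumes "length (p y) = L" "d * L = K" "1 \<le> d" "1 \<le> K"
  shows "prod_list (map (\<lambda>\<phi>. lst (real d / 2) p \<phi> y) (void_list K a)) = (if \<forall>x\<in>set (p y). a < \<bar>x\<bar> then 1 else 0)"
proof -
  define n where "n = length (filter (\<lambda>x. \<bar>x\<bar> \<le> a) (p y))"
  have s: "sum_list (map (\<lambda>x. b * (if \<bar>x\<bar> \<le> a then 1 else 0) + e) xs) = b * real (length (filter (\<lambda>x. \<bar>x\<bar> \<le> a) xs)) + real (length xs) * e" for b e :: real and xs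
    by (induction xs) (simp_all add: algebra_simps)
  have dL: "real d * real L = real K" using assms(2) by (metis of_nat_mult)
  have K: "real K \<noteq> 0" using assms(4) by simp
  have v: "lst (real d / 2) p (\<lambda>x. (- 2 / real j) * (if \<bar>x\<bar> \<le> a then 1 else 0) + 2 / real K) y = 1 - real (d * n) / real j" for j
  proof -
    have "lst (real d / 2) p (\<lambda>x. (- 2 / real j) * (if \<bar>x\<bar> \<le> a then 1 else 0) + 2 / real K) y = real d / 2 * ((- 2 / real j) * real n + real L * (2 / real K))"
      unfolding lst_def s n_def assms(1) ..
    also have "\<dots> = (real d * real L) / real K - real (d * n) / real j" by (simp add: algebra_simps)
    finally show ?thesis using dL K by simp
  qed
  have e: "map (\<lambda>\<phi>. lst (real d / 2) p \<phi> y) (void_list K a) = map (\<lambda>j. 1 - real (d * n) / real j) [1..<Suc K]"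
    unfolding void_list_def map_map o_def v ..
  show ?thesis
  proof (cases "n = 0")
    case True
    have "prod_list (map (\<lambda>j. 1 - real (d * n) / real j) xs) = 1" for xs by (induction xs) (simp_all add: True)
    moreover have "\<forall>x\<in>set (p y). a < \<bar>x\<bar>" using True by (auto simp: n_def filter_empty_conv not_le)
    ultimately show ?thesis unfolding e by simp
  next
    case False
    have "n \<le> L" unfolding n_def using assms(1) length_filter_le[of "\<lambda>x. \<bar>x\<bar> \<le> a" "p y"] by simp
    then have "d * n \<le> K" using assms(2) by (metis mult_le_mono2)
    moreover have "1 \<le> d * n" using False assms(3) by simp
    ultimately have "d * n \<in> set [1..<Suc K]" by (simp only: set_upt atLeastLessThan_iff less_Suc_eq_le simp_thms)
    moreover have "1 - real (d * n) / real (d * n) = 0" using \<open>1 \<le> d * n\<close> by simp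
    ultimately have "0 \<in> set (map (\<lambda>j. 1 - real (d * n) / real j) [1..<Suc K])" unfolding set_map by (metis image_eqI)
    then have X: "prod_list (map (\<lambda>j. 1 - real (d * n) / real j) [1..<Suc K]) = 0" by (simp only: prod_list_zero_iff)
    have Y: "\<not> (\<forall>x\<in>set (p y). a < \<bar>x\<bar>)" using False by (auto simp: n_def filter_empty_conv not_le)
    show ?thesis unfolding e X if_not_P[OF Y] ..
  qed
qed

text \<open>The condition \<open>d * L = K\<close> for both configurations lets one and the same
  list of test functions detect emptiness on either side.\<close>

theorem void_agree:
  assumes A: "linstat M1 w1 p1 e1 L1" and B: "linstat M2 w2 p2 e2 L2"
    and d: "d1 * L1 = K" "1 \<le> d1" "d2 * L2 = K" "1 \<le> d2" "1 \<le> K"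
    and gA: "\<And>\<phi>. \<phi> \<in> evenpow \<Longrightarrow> gd M1 (real d1 / 2) p1 \<phi>" and gB: "\<And>\<phi>. \<phi> \<in> evenpow \<Longrightarrow> gd M2 (real d2 / 2) p2 \<phi>"
    and ag: "\<And>\<phi>s. set \<phi>s \<subseteq> evenpow \<Longrightarrow> (LINT y|M1. w1 y * prod_list (map (\<lambda>\<phi>. lst (real d1 / 2) p1 \<phi> y) \<phi>s)) = (LINT y|M2. w2 y * prod_list (map (\<lambda>\<phi>. lst (real d2 / 2) p2 \<phi> y) \<phi>s))"
  shows "(LINT y|M1. w1 y * (if \<forall>x\<in>set (p1 y). a < \<bar>x\<bar> then 1 else 0)) = (LINT y|M2. w2 y * (if \<forall>x\<in>set (p2 y). a < \<bar>x\<bar> then 1 else 0))"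
proof -
  have "(LINT y|M1. w1 y * prod_list (map (\<lambda>\<phi>. lst (real d1 / 2) p1 \<phi> y) (void_list K a @ []))) = (LINT y|M2. w2 y * prod_list (map (\<lambda>\<phi>. lst (real d2 / 2) p2 \<phi> y) (void_list K a @ [])))"
  proof (rule mcl_agree[where T = evenpow, OF A B])
    show "gd M1 (real d1 / 2) p1 \<phi>" if "\<phi> \<in> evenpow" for \<phi> by (rule gA[OF that])
    show "gd M2 (real d2 / 2) p2 \<phi>" if "\<phi> \<in> evenpow" for \<phi> by (rule gB[OF that])
    show "mcl evenpow \<phi>" if "\<phi> \<in> set (void_list K a)" for \<phi> by (rule mcl_void_list[OF that])
    show "set [] \<subseteq> evenpow" by simp
  qed (rule ag)
  moreover have "prod_list (map (\<lambda>\<phi>. lst (real d1 / 2) p1 \<phi> y) (void_list K a)) = (if \<forall>x\<in>set (p1 y). a < \<bar>x\<bar> then 1 else 0)" for y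
    by (rule void_prod[where p = p1 and y = y, OF linstat.len[OF A, of y] d(1,2,5)])
  moreover have "prod_list (map (\<lambda>\<phi>. lst (real d2 / 2) p2 \<phi> y) (void_list K a)) = (if \<forall>x\<in>set (p2 y). a < \<bar>x\<bar> then 1 else 0)" for y
    by (rule void_prod[where p = p2 and y = y, OF linstat.len[OF B, of y] d(3,4,5)])
  ultimately show ?thesis by (simp only: append_Nil2)
qed

section \<open>The spectrum of the aGUE matrix\<close>

lemma mat_mult_entry:
  assumes "A \<in> carrier_mat n n" "B \<in> carrier_mat n n" "i < n" "j < n"
  shows "(A * B) $$ (i, j) = (\<Sum>r<n. A $$ (i, r) * B $$ (r, j))"
proof -
  have "(A * B) $$ (i, j) = row A i \<bullet> col B j" using assms by simp
  also have "\<dots> = (\<Sum>r = 0..<n. row A i $ r * col B j $ r)" using assms by (simp add: scalar_prod_def)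
  also have "\<dots> = (\<Sum>r<n. A $$ (i, r) * B $$ (r, j))"
    unfolding atLeast0LessThan by (rule sum.cong[OF refl]) (use assms in simp)
  finally show ?thesis .
qed

lemma trace_mult_commute:
  fixes A B :: "'b :: comm_ring_1 mat"
  assumes "A \<in> carrier_mat n n" "B \<in> carrier_mat n n"
  shows "(\<Sum>i<n. (A * B) $$ (i, i)) = (\<Sum>i<n. (B * A) $$ (i, i))"
proof -
  have "(\<Sum>i<n. (A * B) $$ (i, i)) = (\<Sum>i<n. \<Sum>r<n. A $$ (i, r) * B $$ (r, i))"
    by (rule sum.cong[OF refl]) (rule mat_mult_entry[OF assms], simp_all)
  also have "\<dots> = (\<Sum>r<n. \<Sum>i<n. A $$ (i, r) * B $$ (r, i))" by (rule sum.swap)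
  also have "\<dots> = (\<Sum>i<n. (B * A) $$ (i, i))"
  proof (rule sum.cong[OF refl])
    fix r assume "r \<in> {..<n}"
    then have "(B * A) $$ (r, r) = (\<Sum>i<n. B $$ (r, i) * A $$ (i, r))" using mat_mult_entry[OF assms(2,1)] by simp
    then show "(\<Sum>i<n. A $$ (i, r) * B $$ (r, i)) = (B * A) $$ (r, r)" by (simp add: mult.commute)
  qed
  finally show ?thesis .
qed

lemma upper_triangular_pow:
  fixes B :: "'b :: comm_ring_1 mat"
  assumes B: "B \<in> carrier_mat n n" and u: "\<And>i j. j < i \<Longrightarrow> i < n \<Longrightarrow> B $$ (i, j) = 0"
  shows "i < n \<Longrightarrow> j \<le> i \<Longrightarrow> (B ^\<^sub>m m) $$ (i, j) = (if i = j then B $$ (i, i) ^ m else 0)"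
proof (induction m arbitrary: i j)
  case 0
  then show ?case using B by simp
next
  case (Suc m)
  have "(B ^\<^sub>m Suc m) $$ (i, j) = (\<Sum>r<n. (B ^\<^sub>m m) $$ (i, r) * B $$ (r, j))"
    using mat_mult_entry[OF pow_carrier_mat[OF B, of m] B Suc.prems(1), of j] Suc.prems by simp
  also have "\<dots> = (\<Sum>r<n. if r = i then (if i = j then B $$ (i, i) ^ Suc m else 0) else 0)"
  proof (rule sum.cong[OF refl])
    fix r assume "r \<in> {..<n}"
    then have r: "r < n" by simp
    consider "r < i" | "r = i" | "i < r" by linarith
    then show "(B ^\<^sub>m m) $$ (i, r) * B $$ (r, j) = (if r = i then (if i = j then B $$ (i, i) ^ Suc m else 0) else 0)"
    proof cases
      case 1
      then show ?thesis using Suc.IH[of i r] Suc.prems by simp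
    next
      case 2
      then show ?thesis using Suc.IH[of i i] Suc.prems u[of j i] by (cases "i = j") (simp_all add: mult.commute)
    next
      case 3
      then show ?thesis using u[of j r] r Suc.prems by simp
    qed
  qed
  also have "\<dots> = (if i = j then B $$ (i, i) ^ Suc m else 0)" using Suc.prems(1) by simp
  finally show ?case .
qed

text \<open>Schur triangularisation puts the roots of the characteristic polynomial, with
  multiplicity, on a diagonal whose powers are entrywise.\<close>

lemma trace_pow_eigenvalues:
  fixes A :: "complex mat"
  assumes A: "A \<in> carrier_mat n n" and c: "char_poly A = (\<Prod>a\<leftarrow>as. [:- a, 1:])"
  shows "(\<Sum>i<n. (A ^\<^sub>m m) $$ (i, i)) = sum_list (map (\<lambda>a. a ^ m) as)"
proof -
  obtain B P Q where s: "schur_decomposition A as = (B, P, Q)" by (cases "schur_decomposition A as") auto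
  from schur_decomposition[OF A c s] have w: "similar_mat_wit A B P Q" and u: "upper_triangular B" and d: "diag_mat B = as" by auto
  note D = similar_mat_witD2[OF A w]
  note W = similar_mat_witD2[OF pow_carrier_mat[OF A] similar_mat_wit_pow[OF w, of m]]
  have Bm: "B ^\<^sub>m m \<in> carrier_mat n n" by (rule pow_carrier_mat[OF D(5)])
  have "A ^\<^sub>m m = P * (B ^\<^sub>m m * Q)" using W(3) assoc_mult_mat[OF D(6) Bm D(7)] by simp
  then have "(\<Sum>i<n. (A ^\<^sub>m m) $$ (i, i)) = (\<Sum>i<n. ((B ^\<^sub>m m * Q) * P) $$ (i, i))"
    using trace_mult_commute[OF D(6) mult_carrier_mat[OF Bm D(7)]] by simp
  also have "(B ^\<^sub>m m * Q) * P = B ^\<^sub>m m" using assoc_mult_mat[OF Bm D(7) D(6)] D(2) right_mult_one_mat[OF Bm] by simp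
  also have "(\<Sum>i<n. (B ^\<^sub>m m) $$ (i, i)) = (\<Sum>i<n. B $$ (i, i) ^ m)"
  proof (rule sum.cong[OF refl])
    fix i assume "i \<in> {..<n}"
    then have i: "i < n" by simp
    have "B $$ (i, j) = 0" if "j < i" "i < n" for i j using upper_triangularD[OF u that(1)] that D(5) by simp
    from upper_triangular_pow[OF D(5) this i order.refl] show "(B ^\<^sub>m m) $$ (i, i) = B $$ (i, i) ^ m" by simp
  qed
  also have "\<dots> = sum_list (map (\<lambda>i. B $$ (i, i) ^ m) [0..<n])"
    by (simp add: interv_sum_list_conv_sum_set_nat atLeast0LessThan)
  also have "\<dots> = sum_list (map (\<lambda>a. a ^ m) as)"
    unfolding d[symmetric] diag_mat_def using D(5) by (simp add: o_def)
  finally show ?thesis .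
qed

lemma aGUE_carrier: "aGUE_mat l Y \<in> carrier_mat l l" by (simp add: aGUE_mat_def)

lemma aGUE_entry: "i < l \<Longrightarrow> j < l \<Longrightarrow> aGUE_mat l Y $$ (i, j) = \<i> * complex_of_real (Am i j Y)"
  by (simp add: aGUE_mat_def Am_def)

lemma Apow_one: "j < l \<Longrightarrow> Apow l 1 r j y = Am r j y"
proof -
  assume j: "j < l"
  have "Apow l 1 r j y = (\<Sum>s<l. if s = j then Am r j y else 0)"
    unfolding One_nat_def Apow.simps by (rule sum.cong[OF refl]) simp
  then show ?thesis using j by simp
qed

lemma aGUE_pow: "i < l \<Longrightarrow> j < l \<Longrightarrow> (aGUE_mat l Y ^\<^sub>m m) $$ (i, j) = \<i> ^ m * complex_of_real (Apow l m i j Y)"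
proof (induction m arbitrary: j)
  case 0
  then show ?case using aGUE_carrier[of l Y] by simp
next
  case (Suc m)
  have "(aGUE_mat l Y ^\<^sub>m Suc m) $$ (i, j) = (\<Sum>r<l. (aGUE_mat l Y ^\<^sub>m m) $$ (i, r) * aGUE_mat l Y $$ (r, j))"
    using mat_mult_entry[OF pow_carrier_mat[OF aGUE_carrier, of _ _ m] aGUE_carrier Suc.prems] by simp
  also have "\<dots> = (\<Sum>r<l. \<i> ^ Suc m * complex_of_real (Apow l m i r Y * Apow l 1 r j Y))"
  proof (rule sum.cong[OF refl])
    fix r assume "r \<in> {..<l}"
    then have r: "r < l" by simp
    show "(aGUE_mat l Y ^\<^sub>m m) $$ (i, r) * aGUE_mat l Y $$ (r, j) = \<i> ^ Suc m * complex_of_real (Apow l m i r Y * Apow l 1 r j Y)"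
      unfolding Suc.IH[OF Suc.prems(1) r] aGUE_entry[OF r Suc.prems(2)] Apow_one[OF Suc.prems(2)] by (simp add: mult_ac)
  qed
  also have "\<dots> = \<i> ^ Suc m * complex_of_real (\<Sum>r<l. Apow l m i r Y * Apow l 1 r j Y)"
    by (simp only: sum_distrib_left of_real_sum)
  also have "\<dots> = \<i> ^ Suc m * complex_of_real (Apow l (Suc m) i j Y)"
    unfolding Apow_add[OF Suc.prems(1)] by simp
  finally show ?case .
qed

lemma aGUE_eigenvalue_iff:
  "eigenvalue (aGUE_mat l Y) x \<longleftrightarrow> (\<exists>v :: nat \<Rightarrow> complex. (\<exists>i<l. v i \<noteq> 0) \<and> (\<forall>i<l. (\<Sum>j<l. \<i> * complex_of_real (Am i j Y) * v j) = x * v i))"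
proof -
  have e: "(aGUE_mat l Y *\<^sub>v v) $ i = (\<Sum>j<l. \<i> * complex_of_real (Am i j Y) * v $ j)" if "v \<in> carrier_vec l" "i < l" for v i
  proof -
    have "(aGUE_mat l Y *\<^sub>v v) $ i = (\<Sum>j = 0..<l. row (aGUE_mat l Y) i $ j * v $ j)"
      using that aGUE_carrier[of l Y] by (simp add: scalar_prod_def)
    also have "\<dots> = (\<Sum>j<l. \<i> * complex_of_real (Am i j Y) * v $ j)"
      unfolding atLeast0LessThan
      by (rule sum.cong[OF refl]) (use that aGUE_carrier[of l Y] in \<open>simp add: aGUE_entry\<close>)
    finally show ?thesis .
  qed
  have dr: "dim_row (aGUE_mat l Y) = l" using aGUE_carrier[of l Y] by simp
  show ?thesis
  proof
    assume "eigenvalue (aGUE_mat l Y) x"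
    then obtain v where v: "v \<in> carrier_vec l" "v \<noteq> 0\<^sub>v l" "aGUE_mat l Y *\<^sub>v v = x \<cdot>\<^sub>v v"
      unfolding eigenvalue_def eigenvector_def dr by auto
    have "\<exists>i<l. v $ i \<noteq> 0"
    proof (rule ccontr)
      assume "\<not> ?thesis"
      then have "v = 0\<^sub>v l" using v(1) by (intro eq_vecI) auto
      then show False using v(2) by simp
    qed
    moreover have "(\<Sum>j<l. \<i> * complex_of_real (Am i j Y) * v $ j) = x * v $ i" if "i < l" for i
      using e[OF v(1) that] v that by simp
    ultimately show "\<exists>v :: nat \<Rightarrow> complex. (\<exists>i<l. v i \<noteq> 0) \<and> (\<forall>i<l. (\<Sum>j<l. \<i> * complex_of_real (Am i j Y) * v j) = x * v i)"
      by (intro exI[of _ "\<lambda>i. v $ i"] conjI allI impI)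
  next
    assume "\<exists>v :: nat \<Rightarrow> complex. (\<exists>i<l. v i \<noteq> 0) \<and> (\<forall>i<l. (\<Sum>j<l. \<i> * complex_of_real (Am i j Y) * v j) = x * v i)"
    then obtain v where vv: "(\<exists>i<l. v i \<noteq> 0) \<and> (\<forall>i<l. (\<Sum>j<l. \<i> * complex_of_real (Am i j Y) * v j) = x * v i)" ..
    note v = vv[THEN conjunct1] vv[THEN conjunct2]
    have c: "vec l v \<in> carrier_vec l" by simp
    have "vec l v \<noteq> 0\<^sub>v l"
    proof
      assume h: "vec l v = 0\<^sub>v l"
      from v(1) obtain i where i: "i < l" "v i \<noteq> 0" by (elim exE conjE)
      have "vec l v $ i = 0\<^sub>v l $ i" by (simp only: h)
      then show False using i by simp
    qed
    moreover have "aGUE_mat l Y *\<^sub>v vec l v = x \<cdot>\<^sub>v vec l v"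
    proof (rule eq_vecI)
      fix i assume "i < dim_vec (x \<cdot>\<^sub>v vec l v)"
      then have i: "i < l" by simp
      have "(\<Sum>j<l. \<i> * complex_of_real (Am i j Y) * vec l v $ j) = (\<Sum>j<l. \<i> * complex_of_real (Am i j Y) * v j)"
        by (rule sum.cong[OF refl]) simp
      then show "(aGUE_mat l Y *\<^sub>v vec l v) $ i = (x \<cdot>\<^sub>v vec l v) $ i"
        using e[OF c i] v(2) i by simp
    qed (use dr in simp)
    ultimately show "eigenvalue (aGUE_mat l Y) x" unfolding eigenvalue_def eigenvector_def dr using c by blast
  qed
qed

text \<open>The quadratic form of an eigenvector equals x times a positive number, and antisymmetry
  makes it its own conjugate.\<close>

lemma aGUE_eigenvalue_real:
  assumes "eigenvalue (aGUE_mat l Y) x"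
  shows "x = complex_of_real (Re x)"
proof -
  from assms obtain v where vv: "(\<exists>i<l. v i \<noteq> 0) \<and> (\<forall>i<l. (\<Sum>j<l. \<i> * complex_of_real (Am i j Y) * v j) = x * v i)"
    unfolding aGUE_eigenvalue_iff ..
  note v0 = vv[THEN conjunct1] and v = vv[THEN conjunct2]
  define R where "R = (\<Sum>i<l. (cmod (v i))\<^sup>2)"
  have R: "R \<noteq> 0"
  proof -
    obtain i where i: "i < l" "v i \<noteq> 0" using v0 by (elim exE conjE)
    have "0 < (cmod (v i))\<^sup>2" using i(2) by simp
    also have "\<dots> \<le> R" unfolding R_def by (rule member_le_sum) (use i in simp_all)
    finally show ?thesis by simp
  qed
  define q where "q = (\<Sum>i<l. \<Sum>j<l. cnj (v i) * (\<i> * complex_of_real (Am i j Y) * v j))"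
  have "q = (\<Sum>i<l. cnj (v i) * (x * v i))"
    unfolding q_def sum_distrib_left[symmetric] by (rule sum.cong[OF refl]) (simp only: v[rule_format] lessThan_iff)
  also have "\<dots> = (\<Sum>i<l. x * complex_of_real ((cmod (v i))\<^sup>2))"
    by (rule sum.cong[OF refl]) (simp only: complex_norm_square mult_ac)
  also have "\<dots> = x * complex_of_real R" by (simp only: R_def sum_distrib_left of_real_sum)
  finally have q: "q = x * complex_of_real R" .
  have "cnj q = (\<Sum>i<l. \<Sum>j<l. v i * (- \<i> * complex_of_real (Am i j Y) * cnj (v j)))"
    unfolding q_def by (simp only: cnj_sum complex_cnj_mult complex_cnj_cnj complex_cnj_i complex_cnj_complex_of_real)
  also have "\<dots> = (\<Sum>i<l. \<Sum>j<l. cnj (v j) * (\<i> * complex_of_real (Am j i Y) * v i))"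
  proof (intro sum.cong refl)
    fix i j
    have "complex_of_real (Am i j Y) = - complex_of_real (Am j i Y)" using Am_antisym[of i j Y] by simp
    then show "v i * (- \<i> * complex_of_real (Am i j Y) * cnj (v j)) = cnj (v j) * (\<i> * complex_of_real (Am j i Y) * v i)" by simp
  qed
  also have "\<dots> = q" unfolding q_def by (rule sum.swap)
  finally have "cnj x * complex_of_real R = x * complex_of_real R" unfolding q by simp
  then have "cnj x = x" using R by simp
  then show ?thesis by (simp add: complex_eq_iff)
qed

text \<open>The matrix is i times a real one, so conjugating an eigenvector reverses the sign of its
  real eigenvalue.\<close>

lemma aGUE_eigenvalue_uminus:
  assumes "eigenvalue (aGUE_mat l Y) (complex_of_real x)"
  shows "eigenvalue (aGUE_mat l Y) (complex_of_real (- x))"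
proof -
  from assms obtain v where vv: "(\<exists>i<l. v i \<noteq> 0) \<and> (\<forall>i<l. (\<Sum>j<l. \<i> * complex_of_real (Am i j Y) * v j) = complex_of_real x * v i)"
    unfolding aGUE_eigenvalue_iff ..
  note v0 = vv[THEN conjunct1] and v = vv[THEN conjunct2]
  have "(\<Sum>j<l. \<i> * complex_of_real (Am i j Y) * cnj (v j)) = complex_of_real (- x) * cnj (v i)" if "i < l" for i
  proof -
    have "(\<Sum>j<l. \<i> * complex_of_real (Am i j Y) * cnj (v j)) = (\<Sum>j<l. - cnj (\<i> * complex_of_real (Am i j Y) * v j))"
      by (rule sum.cong[OF refl]) simp
    also have "\<dots> = - cnj (\<Sum>j<l. \<i> * complex_of_real (Am i j Y) * v j)" by (simp only: sum_negf cnj_sum)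
    also have "\<dots> = - cnj (complex_of_real x * v i)" using v that by simp
    finally show ?thesis by simp
  qed
  then show ?thesis unfolding aGUE_eigenvalue_iff using v0
    by (intro exI[of _ "\<lambda>j. cnj (v j)"] conjI allI impI) simp_all
qed

lemma aGUE_spectrum:
  "\<exists>es :: real list. length es = l \<and> (\<forall>x. eigenvalue (aGUE_mat l Y) (complex_of_real x) \<longleftrightarrow> x \<in> set es) \<and> (\<forall>m. sum_list (map (\<lambda>x. x ^ (2 * m)) es) = 2 * PA l m Y)"
proof -
  let ?A = "aGUE_mat l Y"
  from char_poly_factorized[OF aGUE_carrier[of l Y]] obtain as where as: "char_poly ?A = (\<Prod>a\<leftarrow>as. [:- a, 1:])" "length as = l" by (elim exE conjE)
  have "poly (\<Prod>a\<leftarrow>bs. [:- a, 1:]) x = 0 \<longleftrightarrow> x \<in> set bs" for bs and x :: complex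
    by (induction bs) auto
  then have eig: "eigenvalue ?A x \<longleftrightarrow> x \<in> set as" for x
    unfolding eigenvalue_root_char_poly[OF aGUE_carrier] as(1) .
  have re: "a = complex_of_real (Re a)" if "a \<in> set as" for a
    by (rule aGUE_eigenvalue_real) (use eig that in blast)
  have as': "as = map complex_of_real (map Re as)"
    unfolding map_map by (rule map_idI[symmetric]) (simp add: re[symmetric])
  show ?thesis
  proof (intro exI[of _ "map Re as"] conjI allI)
    show "length (map Re as) = l" using as(2) by simp
    fix x
    show "eigenvalue ?A (complex_of_real x) \<longleftrightarrow> x \<in> set (map Re as)"
    proof
      assume "eigenvalue ?A (complex_of_real x)"
      then have "complex_of_real x \<in> set as" by (simp only: eig)
      then have "Re (complex_of_real x) \<in> Re ` set as" by (rule imageI)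
      then show "x \<in> set (map Re as)" by simp
    next
      assume "x \<in> set (map Re as)"
      then obtain a where a: "a \<in> set as" "x = Re a" by auto
      show "eigenvalue ?A (complex_of_real x)" unfolding eig a(2) re[OF a(1), symmetric] by (rule a(1))
    qed
  next
    fix m
    have "complex_of_real (sum_list (map (\<lambda>x. x ^ (2 * m)) (map Re as))) = sum_list (map (\<lambda>a. a ^ (2 * m)) (map complex_of_real (map Re as)))"
    proof -
      have "complex_of_real (sum_list (map (\<lambda>x. x ^ (2 * m)) xs)) = sum_list (map (\<lambda>a. a ^ (2 * m)) (map complex_of_real xs))" for xs
        by (induction xs) simp_all
      then show ?thesis .
    qed
    also have "\<dots> = (\<Sum>i<l. (?A ^\<^sub>m (2 * m)) $$ (i, i))"
      unfolding as'[symmetric] by (rule trace_pow_eigenvalues[OF aGUE_carrier as(1), symmetric])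
    also have "\<dots> = (\<Sum>i<l. complex_of_real ((- 1) ^ m * Apow l (2 * m) i i Y))"
      by (rule sum.cong[OF refl]) (simp add: aGUE_pow power_mult)
    also have "\<dots> = complex_of_real (2 * PA l m Y)"
      by (simp only: of_real_sum[symmetric] sum_distrib_left[symmetric] PA_def trA_def) simp
    finally show "sum_list (map (\<lambda>x. x ^ (2 * m)) (map Re as)) = 2 * PA l m Y" by (simp only: of_real_eq_iff)
  qed
qed

text \<open>An enumeration with multiplicity, chosen separately for each \<open>Y\<close>. No
  measurability of the choice is claimed; it is used through symmetric functions of the
  list.\<close>

definition spec :: "nat \<Rightarrow> (nat \<times> nat \<Rightarrow> real) \<Rightarrow> real list" where
  "spec l Y = (SOME es. length es = l \<and> (\<forall>x. eigenvalue (aGUE_mat l Y) (complex_of_real x) \<longleftrightarrow> x \<in> set es) \<and> (\<forall>m. sum_list (map (\<lambda>x. x ^ (2 * m)) es) = 2 * PA l m Y))"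

lemma spec_properties:
  "length (spec l Y) = l" "eigenvalue (aGUE_mat l Y) (complex_of_real x) \<longleftrightarrow> x \<in> set (spec l Y)"
  "sum_list (map (\<lambda>x. x ^ (2 * m)) (spec l Y)) = 2 * PA l m Y"
proof -
  note h = someI_ex[OF aGUE_spectrum[of l Y], folded spec_def]
  show "length (spec l Y) = l" by (rule h[THEN conjunct1])
  show "eigenvalue (aGUE_mat l Y) (complex_of_real x) \<longleftrightarrow> x \<in> set (spec l Y)" by (rule h[THEN conjunct2, THEN conjunct1, rule_format])
  show "sum_list (map (\<lambda>x. x ^ (2 * m)) (spec l Y)) = 2 * PA l m Y" by (rule h[THEN conjunct2, THEN conjunct2, rule_format])
qed

lemma spec_uminus: "x \<in> set (spec l Y) \<Longrightarrow> - x \<in> set (spec l Y)"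
  unfolding spec_properties(2)[symmetric] by (rule aGUE_eigenvalue_uminus)

text \<open>x^2 is at most the trace of M^2, which is the squared Frobenius norm of A; its root is
  at most the sum of the absolute entries.\<close>

lemma spec_bound:
  assumes "x \<in> set (spec l Y)"
  shows "\<bar>x\<bar> \<le> (\<Sum>d\<in>idx l. \<bar>Y d\<bar>)"
proof -
  have "x\<^sup>2 \<le> sum_list (map (\<lambda>x. x\<^sup>2) xs)" if "x \<in> set xs" for xs
    using that
  proof (induction xs)
    case (Cons y xs)
    have "0 \<le> sum_list (map (\<lambda>x::real. x\<^sup>2) xs)" by (rule sum_list_nonneg) auto
    then show ?case using Cons by (cases "x = y") (auto intro: add_increasing)
  qed simp
  from this[OF assms] have "x\<^sup>2 \<le> 2 * PA l 1 Y" using spec_properties(3)[of 1 l Y] by simp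
  also have "\<dots> = (\<Sum>i<l. - Apow l 2 i i Y)" by (simp add: PA_def trA_def sum_negf)
  also have "\<dots> = (\<Sum>i<l. \<Sum>j<l. (Am i j Y)\<^sup>2)"
  proof (rule sum.cong[OF refl])
    fix i assume "i \<in> {..<l}"
    then have i: "i < l" by simp
    have "Apow l 2 i i Y = (\<Sum>r<l. Am i r Y * Apow l 1 r i Y)" unfolding numeral_2_eq_2 One_nat_def by (rule Apow.simps(2))
    also have "\<dots> = (\<Sum>r<l. - ((Am i r Y)\<^sup>2))"
      unfolding Apow_one[OF i] by (rule sum.cong[OF refl]) (simp add: Am_def power2_eq_square field_simps)
    finally show "- Apow l 2 i i Y = (\<Sum>j<l. (Am i j Y)\<^sup>2)" by (simp add: sum_negf)
  qed
  also have "\<dots> = (\<Sum>d\<in>idx l. (Am (fst d) (snd d) Y)\<^sup>2)" unfolding sum.cartesian_product by (simp add: case_prod_unfold)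
  finally have "sqrt (x\<^sup>2) \<le> L2_set (\<lambda>d. Am (fst d) (snd d) Y) (idx l)" unfolding L2_set_def by (rule real_sqrt_le_mono)
  also have "\<dots> \<le> (\<Sum>d\<in>idx l. \<bar>Am (fst d) (snd d) Y\<bar>)" by (rule L2_set_le_sum_abs)
  also have "\<dots> \<le> (\<Sum>d\<in>idx l. \<bar>Y (fst d, snd d)\<bar> / 2 + \<bar>Y (snd d, fst d)\<bar> / 2)"
    by (rule sum_mono) (simp add: Am_def)
  also have "\<dots> = (\<Sum>i<l. \<Sum>j<l. \<bar>Y (i, j)\<bar> / 2) + (\<Sum>i<l. \<Sum>j<l. \<bar>Y (j, i)\<bar> / 2)"
    unfolding sum.distrib sum.cartesian_product by (simp add: case_prod_unfold)
  also have "(\<Sum>i<l. \<Sum>j<l. \<bar>Y (j, i)\<bar> / 2) = (\<Sum>i<l. \<Sum>j<l. \<bar>Y (i, j)\<bar> / 2)" by (rule sum.swap)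
  also have "(\<Sum>i<l. \<Sum>j<l. \<bar>Y (i, j)\<bar> / 2) + (\<Sum>i<l. \<Sum>j<l. \<bar>Y (i, j)\<bar> / 2) = (\<Sum>i<l. \<Sum>j<l. \<bar>Y (i, j)\<bar>)"
    by (simp only: sum.distrib[symmetric] field_sum_of_halves)
  also have "\<dots> = (\<Sum>d\<in>idx l. \<bar>Y d\<bar>)" unfolding sum.cartesian_product by (simp add: case_prod_unfold)
  finally show ?thesis by simp
qed

lemma power_le_fact_exp: "0 \<le> z \<Longrightarrow> z ^ n \<le> fact n * exp (z::real)"
proof -
  assume z: "0 \<le> z"
  have "z ^ n /\<^sub>R fact n \<le> (\<Sum>i<Suc n. z ^ i /\<^sub>R fact i)"
    by (rule member_le_sum) (use z in simp_all)
  also have "\<dots> \<le> exp z" unfolding exp_def by (rule sum_le_suminf[OF summable_exp_generic]) (use z in auto)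
  finally have "fact n * (z ^ n /\<^sub>R fact n) \<le> fact n * exp z" by (rule mult_left_mono) simp
  moreover have "fact n * (z ^ n /\<^sub>R fact n) = z ^ n" by (simp add: field_simps)
  ultimately show ?thesis by (simp only:)
qed

lemma expbd_evenpow: "\<phi> \<in> evenpow \<Longrightarrow> expbd \<phi>"
proof -
  assume "\<phi> \<in> evenpow"
  then obtain m where m: "\<phi> = (\<lambda>x. x ^ (2 * m))" by auto
  show ?thesis unfolding m
  proof (rule expbdI[of _ "fact (2 * m)" 1])
    fix x :: real
    show "\<bar>x ^ (2 * m)\<bar> \<le> fact (2 * m) * exp (1 * \<bar>x\<bar>)"
      using power_le_fact_exp[of "\<bar>x\<bar>" "2 * m"] by (simp only: power_abs mult_1_left abs_ge_zero)
  qed simp_all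
qed

lemma linstat_aGUE: "linstat (gauss (idx l)) (\<lambda>_. 1) (spec l) (\<lambda>Y. \<Sum>d\<in>idx l. \<bar>Y d\<bar>) l"
proof (rule linstat.intro)
  show "(\<lambda>_. 1::real) \<in> borel_measurable (gauss (idx l))" by simp
  show "\<bar>x\<bar> \<le> (\<Sum>d\<in>idx l. \<bar>Y d\<bar>)" if "x \<in> set (spec l Y)" for x Y by (rule spec_bound[OF that])
  show "length (spec l Y) = l" for Y by (rule spec_properties(1))
  fix m :: real
  have "integrable (gauss (idx l)) (expsum (idx l) m)" by (rule integrable_expsum) simp
  moreover have "expsum (idx l) m = (\<lambda>Y. 1 * exp (m * (\<Sum>d\<in>idx l. \<bar>Y d\<bar>)))" by (rule ext) (simp only: expsum_def mult_1_left)
  ultimately show "integrable (gauss (idx l)) (\<lambda>Y. 1 * exp (m * (\<Sum>d\<in>idx l. \<bar>Y d\<bar>)))" by simp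
qed

lemma lst_spec: "lst (real 1 / 2) (spec l) (\<lambda>x. x ^ (2 * m)) Y = PA l m Y"
  unfolding lst_def spec_properties(3) by simp

lemma gd_spec:
  assumes "\<phi> \<in> evenpow"
  shows "gd (gauss (idx l)) (real 1 / 2) (spec l) \<phi>"
proof -
  from assms obtain m where m: "\<phi> = (\<lambda>x. x ^ (2 * m))" by auto
  have e: "lst (real 1 / 2) (spec l) \<phi> = PA l m" unfolding m by (rule ext) (rule lst_spec)
  have "lst (real 1 / 2) (spec l) \<phi> \<in> borel_measurable (gauss (idx l))" unfolding e by (rule polyfun_measurable[OF polyfun_PA])
  then show ?thesis unfolding gd_def using expbd_evenpow[OF assms] by (rule conjI)
qed

definition halfpts :: "nat \<Rightarrow> (nat \<Rightarrow> real) \<Rightarrow> real list" where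
  "halfpts k y = map (\<lambda>i. y i / sqrt 2) [0..<k]"

lemma linstat_density: "linstat (gauss {..<k}) (wZ k) (halfpts k) (\<lambda>y. \<Sum>d<k. \<bar>y d\<bar>) k"
proof (rule linstat.intro)
  show "wZ k \<in> borel_measurable (gauss {..<k})" by (rule polyfun_measurable[OF polyfun_wZ])
  show "length (halfpts k y) = k" for y by (simp add: halfpts_def)
  show "\<bar>x\<bar> \<le> (\<Sum>d<k. \<bar>y d\<bar>)" if x: "x \<in> set (halfpts k y)" for x y
  proof -
    obtain i where i: "i < k" "x = y i / sqrt 2" using x by (auto simp: halfpts_def)
    have "\<bar>x\<bar> = \<bar>y i\<bar> / sqrt 2" by (simp add: i(2) abs_divide)
    also have "\<dots> \<le> \<bar>y i\<bar> / 1" by (rule divide_left_mono) simp_all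
    also have "\<dots> \<le> (\<Sum>d<k. \<bar>y d\<bar>)" unfolding div_by_1 by (rule member_le_sum) (use i in simp_all)
    finally show ?thesis .
  qed
  fix m :: real
  have "integrable (gauss {..<k}) (\<lambda>y. wZ k y * expsum {..<k} m y)"
    by (rule polyfun_expsum_integrable[where C = 1 and m = m, OF _ polyfun_wZ expsum_measurable]) (simp_all add: abs_of_nonneg)
  then show "integrable (gauss {..<k}) (\<lambda>y. wZ k y * exp (m * (\<Sum>d<k. \<bar>y d\<bar>)))" unfolding expsum_def .
qed

lemma lst_halfpts: "lst (real 2 / 2) (halfpts k) (\<lambda>x. x ^ (2 * m)) y = PZ k m y"
proof -
  have "lst (real 2 / 2) (halfpts k) (\<lambda>x. x ^ (2 * m)) y = (\<Sum>i<k. (y i / sqrt 2) ^ (2 * m))"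
    by (simp add: lst_def halfpts_def o_def interv_sum_list_conv_sum_set_nat atLeast0LessThan)
  also have "\<dots> = PZ k m y"
  proof -
    have "(y i / sqrt 2)\<^sup>2 = zf i y" for i by (simp add: power_divide zf_def power2_eq_square)
    then show ?thesis unfolding PZ_def power_mult by simp
  qed
  finally show ?thesis .
qed

lemma gd_halfpts:
  assumes "\<phi> \<in> evenpow"
  shows "gd (gauss {..<k}) (real 2 / 2) (halfpts k) \<phi>"
proof -
  from assms obtain m where m: "\<phi> = (\<lambda>x. x ^ (2 * m))" by auto
  have e: "lst (real 2 / 2) (halfpts k) \<phi> = PZ k m" unfolding m by (rule ext) (rule lst_halfpts)
  have "lst (real 2 / 2) (halfpts k) \<phi> \<in> borel_measurable (gauss {..<k})" unfolding e by (rule polyfun_measurable[OF polyfun_PZ])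
  then show ?thesis unfolding gd_def using expbd_evenpow[OF assms] by (rule conjI)
qed

text \<open>The two loop systems share the constant \<open>P 0\<close>, namely half of the size 2k
  on one side and the number of points k on the other, so \<open>loop_unique\<close>
  applies.\<close>

lemma moments_agree:
  assumes "set \<phi>s \<subseteq> evenpow"
  shows "(LINT Y|gauss (idx (2 * k)). 1 * prod_list (map (\<lambda>\<phi>. lst (real 1 / 2) (spec (2 * k)) \<phi> Y) \<phi>s))
    = (LINT y|gauss {..<k}. wZ k y * prod_list (map (\<lambda>\<phi>. lst (real 2 / 2) (halfpts k) \<phi> y) \<phi>s))"
proof -
  have "\<forall>\<phi>\<in>set \<phi>s. \<exists>m. \<phi> = (\<lambda>x::real. x ^ (2 * m))" using assms by auto
  then have "\<exists>ms. \<phi>s = map (\<lambda>m x. x ^ (2 * m)) ms" unfolding ex_map_conv .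
  then obtain ms where ms: "\<phi>s = map (\<lambda>m x. x ^ (2 * m)) ms" ..
  have "loopsys (gauss (idx (2 * k))) (\<lambda>_. 1) (PA (2 * k)) (real k)" using aGUE_loopsys[of "2 * k"] by simp
  moreover have "loopsys (gauss {..<k}) (wZ k) (PZ k) (real k)" by (rule density_loopsys) (use ZZ_pos[of k] in simp)
  ultimately show ?thesis unfolding ms map_map o_def lst_spec lst_halfpts by (rule loop_unique)
qed

lemma void_transfer:
  assumes "1 \<le> k"
  shows "(LINT Y|gauss (idx (2 * k)). 1 * (if \<forall>x\<in>set (spec (2 * k) Y). a < \<bar>x\<bar> then 1 else 0))
    = (LINT y|gauss {..<k}. wZ k y * (if \<forall>x\<in>set (halfpts k y). a < \<bar>x\<bar> then 1 else 0))"
proof (rule void_agree[where ?d1.0 = 1 and ?d2.0 = 2 and K = "2 * k", OF linstat_aGUE linstat_density])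
  show "1 * (2 * k) = 2 * k" "(1::nat) \<le> 1" "2 * k = 2 * k" "(1::nat) \<le> 2" "1 \<le> 2 * k" using assms by simp_all
  show "gd (gauss (idx (2 * k))) (real 1 / 2) (spec (2 * k)) \<phi>" if "\<phi> \<in> evenpow" for \<phi> by (rule gd_spec[OF that])
  show "gd (gauss {..<k}) (real 2 / 2) (halfpts k) \<phi>" if "\<phi> \<in> evenpow" for \<phi> by (rule gd_halfpts[OF that])
qed (rule moments_agree)

section \<open>Gap probabilities as Hankel determinants\<close>

text \<open>Reflection folds the two tails into one, hence the factor 2. Leaving
  \<open>\<phi>\<close> free on the null set |u| = sqrt 2 a covers both the constant 1 at a = 0 and
  the strict indicator.\<close>

lemma mom_Kint:
  assumes a: "0 \<le> a" and m: "\<phi> \<in> borel_measurable borel" and \<phi>: "\<And>u. \<bar>u\<bar> \<noteq> sqrt 2 * a \<Longrightarrow> \<phi> u = (if sqrt 2 * a < \<bar>u\<bar> then 1 else 0)"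
  shows "mom \<phi> b = (2 / sqrt (2 * pi)) * Kint b a"
proof -
  define F where "F u = indicator {sqrt 2 * a..} u * ((u\<^sup>2 / 2) ^ b * exp (- u\<^sup>2 / 2))" for u :: real
  have Fi: "integrable lborel F"
  proof -
    have "integrable lborel (\<lambda>u. (sqrt (2 * pi) / 2 ^ b) * (std_normal_density u * u ^ (2 * b)))"
      by (rule integrable_mult_right) (rule integrable_std_normal_moment)
    then have "integrable lborel (\<lambda>u. (sqrt (2 * pi) / 2 ^ b) * (std_normal_density u * u ^ (2 * b)) * indicator {sqrt 2 * a..} u)"
      by (rule integrable_real_mult_indicator[rotated]) simp
    moreover have "(\<lambda>u. (sqrt (2 * pi) / 2 ^ b) * (std_normal_density u * u ^ (2 * b)) * indicator {sqrt 2 * a..} u) = F"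
      by (rule ext) (simp add: F_def std_normal_density_def power_divide power_mult)
    ultimately show ?thesis by simp
  qed
  have Fm: "F \<in> borel_measurable borel" using borel_measurable_integrable[OF Fi] by (simp only: measurable_lborel1 measurable_lborel2)
  have "(\<lambda>x::real. - x) \<in> borel_measurable borel" by (rule borel_measurable_continuous_onI) (intro continuous_intros)
  then have um: "uminus \<in> measurable lborel (borel :: real measure)" by (simp only: measurable_lborel1 measurable_lborel2)
  have "(LINT u|lborel. F u) = (LINT u|distr lborel borel uminus. F u)" unfolding lborel_distr_uminus ..
  also have "\<dots> = (LINT u|lborel. F (- u))" by (rule integral_distr[OF um Fm])
  finally have ref: "(LINT u|lborel. F (- u)) = (LINT u|lborel. F u)" ..
  have KF: "(LINT u|lborel. F u) = Kint b a" unfolding Kint_def F_def ..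
  have Fi': "integrable lborel (\<lambda>u. F (- u))"
  proof -
    have "integrable (distr lborel borel uminus) F" unfolding lborel_distr_uminus by (rule Fi)
    then show ?thesis unfolding integrable_distr_eq[OF um Fm] .
  qed
  have mm: "(\<lambda>u. \<phi> u * (u * u / 2) ^ b) \<in> borel_measurable lborel"
    using weighted_power_measurable[OF m] by (simp only: measurable_lborel1 measurable_lborel2)
  have sm: "(\<lambda>u. std_normal_density u) \<in> borel_measurable lborel" by simp
  have "mom \<phi> b = (LINT u|lborel. std_normal_density u *\<^sub>R (\<phi> u * (u * u / 2) ^ b))"
    unfolding mom_def by (rule integral_density[OF mm sm]) simp
  also have "\<dots> = (LINT u|lborel. (1 / sqrt (2 * pi)) * (F u + F (- u)))"
  proof (rule integral_cong_AE)
    show "(\<lambda>u. std_normal_density u *\<^sub>R (\<phi> u * (u * u / 2) ^ b)) \<in> borel_measurable lborel"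
      by (rule borel_measurable_scaleR[OF sm mm])
    show "(\<lambda>u. (1 / sqrt (2 * pi)) * (F u + F (- u))) \<in> borel_measurable lborel"
      by (rule borel_measurable_times[OF borel_measurable_const borel_measurable_add[OF borel_measurable_integrable[OF Fi] borel_measurable_integrable[OF Fi']]])
    show "AE u in lborel. std_normal_density u *\<^sub>R (\<phi> u * (u * u / 2) ^ b) = (1 / sqrt (2 * pi)) * (F u + F (- u))"
      using AE_lborel_singleton[of "sqrt 2 * a"] AE_lborel_singleton[of "- (sqrt 2 * a)"]
    proof eventually_elim
      case (elim u)
      define t where "t = sqrt 2 * a"
      have t: "0 \<le> t" using a by (simp add: t_def)
      have u: "u \<noteq> t" "u \<noteq> - t" using elim by (simp_all add: t_def)
      then have "\<bar>u\<bar> \<noteq> t" by linarith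
      then have p: "\<phi> u = (if t < \<bar>u\<bar> then 1 else 0)" using \<phi>[of u] by (simp add: t_def)
      have i: "\<phi> u = indicator {t..} u + indicator {t..} (- u)"
      proof (cases "t < \<bar>u\<bar>")
        case True
        then consider "t < u" | "u < - t" by linarith
        then show ?thesis
        proof cases
          case 1
          then have "t \<le> u" "\<not> t \<le> - u" using t by linarith+
          then show ?thesis using p True by simp
        next
          case 2
          then have "\<not> t \<le> u" "t \<le> - u" using t by linarith+
          then show ?thesis using p True by simp
        qed
      next
        case False
        then have "\<not> t \<le> u" "\<not> t \<le> - u" using u by linarith+
        then show ?thesis using p False by simp
      qed
      have d: "std_normal_density u = (1 / sqrt (2 * pi)) * exp (- u\<^sup>2 / 2)" by (simp add: std_normal_density_def)
      have s: "u * u = u\<^sup>2" by (simp add: power2_eq_square)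
      have "F u + F (- u) = \<phi> u * ((u\<^sup>2 / 2) ^ b * exp (- u\<^sup>2 / 2))"
        unfolding F_def t_def[symmetric] i by (simp only: power2_minus distrib_right)
      then show ?case unfolding d s by simp
    qed
  qed
  also have "\<dots> = (1 / sqrt (2 * pi)) * ((LINT u|lborel. F u) + (LINT u|lborel. F (- u)))"
    by (simp only: integral_mult_right_zero Bochner_Integration.integral_add[OF Fi Fi'])
  also have "\<dots> = (1 / sqrt (2 * pi)) * (Kint b a + Kint b a)" unfolding ref KF ..
  finally show ?thesis by simp
qed

lemma det_mom:
  assumes "0 \<le> a" "\<phi> \<in> borel_measurable borel" "\<And>u. \<bar>u\<bar> \<noteq> sqrt 2 * a \<Longrightarrow> \<phi> u = (if sqrt 2 * a < \<bar>u\<bar> then 1 else 0)"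
  shows "Determinant.det (Matrix.mat k k (\<lambda>(i, l). mom \<phi> (i + l))) = (2 / sqrt (2 * pi)) ^ k * Kdet k a"
proof -
  have mk: "mom \<phi> b = (2 / sqrt (2 * pi)) * Kint b a" for b by (rule mom_Kint[OF assms(1,2)]) (rule assms(3))
  have "Matrix.mat k k (\<lambda>(i, l). mom \<phi> (i + l)) = (2 / sqrt (2 * pi)) \<cdot>\<^sub>m Matrix.mat k k (\<lambda>(i, l). Kint (i + l) a)"
    unfolding mk by (rule eq_matI) auto
  then show ?thesis by (simp add: Kdet_def)
qed

lemma ZZ_Kdet: "ZZ k = fact k * ((2 / sqrt (2 * pi)) ^ k * Kdet k 0)"
proof -
  have "ZZ k = (LINT y|gauss {..<k}. (\<Prod>i<k. (\<lambda>_. 1) (y i)) * (VZ k y * VZ k y))" unfolding ZZ_def by simp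
  also have "\<dots> = fact k * Determinant.det (Matrix.mat k k (\<lambda>(i, l). mom (\<lambda>_. 1) (i + l)))" by (rule andreief) simp_all
  also have "Determinant.det (Matrix.mat k k (\<lambda>(i, l). mom (\<lambda>_. 1) (i + l))) = (2 / sqrt (2 * pi)) ^ k * Kdet k 0" by (rule det_mom) simp_all
  finally show ?thesis .
qed

lemma Kdet_0_nonzero: "Kdet k 0 \<noteq> 0"
  using ZZ_pos[of k] unfolding ZZ_Kdet by auto

lemma density_void:
  assumes "0 \<le> a"
  shows "(LINT y|gauss {..<k}. wZ k y * (if \<forall>x\<in>set (halfpts k y). a < \<bar>x\<bar> then 1 else 0)) = Kdet k a / Kdet k 0"
proof -
  define \<phi> :: "real \<Rightarrow> real" where "\<phi> u = (if sqrt 2 * a < \<bar>u\<bar> then 1 else 0)" for u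
  have \<phi>m: "\<phi> \<in> borel_measurable borel" unfolding \<phi>_def by measurable
  have e: "(if \<forall>x\<in>set (halfpts k y). a < \<bar>x\<bar> then 1 else 0) = (\<Prod>i<k. \<phi> (y i))" for y
  proof -
    have s: "a < \<bar>y i / sqrt 2\<bar> \<longleftrightarrow> sqrt 2 * a < \<bar>y i\<bar>" for i by (simp add: abs_divide pos_less_divide_eq mult.commute)
    have q: "(\<forall>x\<in>set (halfpts k y). a < \<bar>x\<bar>) \<longleftrightarrow> (\<forall>i<k. sqrt 2 * a < \<bar>y i\<bar>)" unfolding halfpts_def using s by auto
    show ?thesis
    proof (cases "\<forall>i<k. sqrt 2 * a < \<bar>y i\<bar>")
      case True
      then have "(\<Prod>i<k. \<phi> (y i)) = 1" by (intro prod.neutral) (simp add: \<phi>_def)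
      then show ?thesis unfolding q using True by simp
    next
      case False
      then obtain i where i: "i < k" "\<not> sqrt 2 * a < \<bar>y i\<bar>" by auto
      have z: "(\<Prod>i<k. \<phi> (y i)) = 0" by (rule prod_zero, simp, rule bexI[of _ i]) (use i in \<open>simp_all add: \<phi>_def\<close>)
      show ?thesis unfolding q z if_not_P[OF False] ..
    qed
  qed
  have "(LINT y|gauss {..<k}. wZ k y * (if \<forall>x\<in>set (halfpts k y). a < \<bar>x\<bar> then 1 else 0)) = (LINT y|gauss {..<k}. (1 / ZZ k) * ((\<Prod>i<k. \<phi> (y i)) * (VZ k y * VZ k y)))"
    unfolding e wZ_def by (simp only: mult_ac)
  also have "\<dots> = (1 / ZZ k) * (fact k * Determinant.det (Matrix.mat k k (\<lambda>(i, l). mom \<phi> (i + l))))"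
    unfolding integral_mult_right_zero by (subst andreief[OF \<phi>m]) (simp_all add: \<phi>_def)
  also have "Determinant.det (Matrix.mat k k (\<lambda>(i, l). mom \<phi> (i + l))) = (2 / sqrt (2 * pi)) ^ k * Kdet k a"
    by (rule det_mom[OF assms \<phi>m]) (simp add: \<phi>_def)
  finally show ?thesis unfolding ZZ_Kdet by simp
qed

section \<open>Distribution of the smallest positive eigenvalue\<close>

definition cn :: "nat \<Rightarrow> real \<Rightarrow> (nat \<times> nat \<Rightarrow> real) \<Rightarrow> nat" where
  "cn l a Y = length (filter (\<lambda>x. \<bar>x\<bar> \<le> a) (spec l Y))"

text \<open>The count is the linear statistic of an indicator from the closure of the even powers.
  Measurability passes from the traces through that closure, although \<open>spec\<close> is only a
  pointwise choice.\<close>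

lemma cn_measurable: "(\<lambda>Y. real (cn l a Y)) \<in> borel_measurable (gauss (idx l))"
proof -
  have "sum_list (map (\<lambda>x. if \<bar>x\<bar> \<le> a then 1 else 0) xs) = real (length (filter (\<lambda>x. \<bar>x\<bar> \<le> a) xs))" for xs
    by (induction xs) simp_all
  then have e: "real (cn l a Y) = 2 * lst (real 1 / 2) (spec l) (\<lambda>x. if \<bar>x\<bar> \<le> a then 1 else 0) Y" for Y
    by (simp add: lst_def cn_def)
  have "gd (gauss (idx l)) (real 1 / 2) (spec l) (\<lambda>x. if \<bar>x\<bar> \<le> a then 1 else 0)"
    by (rule mcl_gd[OF mcl_indicator]) (rule gd_spec)
  then show ?thesis unfolding e gd_def by (intro borel_measurable_times borel_measurable_const) (elim conjE)
qed

lemma filter_length_less_iff: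
  assumes "\<And>x. P x \<Longrightarrow> Q x"
  shows "length (filter P xs) < length (filter Q xs) \<longleftrightarrow> (\<exists>x\<in>set xs. Q x \<and> \<not> P x)"
proof -
  have "length (filter P xs) \<le> length (filter Q xs) \<and> (length (filter P xs) < length (filter Q xs) \<longleftrightarrow> (\<exists>x\<in>set xs. Q x \<and> \<not> P x))"
  proof (induction xs)
    case (Cons x xs)
    then show ?case using assms[of x] by (cases "P x"; cases "Q x") auto
  qed simp
  then show ?thesis by (rule conjunct2)
qed

lemma cn_less_iff: "0 \<le> a \<Longrightarrow> cn l 0 Y < cn l a Y \<longleftrightarrow> (\<exists>x\<in>set (spec l Y). \<bar>x\<bar> \<le> a \<and> x \<noteq> 0)"
  unfolding cn_def by (subst filter_length_less_iff) auto

lemma cn_full_iff: "cn l 0 Y = l \<longleftrightarrow> (\<forall>x\<in>set (spec l Y). x = 0)"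
proof -
  have "cn l 0 Y < l \<longleftrightarrow> (\<exists>x\<in>set (spec l Y). x \<noteq> 0)"
    using filter_length_less_iff[of "\<lambda>x::real. \<bar>x\<bar> \<le> 0" "\<lambda>_. True" "spec l Y"] by (simp add: cn_def spec_properties(1))
  moreover have "cn l 0 Y \<le> l" using length_filter_le[of "\<lambda>x::real. \<bar>x\<bar> \<le> 0" "spec l Y"] by (simp add: cn_def spec_properties(1))
  ultimately show ?thesis by (metis le_neq_implies_less less_irrefl)
qed

text \<open>By symmetry a nonzero eigenvalue yields a positive one. If all of them are 0, the value
  is the unspecified \<open>Min {}\<close>; the case is kept because measurability concerns every
  \<open>Y\<close>.\<close>

lemma smallest_pos_eigenvalue_le_iff:
  "smallest_pos_eigenvalue (aGUE_mat l Y) \<le> a \<longleftrightarrow>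
    (real (cn l 0 Y) = real l \<and> Min {} \<le> a) \<or> (real (cn l 0 Y) \<noteq> real l \<and> 0 \<le> a \<and> real (cn l 0 Y) < real (cn l a Y))"
proof -
  let ?E = "{x. 0 < x \<and> x \<in> set (spec l Y)}"
  have f: "smallest_pos_eigenvalue (aGUE_mat l Y) = Min ?E" unfolding smallest_pos_eigenvalue_def spec_properties(2) ..
  have fin: "finite ?E" by (rule finite_subset[of _ "set (spec l Y)"]) auto
  show ?thesis
  proof (cases "cn l 0 Y = l")
    case True
    then have "?E = {}" unfolding cn_full_iff by auto
    then have "smallest_pos_eigenvalue (aGUE_mat l Y) = Min {}" unfolding f by (rule arg_cong)
    then show ?thesis using True by simp
  next
    case False
    then obtain x where x: "x \<in> set (spec l Y)" "x \<noteq> 0" unfolding cn_full_iff by auto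
    have ne: "?E \<noteq> {}"
    proof (cases "0 < x")
      case True
      then show ?thesis using x by auto
    next
      case False
      then have "0 < - x" using x(2) by simp
      then show ?thesis using spec_uminus[OF x(1)] by blast
    qed
    have 1: "Min ?E \<le> a \<longleftrightarrow> (\<exists>x\<in>?E. x \<le> a)" by (rule Min_le_iff[OF fin ne])
    have 2: "(\<exists>x\<in>?E. x \<le> a) \<longleftrightarrow> 0 \<le> a \<and> (\<exists>x\<in>set (spec l Y). \<bar>x\<bar> \<le> a \<and> x \<noteq> 0)"
    proof
      assume "\<exists>x\<in>?E. x \<le> a"
      then obtain x where x: "0 < x" "x \<in> set (spec l Y)" "x \<le> a" by auto
      then have "0 \<le> a" "\<bar>x\<bar> \<le> a" "x \<noteq> 0" by auto
      then show "0 \<le> a \<and> (\<exists>x\<in>set (spec l Y). \<bar>x\<bar> \<le> a \<and> x \<noteq> 0)" using x(2) by blast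
    next
      assume h: "0 \<le> a \<and> (\<exists>x\<in>set (spec l Y). \<bar>x\<bar> \<le> a \<and> x \<noteq> 0)"
      then obtain x where x: "x \<in> set (spec l Y)" "\<bar>x\<bar> \<le> a" "x \<noteq> 0" by blast
      have "\<bar>x\<bar> \<in> set (spec l Y)" using x(1) spec_uminus[OF x(1)] by (cases "0 \<le> x") simp_all
      then have "\<bar>x\<bar> \<in> ?E" using x(3) by simp
      then show "\<exists>x\<in>?E. x \<le> a" using x(2) by (rule bexI[rotated])
    qed
    have 3: "0 \<le> a \<and> (\<exists>x\<in>set (spec l Y). \<bar>x\<bar> \<le> a \<and> x \<noteq> 0) \<longleftrightarrow> 0 \<le> a \<and> cn l 0 Y < cn l a Y"
      using cn_less_iff[of a l Y] by (cases "0 \<le> a") simp_all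
    show ?thesis unfolding f 1 2 3 using False by simp
  qed
qed

lemma smallest_pos_eigenvalue_measurable:
  "(\<lambda>Y. smallest_pos_eigenvalue (aGUE_mat l Y)) \<in> borel_measurable (gauss (idx l))"
  unfolding borel_measurable_iff_le
proof
  fix a
  let ?M = "gauss (idx l)"
  define V where "V = (\<lambda>Y. real (cn l 0 Y)) -` {real l} \<inter> space ?M"
  define D where "D = (\<lambda>Y. real (cn l a Y) - real (cn l 0 Y)) -` {0<..} \<inter> space ?M"
  have V: "V \<in> sets ?M" unfolding V_def by (rule measurable_sets[OF cn_measurable]) simp
  have "D \<in> sets ?M" unfolding D_def by (rule measurable_sets[OF borel_measurable_diff[OF cn_measurable cn_measurable]]) simp
  then have W: "(space ?M - V) \<inter> D \<in> sets ?M" by (rule sets.Int[OF sets.compl_sets[OF V]])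
  have "{Y \<in> space ?M. smallest_pos_eigenvalue (aGUE_mat l Y) \<le> a} = (if Min {} \<le> a then V else {}) \<union> (if 0 \<le> a then (space ?M - V) \<inter> D else {})"
    unfolding smallest_pos_eigenvalue_le_iff V_def D_def by auto
  also have "\<dots> \<in> sets ?M"
    by (cases "Min {} \<le> a"; cases "0 \<le> a") (simp_all only: if_True if_False Un_empty_left Un_empty_right V W sets.Un[OF V W] sets.empty_sets)
  finally show "{Y \<in> space ?M. smallest_pos_eigenvalue (aGUE_mat l Y) \<le> a} \<in> sets ?M" .
qed

definition voidset :: "nat \<Rightarrow> real \<Rightarrow> (nat \<times> nat \<Rightarrow> real) set" where
  "voidset l a = {Y \<in> space (gauss (idx l)). \<forall>x\<in>set (spec l Y). a < \<bar>x\<bar>}"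

lemma voidset_sets: "voidset l a \<in> sets (gauss (idx l))"
proof -
  have "voidset l a = (\<lambda>Y. real (cn l a Y)) -` {0} \<inter> space (gauss (idx l))"
    by (auto simp: voidset_def cn_def filter_empty_conv not_le)
  also have "\<dots> \<in> sets (gauss (idx l))" by (rule measurable_sets[OF cn_measurable]) simp
  finally show ?thesis .
qed

lemma measure_voidset:
  assumes "1 \<le> k" "0 \<le> a"
  shows "measure (gauss (idx (2 * k))) (voidset (2 * k) a) = Kdet k a / Kdet k 0"
proof -
  let ?M = "gauss (idx (2 * k))"
  have "measure ?M (voidset (2 * k) a) = (LINT Y|?M. indicator (voidset (2 * k) a) Y)"
    using sets.sets_into_space[OF voidset_sets[of "2 * k" a]] by (simp add: Int_absorb2)
  also have "\<dots> = (LINT Y|?M. 1 * (if \<forall>x\<in>set (spec (2 * k) Y). a < \<bar>x\<bar> then 1 else 0))"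
    by (rule Bochner_Integration.integral_cong[OF refl]) (simp add: voidset_def indicator_def)
  also have "\<dots> = Kdet k a / Kdet k 0" unfolding void_transfer[OF assms(1)] by (rule density_void[OF assms(2)])
  finally show ?thesis .
qed

lemma smallest_pos_eigenvalue_cdf:
  assumes k: "1 \<le> k"
  shows "cdf (distr (gauss (idx (2 * k))) borel (\<lambda>Y. (1 / 2) * smallest_pos_eigenvalue (aGUE_mat (2 * k) Y))) y
    = (if 0 \<le> y then 1 - Kdet k (2 * y) / Kdet k 0 else 0)"
proof -
  let ?M = "gauss (idx (2 * k))"
  let ?f = "\<lambda>Y. smallest_pos_eigenvalue (aGUE_mat (2 * k) Y)"
  interpret prob_space ?M by (rule prob_space_gauss)
  note fm = smallest_pos_eigenvalue_measurable[of "2 * k"]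
  define A where "A = {Y \<in> space ?M. ?f Y \<le> 2 * y}"
  have "A = ?f -` {..2 * y} \<inter> space ?M" unfolding A_def by auto
  also have "\<dots> \<in> sets ?M" by (rule measurable_sets[OF fm]) simp
  finally have A: "A \<in> sets ?M" .
  have "cdf (distr ?M borel (\<lambda>Y. (1 / 2) * ?f Y)) y = measure ?M ((\<lambda>Y. (1 / 2) * ?f Y) -` {..y} \<inter> space ?M)"
    unfolding cdf_def by (rule measure_distr[OF borel_measurable_times[OF borel_measurable_const fm]]) simp
  also have "(\<lambda>Y. (1 / 2) * ?f Y) -` {..y} \<inter> space ?M = A" unfolding A_def by auto
  finally have c: "cdf (distr ?M borel (\<lambda>Y. (1 / 2) * ?f Y)) y = measure ?M A" .
  \<comment> \<open>The gap formula at a = 0 shows that 0 is almost surely not an eigenvalue. The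
    event that the minimum is at most 2y is then the complement of a gap event.\<close>
  have "prob (voidset (2 * k) 0) = 1" using measure_voidset[OF k, of 0] Kdet_0_nonzero[of k] by simp
  then have ae: "AE Y in ?M. Y \<in> voidset (2 * k) 0" using AE_in_set_eq_1[OF voidset_sets] by simp
  have z: "cn (2 * k) 0 Y = 0" if "Y \<in> voidset (2 * k) 0" for Y
    using that by (auto simp: voidset_def cn_def filter_empty_conv)
  show ?thesis
  proof (cases "0 \<le> y")
    case True
    have "measure ?M A = measure ?M (space ?M - voidset (2 * k) (2 * y))"
    proof (rule measure_eq_AE)
      show "AE Y in ?M. Y \<in> A \<longleftrightarrow> Y \<in> space ?M - voidset (2 * k) (2 * y)"
        using ae
      proof eventually_elim
        case (elim Y)
        have s: "Y \<in> space ?M" using elim by (simp add: voidset_def)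
        have "?f Y \<le> 2 * y \<longleftrightarrow> 0 < cn (2 * k) (2 * y) Y"
          unfolding smallest_pos_eigenvalue_le_iff z[OF elim] using True k by simp
        also have "\<dots> \<longleftrightarrow> \<not> (\<forall>x\<in>set (spec (2 * k) Y). 2 * y < \<bar>x\<bar>)"
          by (auto simp: cn_def filter_empty_conv not_le)
        finally show ?case using s by (simp add: A_def voidset_def)
      qed
    qed (use A voidset_sets in auto)
    also have "\<dots> = 1 - Kdet k (2 * y) / Kdet k 0"
      unfolding prob_compl[OF voidset_sets] using measure_voidset[OF k, of "2 * y"] True by simp
    finally show ?thesis using c True by simp
  next
    case False
    have "measure ?M A = measure ?M {}"
    proof (rule measure_eq_AE)
      show "AE Y in ?M. Y \<in> A \<longleftrightarrow> Y \<in> {}"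
        using ae
      proof eventually_elim
        case (elim Y)
        have "\<not> ?f Y \<le> 2 * y" unfolding smallest_pos_eigenvalue_le_iff z[OF elim] using False k by simp
        then show ?case by (simp add: A_def)
      qed
    qed (use A in auto)
    then show ?thesis using c False by simp
  qed
qed

theorem theorem1p5:
  fixes k :: nat
  assumes "1 \<le> k"
  shows "weak_conv_m
           (\<lambda>n. distr (measure_pmf (pmf_of_set (sorting_networks n))) borel
                   (\<lambda>s. real (first_swap_time k s) / real n powr (3 / 2)))
           (distr (gaussian_array (2 * k)) borel
                   (\<lambda>Y. (1 / 2) * smallest_pos_eigenvalue (aGUE_mat (2 * k) Y)))"
  unfolding weak_conv_m_def weak_conv_def gaussian_array_def gauss_def[symmetric]
proof (intro allI impI)
  fix y
  assume "isCont (cdf (distr (gauss (idx (2 * k))) borel (\<lambda>Y. (1 / 2) * smallest_pos_eigenvalue (aGUE_mat (2 * k) Y)))) y"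
  then show "(\<lambda>n. cdf (distr (measure_pmf (pmf_of_set (sorting_networks n))) borel (\<lambda>s. real (first_swap_time k s) / real n powr (3 / 2))) y)
    \<longlonglongrightarrow> cdf (distr (gauss (idx (2 * k))) borel (\<lambda>Y. (1 / 2) * smallest_pos_eigenvalue (aGUE_mat (2 * k) Y))) y"
  proof (rule first_swap_cdf_tendsto[OF assms Kdet_0_nonzero])
    fix z :: real
    show "cdf (distr (gauss (idx (2 * k))) borel (\<lambda>Y. (1 / 2) * smallest_pos_eigenvalue (aGUE_mat (2 * k) Y))) z = 1 - Kdet k (2 * z) / Kdet k 0" if "0 \<le> z"
      unfolding smallest_pos_eigenvalue_cdf[OF assms] by (rule if_P[OF that])
    show "cdf (distr (gauss (idx (2 * k))) borel (\<lambda>Y. (1 / 2) * smallest_pos_eigenvalue (aGUE_mat (2 * k) Y))) z = 0" if "z < 0"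
      unfolding smallest_pos_eigenvalue_cdf[OF assms] by (rule if_not_P) (use that in simp)
  qed
qed

end
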